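(* Let $\mathcal I\subset\mathcal O$ be a coherent ideal sheaf of pure codimension $p$ with zero variety $Z$, and let $Z_k$, $k\ge1$, be the analytic sets associated with a free resolution of $\mathcal O/\mathcal I$. If $\phi$ is a meromorphic function on $Z$ with pole set $P_\phi$ and $$\operatorname{codim}(P_\phi\cap Z_k)\ge k+2\quad\text{for all }k\ge p,$$ then $\phi$ is strongly holomorphic on $Z$.
   Context: Setting: $X$ is a neighborhood of the closed unit ball in $\mathbb C^n$, $\mathcal O$ its sheaf of holomorphic functions, $\mathcal I\subset\mathcal O$ a coherent ideal sheaf with zero variety $Z$. $\mathcal I$ (or $Z$) has pure codimension $p\ge1$ if in each local ring $\mathcal O_x$, $x\in Z$, all associated primes of $\mathcal I_x$ have codimension $p$. $\mathcal I$ need not be radical. $\mathcal O_Z=\mathcal O/\mathcal I$ is the sheaf of (strongly) holomorphic functions on $Z$. $\mathcal M_Z$ is the sheaf whose stalk at $x$ is the ring of quotients $g/h$, $g,h\in\mathcal O_{Z,x}$, $h$ a nonzerodivisor; its sections are the meromorphic functions on $Z$. For meromorphic $\phi$, the pole set $P_\phi\subset Z$ is the smallest analytic subvariety outside which $\phi$ is strongly holomorphic. Let $0\to \mathcal O(E_N)\xrightarrow{f_N}\cdots\xrightarrow{f_2}\mathcal O(E_1)\xrightarrow{f_1}\mathcal O(E_0)$ be a free resolution of $\mathcal O/\mathcal I$ in $X$ ($E_k$ trivial vector bundles, $E_0\simeq\mathbb C$, $\operatorname{im}f_1=\mathcal I$). $Z_k$ is the analytic set of points of $X$ where $f_k$ does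 not have optimal (i.e. its generic, maximal) rank; $Z_k=\emptyset$ for $k>N$. These sets are independent of the choice of resolution, and $Z_p=\cdots=Z_1=Z$. Codimensions are in $\mathbb C^n$, and the empty set has codimension $\infty$. *)

theory Defs
  imports
    "HOL-Analysis.Analysis"
    "HOL-Algebra.QuotRing"
    "HOL-Library.Extended_Nat"
    "Jordan_Normal_Form.DL_Rank"
begin

text \<open>HOL-Analysis and Jordan_Normal_Form both use the infix dollar sign; the rank-varying
  matrices and vectors below are written with the constants \<^term>\<open>vec_index\<close> and
  \<^term>\<open>index_mat\<close> of the latter.\<close>

no_notation Matrix.vec_index (infixl "$" 100)
hide_type (open) Matrix.vec

section \<open>Holomorphic functions of several variables and their germs\<close>

definition holo_on :: "((complex ^ 'n) \<Rightarrow> complex) \<Rightarrow> (complex ^ 'n) set \<Rightarrow> bool" where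
  "holo_on f U \<longleftrightarrow> open U \<and>
     (\<forall>z\<in>U. \<exists>f'. (f has_derivative f') (at z) \<and> (\<forall>c v. f' (c *s v) = c * f' v))"

definition holo_at :: "((complex ^ 'n) \<Rightarrow> complex) \<Rightarrow> complex ^ 'n \<Rightarrow> bool" where
  "holo_at f x \<longleftrightarrow> (\<exists>U. x \<in> U \<and> holo_on f U)"

definition fun_ring :: "complex ^ 'n \<Rightarrow> ((complex ^ 'n) \<Rightarrow> complex) ring" where
  "fun_ring x = \<lparr>carrier = {f. holo_at f x}, mult = (\<lambda>f g z. f z * g z), one = (\<lambda>_. 1),
                 zero = (\<lambda>_. 0), add = (\<lambda>f g z. f z + g z)\<rparr>"

definition null_germs :: "complex ^ 'n \<Rightarrow> ((complex ^ 'n) \<Rightarrow> complex) set" where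
  "null_germs x = {f. eventually (\<lambda>z. f z = 0) (nhds x)}"

type_synonym 'n germ = "((complex ^ 'n) \<Rightarrow> complex) set"

text \<open>The local ring \<open>\<O>\<^sub>x\<close>: functions holomorphic near \<open>x\<close>, modulo equality near \<open>x\<close>.\<close>

definition local_ring :: "complex ^ 'n \<Rightarrow> 'n germ ring" where
  "local_ring x = fun_ring x Quot null_germs x"

definition germ :: "complex ^ 'n \<Rightarrow> ((complex ^ 'n) \<Rightarrow> complex) \<Rightarrow> 'n germ" where
  "germ x f = null_germs x +>\<^bsub>fun_ring x\<^esub> f"


section \<open>Coherent ideal sheaves\<close>

text \<open>Sections are represented by total functions, of which only the values on the open set
  matter (the congruence clause below). Only open subsets of \<open>X\<close> are considered.\<close>

type_synonym 'n presheaf = "(complex ^ 'n) set \<Rightarrow> ((complex ^ 'n) \<Rightarrow> complex) set"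

definition ideal_sheaf :: "(complex ^ 'n) set \<Rightarrow> 'n presheaf \<Rightarrow> bool" where
  "ideal_sheaf X I \<longleftrightarrow>
     (\<forall>U. open U \<and> U \<subseteq> X \<longrightarrow>
        (\<forall>f\<in>I U. holo_on f U) \<and>
        (\<forall>f\<in>I U. \<forall>g. (\<forall>z\<in>U. g z = f z) \<longrightarrow> g \<in> I U) \<and>
        (\<lambda>_. 0) \<in> I U \<and>
        (\<forall>f\<in>I U. \<forall>g\<in>I U. (\<lambda>z. f z + g z) \<in> I U) \<and>
        (\<forall>f\<in>I U. \<forall>h. holo_on h U \<longrightarrow> (\<lambda>z. h z * f z) \<in> I U)) \<and>
     (\<forall>U V. open U \<and> U \<subseteq> X \<and> open V \<and> V \<subseteq> U \<longrightarrow> I U \<subseteq> I V) \<and>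
     (\<forall>\<U> f. (\<forall>U\<in>\<U>. open U \<and> U \<subseteq> X \<and> f \<in> I U) \<longrightarrow> f \<in> I (\<Union>\<U>))"

definition stalk :: "(complex ^ 'n) set \<Rightarrow> 'n presheaf \<Rightarrow> complex ^ 'n \<Rightarrow> 'n germ set" where
  "stalk X I x = {germ x f | f U. open U \<and> x \<in> U \<and> U \<subseteq> X \<and> f \<in> I U}"

definition finite_type :: "(complex ^ 'n) set \<Rightarrow> 'n presheaf \<Rightarrow> bool" where
  "finite_type X I \<longleftrightarrow>
     (\<forall>x\<in>X. \<exists>U m s. open U \<and> x \<in> U \<and> U \<subseteq> X \<and> (\<forall>i<(m::nat). s i \<in> I U) \<and>
        (\<forall>y\<in>U. stalk X I y = genideal (local_ring y) (germ y ` s ` {..<m})))"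

text \<open>\<open>relation_at m s a y\<close>: the germs at \<open>y\<close> of \<open>a\<^sub>0, \<dots>, a\<^bsub>m-1\<^esub>\<close> form a relation among those of
  \<open>s\<^sub>0, \<dots>, s\<^bsub>m-1\<^esub>\<close>, i.e. an element of the stalk at \<open>y\<close> of the kernel of \<open>\<O>\<^sup>m \<rightarrow> \<I>\<close>.\<close>

definition relation_at ::
  "nat \<Rightarrow> (nat \<Rightarrow> (complex ^ 'n) \<Rightarrow> complex) \<Rightarrow> (nat \<Rightarrow> (complex ^ 'n) \<Rightarrow> complex) \<Rightarrow> complex ^ 'n \<Rightarrow> bool"
  where
  "relation_at m s a y \<longleftrightarrow> (\<forall>i<m. holo_at (a i) y) \<and>
     eventually (\<lambda>z. (\<Sum>i<m. a i z * s i z) = 0) (nhds y)"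

definition finite_type_relations :: "(complex ^ 'n) set \<Rightarrow> 'n presheaf \<Rightarrow> bool" where
  "finite_type_relations X I \<longleftrightarrow>
     (\<forall>U m s. open U \<and> U \<subseteq> X \<and> (\<forall>i<m. s i \<in> I U) \<longrightarrow>
       (\<forall>x\<in>U. \<exists>V l \<rho>. open V \<and> x \<in> V \<and> V \<subseteq> U \<and>
          (\<forall>j<(l::nat). (\<forall>i<m. holo_on (\<rho> j i) V) \<and> (\<forall>y\<in>V. relation_at m s (\<rho> j) y)) \<and>
          (\<forall>y\<in>V. \<forall>a. relation_at m s a y \<longrightarrow>
             (\<exists>c. (\<forall>j<l. holo_at (c j) y) \<and>
                  eventually (\<lambda>z. \<forall>i<m. a i z = (\<Sum>j<l. c j z * \<rho> j i z)) (nhds y)))))"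

definition coherent_ideal_sheaf :: "(complex ^ 'n) set \<Rightarrow> 'n presheaf \<Rightarrow> bool" where
  "coherent_ideal_sheaf X I \<longleftrightarrow> ideal_sheaf X I \<and> finite_type X I \<and> finite_type_relations X I"

definition zero_variety :: "(complex ^ 'n) set \<Rightarrow> 'n presheaf \<Rightarrow> (complex ^ 'n) set" where
  "zero_variety X I = {x\<in>X. \<forall>U f. open U \<and> x \<in> U \<and> U \<subseteq> X \<and> f \<in> I U \<longrightarrow> f x = 0}"


section \<open>Pure codimension\<close>

definition height :: "('a, 'b) ring_scheme \<Rightarrow> 'a set \<Rightarrow> enat" where
  "height R Q = Sup {enat m | m. \<exists>c :: nat \<Rightarrow> 'a set.
     (\<forall>i\<le>m. primeideal (c i) R) \<and> (\<forall>i<m. c i \<subset> c (Suc i)) \<and> c m = Q}"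

text \<open>Associated primes of an ideal \<open>J\<close> means those of the module \<open>R/J\<close>.\<close>

definition associated_prime :: "('a, 'b) ring_scheme \<Rightarrow> 'a set \<Rightarrow> 'a set \<Rightarrow> bool" where
  "associated_prime R J Q \<longleftrightarrow> primeideal Q R \<and>
     (\<exists>a\<in>carrier R. Q = {b\<in>carrier R. b \<otimes>\<^bsub>R\<^esub> a \<in> J})"

definition pure_codim :: "(complex ^ 'n) set \<Rightarrow> 'n presheaf \<Rightarrow> nat \<Rightarrow> bool" where
  "pure_codim X I p \<longleftrightarrow> (\<forall>x\<in>zero_variety X I. \<forall>Q.
     associated_prime (local_ring x) (stalk X I x) Q \<longrightarrow> height (local_ring x) Q = enat p)"


section \<open>Analytic subsets and their codimension\<close>

definition analytic_subset :: "(complex ^ 'n) set \<Rightarrow> (complex ^ 'n) set \<Rightarrow> bool" where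
  "analytic_subset X A \<longleftrightarrow> A \<subseteq> X \<and>
     (\<forall>x\<in>X. \<exists>U F. open U \<and> x \<in> U \<and> U \<subseteq> X \<and> finite F \<and> (\<forall>f\<in>F. holo_on f U) \<and>
        A \<inter> U = {z\<in>U. \<forall>f\<in>F. f z = 0})"

text \<open>\<open>A\<close> is near \<open>x\<close> a complex submanifold of codimension \<open>q\<close>.\<close>

definition regular_point :: "(complex ^ 'n) set \<Rightarrow> complex ^ 'n \<Rightarrow> nat \<Rightarrow> bool" where
  "regular_point A x q \<longleftrightarrow> x \<in> A \<and>
     (\<exists>U g. open U \<and> x \<in> U \<and> (\<forall>i<q. holo_on (g i) U) \<and>
        A \<inter> U = {z\<in>U. \<forall>i<q. g i z = 0} \<and>
        (\<forall>c :: nat \<Rightarrow> complex. (\<forall>v. (\<Sum>i<q. c i * frechet_derivative (g i) (at x) v) = 0)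
             \<longrightarrow> (\<forall>i<q. c i = 0)))"

text \<open>The dimension of an analytic set is the maximal dimension at its regular points, which are
  dense. As \<^term>\<open>Inf {} = (\<infinity>::enat)\<close>, the empty set has codimension \<open>\<infinity>\<close>.\<close>

definition codim :: "(complex ^ 'n) set \<Rightarrow> enat" where
  "codim A = Inf {enat q | q. \<exists>x. regular_point A x q}"


section \<open>Strongly holomorphic and meromorphic functions on \<open>Z\<close>\<close>

definition OZ_ring :: "(complex ^ 'n) set \<Rightarrow> 'n presheaf \<Rightarrow> complex ^ 'n \<Rightarrow> 'n germ set ring" where
  "OZ_ring X I x = local_ring x Quot stalk X I x"

definition OZ_germ ::
  "(complex ^ 'n) set \<Rightarrow> 'n presheaf \<Rightarrow> complex ^ 'n \<Rightarrow> ((complex ^ 'n) \<Rightarrow> complex) \<Rightarrow> 'n germ set" where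
  "OZ_germ X I x f = stalk X I x +>\<^bsub>local_ring x\<^esub> germ x f"

definition nonzerodivisors :: "('a, 'b) ring_scheme \<Rightarrow> 'a set" where
  "nonzerodivisors R = {h\<in>carrier R. \<forall>a\<in>carrier R. a \<otimes>\<^bsub>R\<^esub> h = \<zero>\<^bsub>R\<^esub> \<longrightarrow> a = \<zero>\<^bsub>R\<^esub>}"

text \<open>The element \<open>g/h\<close> of the total ring of quotients, as a class of pairs.\<close>

definition fraction :: "('a, 'b) ring_scheme \<Rightarrow> 'a \<Rightarrow> 'a \<Rightarrow> ('a \<times> 'a) set" where
  "fraction R g h = {(a, b). a \<in> carrier R \<and> b \<in> nonzerodivisors R \<and> a \<otimes>\<^bsub>R\<^esub> h = g \<otimes>\<^bsub>R\<^esub> b}"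

text \<open>A section of \<open>\<M>\<^sub>Z\<close> is a family of stalk elements \<open>\<phi> x\<close>, \<open>x \<in> Z\<close>, that locally comes from
  one pair of sections of \<open>\<O>\<^sub>Z\<close>. The values of \<open>\<phi>\<close> outside \<open>Z\<close> are irrelevant.\<close>

type_synonym 'n mero = "complex ^ 'n \<Rightarrow> ('n germ set \<times> 'n germ set) set"

definition meromorphic_function :: "(complex ^ 'n) set \<Rightarrow> 'n presheaf \<Rightarrow> 'n mero \<Rightarrow> bool" where
  "meromorphic_function X I \<phi> \<longleftrightarrow>
     (\<forall>x\<in>zero_variety X I. \<exists>U g h. open U \<and> x \<in> U \<and> U \<subseteq> X \<and> holo_on g U \<and> holo_on h U \<and>
        (\<forall>y\<in>U \<inter> zero_variety X I.
           OZ_germ X I y h \<in> nonzerodivisors (OZ_ring X I y) \<and>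
           \<phi> y = fraction (OZ_ring X I y) (OZ_germ X I y g) (OZ_germ X I y h)))"

text \<open>For \<open>W\<close> open in \<open>Z\<close>: the restriction of \<open>\<phi>\<close> to \<open>W\<close> is a section of \<open>\<O>\<^sub>Z \<subseteq> \<M>\<^sub>Z\<close>.\<close>

definition strongly_holomorphic_on ::
  "(complex ^ 'n) set \<Rightarrow> 'n presheaf \<Rightarrow> 'n mero \<Rightarrow> (complex ^ 'n) set \<Rightarrow> bool" where
  "strongly_holomorphic_on X I \<phi> W \<longleftrightarrow>
     (\<forall>x\<in>W. \<exists>U g. open U \<and> x \<in> U \<and> U \<subseteq> X \<and> holo_on g U \<and>
        (\<forall>y\<in>U \<inter> W. \<phi> y = fraction (OZ_ring X I y) (OZ_germ X I y g) \<one>\<^bsub>OZ_ring X I y\<^esub>))"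

definition is_pole_set ::
  "(complex ^ 'n) set \<Rightarrow> 'n presheaf \<Rightarrow> 'n mero \<Rightarrow> (complex ^ 'n) set \<Rightarrow> bool" where
  "is_pole_set X I \<phi> P \<longleftrightarrow>
     (let Z = zero_variety X I;
          admissible = (\<lambda>Q. analytic_subset X Q \<and> Q \<subseteq> Z \<and> strongly_holomorphic_on X I \<phi> (Z - Q))
      in admissible P \<and> (\<forall>Q. admissible Q \<longrightarrow> P \<subseteq> Q))"


section \<open>Free resolutions and the associated sets\<close>

text \<open>\<open>E\<^sub>k\<close> is the trivial bundle of rank \<open>r k\<close>, and \<open>f k\<close> (for \<open>1 \<le> k \<le> N\<close>) is a holomorphic
  \<open>r (k - 1) \<times> r k\<close> matrix acting on column vectors.\<close>

definition holo_mat_on ::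
  "nat \<Rightarrow> nat \<Rightarrow> ((complex ^ 'n) \<Rightarrow> complex Matrix.mat) \<Rightarrow> (complex ^ 'n) set \<Rightarrow> bool" where
  "holo_mat_on m l F U \<longleftrightarrow> (\<forall>z\<in>U. F z \<in> carrier_mat m l) \<and>
     (\<forall>i<m. \<forall>j<l. holo_on (\<lambda>z. index_mat (F z) (i, j)) U)"

text \<open>\<open>v\<close> represents an element of the stalk at \<open>x\<close> of \<open>\<O>(\<complex>\<^sup>m)\<close>.\<close>

definition holo_vec_at ::
  "nat \<Rightarrow> ((complex ^ 'n) \<Rightarrow> complex Matrix.vec) \<Rightarrow> complex ^ 'n \<Rightarrow> bool" where
  "holo_vec_at m v x \<longleftrightarrow> eventually (\<lambda>z. v z \<in> carrier_vec m) (nhds x) \<and>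
     (\<forall>i<m. holo_at (\<lambda>z. vec_index (v z) i) x)"

definition free_resolution ::
  "(complex ^ 'n) set \<Rightarrow> 'n presheaf \<Rightarrow> nat \<Rightarrow> (nat \<Rightarrow> nat) \<Rightarrow>
   (nat \<Rightarrow> (complex ^ 'n) \<Rightarrow> complex Matrix.mat) \<Rightarrow> bool" where
  "free_resolution X I N r f \<longleftrightarrow>
     N \<ge> 1 \<and> r 0 = 1 \<and>
     (\<forall>k\<in>{1..N}. holo_mat_on (r (k - 1)) (r k) (f k) X) \<and>
     (\<forall>x\<in>X. stalk X I x =
        {germ x (\<lambda>z. vec_index (f 1 z *\<^sub>v w z) 0) | w. holo_vec_at (r 1) w x}) \<and>
     (\<forall>k\<in>{1..<N}. \<forall>x\<in>X. \<forall>v. holo_vec_at (r k) v x \<longrightarrow>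
        (eventually (\<lambda>z. f k z *\<^sub>v v z = 0\<^sub>v (r (k - 1))) (nhds x) \<longleftrightarrow>
         (\<exists>w. holo_vec_at (r (k + 1)) w x \<and>
              eventually (\<lambda>z. v z = f (k + 1) z *\<^sub>v w z) (nhds x)))) \<and>
     (\<forall>x\<in>X. \<forall>v. holo_vec_at (r N) v x \<and>
        eventually (\<lambda>z. f N z *\<^sub>v v z = 0\<^sub>v (r (N - 1))) (nhds x) \<longrightarrow>
        eventually (\<lambda>z. v z = 0\<^sub>v (r N)) (nhds x))"

text \<open>The points where the rank of \<open>f k\<close> is not the maximal one; \<open>vec_space.rank m F\<close> is the rank
  of a matrix \<open>F\<close> with \<open>m\<close> rows.\<close>

definition resolution_set ::
  "(complex ^ 'n) set \<Rightarrow> nat \<Rightarrow> (nat \<Rightarrow> nat) \<Rightarrow>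
   (nat \<Rightarrow> (complex ^ 'n) \<Rightarrow> complex Matrix.mat) \<Rightarrow> nat \<Rightarrow> (complex ^ 'n) set" where
  "resolution_set X N r f k =
     (if k \<in> {1..N}
      then {z\<in>X. \<exists>w\<in>X. vec_space.rank (r (k - 1)) (f k z) < vec_space.rank (r (k - 1)) (f k w)}
      else {})"


section \<open>Well-definedness of the local rings and the stalks\<close>


lemma holo_on_simps:
  assumes "holo_on f U" "holo_on g U"
  shows "holo_on (\<lambda>z. f z + g z) U" "holo_on (\<lambda>z. f z * g z) U"
proof -
  have o: "open U" using assms by (auto simp: holo_on_def)
  have "\<exists>f'. ((\<lambda>z. f z + g z) has_derivative f') (at z) \<and> (\<forall>c v. f' (c *s v) = c * f' v)"
       "\<exists>f'. ((\<lambda>z. f z * g z) has_derivative f') (at z) \<and> (\<forall>c v. f' (c *s v) = c * f' v)"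
    if z: "z \<in> U" for z
  proof -
    obtain f' g' where d: "(f has_derivative f') (at z)" "\<forall>c v. f' (c *s v) = c * f' v"
      "(g has_derivative g') (at z)" "\<forall>c v. g' (c *s v) = c * g' v"
      using assms z unfolding holo_on_def by blast
    show "\<exists>f'. ((\<lambda>z. f z + g z) has_derivative f') (at z) \<and> (\<forall>c v. f' (c *s v) = c * f' v)"
      by (rule exI, rule conjI, rule has_derivative_add[OF d(1,3)]) (simp add: d distrib_left)
    show "\<exists>f'. ((\<lambda>z. f z * g z) has_derivative f') (at z) \<and> (\<forall>c v. f' (c *s v) = c * f' v)"
      by (rule exI, rule conjI, rule has_derivative_mult[OF d(1,3)]) (simp add: d algebra_simps)
  qed
  then show "holo_on (\<lambda>z. f z + g z) U" "holo_on (\<lambda>z. f z * g z) U"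
    using o by (auto simp: holo_on_def)
qed

lemma holo_on_const: "open U \<Longrightarrow> holo_on (\<lambda>_. c) U"
  unfolding holo_on_def by (auto intro!: exI[of _ "\<lambda>_. 0"])

lemma holo_on_subset: "holo_on f U \<Longrightarrow> open V \<Longrightarrow> V \<subseteq> U \<Longrightarrow> holo_on f V"
  unfolding holo_on_def by blast

lemma holo_at_simps:
  "holo_at (\<lambda>_. c) x"
  "holo_at f x \<Longrightarrow> holo_at g x \<Longrightarrow> holo_at (\<lambda>z. f z + g z) x"
  "holo_at f x \<Longrightarrow> holo_at g x \<Longrightarrow> holo_at (\<lambda>z. f z * g z) x"
proof -
  show "holo_at (\<lambda>_. c) x" unfolding holo_at_def by (auto intro!: exI[of _ UNIV] holo_on_const)
  assume "holo_at f x" "holo_at g x"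
  then obtain U V where "x \<in> U" "holo_on f U" "x \<in> V" "holo_on g V" unfolding holo_at_def by blast
  moreover then have "open U" "open V" by (auto simp: holo_on_def)
  ultimately have *: "x \<in> U \<inter> V" "holo_on f (U \<inter> V)" "holo_on g (U \<inter> V)"
    by (auto intro: holo_on_subset)
  from holo_on_simps[OF *(2,3)] *(1)
  show "holo_at (\<lambda>z. f z + g z) x" "holo_at (\<lambda>z. f z * g z) x" unfolding holo_at_def by blast+
qed

lemma cring_fun_ring: "cring (fun_ring x)"
proof (rule cringI)
  have "\<exists>g. holo_at g x \<and> (\<lambda>z. g z + f z) = (\<lambda>_. 0)" if "holo_at f x" for f
    using holo_at_simps(3)[OF holo_at_simps(1)[of "-1"] that] by (intro exI[of _ "\<lambda>z. -1 * f z"]) auto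
  then show "abelian_group (fun_ring x)"
    by (intro abelian_groupI) (auto simp: fun_ring_def holo_at_simps add_ac)
  show "comm_monoid (fun_ring x)"
    by (intro comm_monoidI) (auto simp: fun_ring_def holo_at_simps mult_ac)
qed (auto simp: fun_ring_def distrib_right)

lemma holo_at_eventually_zero: "eventually (\<lambda>z. f z = 0) (nhds x) \<Longrightarrow> holo_at f x"
proof -
  assume "eventually (\<lambda>z. f z = 0) (nhds x)"
  then obtain U where U: "open U" "x \<in> U" "\<forall>z\<in>U. f z = 0" by (auto simp: eventually_nhds)
  have "(f has_derivative (\<lambda>_. 0)) (at z)" if "z \<in> U" for z
    by (rule has_derivative_transform_within_open[of "\<lambda>_. 0" _ _ _ U]) (use U that in auto)
  then show ?thesis unfolding holo_at_def holo_on_def using U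
    by (intro exI[of _ U]) (auto intro!: exI[of _ "\<lambda>_. 0"])
qed

lemma ideal_null_germs: "ideal (null_germs x) (fun_ring x)"
proof -
  interpret cring "fun_ring x" by (rule cring_fun_ring)
  have sub: "null_germs x \<subseteq> carrier (fun_ring x)"
    by (auto simp: null_germs_def fun_ring_def holo_at_eventually_zero)
  have add: "f \<oplus>\<^bsub>fun_ring x\<^esub> g \<in> null_germs x" if "f \<in> null_germs x" "g \<in> null_germs x" for f g
    using that by (auto simp: null_germs_def fun_ring_def elim: eventually_elim2)
  have mul: "a \<otimes>\<^bsub>fun_ring x\<^esub> f \<in> null_germs x" if "f \<in> null_germs x" for f a
    using that by (auto simp: null_germs_def fun_ring_def elim: eventually_mono)
  have neg: "\<ominus>\<^bsub>fun_ring x\<^esub> f \<in> null_germs x" if "f \<in> null_germs x" for f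
    using mul[OF that, of "\<ominus>\<^bsub>fun_ring x\<^esub> \<one>\<^bsub>fun_ring x\<^esub>"] that sub by (auto simp: l_minus)
  have zin: "(\<lambda>_. 0) \<in> null_germs x" by (simp add: null_germs_def)
  show ?thesis
  proof (rule idealI)
    show "subgroup (null_germs x) (add_monoid (fun_ring x))"
      using sub add neg
      using zin by (intro add.subgroupI) (auto simp: a_inv_def)
  next
    fix a b assume "a \<in> null_germs x" "b \<in> carrier (fun_ring x)"
    then show "b \<otimes>\<^bsub>fun_ring x\<^esub> a \<in> null_germs x" "a \<otimes>\<^bsub>fun_ring x\<^esub> b \<in> null_germs x"
      using mul[of a b] m_comm[of a b] sub by auto
  qed (rule ring_axioms)
qed

lemma cring_local_ring: "cring (local_ring x)"
  unfolding local_ring_def using ideal.quotient_is_cring[OF ideal_null_germs cring_fun_ring] .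

lemma germ_ops:
  assumes "holo_at f x" "holo_at g x"
  shows "germ x f \<oplus>\<^bsub>local_ring x\<^esub> germ x g = germ x (\<lambda>z. f z + g z)"
    and "germ x f \<otimes>\<^bsub>local_ring x\<^esub> germ x g = germ x (\<lambda>z. f z * g z)"
proof -
  interpret ideal "null_germs x" "fun_ring x" by (rule ideal_null_germs)
  have c: "f \<in> carrier (fun_ring x)" "g \<in> carrier (fun_ring x)" using assms by (auto simp: fun_ring_def)
  show "germ x f \<oplus>\<^bsub>local_ring x\<^esub> germ x g = germ x (\<lambda>z. f z + g z)"
    using a_rcos_sum[OF c] by (simp add: local_ring_def FactRing_def germ_def fun_ring_def)
  show "germ x f \<otimes>\<^bsub>local_ring x\<^esub> germ x g = germ x (\<lambda>z. f z * g z)"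
    using rcoset_mult_add[OF c] by (simp add: local_ring_def FactRing_def germ_def fun_ring_def)
qed

lemma germ_eq_iff:
  assumes "holo_at f x" "holo_at g x"
  shows "germ x f = germ x g \<longleftrightarrow> eventually (\<lambda>z. f z = g z) (nhds x)"
proof -
  interpret ideal "null_germs x" "fun_ring x" by (rule ideal_null_germs)
  note cr = cring_fun_ring[of x]
  have c: "f \<in> carrier (fun_ring x)" "g \<in> carrier (fun_ring x)" using assms by (auto simp: fun_ring_def)
  have m: "holo_at (\<lambda>z. - g z) x"
    using holo_at_simps(3)[OF holo_at_simps(1)[of "-1"] assms(2)] by simp
  have "\<ominus>\<^bsub>fun_ring x\<^esub> g = (\<lambda>z. - g z)"
    using abelian_group.minus_equality[OF ring.is_abelian_group[OF cring.axioms(1)[OF cr]], of "\<lambda>z. - g z" g] c m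
    by (auto simp: fun_ring_def)
  then have "f \<ominus>\<^bsub>fun_ring x\<^esub> g = (\<lambda>z. f z - g z)"
    by (simp add: a_minus_def fun_ring_def)
  then show ?thesis
    unfolding germ_def using quotient_eq_iff_same_a_r_cos[OF ideal_null_germs c]
    by (simp add: null_germs_def)
qed

lemma carrier_local_ring: "carrier (local_ring x) = {germ x f | f. holo_at f x}"
  by (auto simp: local_ring_def FactRing_def A_RCOSETS_def' germ_def fun_ring_def)

lemma ideal_stalk:
  assumes "ideal_sheaf X I" "open X" "x \<in> X"
  shows "ideal (stalk X I x) (local_ring x)"
proof -
  interpret L: cring "local_ring x" by (rule cring_local_ring)
  have A: "open U \<and> U \<subseteq> X \<longrightarrow>
        (\<forall>f\<in>I U. holo_on f U) \<and>
        (\<forall>f\<in>I U. \<forall>g. (\<forall>z\<in>U. g z = f z) \<longrightarrow> g \<in> I U) \<and>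
        (\<lambda>_. 0) \<in> I U \<and>
        (\<forall>f\<in>I U. \<forall>g\<in>I U. (\<lambda>z. f z + g z) \<in> I U) \<and>
        (\<forall>f\<in>I U. \<forall>h. holo_on h U \<longrightarrow> (\<lambda>z. h z * f z) \<in> I U)" for U
    using conjunct1[OF assms(1)[unfolded ideal_sheaf_def]] by (rule spec)
  have I1: "holo_on f U" if "open U" "U \<subseteq> X" "f \<in> I U" for U f
    using A[of U] that by simp
  have I2: "(\<lambda>z. f z + g z) \<in> I U" if "open U" "U \<subseteq> X" "f \<in> I U" "g \<in> I U" for U f g
    using A[of U] that by simp
  have I3: "(\<lambda>z. h z * f z) \<in> I U" if "open U" "U \<subseteq> X" "f \<in> I U" "holo_on h U" for U f h
    using A[of U] that by simp
  have I4: "(\<lambda>_. 0) \<in> I U" if "open U" "U \<subseteq> X" for U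
    using A[of U] that by simp
  have I5: "f \<in> I V" if "open U" "U \<subseteq> X" "open V" "V \<subseteq> U" "f \<in> I U" for U V f
    using assms(1)[unfolded ideal_sheaf_def, THEN conjunct2, THEN conjunct1, rule_format, of U V] that
    by blast
  have ho: "holo_at f x" if "open U" "x \<in> U" "U \<subseteq> X" "f \<in> I U" for f U
    using I1[OF that(1,3,4)] that(2) unfolding holo_at_def by blast
  have sub: "stalk X I x \<subseteq> carrier (local_ring x)"
    unfolding stalk_def carrier_local_ring using ho by blast
  have add: "a \<oplus>\<^bsub>local_ring x\<^esub> b \<in> stalk X I x" if ab: "a \<in> stalk X I x" "b \<in> stalk X I x" for a b
  proof -
    obtain f U g V where *: "a = germ x f" "open U" "x \<in> U" "U \<subseteq> X" "f \<in> I U"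
      "b = germ x g" "open V" "x \<in> V" "V \<subseteq> X" "g \<in> I V"
      using ab unfolding stalk_def by blast
    have "(\<lambda>z. f z + g z) \<in> I (U \<inter> V)"
      using * by (intro I2 I5[of U "U \<inter> V" f] I5[of V "U \<inter> V" g]) auto
    moreover have "a \<oplus>\<^bsub>local_ring x\<^esub> b = germ x (\<lambda>z. f z + g z)"
      using germ_ops(1)[OF ho[OF *(2-5)] ho[OF *(7-10)]] *(1,6) by simp
    moreover have "open (U \<inter> V) \<and> x \<in> U \<inter> V \<and> U \<inter> V \<subseteq> X" using * by auto
    ultimately show ?thesis unfolding stalk_def by blast
  qed
  have mul: "a \<otimes>\<^bsub>local_ring x\<^esub> b \<in> stalk X I x"
    if ab: "b \<in> stalk X I x" "a \<in> carrier (local_ring x)" for a b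
  proof -
    obtain f U g V where *: "a = germ x f" "x \<in> U" "holo_on f U"
      "b = germ x g" "open V" "x \<in> V" "V \<subseteq> X" "g \<in> I V"
      using ab unfolding stalk_def carrier_local_ring holo_at_def by blast
    have oU: "open U" using * by (auto simp: holo_on_def)
    have "g \<in> I (U \<inter> V)" by (rule I5[of V]) (use * oU in auto)
    moreover have "holo_on f (U \<inter> V)" by (rule holo_on_subset[of f U]) (use * oU in auto)
    ultimately have "(\<lambda>z. f z * g z) \<in> I (U \<inter> V)"
      using I3[of "U \<inter> V" g f] * oU by (simp add: open_Int le_infI2)
    moreover have "a \<otimes>\<^bsub>local_ring x\<^esub> b = germ x (\<lambda>z. f z * g z)"
      using germ_ops(2)[of f x g] ho[OF *(5-8)] *(1-4) unfolding holo_at_def by blast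
    moreover have "open (U \<inter> V) \<and> x \<in> U \<inter> V \<and> U \<inter> V \<subseteq> X" using * oU by auto
    ultimately show ?thesis unfolding stalk_def by blast
  qed
  have ne: "stalk X I x \<noteq> {}" unfolding stalk_def using I4[of X] assms(2,3) by blast
  have neg: "\<ominus>\<^bsub>local_ring x\<^esub> a \<in> stalk X I x" if "a \<in> stalk X I x" for a
    using mul[OF that, of "\<ominus>\<^bsub>local_ring x\<^esub> \<one>\<^bsub>local_ring x\<^esub>"] that sub
    by (auto simp: L.l_minus)
  show ?thesis
  proof (rule idealI)
    show "subgroup (stalk X I x) (add_monoid (local_ring x))"
      using sub add neg ne by (intro L.add.subgroupI) (auto simp: a_inv_def)
  next
    fix a b assume "a \<in> stalk X I x" "b \<in> carrier (local_ring x)"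
    then show "b \<otimes>\<^bsub>local_ring x\<^esub> a \<in> stalk X I x" "a \<otimes>\<^bsub>local_ring x\<^esub> b \<in> stalk X I x"
      using mul[of a b] L.m_comm[of a b] sub by auto
  qed (rule L.ring_axioms)
qed

end

theory Submission
  imports Defs "HOL-Complex_Analysis.Complex_Analysis" "Jordan_Normal_Form.Char_Poly"
begin

text \<open>Fix \<open>x \<in> Z\<close> and write \<open>\<phi> = g/h\<close> near \<open>x\<close>. The germs \<open>a\<close> with \<open>a g \<in> (\<I>, h)\<close> form an ideal \<open>q\<close>, and \<open>\<phi>\<close> is
  strongly holomorphic at \<open>x\<close> if and only if \<open>1 \<in> q\<close>. As relations among sections of \<open>\<I>\<close> are locally finitely
  generated, the pole set is near \<open>x\<close> the zero set of generators of \<open>q\<close>.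

  Let \<open>J\<^sub>k\<close> be the ideal of the maximal minors of \<open>f\<^sub>k\<close>. After inverting such a minor of \<open>f\<^bsub>k+1\<^esub>\<close>, the image of \<open>f\<^bsub>k+1\<^esub>\<close>
  is a direct summand, so that \<open>\<O>/\<I>\<close> has a free resolution of length \<open>k\<close>. Comparison with the Koszul complex shows
  that then an element of \<open>\<O>/\<I>\<close> annihilated by a regular sequence of \<open>\<O>\<close> of length \<open>k+1\<close> vanishes, and likewise for
  \<open>\<O>/(\<I>, h)\<close> and length \<open>k+2\<close>. The associated primes of \<open>\<I>\<close> have height \<open>p\<close> and contain regular sequences of length
  \<open>p\<close>, hence \<open>J\<^sub>p\<close> is contained in the radical of \<open>\<I>\<close>. Then, by induction on \<open>k \<ge> p\<close>, \<open>J\<^sub>k\<close> is contained in the radical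
  of \<open>q\<close>: the zero set \<open>P\<^sub>\<phi> \<inter> Z\<^sub>k\<close> of \<open>q + J\<^sub>k\<close> has codimension at least \<open>k+2\<close>, so that this ideal contains a regular
  sequence of length \<open>k+2\<close>, powers of which lie in \<open>q\<close>, and the elements of \<open>J\<^bsub>k+1\<^esub>\<close> have powers in \<open>q\<close>. For \<open>k = N\<close>
  nothing has to be inverted, and \<open>1 \<in> q\<close>.

  The regular sequences are found by induction on the number of variables, with the determinant of the
  multiplication modulo a Weierstrass polynomial as eliminant; regular points of analytic sets are lifted
  along the roots of that polynomial.\<close>

text \<open>The lengths k+1 and k+2 are degrees in the Koszul complex. With coefficients in a module
  that has a free resolution of length k, the complex of a regular sequence of length m is exact in
  degrees below m - k. An element killed by the sequence is a cocycle of degree 0, which asks for m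
  > k. If x_i g = u_i h modulo I for all i, then the u_i form a cocycle of degree 1, which asks for
  m > k + 1; this is the origin of the bound in the hypothesis. Nothing is formally inverted: every
  conclusion is stated after multiplication by a power of \<Delta>.

  Codimension is given by regular points, but the homological argument consumes regular sequences.
  One induction therefore produces both, the length of the sequence being the codimension at the
  points it constructs. As the induction on k controls only radicals, the sequences have to remain
  regular when all entries are raised to a common power.

  The ideal q belongs to the single point x, while P is a set. They are linked by functions near x
  whose germs generate the corresponding ideal at every nearby point, and this is where coherence
  enters.\<close>

no_notation Matrix.vec_index (infixl "$" 100)
no_notation fps_nth (infixl "$" 75)


section \<open>Holomorphic functions of several variables\<close>

lemma norm_smult_vec: "norm (c *s (v :: complex ^ 'n)) = cmod c * norm v"
proof -
  have "(\<Sum>i\<in>UNIV. (norm (c * v $ i))\<^sup>2) = (cmod c)\<^sup>2 * (\<Sum>i\<in>UNIV. (norm (v $ i))\<^sup>2)"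
    by (simp add: norm_mult power_mult_distrib sum_distrib_left)
  then show ?thesis
    by (simp add: norm_vec_def L2_set_def real_sqrt_mult)
qed

lemma bounded_linear_smult_vec: "bounded_linear (\<lambda>t::complex. t *s (v :: complex ^ 'n))"
proof (rule bounded_linear_intro[where K = "norm v"])
  show "(r *\<^sub>R x) *s v = r *\<^sub>R (x *s v)" for r x
    by (simp add: vec_eq_iff vector_scalar_mult_def scaleR_vec_def)
qed (simp_all add: vec_eq_iff norm_smult_vec algebra_simps)

lemma continuous_on_smult_vec [continuous_intros]:
  "continuous_on A f \<Longrightarrow> continuous_on A (\<lambda>x. f x *s (v :: complex ^ 'n))"
  by (rule bounded_linear.continuous_on[OF bounded_linear_smult_vec])

lemma holo_line_deriv:
  assumes "(f has_derivative f') (at (z + t *s v))" "\<And>c v. f' (c *s v) = c * f' v"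
  shows "((\<lambda>t. f (z + t *s (v :: complex ^ 'n))) has_field_derivative f' v) (at t)"
proof -
  have "((\<lambda>t. z + t *s v) has_derivative (\<lambda>t. t *s v)) (at t)"
    using bounded_linear_imp_has_derivative[OF bounded_linear_smult_vec[of v]]
    by (auto intro!: derivative_eq_intros)
  from has_derivative_compose[OF this assms(1)] show ?thesis
    by (simp add: has_field_derivative_def assms(2) mult.commute[of _ "f' v"])
qed

lemma holo_on_line:
  assumes "holo_on f U"
  shows "(\<lambda>t. f (z + t *s v)) holomorphic_on {t. z + t *s v \<in> U}"
  unfolding holomorphic_on_def
proof
  fix t assume "t \<in> {t. z + t *s v \<in> U}"
  then obtain f' where "(f has_derivative f') (at (z + t *s v))" "\<forall>c v. f' (c *s v) = c * f' v"
    using assms unfolding holo_on_def by blast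
  from holo_line_deriv[OF this(1)] this(2)
  show "(\<lambda>t. f (z + t *s v)) field_differentiable at t within {t. z + t *s v \<in> U}"
    by (metis field_differentiable_at_within field_differentiable_def)
qed

lemma open_line: "open U \<Longrightarrow> open {t. z + t *s (v :: complex ^ 'n) \<in> U}"
  by (rule open_vimage[unfolded vimage_def]) (auto intro!: continuous_intros)

lemma holo_on_continuous: "holo_on f U \<Longrightarrow> continuous_on U f"
  unfolding holo_on_def
  by (meson continuous_at_imp_continuous_on has_derivative_continuous)

lemma holo_on_open: "holo_on f U \<Longrightarrow> open U"
  by (simp add: holo_on_def)

lemma holo_on_cong:
  assumes "holo_on f U" "\<And>z. z \<in> U \<Longrightarrow> g z = f z"
  shows "holo_on g U"
  unfolding holo_on_def
proof (intro conjI ballI)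
  show "open U" using assms(1) by (rule holo_on_open)
  fix z assume z: "z \<in> U"
  then obtain f' where "(f has_derivative f') (at z)" "\<forall>c v. f' (c *s v) = c * f' v"
    using assms(1) unfolding holo_on_def by blast
  then show "\<exists>f'. (g has_derivative f') (at z) \<and> (\<forall>c v. f' (c *s v) = c * f' v)"
    using has_derivative_transform_within_open[of f f' z UNIV U g] z \<open>open U\<close> assms(2) by auto
qed

lemma holo_on_local:
  assumes "open U" "\<And>z. z \<in> U \<Longrightarrow> \<exists>V. z \<in> V \<and> holo_on f V"
  shows "holo_on f U"
  using assms unfolding holo_on_def by blast

lemma holo_at_holo_on: "holo_on f U \<Longrightarrow> z \<in> U \<Longrightarrow> holo_at f z"
  by (auto simp: holo_at_def)

lemma holo_on_minus: "holo_on f U \<Longrightarrow> holo_on g U \<Longrightarrow> holo_on (\<lambda>z. f z - g z) U"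
  using holo_on_simps(1)[of f U "\<lambda>z. (-1) * g z"] holo_on_simps(2)[of "\<lambda>_. -1" U g]
    holo_on_const[of U "-1"] holo_on_open[of f U] by auto

lemma holo_on_sum: "open U \<Longrightarrow> (\<And>i. i \<in> A \<Longrightarrow> holo_on (f i) U) \<Longrightarrow> holo_on (\<lambda>z. \<Sum>i\<in>A. f i z) U"
proof (induction A rule: infinite_finite_induct)
  case (insert x F)
  have "holo_on (\<lambda>z. f x z + (\<Sum>i\<in>F. f i z)) U"
    by (rule holo_on_simps(1)) (use insert in auto)
  then show ?case using insert by (auto simp: sum.insert[OF insert(1,2)])
qed (auto intro: holo_on_const)

lemma holo_on_power: "holo_on f U \<Longrightarrow> holo_on (\<lambda>z. f z ^ k) U"
proof (induction k)
  case 0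
  then show ?case using holo_on_const[of U 1] holo_on_open[of f U] by simp
next
  case (Suc k)
  then show ?case using holo_on_simps(2)[of f U "\<lambda>z. f z ^ k"] by simp
qed

lemma holo_on_inverse:
  assumes "holo_on f U" "\<And>z. z \<in> U \<Longrightarrow> f z \<noteq> 0"
  shows "holo_on (\<lambda>z. inverse (f z)) U"
  unfolding holo_on_def
proof (intro conjI ballI)
  show "open U" using assms(1) by (rule holo_on_open)
  fix z assume z: "z \<in> U"
  then obtain f' where f': "(f has_derivative f') (at z)" "\<forall>c v. f' (c *s v) = c * f' v"
    using assms(1) unfolding holo_on_def by blast
  have "((\<lambda>z. inverse (f z)) has_derivative (\<lambda>h. - (inverse (f z) * f' h * inverse (f z)))) (at z)"
    by (rule Deriv.has_derivative_inverse[OF assms(2)[OF z] f'(1)])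
  then show "\<exists>f'. ((\<lambda>z. inverse (f z)) has_derivative f') (at z) \<and> (\<forall>c v. f' (c *s v) = c * f' v)"
    using f'(2) by (intro exI[of _ "\<lambda>h. - (inverse (f z) * f' h * inverse (f z))"]) auto
qed

lemma bounded_linear_component: "bounded_linear (\<lambda>z :: complex ^ 'n. z $ i)"
  by (rule bounded_linear_vec_nth)

lemma holo_on_component: "open U \<Longrightarrow> holo_on (\<lambda>z. z $ i) U"
  unfolding holo_on_def
  using bounded_linear_imp_has_derivative[OF bounded_linear_component[of i]]
  by (auto intro!: exI[of _ "\<lambda>v. v $ i"])

lemma holo_on_compose_linear:
  assumes "holo_on f U" "open V" "\<And>z. z \<in> V \<Longrightarrow> a + T z \<in> U" "linear T" "\<And>c v. T (c *s v) = c *s T v"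
  shows "holo_on (\<lambda>z. f (a + T z)) V"
  unfolding holo_on_def
proof (intro conjI ballI)
  fix z assume z: "z \<in> V"
  then obtain f' where f': "(f has_derivative f') (at (a + T z))" "\<forall>c v. f' (c *s v) = c * f' v"
    using assms(1,3) unfolding holo_on_def by blast
  have "((\<lambda>z. a + T z) has_derivative T) (at z)"
    using bounded_linear_imp_has_derivative[OF linear_conv_bounded_linear[THEN iffD1, OF assms(4)]]
    by (auto intro!: derivative_eq_intros)
  from has_derivative_compose[OF this f'(1)]
  show "\<exists>f'. ((\<lambda>z. f (a + T z)) has_derivative f') (at z) \<and> (\<forall>c v. f' (c *s v) = c * f' v)"
    using f'(2) assms(5) by (intro exI[of _ "\<lambda>v. f' (T v)"]) auto
qed (rule assms(2))

text \<open>The one-variable identity theorem is applied on the complex line through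
  \<open>b\<close> and \<open>u\<close>. The parameters that stay in the ball form a convex, hence
  connected, set containing 0 and 1, and the function vanishes near the parameter 0.\<close>

lemma holo_identity:
  assumes f: "holo_on f (ball a r)" and b: "b \<in> ball a r" and ev: "eventually (\<lambda>z. f z = 0) (nhds b)"
    and u: "u \<in> ball a r"
  shows "f u = 0"
proof -
  let ?S = "{t. b + t *s (u - b) \<in> ball a r}"
  obtain V where V: "open V" "b \<in> V" "\<And>z. z \<in> V \<Longrightarrow> f z = 0"
    using ev unfolding eventually_nhds by blast
  have "convex ?S"
  proof -
    have "?S = (\<lambda>t. t *s (u - b)) -` ((\<lambda>z. z - b) ` ball a r)"
      by (force simp: image_iff algebra_simps)
    moreover have "convex ((\<lambda>z. z - b) ` ball a r)"
      by (rule convex_translation_subtract) simp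
    ultimately show ?thesis
      using convex_linear_vimage[OF bounded_linear.linear[OF bounded_linear_smult_vec[of "u - b"]]] by simp
  qed
  then have "connected ?S" by (rule convex_connected)
  have oS: "open ?S" by (rule open_line) simp
  let ?T = "?S \<inter> {t. b + t *s (u - b) \<in> V}"
  have "open ?T" using oS open_line[OF V(1), of b "u - b"] by auto
  have hol: "(\<lambda>t. f (b + t *s (u - b))) holomorphic_on ?S" by (rule holo_on_line[OF f])
  have "f (b + 1 *s (u - b)) = 0"
  proof (rule analytic_continuation_open[of ?T ?S "\<lambda>t. f (b + t *s (u - b))" "\<lambda>_. 0" 1])
    have "0 \<in> ?T" using b V(2) by simp
    then show "?T \<noteq> {}" by blast
    show "1 \<in> ?S" using u by simp
  qed (use hol oS \<open>open ?T\<close> \<open>connected ?S\<close> V in auto)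
  then show ?thesis by simp
qed

section \<open>Second-order estimates; holomorphy of uniform limits and of integrals with a
  parameter\<close>

lemma one_var_quadratic:
  assumes hol: "\<phi> holomorphic_on ball 0 1" and M: "\<And>t. t \<in> ball 0 1 \<Longrightarrow> cmod (\<phi> t) \<le> M"
    and t: "cmod t \<le> 1/2"
  shows "cmod (\<phi> t - \<phi> 0 - deriv \<phi> 0 * t) \<le> 32 * M * (cmod t)\<^sup>2"
proof -
  have "cmod ((deriv ^^ 0) \<phi> t - (\<Sum>i\<le>1. (deriv ^^ i) \<phi> 0 * (t - 0) ^ i / fact i)) \<le>
    32 * M * cmod (t - 0) ^ Suc 1 / fact 1"
  proof (rule complex_Taylor[of "cball 0 (1/2)" 1 "\<lambda>i. (deriv ^^ i) \<phi>"])
    fix i x assume x: "x \<in> cball (0::complex) (1/2)"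
    then have "x \<in> ball 0 1" by (auto simp: dist_norm)
    then have "(deriv ^^ i) \<phi> field_differentiable at x"
      using holomorphic_higher_deriv[OF hol open_ball, of i]
      by (simp add: holomorphic_on_imp_differentiable_at)
    then have "((deriv ^^ i) \<phi> has_field_derivative (deriv ^^ Suc i) \<phi> x) (at x)"
      by (simp add: DERIV_deriv_iff_field_differentiable)
    then show "((deriv ^^ i) \<phi> has_field_derivative (deriv ^^ Suc i) \<phi> x) (at x within cball 0 (1/2))"
      by (rule has_field_derivative_at_within)
  next
    fix x assume x: "x \<in> cball (0::complex) (1/2)"
    have sub: "cball x (1/4) \<subseteq> ball 0 1"
    proof
      fix y assume "y \<in> cball x (1/4)"
      then have "dist x y \<le> 1/4" by simp
      with x show "y \<in> ball 0 1" using dist_triangle[of 0 y x] by auto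
    qed
    \<comment> \<open>Discs of radius 1/4 about points of modulus at most 1/2 stay in the unit disc;
      Cauchy's inequality gives 2M * 16 = 32 M.\<close>
    have "cmod ((deriv ^^ 2) \<phi> x) \<le> fact 2 * M / (1/4) ^ 2"
    proof (rule Cauchy_inequality)
      show "\<phi> holomorphic_on ball x (1/4)"
        using hol by (rule holomorphic_on_subset) (use sub ball_subset_cball in fastforce)
      show "continuous_on (cball x (1/4)) \<phi>"
        using holomorphic_on_imp_continuous_on[OF hol] sub by (rule continuous_on_subset)
      show "cmod (\<phi> z) \<le> M" if "cmod (x - z) = 1/4" for z
        by (rule M) (use that sub in \<open>auto simp: dist_norm subset_iff\<close>)
    qed auto
    also have "fact 2 * M / (1/4) ^ 2 = 32 * M" by (simp add: power2_eq_square)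
    finally show "cmod ((deriv ^^ Suc 1) \<phi> x) \<le> 32 * M" by (simp add: eval_nat_numeral)
  qed (use t in auto)
  moreover have "(\<Sum>i\<le>1. (deriv ^^ i) \<phi> 0 * (t - 0) ^ i / fact i) = \<phi> 0 + deriv \<phi> 0 * t"
    by (simp add: atMost_Suc)
  ultimately show ?thesis by (simp add: power2_eq_square algebra_simps)
qed

text \<open>Rescaling \<open>v\<close> to a vector \<open>w\<close> of length \<delta> turns the
  restriction to the line into a function on the unit disc bounded by \<open>M\<close>. The estimate
  is uniform over all functions with the same bound; this lets derivatives pass to limits and under
  integrals.\<close>

lemma holo_quadratic:
  assumes f: "holo_on f (ball z \<delta>)" and \<delta>: "\<delta> > 0" and M: "\<And>u. u \<in> ball z \<delta> \<Longrightarrow> cmod (f u) \<le> M"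
    and f': "(f has_derivative f') (at z)" "\<And>c v. f' (c *s v) = c * f' v"
    and v: "norm v \<le> \<delta> / 2"
  shows "cmod (f (z + v) - f z - f' v) \<le> 32 * M / \<delta>\<^sup>2 * (norm v)\<^sup>2"
proof (cases "v = 0")
  case True
  then show ?thesis using linear_0[OF has_derivative_linear[OF f'(1)]] by simp
next
  case False
  define t where "t = complex_of_real (norm v / \<delta>)"
  define w where "w = complex_of_real (\<delta> / norm v) *s v"
  have tw: "t *s w = v" using False \<delta> by (simp add: t_def w_def vec_eq_iff)
  have nw: "norm w = \<delta>" using False \<delta> unfolding w_def norm_smult_vec norm_of_real by simp
  have nt: "cmod t = norm v / \<delta>" using \<delta> unfolding t_def norm_of_real by simp
  define \<phi> where "\<phi> = (\<lambda>t. f (z + t *s w))"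
  have in_ball: "z + s *s w \<in> ball z \<delta>" if "s \<in> ball 0 1" for s
    using that \<delta> by (simp add: dist_norm norm_smult_vec nw)
  have hol: "\<phi> holomorphic_on ball 0 1" unfolding \<phi>_def
    by (rule holomorphic_on_subset[OF holo_on_line[OF f]]) (use in_ball in auto)
  have d: "deriv \<phi> 0 = f' w"
    unfolding \<phi>_def by (rule DERIV_imp_deriv, rule holo_line_deriv) (use f' in auto)
  have nt2: "cmod t \<le> 1/2" using v \<delta> unfolding nt by (simp add: divide_simps)
  have "cmod (\<phi> t - \<phi> 0 - deriv \<phi> 0 * t) \<le> 32 * M * (cmod t)\<^sup>2"
    by (rule one_var_quadratic[OF hol _ nt2]) (simp only: \<phi>_def M in_ball)
  moreover have "f' v = deriv \<phi> 0 * t" using f'(2)[of t w] by (simp add: tw d)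
  moreover have "32 * M * (cmod t)\<^sup>2 = 32 * M / \<delta>\<^sup>2 * (norm v)\<^sup>2"
    by (simp add: nt power_divide)
  ultimately show ?thesis by (simp add: \<phi>_def tw)
qed

lemma has_derivative_from_quadratic:
  assumes L: "linear L" and \<delta>: "\<delta> > 0"
    and bd: "\<And>v. norm v < \<delta> \<Longrightarrow> cmod (f (z + v) - f z - L v) \<le> C * (norm v)\<^sup>2"
  shows "(f has_derivative L) (at (z :: complex ^ 'n))"
  unfolding has_derivative_at'
proof (intro conjI allI impI)
  show "bounded_linear L" using L by (simp add: linear_conv_bounded_linear)
  fix e :: real assume e: "e > 0"
  define d where "d = min \<delta> (e / (\<bar>C\<bar> + 1))"
  have "d > 0" using \<delta> e by (simp add: d_def)
  moreover have "norm (f x - f z - L (x - z)) / norm (x - z) < e" if x: "0 < norm (x - z)" "norm (x - z) < d" for x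
  proof -
    have "norm (f x - f z - L (x - z)) \<le> C * (norm (x - z))\<^sup>2"
      using bd[of "x - z"] x by (simp add: d_def)
    also have "\<dots> \<le> (\<bar>C\<bar> + 1) * (norm (x - z))\<^sup>2" by (intro mult_right_mono) auto
    finally have "norm (f x - f z - L (x - z)) / norm (x - z) \<le> (\<bar>C\<bar> + 1) * norm (x - z)"
      using x by (simp add: field_simps power2_eq_square)
    also have "\<dots> < (\<bar>C\<bar> + 1) * (e / (\<bar>C\<bar> + 1))"
      by (rule mult_strict_left_mono) (use x in \<open>auto simp: d_def\<close>)
    also have "\<dots> = e" by (simp add: field_simps)
    finally show ?thesis .
  qed
  ultimately show "\<exists>d>0. \<forall>x'. 0 < norm (x' - z) \<and> norm (x' - z) < d \<longrightarrow>
    norm (f x' - f z - L (x' - z)) / norm (x' - z) < e" by blast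
qed

text \<open>At the multiple of \<open>v\<close> of norm \<delta>/2 the quadratic remainder is at
  most 8M, so the derivative there is at most 10M. Rescaling gives the constant 20, which is then
  enlarged to 34.\<close>

lemma has_derivative_Cauchy_bound:
  assumes f: "holo_on f (ball z \<delta>)" and \<delta>: "\<delta> > 0" and M: "\<And>u. u \<in> ball z \<delta> \<Longrightarrow> cmod (f u) \<le> M"
    and f': "(f has_derivative f') (at z)" "\<And>c v. f' (c *s v) = c * f' v"
  shows "cmod (f' v) \<le> 34 * M / \<delta> * norm v"
proof (cases "v = 0")
  case True
  then show ?thesis using linear_0[OF has_derivative_linear[OF f'(1)]] by simp
next
  case False
  define c where "c = complex_of_real (\<delta> / (2 * norm v))"
  have nc: "cmod c = \<delta> / (2 * norm v)" using \<delta> unfolding c_def norm_of_real by simp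
  have nv: "norm (c *s v) = \<delta> / 2" using False by (simp add: norm_smult_vec nc)
  have "cmod (f (z + c *s v) - f z - f' (c *s v)) \<le> 32 * M / \<delta>\<^sup>2 * (norm (c *s v))\<^sup>2"
    by (rule holo_quadratic[OF f \<delta> M f']) (simp_all add: nv)
  also have "\<dots> = 8 * M" using \<delta> by (simp add: nv power2_eq_square)
  finally have "cmod (f' (c *s v)) \<le> 8 * M + cmod (f (z + c *s v)) + cmod (f z)"
    by (smt (verit) norm_minus_commute norm_triangle_sub norm_triangle_ineq4)
  also have "\<dots> \<le> 10 * M"
    using M[of z] M[of "z + c *s v"] \<delta> nv by (simp add: dist_norm)
  finally have "\<delta> * cmod (f' v) \<le> 20 * M * norm v"
    using False by (simp add: f'(2) norm_mult nc field_simps)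
  moreover have "M \<ge> 0" using order_trans[OF norm_ge_zero M[of z]] \<delta> by simp
  ultimately have "\<delta> * cmod (f' v) \<le> 34 * M * norm v"
    by (smt (verit) mult_right_mono norm_ge_zero)
  then show ?thesis using \<delta> by (simp add: field_simps)
qed

text \<open>The derivatives of the approximants form a Cauchy sequence by the Cauchy estimate, and the
  quadratic remainder estimate passes to the limit.\<close>

lemma holo_on_uniform_limit:
  assumes f: "\<And>k. holo_on (f k) U" and lim: "uniform_limit U f g sequentially"
  shows "holo_on g (U :: (complex ^ 'n) set)"
  unfolding holo_on_def
proof (intro conjI ballI)
  show oU: "open U" using holo_on_open[OF f[of 0]] .
  fix z assume z: "z \<in> U"
  have "continuous_on U g"
    by (rule uniform_limit_theorem[OF _ lim]) (simp_all add: holo_on_continuous[OF f])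
  then have "continuous (at z) g" using oU z by (simp add: continuous_on_eq_continuous_at)
  then have "\<forall>e>0. \<exists>d>0. \<forall>u. dist u z < d \<longrightarrow> dist (g u) (g z) < e"
    by (simp add: continuous_at_eps_delta)
  from this[rule_format, of 1] obtain d where d: "d > 0" "\<And>u. dist u z < d \<Longrightarrow> dist (g u) (g z) < 1"
    by auto
  obtain d' where d': "d' > 0" "ball z d' \<subseteq> U" using oU z by (meson open_contains_ball)
  define \<delta> where "\<delta> = min d d'"
  have \<delta>: "\<delta> > 0" "ball z \<delta> \<subseteq> U" using d d' by (auto simp: \<delta>_def)
  define M where "M = cmod (g z) + 2"
  obtain K where K: "\<And>k u. k \<ge> K \<Longrightarrow> u \<in> U \<Longrightarrow> dist (f k u) (g u) < 1"
    using uniform_limitD[OF lim, of 1] unfolding eventually_sequentially by auto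
  have M: "cmod (f k u) \<le> M" if "k \<ge> K" "u \<in> ball z \<delta>" for k u
  proof -
    have "dist (f k u) (g u) < 1" using K that \<delta> by blast
    moreover have "dist (g u) (g z) < 1" using d(2)[of u] that by (simp add: \<delta>_def dist_commute)
    ultimately show ?thesis unfolding M_def dist_norm
      using norm_triangle_ineq2[of "f k u" "g z"] norm_triangle_ineq[of "f k u - g u" "g u - g z"] by simp
  qed
  have fb: "holo_on (f k) (ball z \<delta>)" for k by (rule holo_on_subset[OF f]) (use \<delta> in auto)
  have "\<forall>k. \<exists>f'. (f k has_derivative f') (at z) \<and> (\<forall>c v. f' (c *s v) = c * f' v)"
    using f z unfolding holo_on_def by blast
  then obtain L where L: "\<And>k. (f k has_derivative L k) (at z)" "\<And>k c v. L k (c *s v) = c * L k v"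
    by metis
  have "Cauchy (\<lambda>k. L k v)" for v
    unfolding Cauchy_altdef2
  proof (intro allI impI)
    fix e :: real assume e: "e > 0"
    \<comment> \<open>Here 68 = 2 * 34: two late approximants differ by at most 2 \<eta>, and the
      Cauchy bound makes their derivatives at \<open>v\<close> differ by at most
      \<open>e * (norm v / (norm v + 1))\<close>.\<close>
    define \<eta> where "\<eta> = e * \<delta> / (68 * (norm v + 1))"
    have \<eta>: "\<eta> > 0" unfolding \<eta>_def using e \<delta>
      by (intro divide_pos_pos mult_pos_pos) (auto intro: add_nonneg_pos)
    obtain N where N: "\<And>k u. k \<ge> N \<Longrightarrow> u \<in> U \<Longrightarrow> dist (f k u) (g u) < \<eta>"
      using uniform_limitD[OF lim \<eta>] unfolding eventually_sequentially by auto
    have "dist (L k v) (L N v) < e" if k: "k \<ge> N" for k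
    proof -
      have "cmod (L k v - L N v) \<le> 34 * (2 * \<eta>) / \<delta> * norm v"
      proof (rule has_derivative_Cauchy_bound[of "\<lambda>u. f k u - f N u"])
        show "holo_on (\<lambda>u. f k u - f N u) (ball z \<delta>)" by (intro holo_on_minus fb)
        show "cmod (f k u - f N u) \<le> 2 * \<eta>" if "u \<in> ball z \<delta>" for u
          using N[OF k, of u] N[of N u] that \<delta>(2) dist_triangle2[of "f k u" "f N u" "g u"]
          by (auto simp: dist_norm subset_iff)
        show "((\<lambda>u. f k u - f N u) has_derivative (\<lambda>v. L k v - L N v)) (at z)"
          by (intro has_derivative_diff L)
        show "L k (c *s v) - L N (c *s v) = c * (L k v - L N v)" for c v
          by (simp add: L right_diff_distrib)
      qed (rule \<delta>)
      also have "\<dots> = e * (norm v / (norm v + 1))"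
        using \<delta> by (simp add: \<eta>_def field_simps add_nonneg_eq_0_iff)
      also have "\<dots> < e * 1"
        by (rule mult_strict_left_mono) (use e in \<open>auto simp: divide_less_eq add_nonneg_pos\<close>)
      finally show ?thesis by (simp add: dist_norm)
    qed
    then show "\<exists>N. \<forall>n\<ge>N. dist (L n v) (L N v) < e" by blast
  qed
  then have "\<forall>v. \<exists>l. (\<lambda>k. L k v) \<longlonglongrightarrow> l" by (simp add: Cauchy_convergent_iff convergent_def)
  then obtain L0 where L0: "\<And>v. (\<lambda>k. L k v) \<longlonglongrightarrow> L0 v" by metis
  have lin: "linear L0"
  proof (rule linearI)
    show "L0 (u + v) = L0 u + L0 v" for u v
    proof (rule LIMSEQ_unique[OF L0])
      have "(\<lambda>k. L k u + L k v) \<longlonglongrightarrow> L0 u + L0 v" by (intro tendsto_add L0)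
      then show "(\<lambda>k. L k (u + v)) \<longlonglongrightarrow> L0 u + L0 v"
        by (simp add: linear_add[OF has_derivative_linear[OF L(1)]])
    qed
    show "L0 (r *\<^sub>R v) = r *\<^sub>R L0 v" for r v
    proof (rule LIMSEQ_unique[OF L0])
      have "(\<lambda>k. r *\<^sub>R L k v) \<longlonglongrightarrow> r *\<^sub>R L0 v" by (intro tendsto_intros L0)
      then show "(\<lambda>k. L k (r *\<^sub>R v)) \<longlonglongrightarrow> r *\<^sub>R L0 v"
        by (simp add: linear_scale[OF has_derivative_linear[OF L(1)]])
    qed
  qed
  have hom: "L0 (c *s v) = c * L0 v" for c v
  proof (rule LIMSEQ_unique[OF L0])
    show "(\<lambda>k. L k (c *s v)) \<longlonglongrightarrow> c * L0 v" unfolding L(2) by (intro tendsto_intros L0)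
  qed
  have fg: "(\<lambda>k. f k u) \<longlonglongrightarrow> g u" if "u \<in> U" for u
    by (rule tendsto_uniform_limitI[OF lim that])
  have "cmod (g (z + v) - g z - L0 v) \<le> 32 * M / \<delta>\<^sup>2 * (norm v)\<^sup>2" if v: "norm v < \<delta> / 2" for v
  proof (rule tendsto_upperbound)
    have "z + v \<in> U" using v \<delta> by (auto simp: dist_norm subset_iff)
    then show "(\<lambda>k. cmod (f k (z + v) - f k z - L k v)) \<longlonglongrightarrow> cmod (g (z + v) - g z - L0 v)"
      by (intro tendsto_intros fg L0 z)
    show "\<forall>\<^sub>F k in sequentially. cmod (f k (z + v) - f k z - L k v) \<le> 32 * M / \<delta>\<^sup>2 * (norm v)\<^sup>2"
      using eventually_ge_at_top[of K]
    proof eventually_elim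
      case (elim k)
      show ?case by (rule holo_quadratic[OF fb \<delta>(1) M L]) (use elim v in auto)
    qed
  qed simp
  then have "(g has_derivative L0) (at z)"
    by (rule has_derivative_from_quadratic[OF lin, of "\<delta> / 2", rotated]) (use \<delta> in auto)
  then show "\<exists>f'. (g has_derivative f') (at z) \<and> (\<forall>c v. f' (c *s v) = c * f' v)"
    using hom by blast
qed

text \<open>By compactness of the closed ball times the interval, the integrand is bounded there, so
  its remainder is quadratic in the increment uniformly in \<theta>. Integrating this estimate gives
  the derivative of the integral.\<close>

lemma holo_on_integral:
  fixes F :: "complex ^ 'n \<Rightarrow> real \<Rightarrow> complex"
  assumes oU: "open U" and holo: "\<And>\<theta>. \<theta> \<in> {0..1} \<Longrightarrow> holo_on (\<lambda>z. F z \<theta>) U"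
    and cont: "continuous_on (U \<times> {0..1}) (\<lambda>(z, \<theta>). F z \<theta>)"
  shows "holo_on (\<lambda>z. integral {0..1} (F z)) U"
  unfolding holo_on_def
proof (intro conjI ballI oU)
  fix z assume z: "z \<in> U"
  obtain \<delta> where \<delta>: "\<delta> > 0" "cball z \<delta> \<subseteq> U" using oU z by (meson open_contains_cball)
  have cpt: "compact ((\<lambda>(z, \<theta>). F z \<theta>) ` (cball z \<delta> \<times> {0..1}))"
    by (intro compact_continuous_image continuous_on_subset[OF cont] compact_Times) (use \<delta> in auto)
  obtain M where M0: "\<forall>y \<in> (\<lambda>(z, \<theta>). F z \<theta>) ` (cball z \<delta> \<times> {0..1}). norm y \<le> M"
    using compact_imp_bounded[OF cpt, unfolded bounded_iff] by (elim exE)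
  have M: "cmod (F u \<theta>) \<le> M" if "u \<in> ball z \<delta>" "\<theta> \<in> {0..1}" for u \<theta>
    using M0 that by force
  have "\<forall>\<theta>\<in>{0..1}. \<exists>f'. ((\<lambda>z. F z \<theta>) has_derivative f') (at z) \<and> (\<forall>c v. f' (c *s v) = c * f' v)"
    using holo z unfolding holo_on_def by blast
  then obtain L where L: "\<And>\<theta>. \<theta> \<in> {0..1} \<Longrightarrow> ((\<lambda>z. F z \<theta>) has_derivative L \<theta>) (at z)"
    "\<And>\<theta> c v. \<theta> \<in> {0..1} \<Longrightarrow> L \<theta> (c *s v) = c * L \<theta> v" by metis
  have quad: "cmod (F (z + v) \<theta> - F z \<theta> - L \<theta> v) \<le> 32 * M / \<delta>\<^sup>2 * (norm v)\<^sup>2"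
    if "\<theta> \<in> {0..1}" "norm v \<le> \<delta> / 2" for v \<theta>
  proof -
    have "ball z \<delta> \<subseteq> U" using \<delta> ball_subset_cball[of z \<delta>] by blast
    then have "holo_on (\<lambda>z. F z \<theta>) (ball z \<delta>)" by (intro holo_on_subset[OF holo[OF that(1)]]) auto
    then show ?thesis by (rule holo_quadratic) (use that M L \<delta> in auto)
  qed
  have contF: "continuous_on {0..1} (F u)" if "u \<in> U" for u
  proof -
    have "continuous_on {0..1} ((\<lambda>(z, \<theta>). F z \<theta>) \<circ> (\<lambda>\<theta>. (u, \<theta>)))"
      by (intro continuous_on_compose continuous_intros continuous_on_subset[OF cont]) (use that in auto)
    then show ?thesis by (simp add: o_def)
  qed
  \<comment> \<open>The \<theta>-dependence of the derivative is not known to be continuous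
    beforehand. It is a uniform limit of difference quotients with real steps \<open>h k\<close>;
    \<kappa> keeps the displaced points within \<delta>/2 of \<open>z\<close>.\<close>
  have contL: "continuous_on {0..1} (\<lambda>\<theta>. L \<theta> v)" for v
  proof -
    define \<kappa> where "\<kappa> = \<delta> / 2 / (norm v + 1)"
    have nv1: "norm v + 1 > 0" by (simp add: add_nonneg_pos)
    have kpos: "\<kappa> > 0" using \<delta>(1) nv1 by (simp add: \<kappa>_def)
    have kv: "\<kappa> * norm v \<le> \<delta> / 2" using \<delta>(1) nv1 by (simp add: \<kappa>_def divide_simps)
    define h where "h k = \<kappa> * inverse (real (Suc k))" for k
    have hpos: "h k > 0" for k using kpos by (simp add: h_def)
    have hv: "norm (complex_of_real (h k) *s v) \<le> \<delta> / 2" for k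
    proof -
      have "h k \<le> \<kappa> * 1" unfolding h_def
        by (rule mult_left_mono) (use kpos in \<open>auto simp: inverse_le_1_iff\<close>)
      then have "h k * norm v \<le> \<kappa> * norm v" by (intro mult_right_mono) auto
      then show ?thesis using hpos[of k] kv by (simp add: norm_smult_vec)
    qed
    have hlim: "h \<longlonglongrightarrow> 0"
    proof -
      have "h \<longlonglongrightarrow> \<kappa> * 0" unfolding h_def
        by (intro tendsto_intros LIMSEQ_inverse_real_of_nat)
      then show ?thesis by simp
    qed
    have ul: "uniform_limit {0..1} (\<lambda>k \<theta>. (F (z + complex_of_real (h k) *s v) \<theta> - F z \<theta>) / h k) (\<lambda>\<theta>. L \<theta> v) sequentially"
      unfolding uniform_limit_iff
    proof (intro allI impI)
      fix e :: real assume e: "e > 0"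
      have "(\<lambda>k. 32 * M / \<delta>\<^sup>2 * (norm v)\<^sup>2 * h k) \<longlonglongrightarrow> 32 * M / \<delta>\<^sup>2 * (norm v)\<^sup>2 * 0"
        by (intro tendsto_intros hlim)
      then have "\<forall>\<^sub>F k in sequentially. 32 * M / \<delta>\<^sup>2 * (norm v)\<^sup>2 * h k < e"
        using e by (intro order_tendstoD) auto
      then show "\<forall>\<^sub>F k in sequentially. \<forall>\<theta>\<in>{0..1}.
        dist ((F (z + complex_of_real (h k) *s v) \<theta> - F z \<theta>) / h k) (L \<theta> v) < e"
      proof eventually_elim
        case (elim k)
        show ?case
        proof
          fix \<theta> :: real assume t: "\<theta> \<in> {0..1}"
          have eq: "(F (z + complex_of_real (h k) *s v) \<theta> - F z \<theta>) / h k - L \<theta> v =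
            (F (z + complex_of_real (h k) *s v) \<theta> - F z \<theta> - L \<theta> (complex_of_real (h k) *s v)) / h k"
            using hpos[of k] by (simp add: L(2)[OF t] field_simps)
          have "dist ((F (z + complex_of_real (h k) *s v) \<theta> - F z \<theta>) / h k) (L \<theta> v) =
            cmod (F (z + complex_of_real (h k) *s v) \<theta> - F z \<theta> - L \<theta> (complex_of_real (h k) *s v)) / h k"
            unfolding dist_norm eq using hpos[of k] by (simp add: norm_divide)
          also have "\<dots> \<le> (32 * M / \<delta>\<^sup>2 * (norm (complex_of_real (h k) *s v))\<^sup>2) / h k"
            by (intro divide_right_mono quad t hv) (use hpos[of k] in simp)
          also have "\<dots> = 32 * M / \<delta>\<^sup>2 * (norm v)\<^sup>2 * h k"
            using hpos[of k] by (simp add: norm_smult_vec power2_eq_square)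
          finally show "dist ((F (z + complex_of_real (h k) *s v) \<theta> - F z \<theta>) / h k) (L \<theta> v) < e"
            using elim by linarith
        qed
      qed
    qed
    have zU: "z + complex_of_real (h k) *s v \<in> U" for k
      using hv[of k] \<delta> by (auto simp: dist_norm subset_iff)
    show ?thesis
    proof (rule uniform_limit_theorem[OF _ ul])
      show "\<forall>\<^sub>F k in sequentially. continuous_on {0..1}
        (\<lambda>\<theta>. (F (z + complex_of_real (h k) *s v) \<theta> - F z \<theta>) / h k)"
      proof (intro always_eventually allI)
        show "continuous_on {0..1} (\<lambda>\<theta>. (F (z + complex_of_real (h k) *s v) \<theta> - F z \<theta>) / h k)" for k
          using hpos[of k] by (intro continuous_intros contF zU z) auto
      qed
    qed simp
  qed
  have intF: "F u integrable_on {0..1}" if "u \<in> U" for u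
    by (rule integrable_continuous_real[OF contF[OF that]])
  have intL: "(\<lambda>\<theta>. L \<theta> v) integrable_on {0..1}" for v
    by (rule integrable_continuous_real[OF contL])
  define L0 where "L0 v = integral {0..1} (\<lambda>\<theta>. L \<theta> v)" for v
  have lin: "linear L0"
  proof (rule linearI)
    show "L0 (u + v) = L0 u + L0 v" for u v
    proof -
      have "L0 (u + v) = integral {0..1} (\<lambda>\<theta>. L \<theta> u + L \<theta> v)" unfolding L0_def
        by (rule integral_cong) (simp add: linear_add[OF has_derivative_linear[OF L(1)]])
      then show ?thesis by (simp add: L0_def integral_add[OF intL intL])
    qed
    show "L0 (r *\<^sub>R v) = r *\<^sub>R L0 v" for r v
    proof -
      have "L0 (r *\<^sub>R v) = integral {0..1} (\<lambda>\<theta>. r *\<^sub>R L \<theta> v)" unfolding L0_def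
        by (rule integral_cong) (simp add: linear_scale[OF has_derivative_linear[OF L(1)]])
      then show ?thesis by (simp add: L0_def)
    qed
  qed
  have hom: "L0 (c *s v) = c * L0 v" for c v
  proof -
    have "L0 (c *s v) = integral {0..1} (\<lambda>\<theta>. c * L \<theta> v)" unfolding L0_def
      by (rule integral_cong) (simp add: L(2))
    then show ?thesis by (simp add: L0_def)
  qed
  have "cmod (integral {0..1} (F (z + v)) - integral {0..1} (F z) - L0 v) \<le> 32 * M / \<delta>\<^sup>2 * (norm v)\<^sup>2"
    if v: "norm v < \<delta> / 2" for v
  proof -
    have "z + v \<in> U" using v \<delta> by (auto simp: dist_norm subset_iff)
    then have "integral {0..1} (F (z + v)) - integral {0..1} (F z) - L0 v =
      integral {0..1} (\<lambda>\<theta>. F (z + v) \<theta> - F z \<theta> - L \<theta> v)"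
      unfolding L0_def by (simp add: integral_diff intF intL z integrable_diff)
    also have "cmod \<dots> \<le> (32 * M / \<delta>\<^sup>2 * (norm v)\<^sup>2) * (1 - 0)"
    proof (rule integral_bound)
      show "continuous_on {0..1} (\<lambda>\<theta>. F (z + v) \<theta> - F z \<theta> - L \<theta> v)"
        by (intro continuous_intros contF contL z \<open>z + v \<in> U\<close>)
      show "cmod (F (z + v) \<theta> - F z \<theta> - L \<theta> v) \<le> 32 * M / \<delta>\<^sup>2 * (norm v)\<^sup>2" if "\<theta> \<in> {0..1}" for \<theta>
        by (rule quad) (use that v in auto)
    qed simp
    finally show ?thesis by simp
  qed
  then have "((\<lambda>z. integral {0..1} (F z)) has_derivative L0) (at z)"
    by (rule has_derivative_from_quadratic[OF lin, of "\<delta> / 2", rotated]) (use \<delta> in auto)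
  then show "\<exists>f'. ((\<lambda>z. integral {0..1} (F z)) has_derivative f') (at z) \<and> (\<forall>c v. f' (c *s v) = c * f' v)"
    using hom by blast
qed

section \<open>Replacing one coordinate, boxes, and the divided difference in one coordinate\<close>

definition upd :: "'n \<Rightarrow> complex \<Rightarrow> complex ^ 'n \<Rightarrow> complex ^ 'n" where
  "upd s w z = (\<chi> i. if i = s then w else z $ i)"

lemma upd_nth [simp]: "upd s w z $ i = (if i = s then w else z $ i)"
  by (simp add: upd_def)

lemma upd_upd [simp]: "upd s w (upd s w' z) = upd s w z"
  by (simp add: Finite_Cartesian_Product.vec_eq_iff)

lemma upd_same [simp]: "upd s (z $ s) z = z"
  by (simp add: Finite_Cartesian_Product.vec_eq_iff)

lemma upd_eq: "upd s w z = upd s 0 z + w *s axis s 1"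
  by (simp add: Finite_Cartesian_Product.vec_eq_iff axis_def)

lemma upd_eq': "upd s w z = w *s axis s 1 + upd s 0 z"
  by (simp add: Finite_Cartesian_Product.vec_eq_iff axis_def)

lemma linear_upd_0: "linear (upd s 0)"
  by (rule linearI) (simp_all add: Finite_Cartesian_Product.vec_eq_iff)

lemma upd_0_smult: "upd s 0 (c *s v) = c *s upd s 0 v"
  by (simp add: Finite_Cartesian_Product.vec_eq_iff)

lemma continuous_on_upd [continuous_intros]:
  assumes "continuous_on A f" "continuous_on A g"
  shows "continuous_on A (\<lambda>x. upd s (f x) (g x))"
proof -
  have "continuous_on A (\<lambda>x. upd s 0 (g x) + f x *s axis s 1)"
    using linear_upd_0[of s, unfolded linear_conv_bounded_linear] assms
    by (intro continuous_intros bounded_linear.continuous_on[of "upd s 0"])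
  then show ?thesis by (simp add: upd_eq[symmetric])
qed

lemma holo_on_upd:
  assumes "holo_on f U" "open V" "\<And>z. z \<in> V \<Longrightarrow> upd s w z \<in> U"
  shows "holo_on (\<lambda>z. f (upd s w z)) V"
  using holo_on_compose_linear[OF assms(1,2), of "w *s axis s 1" "upd s 0"] assms(3)
  by (simp add: upd_eq'[of s w, symmetric] linear_upd_0 upd_0_smult)

text \<open>The two radii are independent for the sake of the division theorem: \<epsilon> controls
  the norm of the divided difference in the direction \<open>s\<close>, and \<delta> is shrunk
  afterwards to make coefficients small.\<close>

definition pbox :: "'n \<Rightarrow> real \<Rightarrow> real \<Rightarrow> (complex ^ 'n) set" where
  "pbox s \<delta> \<epsilon> = {z. cmod (z $ s) < \<epsilon> \<and> (\<forall>i. i \<noteq> s \<longrightarrow> cmod (z $ i) < \<delta>)}"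

lemma open_pbox: "open (pbox s \<delta> \<epsilon>)"
proof -
  have "open {z :: complex ^ 'n. cmod (z $ i) < r}" for i r
    by (intro open_Collect_less continuous_intros bounded_linear.continuous_on[OF bounded_linear_component])
  then have "open ({z. cmod (z $ s) < \<epsilon>} \<inter> (\<Inter>i\<in>-{s}. {z. cmod (z $ i) < \<delta>}))"
    by (intro open_Int open_INT) auto
  also have "{z. cmod (z $ s) < \<epsilon>} \<inter> (\<Inter>i\<in>-{s}. {z. cmod (z $ i) < \<delta>}) = pbox s \<delta> \<epsilon>"
    by (auto simp: pbox_def)
  finally show ?thesis .
qed

lemma pbox_mono: "\<delta> \<le> \<delta>' \<Longrightarrow> \<epsilon> \<le> \<epsilon>' \<Longrightarrow> pbox s \<delta> \<epsilon> \<subseteq> pbox s \<delta>' \<epsilon>'"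
  by (fastforce simp: pbox_def)

lemma upd_in_pbox: "z \<in> pbox s \<delta> \<epsilon> \<Longrightarrow> cmod w < \<epsilon>' \<Longrightarrow> upd s w z \<in> pbox s \<delta> \<epsilon>'"
  by (auto simp: pbox_def)

lemma zero_in_pbox: "\<delta> > 0 \<Longrightarrow> \<epsilon> > 0 \<Longrightarrow> 0 \<in> pbox s \<delta> \<epsilon>"
  by (auto simp: pbox_def)

lemma ball_contains_pbox: 
  assumes "r > 0" obtains \<delta> where "\<delta> > 0" "pbox s \<delta> \<delta> \<subseteq> ball (0 :: complex ^ 'n) r"
proof
  let ?\<delta> = "r / (real CARD('n) + 1)"
  show "?\<delta> > 0" using assms by simp
  show "pbox s ?\<delta> ?\<delta> \<subseteq> ball (0 :: complex ^ 'n) r"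
  proof
    fix z :: "complex ^ 'n" assume z: "z \<in> pbox s ?\<delta> ?\<delta>"
    have "norm z \<le> (\<Sum>i\<in>UNIV. norm (z $ i))" unfolding norm_vec_def by (rule L2_set_le_sum) simp
    also have "\<dots> \<le> (\<Sum>i\<in>(UNIV :: 'n set). ?\<delta>)"
    proof (rule sum_mono)
      show "norm (z $ i) \<le> ?\<delta>" for i using z by (cases "i = s") (auto simp: pbox_def less_imp_le)
    qed
    also have "\<dots> = real CARD('n) * ?\<delta>" by simp
    also have "\<dots> < r" using assms by (simp add: field_simps)
    finally show "z \<in> ball 0 r" by simp
  qed
qed

lemma holomorphic_on_upd:
  assumes "holo_on g (pbox s \<delta> \<epsilon>)" "z \<in> pbox s \<delta> \<epsilon>"
  shows "(\<lambda>w. g (upd s w z)) holomorphic_on ball 0 \<epsilon>"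
proof -
  have "(\<lambda>w. g (upd s 0 z + w *s axis s 1)) holomorphic_on ball 0 \<epsilon>"
    by (rule holomorphic_on_subset[OF holo_on_line[OF assms(1)]])
      (use upd_in_pbox[OF assms(2)] in \<open>auto simp: upd_eq[symmetric]\<close>)
  then show ?thesis by (simp add: upd_eq[symmetric])
qed

text \<open>This is the quotient in the division of \<open>g\<close> by the coordinate
  \<open>z $ s\<close>, with the derivative as its extension to the hyperplane where this coordinate
  is 0. Its iterates, evaluated at the origin, are the Taylor coefficients of \<open>g\<close> along
  the axis.\<close>

definition dquot :: "'n \<Rightarrow> (complex ^ 'n \<Rightarrow> complex) \<Rightarrow> complex ^ 'n \<Rightarrow> complex" where
  "dquot s g z = (if z $ s = 0 then deriv (\<lambda>w. g (upd s w z)) 0 else (g z - g (upd s 0 z)) / z $ s)"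

lemma dquot_mult: "g z = g (upd s 0 z) + z $ s * dquot s g z"
  using upd_same[of s z] by (cases "z $ s = 0") (auto simp: dquot_def)

lemma dquot_one_var:
  assumes "holo_on g (pbox s \<delta> \<epsilon>)" "z \<in> pbox s \<delta> \<epsilon>"
  shows "(\<lambda>w. dquot s g (upd s w z)) holomorphic_on ball 0 \<epsilon>"
proof -
  let ?\<phi> = "\<lambda>w. g (upd s w z)"
  have "(\<lambda>w. if w = 0 then deriv ?\<phi> 0 else (?\<phi> w - ?\<phi> 0) / (w - 0)) holomorphic_on ball 0 \<epsilon>"
    by (rule pole_lemma_open[OF holomorphic_on_upd[OF assms]]) simp
  moreover have "(\<lambda>w. if w = 0 then deriv ?\<phi> 0 else (?\<phi> w - ?\<phi> 0) / (w - 0)) = (\<lambda>w. dquot s g (upd s w z))"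
    unfolding dquot_def upd_upd by (simp add: fun_eq_iff)
  ultimately show ?thesis by simp
qed

text \<open>Cauchy's formula for the quotient in the variable \<open>s\<close>. On the circle the
  denominator does not vanish, so the integrand is visibly holomorphic in all variables. The
  derivative of the circle contributes 2 pi i times the point of the circle, which cancels the
  constant of Cauchy's formula and the denominator of the quotient.\<close>

lemma dquot_integral:
  assumes g: "holo_on g (pbox s \<delta> \<epsilon>)" and z: "z \<in> pbox s \<delta> \<rho>" and \<rho>: "\<rho> < \<epsilon>"
  shows "dquot s g z = integral {0..1} (\<lambda>\<theta>. (g (upd s (circlepath 0 \<rho> \<theta>) z) - g (upd s 0 z)) / (circlepath 0 \<rho> \<theta> - z $ s))"
proof -
  have z': "z \<in> pbox s \<delta> \<epsilon>" using z \<rho> pbox_mono[of \<delta> \<delta> \<rho> \<epsilon> s] by auto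
  have \<rho>0: "\<rho> > 0" using z by (auto simp: pbox_def intro: le_less_trans[OF norm_ge_zero])
  let ?\<psi> = "\<lambda>w. dquot s g (upd s w z)"
  have "((\<lambda>u. ?\<psi> u / (u - z $ s)) has_contour_integral (2 * complex_of_real pi * \<i> * ?\<psi> (z $ s))) (circlepath 0 \<rho>)"
    by (rule Cauchy_integral_circlepath_simple[where f = ?\<psi>])
      (use z \<rho> holomorphic_on_subset[OF dquot_one_var[OF g z'], of "cball 0 \<rho>"] in
        \<open>auto simp: pbox_def subset_iff\<close>)
  then have "((\<lambda>x. ?\<psi> (circlepath 0 \<rho> x) / (circlepath 0 \<rho> x - z $ s) * vector_derivative (circlepath 0 \<rho>) (at x))
    has_integral (2 * complex_of_real pi * \<i> * dquot s g z)) {0..1}"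
    by (simp add: has_contour_integral)
  from has_integral_mult_right[OF this, of "1 / (2 * complex_of_real pi * \<i>)"]
  have "((\<lambda>x. 1 / (2 * complex_of_real pi * \<i>) * (?\<psi> (circlepath 0 \<rho> x) / (circlepath 0 \<rho> x - z $ s) * vector_derivative (circlepath 0 \<rho>) (at x)))
    has_integral dquot s g z) {0..1}" by simp
  moreover have "1 / (2 * complex_of_real pi * \<i>) * (?\<psi> (circlepath 0 \<rho> x) / (circlepath 0 \<rho> x - z $ s) * vector_derivative (circlepath 0 \<rho>) (at x))
     = (g (upd s (circlepath 0 \<rho> x) z) - g (upd s 0 z)) / (circlepath 0 \<rho> x - z $ s)" for x
    unfolding vector_derivative_circlepath using \<rho>0 by (simp add: circlepath dquot_def divide_simps)
  ultimately show ?thesis by (simp add: integral_unique)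
qed

lemma holo_on_dquot:
  assumes g: "holo_on g (pbox s \<delta> \<epsilon>)"
  shows "holo_on (dquot s g) (pbox s \<delta> \<epsilon>)"
proof (rule holo_on_local[OF open_pbox])
  fix z assume z: "z \<in> pbox s \<delta> \<epsilon>"
  then obtain \<rho> where \<rho>: "cmod (z $ s) < \<rho>" "\<rho> < \<epsilon>" using dense[of "cmod (z $ s)" \<epsilon>] by (auto simp: pbox_def)
  have \<rho>0: "\<rho> > 0" using \<rho>(1) by (auto intro: le_less_trans[OF norm_ge_zero])
  let ?V = "pbox s \<delta> \<rho>"
  let ?c = "circlepath 0 \<rho>"
  have nc: "cmod (?c \<theta>) = \<rho>" for \<theta>
    using \<rho>0 by (simp add: circlepath norm_mult)
  have nz: "?c \<theta> - y $ s \<noteq> 0" if "y \<in> ?V" for \<theta> y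
    using nc[of \<theta>] that by (auto simp: pbox_def)
  have up: "upd s (?c \<theta>) y \<in> pbox s \<delta> \<epsilon>" "upd s 0 y \<in> pbox s \<delta> \<epsilon>" if "y \<in> ?V" for \<theta> y
    using upd_in_pbox[OF that, of "?c \<theta>" \<epsilon>] upd_in_pbox[OF that, of 0 \<epsilon>] nc \<rho> \<rho>0 by auto
  have cc: "continuous_on UNIV ?c" by (auto simp: circlepath intro!: continuous_intros)
  have "holo_on (\<lambda>z. integral {0..1} (\<lambda>\<theta>. (g (upd s (?c \<theta>) z) - g (upd s 0 z)) / (?c \<theta> - z $ s))) ?V"
  proof (rule holo_on_integral[OF open_pbox])
    fix \<theta> :: real
    show "holo_on (\<lambda>z. (g (upd s (?c \<theta>) z) - g (upd s 0 z)) / (?c \<theta> - z $ s)) ?V"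
      unfolding divide_inverse
      by (intro holo_on_simps(2) holo_on_minus holo_on_inverse holo_on_upd[OF g] open_pbox up
          holo_on_const holo_on_component nz)
  next
    have c1: "continuous_on (?V \<times> {0..1}) (\<lambda>x. g (upd s (?c (snd x)) (fst x)))"
      by (rule continuous_on_compose2[OF holo_on_continuous[OF g]])
        (auto intro!: continuous_intros continuous_on_compose2[OF cc] up)
    have c2: "continuous_on (?V \<times> {0..1}) (\<lambda>x. g (upd s 0 (fst x)))"
      by (rule continuous_on_compose2[OF holo_on_continuous[OF g]])
        (auto intro!: continuous_intros up)
    have "continuous_on (?V \<times> {0..1}) (\<lambda>x. (g (upd s (?c (snd x)) (fst x)) - g (upd s 0 (fst x))) / (?c (snd x) - fst x $ s))"
      by (intro continuous_on_divide continuous_on_diff c1 c2)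
        (auto intro!: continuous_intros bounded_linear.continuous_on[OF bounded_linear_component] continuous_on_compose2[OF cc]
          dest: nz simp del: right_minus_eq)
    then show "continuous_on (?V \<times> {0..1}) (\<lambda>(z, \<theta>). (g (upd s (?c \<theta>) z) - g (upd s 0 z)) / (?c \<theta> - z $ s))"
      by (simp add: case_prod_unfold)
  qed
  then have "holo_on (dquot s g) ?V"
    by (rule holo_on_cong) (rule dquot_integral[OF g _ \<rho>(2)])
  moreover have "z \<in> ?V" using z \<rho> by (auto simp: pbox_def)
  ultimately show "\<exists>V. z \<in> V \<and> holo_on (dquot s g) V" by blast
qed

text \<open>On the circle of radius \<rho> the numerator is at most 2M, the maximum principle
  carries 2M/\<rho> inside, and \<rho> tends to \<epsilon>. Each division thus costs a factor
  2/\<epsilon>, whatever \<delta> is.\<close>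

lemma dquot_bound:
  assumes g: "holo_on g (pbox s \<delta> \<epsilon>)" and M: "\<And>u. u \<in> pbox s \<delta> \<epsilon> \<Longrightarrow> cmod (g u) \<le> M"
    and z: "z \<in> pbox s \<delta> \<epsilon>"
  shows "cmod (dquot s g z) \<le> 2 * M / \<epsilon>"
proof -
  have \<epsilon>: "\<epsilon> > 0" using z by (auto simp: pbox_def intro: le_less_trans[OF norm_ge_zero])
  have bd: "cmod (dquot s g z) \<le> 2 * M / \<rho>" if \<rho>: "cmod (z $ s) < \<rho>" "\<rho> < \<epsilon>" for \<rho>
  proof -
    have \<rho>0: "\<rho> > 0" using \<rho>(1) by (auto intro: le_less_trans[OF norm_ge_zero])
    have hol: "(\<lambda>w. dquot s g (upd s w z)) holomorphic_on cball 0 \<rho>"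
      by (rule holomorphic_on_subset[OF dquot_one_var[OF g z]]) (use \<rho> in auto)
    have "cmod (dquot s g (upd s (z $ s) z)) \<le> 2 * M / \<rho>"
    proof (rule maximum_modulus_frontier[of "\<lambda>w. dquot s g (upd s w z)" "cball 0 \<rho>"])
      show "(\<lambda>w. dquot s g (upd s w z)) holomorphic_on interior (cball 0 \<rho>)"
        by (rule holomorphic_on_subset[OF hol]) (rule interior_subset)
      show "continuous_on (closure (cball 0 \<rho>)) (\<lambda>w. dquot s g (upd s w z))"
        using holomorphic_on_imp_continuous_on[OF hol] by simp
      fix w assume "w \<in> frontier (cball (0 :: complex) \<rho>)"
      then have w: "cmod w = \<rho>" using \<rho>0 by simp
      have "cmod (g (upd s w z)) \<le> M" "cmod (g (upd s 0 z)) \<le> M"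
        using M upd_in_pbox[OF z, of w \<epsilon>] upd_in_pbox[OF z, of 0 \<epsilon>] w \<rho> \<epsilon> by auto
      then have "cmod (g (upd s w z) - g (upd s 0 z)) \<le> 2 * M"
        using norm_triangle_ineq4[of "g (upd s w z)" "g (upd s 0 z)"] by linarith
      moreover have "w \<noteq> 0" using w \<rho>0 by auto
      ultimately show "cmod (dquot s g (upd s w z)) \<le> 2 * M / \<rho>"
        using \<rho>0 by (simp add: dquot_def norm_divide w divide_right_mono)
    qed (use \<rho> in auto)
    then show ?thesis by simp
  qed
  have zs: "cmod (z $ s) < \<epsilon>" using z by (auto simp: pbox_def)
  have "((\<lambda>\<rho>. 2 * M / \<rho>) \<longlongrightarrow> 2 * M / \<epsilon>) (at_left \<epsilon>)"
    by (intro tendsto_intros) (use \<epsilon> in auto)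
  then show ?thesis
  proof (rule tendsto_lowerbound)
    show "\<forall>\<^sub>F \<rho> in at_left \<epsilon>. cmod (dquot s g z) \<le> 2 * M / \<rho>"
      unfolding eventually_at_left_field by (intro exI[of _ "cmod (z $ s)"]) (use zs bd in auto)
  qed simp
qed

lemma dquot_cong:
  assumes "\<And>z. z \<in> pbox s \<delta> \<epsilon> \<Longrightarrow> g z = h z" "z \<in> pbox s \<delta> \<epsilon>"
  shows "dquot s g z = dquot s h z"
proof -
  have \<epsilon>: "\<epsilon> > 0" using assms(2) by (auto simp: pbox_def intro: le_less_trans[OF norm_ge_zero])
  have "\<forall>\<^sub>F w in nhds 0. w \<in> ball 0 \<epsilon>"
    by (rule eventually_nhds_in_open) (use \<epsilon> in auto)
  then have "\<forall>\<^sub>F w in nhds 0. g (upd s w z) = h (upd s w z)"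
    by eventually_elim (use upd_in_pbox[OF assms(2)] assms(1) in auto)
  then have "deriv (\<lambda>w. g (upd s w z)) 0 = deriv (\<lambda>w. h (upd s w z)) 0"
    by (rule deriv_cong_ev) simp
  moreover have "upd s 0 z \<in> pbox s \<delta> \<epsilon>" using upd_in_pbox[OF assms(2), of 0 \<epsilon>] \<epsilon> by simp
  ultimately show ?thesis using assms by (simp add: dquot_def)
qed

lemma dquot_add:
  assumes g: "holo_on g (pbox s \<delta> \<epsilon>)" and h: "holo_on h (pbox s \<delta> \<epsilon>)" and z: "z \<in> pbox s \<delta> \<epsilon>"
  shows "dquot s (\<lambda>z. g z + h z) z = dquot s g z + dquot s h z"
proof -
  have \<epsilon>: "\<epsilon> > 0" using z by (auto simp: pbox_def intro: le_less_trans[OF norm_ge_zero])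
  then have "(\<lambda>w. g (upd s w z)) field_differentiable at 0" "(\<lambda>w. h (upd s w z)) field_differentiable at 0"
    using holomorphic_on_upd[OF g z] holomorphic_on_upd[OF h z]
    by (auto intro!: holomorphic_on_imp_differentiable_at[of _ "ball 0 \<epsilon>"])
  then show ?thesis by (simp add: dquot_def add_divide_distrib[symmetric])
qed

lemma holo_on_dquot_pow:
  "holo_on g (pbox s \<delta> \<epsilon>) \<Longrightarrow> holo_on ((dquot s ^^ d) g) (pbox s \<delta> \<epsilon>)"
  by (induction d) (auto intro: holo_on_dquot)

lemma dquot_pow_add:
  assumes "holo_on g (pbox s \<delta> \<epsilon>)" "holo_on h (pbox s \<delta> \<epsilon>)" "z \<in> pbox s \<delta> \<epsilon>"
  shows "(dquot s ^^ d) (\<lambda>z. g z + h z) z = (dquot s ^^ d) g z + (dquot s ^^ d) h z"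
  using assms(3)
proof (induction d arbitrary: z)
  case (Suc d)
  have "dquot s ((dquot s ^^ d) (\<lambda>z. g z + h z)) z = dquot s (\<lambda>z. (dquot s ^^ d) g z + (dquot s ^^ d) h z) z"
    by (rule dquot_cong[OF _ Suc.prems]) (rule Suc.IH)
  also have "\<dots> = dquot s ((dquot s ^^ d) g) z + dquot s ((dquot s ^^ d) h) z"
    by (rule dquot_add[OF _ _ Suc.prems]) (auto intro: holo_on_dquot_pow assms)
  finally show ?case by simp
qed simp

lemma dquot_pow_bound:
  assumes "holo_on g (pbox s \<delta> \<epsilon>)" "\<And>u. u \<in> pbox s \<delta> \<epsilon> \<Longrightarrow> cmod (g u) \<le> M" "z \<in> pbox s \<delta> \<epsilon>"
  shows "cmod ((dquot s ^^ d) g z) \<le> (2 / \<epsilon>) ^ d * M"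
  using assms(3)
proof (induction d arbitrary: z)
  case 0
  then show ?case using assms(2) by simp
next
  case (Suc d)
  have "cmod (dquot s ((dquot s ^^ d) g) z) \<le> 2 * ((2 / \<epsilon>) ^ d * M) / \<epsilon>"
    by (rule dquot_bound[OF holo_on_dquot_pow[OF assms(1)] _ Suc.prems]) (rule Suc.IH)
  then show ?case by (simp add: mult_ac)
qed

text \<open>For small \<open>c\<close> the map \<open>q \<mapsto> Q (f - q c)\<close> is a contraction in the supremum norm, where
  \<open>Q\<close> is the quotient of the division by the \<open>d\<close>-th power of the coordinate \<open>z\<^sub>s\<close>. Its fixed point is the quotient of
  the division of \<open>f\<close> by \<open>z\<^sub>s\<^sup>d + c\<close>.\<close>

lemma division_fixed_point:
  assumes f: "holo_on f (pbox s \<delta> \<epsilon>)" "\<And>u. u \<in> pbox s \<delta> \<epsilon> \<Longrightarrow> cmod (f u) \<le> M"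
    and c: "holo_on c (pbox s \<delta> \<epsilon>)" "\<And>u. u \<in> pbox s \<delta> \<epsilon> \<Longrightarrow> cmod (c u) \<le> \<kappa>"
    and \<kappa>: "(2 / \<epsilon>) ^ d * \<kappa> \<le> 1 / 2" and pos: "\<delta> > 0" "\<epsilon> > 0"
  obtains q where "holo_on q (pbox s \<delta> \<epsilon>)"
    "\<And>z. z \<in> pbox s \<delta> \<epsilon> \<Longrightarrow> q z = (dquot s ^^ d) (\<lambda>z. f z - q z * c z) z"
proof -
  let ?B = "pbox s \<delta> \<epsilon>"
  define A where "A q = (dquot s ^^ d) (\<lambda>z. f z - q z * c z)" for q
  define Q where "Q k = (A ^^ k) (\<lambda>_. 0)" for k
  have Q0: "Q 0 = (\<lambda>_. 0)" and QS: "Q (Suc k) = A (Q k)" for k by (simp_all add: Q_def)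
  have hA: "holo_on (A q) ?B" if "holo_on q ?B" for q
    unfolding A_def by (intro holo_on_dquot_pow holo_on_minus holo_on_simps(2) f c that)
  have hQ: "holo_on (Q k) ?B" for k
    by (induction k) (auto simp: Q0 QS intro: hA holo_on_const open_pbox)
  have zB: "0 \<in> ?B" using zero_in_pbox pos by blast
  have k0: "\<kappa> \<ge> 0" using c(2)[OF zB] norm_ge_zero order_trans by blast
  have M0: "M \<ge> 0" using f(2)[OF zB] norm_ge_zero order_trans by blast
  have contr: "cmod (A q z - A q' z) \<le> m / 2"
    if q: "holo_on q ?B" "holo_on q' ?B" "\<And>u. u \<in> ?B \<Longrightarrow> cmod (q u - q' u) \<le> m" and z: "z \<in> ?B" for q q' m z
  proof -
    have m0: "m \<ge> 0" using q(3)[OF zB] norm_ge_zero order_trans by blast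
    have h1: "holo_on (\<lambda>z. (q' z - q z) * c z) ?B" by (intro holo_on_simps(2) holo_on_minus q c)
    have h2: "holo_on (\<lambda>z. f z - q' z * c z) ?B" by (intro holo_on_minus holo_on_simps(2) f c q)
    have "A q z = (dquot s ^^ d) (\<lambda>z. (f z - q' z * c z) + (q' z - q z) * c z) z"
      unfolding A_def by (simp add: algebra_simps)
    also have "\<dots> = A q' z + (dquot s ^^ d) (\<lambda>z. (q' z - q z) * c z) z"
      unfolding A_def by (rule dquot_pow_add[OF h2 h1 z])
    finally have "cmod (A q z - A q' z) = cmod ((dquot s ^^ d) (\<lambda>z. (q' z - q z) * c z) z)" by simp
    also have "\<dots> \<le> (2 / \<epsilon>) ^ d * (m * \<kappa>)"
    proof (rule dquot_pow_bound[OF h1 _ z])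
      show "cmod ((q' u - q u) * c u) \<le> m * \<kappa>" if "u \<in> ?B" for u
        using q(3)[OF that] c(2)[OF that] m0 by (simp add: norm_mult norm_minus_commute mult_mono)
    qed
    also have "\<dots> = m * ((2 / \<epsilon>) ^ d * \<kappa>)" by simp
    also have "\<dots> \<le> m * (1 / 2)" by (rule mult_left_mono[OF \<kappa> m0])
    finally show ?thesis by simp
  qed
  define K where "K = (2 / \<epsilon>) ^ d * M"
  have step: "cmod (Q (Suc k) z - Q k z) \<le> K * (1 / 2) ^ k" if "z \<in> ?B" for k z
    using that
  proof (induction k arbitrary: z)
    case 0
    have "cmod ((dquot s ^^ d) f z) \<le> K" unfolding K_def by (rule dquot_pow_bound[OF f 0])
    then show ?case by (simp add: QS Q0 A_def)
  next
    case (Suc k)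
    have "cmod (A (Q (Suc k)) z - A (Q k) z) \<le> (K * (1 / 2) ^ k) / 2"
      by (rule contr[OF hQ hQ]) (use Suc in auto)
    then show ?case by (simp add: QS)
  qed
  have "uniform_limit ?B (\<lambda>n x. \<Sum>i<n. Q (Suc i) x - Q i x) (\<lambda>x. suminf (\<lambda>i. Q (Suc i) x - Q i x)) sequentially"
    by (rule Weierstrass_m_test[where M = "\<lambda>k. K * (1 / 2) ^ k"])
      (use step in \<open>auto intro!: summable_mult summable_geometric\<close>)
  moreover have "(\<lambda>n x. \<Sum>i<n. Q (Suc i) x - Q i x) = Q"
  proof (intro ext)
    show "(\<Sum>i<n. Q (Suc i) x - Q i x) = Q n x" for n x
      using sum_lessThan_telescope[of "\<lambda>i. Q i x" n] by (simp add: Q0)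
  qed
  ultimately obtain q where lim: "uniform_limit ?B Q q sequentially" by metis
  have hq: "holo_on q ?B" by (rule holo_on_uniform_limit[OF hQ lim])
  have "q z = A q z" if z: "z \<in> ?B" for z
  proof (rule ccontr)
    assume "q z \<noteq> A q z"
    define e where "e = cmod (q z - A q z) / 4"
    have e: "e > 0" using \<open>q z \<noteq> A q z\<close> by (simp add: e_def)
    obtain k where k: "\<And>n u. n \<ge> k \<Longrightarrow> u \<in> ?B \<Longrightarrow> dist (Q n u) (q u) < e"
      using uniform_limitD[OF lim e] unfolding eventually_sequentially by auto
    have "cmod (A q z - A (Q k) z) \<le> e / 2"
      by (rule contr[OF hq hQ _ z]) (use k[of k] in \<open>auto simp: dist_norm norm_minus_commute less_imp_le\<close>)
    moreover have "cmod (Q (Suc k) z - q z) < e" using k[of "Suc k" z] z by (simp add: dist_norm)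
    ultimately have "cmod (q z - A q z) < 2 * e"
      using norm_triangle_ineq4[of "Q (Suc k) z - A q z" "Q (Suc k) z - q z"] e
      by (simp add: QS norm_minus_commute)
    then show False using e by (simp add: e_def)
  qed
  then show thesis using that[OF hq] unfolding A_def by blast
qed

text \<open>Each use of the fixed-point equation halves the bound on \<open>q\<close>. The equation
  is stated for moduli so that it covers the sign in
  \<open>q = - (hdq s ^^ d) (q * c)\<close>.\<close>

lemma division_fixed_point_zero:
  assumes q: "holo_on q (pbox s \<delta> \<epsilon>)" "\<And>u. u \<in> pbox s \<delta> \<epsilon> \<Longrightarrow> cmod (q u) \<le> M"
    and c: "holo_on c (pbox s \<delta> \<epsilon>)" "\<And>u. u \<in> pbox s \<delta> \<epsilon> \<Longrightarrow> cmod (c u) \<le> \<kappa>"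
    and \<kappa>: "(2 / \<epsilon>) ^ d * \<kappa> \<le> 1 / 2" and pos: "\<delta> > 0" "\<epsilon> > 0"
    and fixp: "\<And>z. z \<in> pbox s \<delta> \<epsilon> \<Longrightarrow> cmod (q z) = cmod ((dquot s ^^ d) (\<lambda>z. q z * c z) z)"
    and z: "z \<in> pbox s \<delta> \<epsilon>"
  shows "q z = 0"
proof -
  let ?B = "pbox s \<delta> \<epsilon>"
  have zB: "0 \<in> ?B" using zero_in_pbox pos by blast
  have M0: "M \<ge> 0" using q(2)[OF zB] norm_ge_zero order_trans by blast
  have "cmod (q u) \<le> M * (1 / 2) ^ k" if "u \<in> ?B" for k u
    using that
  proof (induction k arbitrary: u)
    case 0
    then show ?case using q by simp
  next
    case (Suc k)
    have "cmod ((dquot s ^^ d) (\<lambda>z. q z * c z) u) \<le> (2 / \<epsilon>) ^ d * ((M * (1 / 2) ^ k) * \<kappa>)"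
    proof (rule dquot_pow_bound[OF holo_on_simps(2)[OF q(1) c(1)] _ Suc.prems])
      show "cmod (q u * c u) \<le> (M * (1 / 2) ^ k) * \<kappa>" if "u \<in> ?B" for u
        using Suc.IH[OF that] c(2)[OF that] M0 unfolding norm_mult by (intro mult_mono) auto
    qed
    also have "\<dots> = (M * (1 / 2) ^ k) * ((2 / \<epsilon>) ^ d * \<kappa>)" by simp
    also have "\<dots> \<le> (M * (1 / 2) ^ k) * (1 / 2)" by (rule mult_left_mono[OF \<kappa>]) (use M0 in simp)
    finally show ?case using fixp[OF Suc.prems] by simp
  qed
  moreover have "(\<lambda>k. M * (1 / 2) ^ k) \<longlonglongrightarrow> M * 0" by (intro tendsto_intros LIMSEQ_realpow_zero) auto
  ultimately have "cmod (q z) \<le> 0"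
    by (intro tendsto_lowerbound[of "\<lambda>k. M * (1 / 2) ^ k"]) (use z in auto)
  then show ?thesis by simp
qed


section \<open>The ring of germs at the origin\<close>

definition clin :: "(complex ^ 'n \<Rightarrow> complex ^ 'n) \<Rightarrow> bool" where
  "clin T \<longleftrightarrow> linear T \<and> (\<forall>c v. T (c *s v) = c *s T v)"

lemma clin_0: "clin T \<Longrightarrow> T 0 = 0"
  unfolding clin_def by (simp add: linear_0)

lemma clin_compose: "clin S \<Longrightarrow> clin T \<Longrightarrow> clin (\<lambda>z. S (T z))"
  unfolding clin_def using linear_compose[of T S] by (simp add: o_def)

lemma clin_continuous: "clin T \<Longrightarrow> continuous_on A T"
  unfolding clin_def by (simp add: linear_continuous_on linear_conv_bounded_linear)

lemma clin_tendsto: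
  assumes "clin T" shows "filterlim T (nhds 0) (nhds 0)"
proof -
  have "isCont T 0"
    using clin_continuous[OF assms, of UNIV] by (simp add: continuous_on_eq_continuous_at)
  then have "(T \<longlongrightarrow> T 0) (nhds 0)"
    unfolding isCont_def by (simp only: tendsto_at_iff_tendsto_nhds)
  then show ?thesis by (simp only: clin_0[OF assms])
qed

lemma clin_eventually:
  "clin T \<Longrightarrow> eventually P (nhds 0) \<Longrightarrow> eventually (\<lambda>z. P (T z)) (nhds 0)"
  using clin_tendsto[of T] unfolding filterlim_iff by simp

lemma holo_at_clin:
  assumes "clin T" "holo_at f 0"
  shows "holo_at (\<lambda>z. f (T z)) 0"
proof -
  obtain U where U: "0 \<in> U" "holo_on f U" using assms(2) by (auto simp: holo_at_def)
  have o: "open (T -` U)"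
    using clin_continuous[OF assms(1), of UNIV] holo_on_open[OF U(2)] by (simp add: continuous_on_open_vimage)
  have "holo_on (\<lambda>z. f (T z)) (T -` U)"
    using holo_on_compose_linear[OF U(2) o, of 0 T] assms(1) by (simp add: clin_def)
  then show ?thesis using U(1) clin_0[OF assms(1)] unfolding holo_at_def by auto
qed

definition proj :: "'n set \<Rightarrow> complex ^ 'n \<Rightarrow> complex ^ 'n" where
  "proj S z = (\<chi> i. if i \<in> S then z $ i else 0)"

lemma proj_nth [simp]: "proj S z $ i = (if i \<in> S then z $ i else 0)"
  by (simp add: proj_def)

lemma clin_proj [simp]: "clin (proj S)"
  unfolding clin_def
  by (auto intro!: linearI simp: Finite_Cartesian_Product.vec_eq_iff)

lemma proj_proj [simp]: "proj S (proj S' z) = proj (S \<inter> S') z"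
  by (simp add: Finite_Cartesian_Product.vec_eq_iff)

lemma proj_UNIV [simp]: "proj UNIV z = z"
  by (simp add: Finite_Cartesian_Product.vec_eq_iff)

lemma proj_zero [simp]: "proj S 0 = 0"
  by (simp add: Finite_Cartesian_Product.vec_eq_iff)

lemma proj_upd: "proj (- {s}) z = upd s 0 z"
  by (simp add: Finite_Cartesian_Product.vec_eq_iff)

lemma holo_at_pbox:
  assumes "holo_at f 0"
  obtains r where "r > 0" "holo_on f (pbox s r r)"
proof -
  obtain U where U: "0 \<in> U" "holo_on f U" using assms by (auto simp: holo_at_def)
  obtain d where "d > 0" "ball 0 d \<subseteq> U" using U(1) holo_on_open[OF U(2)] openE by blast
  moreover obtain r where "r > 0" "pbox s r r \<subseteq> ball (0 :: complex ^ 'a) d"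
    using ball_contains_pbox \<open>d > 0\<close> by blast
  ultimately show thesis using that holo_on_subset[OF U(2) open_pbox] by blast
qed

lemma eventually_pbox:
  assumes "eventually P (nhds (0 :: complex ^ 'n))"
  obtains r where "r > 0" "\<And>z. z \<in> pbox s r r \<Longrightarrow> P z"
proof -
  obtain d where "d > 0" "\<And>z. dist z 0 < d \<Longrightarrow> P z" using assms eventually_nhds_metric by blast
  moreover obtain r where "r > 0" "pbox s r r \<subseteq> ball (0 :: complex ^ 'n) d"
    using ball_contains_pbox \<open>d > 0\<close> by blast
  ultimately show thesis using that by (auto simp: dist_commute subset_iff)
qed

lemma pbox_eventually: "r > 0 \<Longrightarrow> r' > 0 \<Longrightarrow> eventually (\<lambda>z. z \<in> pbox s r r') (nhds 0)"
  by (rule eventually_nhds_in_open[OF open_pbox zero_in_pbox])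

lemma holo_at_dquot: 
  assumes "holo_at f 0" shows "holo_at (dquot s f) 0"
proof -
  obtain r where "r > 0" "holo_on f (pbox s r r)" using holo_at_pbox[OF assms] .
  then show ?thesis using holo_at_holo_on[OF holo_on_dquot zero_in_pbox] by blast
qed

lemma dquot_eventually:
  assumes "eventually (\<lambda>z. f z = g z) (nhds 0)"
  shows "eventually (\<lambda>z. dquot s f z = dquot s g z) (nhds 0)"
proof -
  obtain r where r: "r > 0" "\<And>z. z \<in> pbox s r r \<Longrightarrow> f z = g z"
    using eventually_pbox[OF assms, where s = s] by blast
  from pbox_eventually[OF r(1) r(1), of s] show ?thesis
    by eventually_elim (rule dquot_cong[OF r(2)])
qed

lemma holo_at_component: "holo_at (\<lambda>z. z $ i) x"
  using holo_on_component[of UNIV] by (auto simp: holo_at_def)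

lemma holo_at_uminus: "holo_at f x \<Longrightarrow> holo_at (\<lambda>z. - f z) x"
  using holo_at_simps(3)[OF holo_at_simps(1)[of "-1"]] by simp

lemma holo_at_minus: "holo_at f x \<Longrightarrow> holo_at g x \<Longrightarrow> holo_at (\<lambda>z. f z - g z) x"
  using holo_at_simps(2)[OF _ holo_at_uminus, of f x g] by simp

lemma holo_at_isCont: "holo_at f x \<Longrightarrow> isCont f x"
  unfolding holo_at_def by (metis holo_on_continuous holo_on_open continuous_on_eq_continuous_at)

\<comment> \<open>A type of germs at the origin makes the algebra of type classes available:
  integral domains, matrices, determinants, polynomials. Germs at other points are translated to the
  origin.\<close>
quotient_type 'n hg = "complex ^ ('n :: finite) \<Rightarrow> complex" /
  partial: "\<lambda>f g. holo_at f 0 \<and> holo_at g 0 \<and> eventually (\<lambda>z. f z = g z) (nhds 0)"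
  by (rule part_equivpI)
    (auto intro!: exI[of _ "\<lambda>_. 0"] holo_at_simps(1) sympI transpI elim: eventually_mono eventually_elim2)

instantiation hg :: (finite) comm_ring_1
begin

lift_definition zero_hg :: "'a hg" is "\<lambda>_. 0" by (simp add: holo_at_simps)
lift_definition one_hg :: "'a hg" is "\<lambda>_. 1" by (simp add: holo_at_simps)
lift_definition plus_hg :: "'a hg \<Rightarrow> 'a hg \<Rightarrow> 'a hg" is "\<lambda>f g z. f z + g z"
  by (auto simp: holo_at_simps elim: eventually_elim2)
lift_definition times_hg :: "'a hg \<Rightarrow> 'a hg \<Rightarrow> 'a hg" is "\<lambda>f g z. f z * g z"
  by (auto simp: holo_at_simps elim: eventually_elim2)
lift_definition uminus_hg :: "'a hg \<Rightarrow> 'a hg" is "\<lambda>f z. - f z"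
  by (auto simp: holo_at_uminus elim: eventually_mono)
lift_definition minus_hg :: "'a hg \<Rightarrow> 'a hg \<Rightarrow> 'a hg" is "\<lambda>f g z. f z - g z"
  by (auto simp: holo_at_minus elim: eventually_elim2)

instance
proof
  show "0 \<noteq> (1 :: 'a hg)" by transfer simp
qed (transfer, simp add: holo_at_simps holo_at_uminus holo_at_minus algebra_simps)+

end

text \<open>Near some point close to the origin \<open>g\<close> has no zeros, so \<open>f\<close>
  vanishes there, and \<open>holo_identity\<close> spreads this over a ball about the
  origin.\<close>

lemma holo_no_zero_divisors:
  assumes f: "holo_at f 0" "holo_at g 0" and fg: "eventually (\<lambda>z. f z * g z = 0) (nhds (0 :: complex ^ 'n))"
    and g: "\<not> eventually (\<lambda>z. g z = 0) (nhds 0)"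
  shows "eventually (\<lambda>z. f z = 0) (nhds 0)"
proof -
  obtain U V where UV: "0 \<in> U" "holo_on f U" "0 \<in> V" "holo_on g V" using f by (auto simp: holo_at_def)
  obtain W where W: "open W" "0 \<in> W" "\<And>z. z \<in> W \<Longrightarrow> f z * g z = 0"
    using fg unfolding eventually_nhds by blast
  have "open (U \<inter> V \<inter> W)" using UV W holo_on_open by blast
  then obtain d where d: "d > 0" "ball 0 d \<subseteq> U \<inter> V \<inter> W" using UV W openE[of "U \<inter> V \<inter> W" 0] by blast
  have nb: "eventually (\<lambda>z. z \<in> ball 0 d) (nhds (0 :: complex ^ 'n))"
    by (rule eventually_nhds_in_open) (use d in auto)
  have "\<exists>b\<in>ball 0 d. g b \<noteq> 0"
  proof (rule ccontr)
    assume "\<not> ?thesis"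
    then have "eventually (\<lambda>z. g z = 0) (nhds 0)" using nb by (auto elim: eventually_mono)
    then show False using g by contradiction
  qed
  then obtain b where b: "b \<in> ball 0 d" "g b \<noteq> 0" by blast
  have gb: "holo_on g (ball 0 d)" using holo_on_subset[OF UV(4)] d by auto
  have fb: "holo_on f (ball 0 d)" using holo_on_subset[OF UV(2)] d by auto
  have "isCont g b" using holo_at_isCont holo_at_holo_on[OF gb b(1)] by blast
  then have "eventually (\<lambda>z. g z \<noteq> 0) (nhds b)"
    using b(2) tendsto_imp_eventually_ne[of g "g b" "nhds b" 0]
    unfolding isCont_def tendsto_at_iff_tendsto_nhds by blast
  moreover have "eventually (\<lambda>z. z \<in> ball 0 d) (nhds b)" by (rule eventually_nhds_in_open) (use b in auto)
  ultimately have "eventually (\<lambda>z. f z = 0) (nhds b)"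
    by eventually_elim (use W d in force)
  then have "\<And>u. u \<in> ball 0 d \<Longrightarrow> f u = 0" using holo_identity[OF fb b(1)] by blast
  then show ?thesis using nb by (auto elim: eventually_mono)
qed

section \<open>Operations on germs: constants, coordinates, projections, divided differences,
  values, substitutions\<close>

lift_definition hconst :: "complex \<Rightarrow> ('n::finite) hg" is "\<lambda>c z. c" by (simp add: holo_at_simps)

lift_definition hcoord :: "'n \<Rightarrow> ('n::finite) hg" is "\<lambda>i z. z $ i" by (simp add: holo_at_component)

lift_definition hpr :: "'n set \<Rightarrow> ('n::finite) hg \<Rightarrow> 'n hg" is "\<lambda>S f z. f (proj S z)"
  by (auto simp: holo_at_clin intro: clin_eventually[OF clin_proj])

lift_definition hdq :: "'n \<Rightarrow> ('n::finite) hg \<Rightarrow> 'n hg" is dquot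
  by (auto simp: holo_at_dquot intro: dquot_eventually)

lift_definition hev :: "('n::finite) hg \<Rightarrow> complex" is "\<lambda>f. f 0"
  by (auto dest: eventually_nhds_x_imp_x)

text \<open>For maps that are not complex linear the substitution is, arbitrarily, the identity.\<close>

lift_definition hsub :: "(complex ^ 'n \<Rightarrow> complex ^ 'n) \<Rightarrow> ('n::finite) hg \<Rightarrow> 'n hg" is
  "\<lambda>T f. if clin T then (\<lambda>z. f (T z)) else f"
  by (auto simp: holo_at_clin intro: clin_eventually)

definition hfun :: "('n::finite) hg \<Rightarrow> complex ^ 'n \<Rightarrow> complex" where "hfun = rep_hg"

lemma holo_at_hfun: "holo_at (hfun a) 0"
  unfolding hfun_def using Quotient3_rep_reflp[OF Quotient3_hg, of a] by simp

lemma abs_hfun [simp]: "abs_hg (hfun a) = a"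
  unfolding hfun_def by (rule Quotient3_abs_rep[OF Quotient3_hg])

lemma abs_hg_eq_iff:
  "holo_at f 0 \<Longrightarrow> holo_at g 0 \<Longrightarrow> abs_hg f = abs_hg g \<longleftrightarrow> eventually (\<lambda>z. f z = g z) (nhds 0)"
  using Quotient3_rel[OF Quotient3_hg, of f g] by simp

lemma hfun_abs: "holo_at f 0 \<Longrightarrow> eventually (\<lambda>z. hfun (abs_hg f) z = f z) (nhds 0)"
  using abs_hg_eq_iff[OF holo_at_hfun, of f "abs_hg f"] by simp

lemma hg_eqI: "eventually (\<lambda>z. hfun a z = hfun b z) (nhds 0) \<Longrightarrow> a = b"
  using abs_hg_eq_iff[OF holo_at_hfun[of a] holo_at_hfun[of b]] by simp

lemma hg_eq_iff: "a = b \<longleftrightarrow> eventually (\<lambda>z. hfun a z = hfun b z) (nhds 0)"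
  using hg_eqI by auto

lemma hfun_ops:
  "eventually (\<lambda>z. hfun (a + b) z = hfun a z + hfun b z) (nhds 0)"
  "eventually (\<lambda>z. hfun (a - b) z = hfun a z - hfun b z) (nhds 0)"
  "eventually (\<lambda>z. hfun (a * b) z = hfun a z * hfun b z) (nhds 0)"
  "eventually (\<lambda>z. hfun (- a) z = - hfun a z) (nhds 0)"
  "eventually (\<lambda>z. hfun 0 z = 0) (nhds (0 :: complex ^ 'n::finite))"
  "eventually (\<lambda>z. hfun 1 z = 1) (nhds (0 :: complex ^ 'n::finite))"
  "eventually (\<lambda>z. hfun (hconst c) z = c) (nhds (0 :: complex ^ 'n::finite))"
  "eventually (\<lambda>z. hfun (hcoord i) z = z $ i) (nhds (0 :: complex ^ 'n::finite))"
  "eventually (\<lambda>z. hfun (hpr S a) z = hfun a (proj S z)) (nhds 0)"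
  "eventually (\<lambda>z. hfun (hdq s a) z = dquot s (hfun a) z) (nhds 0)"
  "clin T \<Longrightarrow> eventually (\<lambda>z. hfun (hsub T a) z = hfun a (T z)) (nhds 0)"
  using hfun_abs[of "\<lambda>z. hfun a z + hfun b z"] hfun_abs[of "\<lambda>z. hfun a z - hfun b z"]
    hfun_abs[of "\<lambda>z. hfun a z * hfun b z"] hfun_abs[of "\<lambda>z. - hfun a z"]
    hfun_abs[of "\<lambda>z. 0"] hfun_abs[of "\<lambda>z. 1"] hfun_abs[of "\<lambda>z. c"] hfun_abs[of "\<lambda>z. z $ i"]
    hfun_abs[of "\<lambda>z. hfun a (proj S z)"] hfun_abs[of "dquot s (hfun a)"]
    hfun_abs[of "\<lambda>z. hfun a (T z)"]
  by (simp_all add: hfun_def plus_hg_def minus_hg_def times_hg_def uminus_hg_def zero_hg_def one_hg_def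
      hconst_def hcoord_def hpr_def hdq_def hsub_def holo_at_simps holo_at_minus holo_at_uminus holo_at_component
      holo_at_clin holo_at_dquot holo_at_hfun[unfolded hfun_def])

instance hg :: (finite) idom
proof
  fix a b :: "'a hg"
  assume "a \<noteq> 0" "b \<noteq> 0"
  have zero: "c = 0 \<longleftrightarrow> eventually (\<lambda>z. hfun c z = 0) (nhds 0)" for c :: "'a hg"
    unfolding hg_eq_iff using hfun_ops(5) by (auto elim: eventually_elim2)
  show "a * b \<noteq> 0"
  proof
    assume "a * b = 0"
    then have "eventually (\<lambda>z. hfun a z * hfun b z = 0) (nhds 0)"
      using hfun_ops(3)[of a b] unfolding zero by (auto elim: eventually_elim2)
    then have "eventually (\<lambda>z. hfun a z = 0) (nhds 0)"
      by (rule holo_no_zero_divisors[OF holo_at_hfun holo_at_hfun])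
        (use \<open>b \<noteq> 0\<close> zero in auto)
    then show False using \<open>a \<noteq> 0\<close> zero by auto
  qed
qed

lemma hev_hfun: "hev a = hfun a 0"
  by (simp add: hev_def hfun_def)

lemma hpr_simps [simp]:
  "hpr S (a + b) = hpr S a + hpr S b"
  "hpr S (a * b) = hpr S a * hpr S b"
  "hpr S (a - b) = hpr S a - hpr S b"
  "hpr S (- a) = - hpr S a"
  "hpr S 0 = 0" "hpr S 1 = 1"
  "hpr S (hconst c) = hconst c"
  by (transfer; simp add: holo_at_simps holo_at_minus holo_at_uminus
      holo_at_clin[OF clin_proj, of "\<lambda>z. _ z"])+

lemma hpr_hpr [simp]: "hpr S (hpr S' a) = hpr (S' \<inter> S) a"
  by transfer (simp add: holo_at_clin[OF clin_proj, of "\<lambda>z. _ z"])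

lemma hpr_UNIV [simp]: "hpr UNIV a = a"
  by transfer simp

lemma hpr_hcoord [simp]: "hpr S (hcoord i) = (if i \<in> S then hcoord i else 0)"
  by (cases "i \<in> S") (transfer; simp add: holo_at_component holo_at_simps)+

lemma hev_simps [simp]:
  "hev (a + b) = hev a + hev b" "hev (a * b) = hev a * hev b" "hev (a - b) = hev a - hev b"
  "hev (- a) = - hev a" "hev 0 = 0" "hev 1 = 1" "hev (hcoord i) = 0" "hev (hpr S a) = hev a"
  "hev (hconst c) = c"
  by (transfer; simp)+

lemma hsub_simps:
  assumes "clin T"
  shows "hsub T (a + b) = hsub T a + hsub T b"
  "hsub T (a * b) = hsub T a * hsub T b"
  "hsub T (a - b) = hsub T a - hsub T b"
  "hsub T (- a) = - hsub T a"
  "hsub T 0 = 0" "hsub T 1 = 1" "hev (hsub T a) = hev a"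
  using assms
  by (transfer; auto intro!: holo_at_simps holo_at_minus holo_at_uminus simp: clin_0 intro: holo_at_clin)+

lemma hsub_hsub: "clin S \<Longrightarrow> clin T \<Longrightarrow> hsub S (hsub T a) = hsub (\<lambda>z. T (S z)) a"
  by transfer (simp add: clin_compose holo_at_clin[OF clin_compose])

lemma hsub_id: "hsub (\<lambda>z. z) a = a"
  by transfer auto

lemma hpr_sum: "hpr S (\<Sum>i\<in>A. f i) = (\<Sum>i\<in>A. hpr S (f i))"
  by (induction A rule: infinite_finite_induct) auto

lemma hpr_power [simp]: "hpr S (a ^ k) = hpr S a ^ k"
  by (induction k) auto

text \<open>The ring of germs in the variables of \<open>S\<close> is kept inside one type, so that
  inductions on the number of variables run over \<open>S\<close>. As the fixed points of a ring
  endomorphism it is closed under everything that commutes with ring homomorphisms, such as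
  determinants and characteristic polynomials.\<close>

definition hO :: "'n set \<Rightarrow> ('n::finite) hg set" where
  "hO S = {a. hpr S a = a}"

lemma hO_iff: "a \<in> hO S \<longleftrightarrow> hpr S a = a" by (simp add: hO_def)

lemma hO_closed:
  "a \<in> hO S \<Longrightarrow> b \<in> hO S \<Longrightarrow> a + b \<in> hO S"
  "a \<in> hO S \<Longrightarrow> b \<in> hO S \<Longrightarrow> a * b \<in> hO S"
  "a \<in> hO S \<Longrightarrow> b \<in> hO S \<Longrightarrow> a - b \<in> hO S"
  "a \<in> hO S \<Longrightarrow> - a \<in> hO S"
  "0 \<in> hO S" "1 \<in> hO S" "hconst c \<in> hO S" "a \<in> hO S \<Longrightarrow> a ^ k \<in> hO S"
  "i \<in> S \<Longrightarrow> hcoord i \<in> hO S"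
  by (auto simp: hO_def)

lemma hO_sum: "(\<And>i. i \<in> A \<Longrightarrow> f i \<in> hO S) \<Longrightarrow> (\<Sum>i\<in>A. f i) \<in> hO S"
  by (induction A rule: infinite_finite_induct) (auto intro: hO_closed)

lemma hO_mono: "a \<in> hO S \<Longrightarrow> S \<subseteq> S' \<Longrightarrow> a \<in> hO S'"
  unfolding hO_def by (auto simp: Int_absorb2) (metis hpr_hpr Int_absorb2)

lemma hO_UNIV [simp]: "a \<in> hO UNIV" by (simp add: hO_def)

lemma hpr_in_hO: "hpr S a \<in> hO S" by (simp add: hO_def)

lemma hcoord_nonzero: "hcoord s \<noteq> 0"
proof
  assume "hcoord s = (0 :: 'a hg)"
  then have "eventually (\<lambda>z :: complex ^ 'a. z $ s = 0) (nhds 0)"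
    by transfer simp
  then obtain r where r: "r > 0" "\<And>z :: complex ^ 'a. z \<in> pbox s r r \<Longrightarrow> z $ s = 0"
    using eventually_pbox[of "\<lambda>z. z $ s = 0" s] by blast
  have "upd s (of_real (r / 2)) 0 \<in> pbox s r r" using r(1) by (auto simp: pbox_def)
  from r(2)[OF this] show False using r(1) by simp
qed

lemma hdq_decomp: "a = hpr (- {s}) a + hcoord s * hdq s a"
proof -
  have "hpr (- {s}) a + hcoord s * hdq s a = a"
    by transfer (auto simp: holo_at_simps holo_at_dquot holo_at_component proj_upd dquot_mult[symmetric]
        holo_at_clin[OF clin_proj, of "\<lambda>z. _ z", unfolded proj_upd])
  then show ?thesis by simp
qed

lemma hdq_unique:
  assumes "b \<in> hO (- {s})" shows "hdq s (b + hcoord s * c) = c"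
proof -
  have "hpr (- {s}) (b + hcoord s * c) = b" using assms by (simp add: hO_iff)
  then have "hcoord s * hdq s (b + hcoord s * c) = hcoord s * c"
    using hdq_decomp[of "b + hcoord s * c" s] by (metis add_left_cancel)
  then show ?thesis using mult_left_cancel[OF hcoord_nonzero] by blast
qed

lemma hdq_mult_coord: "hdq s (hcoord s * c) = c"
  using hdq_unique[of 0 s c] by (simp add: hO_closed)

lemma hdq_hO: "b \<in> hO (- {s}) \<Longrightarrow> hdq s b = 0"
  using hdq_unique[of b s 0] by simp

lemma hdq_add: "hdq s (a + b) = hdq s a + hdq s b"
proof -
  have "a + b = (hpr (- {s}) a + hpr (- {s}) b) + hcoord s * (hdq s a + hdq s b)"
    using hdq_decomp[of a s] hdq_decomp[of b s] by (simp add: algebra_simps)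
  moreover have "hpr (- {s}) a + hpr (- {s}) b \<in> hO (- {s})" by (intro hO_closed hpr_in_hO)
  ultimately show ?thesis using hdq_unique by metis
qed

lemma hdq_0 [simp]: "hdq s 0 = 0" by (rule hdq_hO) (rule hO_closed)

lemma hdq_pow_add: "(hdq s ^^ d) (a + b) = (hdq s ^^ d) a + (hdq s ^^ d) b"
  by (induction d) (auto simp: hdq_add)

lemma hdq_pow_0 [simp]: "(hdq s ^^ d) 0 = 0"
  by (induction d) auto

lemma hdq_pow_sum: "(hdq s ^^ d) (\<Sum>i\<in>A. f i) = (\<Sum>i\<in>A. (hdq s ^^ d) (f i))"
  by (induction A rule: infinite_finite_induct) (auto simp: hdq_pow_add)

lemma hdq_pow_coord: "(hdq s ^^ k) (hcoord s ^ k * c) = c"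
proof (induction k arbitrary: c)
  case (Suc k)
  have "(hdq s ^^ Suc k) (hcoord s ^ Suc k * c) = (hdq s ^^ k) (hdq s (hcoord s * (hcoord s ^ k * c)))"
    by (simp add: funpow_swap1 mult.assoc)
  then show ?case by (simp only: hdq_mult_coord Suc)
qed simp

lemma hdq_pow_small: "r \<in> hO (- {s}) \<Longrightarrow> k < d \<Longrightarrow> (hdq s ^^ d) (hcoord s ^ k * r) = 0"
proof -
  assume r: "r \<in> hO (- {s})" and "k < d"
  then obtain e where d: "d = Suc e + k" by (metis add_Suc less_imp_Suc_add add.commute)
  have "(hdq s ^^ d) (hcoord s ^ k * r) = (hdq s ^^ Suc e) ((hdq s ^^ k) (hcoord s ^ k * r))"
    unfolding d funpow_add by simp
  also have "\<dots> = (hdq s ^^ e) (hdq s r)" unfolding hdq_pow_coord by (simp add: funpow_swap1)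
  finally show ?thesis using r by (simp add: hdq_hO)
qed

lemma hpr_hdq_pow_coord:
  assumes r: "r \<in> hO (- {s})"
  shows "hpr (- {s}) ((hdq s ^^ j) (hcoord s ^ k * r)) = (if j = k then r else 0)"
proof -
  consider "j = k" | "k < j" | "j < k" by linarith
  then show ?thesis
  proof cases
    case 1
    then show ?thesis using r unfolding 1 hdq_pow_coord by (simp add: hO_iff)
  next
    case 2
    then show ?thesis using hdq_pow_small[OF r 2] by simp
  next
    case 3
    then obtain e where k: "k = j + Suc e" using less_imp_Suc_add by fastforce
    have "(hdq s ^^ j) (hcoord s ^ k * r) = hcoord s ^ Suc e * r"
      unfolding k power_add mult.assoc by (rule hdq_pow_coord)
    then show ?thesis using 3 by simp
  qed
qed

text \<open>Iterating \<open>hdq_decomp\<close> peels off one Taylor coefficient in the coordinate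
  \<open>s\<close> at a time, each a germ in the other variables.\<close>

lemma hdq_expand: "a = (\<Sum>k<d. hcoord s ^ k * hpr (- {s}) ((hdq s ^^ k) a)) + hcoord s ^ d * (hdq s ^^ d) a"
proof (induction d)
  case (Suc d)
  have "(hdq s ^^ d) a = hpr (- {s}) ((hdq s ^^ d) a) + hcoord s * (hdq s ^^ Suc d) a"
    using hdq_decomp[of "(hdq s ^^ d) a" s] by simp
  then have "hcoord s ^ d * (hdq s ^^ d) a =
    hcoord s ^ d * hpr (- {s}) ((hdq s ^^ d) a) + hcoord s ^ Suc d * (hdq s ^^ Suc d) a"
    by (metis distrib_left mult.assoc power_Suc2)
  then show ?case using Suc by (simp add: add.assoc)
qed simp

lemma coord_poly_coeff_unique:
  assumes "\<And>k. k < d \<Longrightarrow> r k \<in> hO (- {s})" "(\<Sum>k<d. hcoord s ^ k * r k) = 0" "j < d"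
  shows "r j = 0"
proof -
  have "0 = hpr (- {s}) ((hdq s ^^ j) (\<Sum>k<d. hcoord s ^ k * r k))" using assms(2) by simp
  also have "\<dots> = (\<Sum>k<d. if j = k then r k else 0)"
    unfolding hdq_pow_sum hpr_sum by (intro sum.cong hpr_hdq_pow_coord assms) auto
  also have "\<dots> = r j" using assms(3) by (simp add: sum.delta)
  finally show ?thesis by simp
qed

lemma hg_unit:
  assumes "hev a \<noteq> 0" shows "\<exists>b. a * b = 1"
proof -
  obtain U where U: "0 \<in> U" "holo_on (hfun a) U" using holo_at_hfun by (auto simp: holo_at_def)
  have "open (U \<inter> hfun a -` (- {0}))"
    by (rule continuous_open_preimage[OF holo_on_continuous[OF U(2)] holo_on_open[OF U(2)]]) auto
  moreover have "0 \<in> U \<inter> hfun a -` (- {0})" using U assms by (simp add: hev_hfun)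
  ultimately have V: "holo_on (hfun a) (U \<inter> hfun a -` (- {0}))" "0 \<in> U \<inter> hfun a -` (- {0})"
    using holo_on_subset[OF U(2)] by auto
  then have h: "holo_on (\<lambda>z. inverse (hfun a z)) (U \<inter> hfun a -` (- {0}))"
    by (intro holo_on_inverse) auto
  then have hat: "holo_at (\<lambda>z. inverse (hfun a z)) 0" using V(2) holo_at_holo_on by blast
  have nz: "eventually (\<lambda>z. z \<in> U \<inter> hfun a -` (- {0})) (nhds 0)"
    by (rule eventually_nhds_in_open[OF holo_on_open[OF V(1)] V(2)])
  have "a * abs_hg (\<lambda>z. inverse (hfun a z)) = 1"
  proof (rule hg_eqI)
    show "eventually (\<lambda>z. hfun (a * abs_hg (\<lambda>z. inverse (hfun a z))) z = hfun 1 z) (nhds 0)"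
      using hfun_ops(3)[of a "abs_hg (\<lambda>z. inverse (hfun a z))"] hfun_ops(6) hfun_abs[OF hat] nz
      by eventually_elim auto
  qed
  then show ?thesis by blast
qed


section \<open>Weierstrass division\<close>

lemma holo_at_dquot_pow: "holo_at f 0 \<Longrightarrow> holo_at ((dquot s ^^ d) f) 0"
  by (induction d) (auto intro: holo_at_dquot)

lemma abs_hg_dquot_pow: "holo_at f 0 \<Longrightarrow> (hdq s ^^ d) (abs_hg f) = abs_hg ((dquot s ^^ d) f)"
proof (induction d)
  case (Suc d)
  have "hdq s (abs_hg ((dquot s ^^ d) f)) = abs_hg (dquot s ((dquot s ^^ d) f))"
    by (rule hdq.abs_eq) (simp add: eq_onp_def holo_at_dquot_pow[OF Suc.prems])
  then show ?case using Suc by simp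
qed simp

lemma abs_hg_ops:
  assumes "holo_at f 0" "holo_at g 0"
  shows "abs_hg (\<lambda>z. f z * g z) = abs_hg f * abs_hg g" "abs_hg (\<lambda>z. f z - g z) = abs_hg f - abs_hg g"
    "abs_hg (\<lambda>z. f z + g z) = abs_hg f + abs_hg g"
  using assms by (simp_all add: times_hg.abs_eq minus_hg.abs_eq plus_hg.abs_eq)

lemma holo_at_bounded:
  assumes "holo_at f 0"
  obtains M r where "r > 0" "holo_on f (pbox s r r)" "\<And>z. z \<in> pbox s r r \<Longrightarrow> cmod (f z) \<le> M"
proof -
  have "isCont f 0" by (rule holo_at_isCont[OF assms])
  then have "(f \<longlongrightarrow> f 0) (nhds 0)"
    unfolding isCont_def by (simp only: tendsto_at_iff_tendsto_nhds)
  then have "eventually (\<lambda>z. dist (f z) (f 0) < 1) (nhds 0)" by (rule tendstoD) simp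
  then obtain r where r: "r > 0" "\<And>z. z \<in> pbox s r r \<Longrightarrow> dist (f z) (f 0) < 1"
    using eventually_pbox[where s = s] by blast
  obtain r' where r': "r' > 0" "holo_on f (pbox s r' r')" using holo_at_pbox[OF assms] .
  show thesis
  proof (rule that[of "min r r'" "cmod (f 0) + 1"])
    show "min r r' > 0" using r r' by simp
    show "holo_on f (pbox s (min r r') (min r r'))"
      by (rule holo_on_subset[OF r'(2) open_pbox pbox_mono]) auto
    fix z assume "z \<in> pbox s (min r r') (min r r')"
    then have "z \<in> pbox s r r" using pbox_mono[of "min r r'" r "min r r'" r s] by auto
    from r(2)[OF this] show "cmod (f z) \<le> cmod (f 0) + 1"
      using norm_triangle_ineq2[of "f z" "f 0"] by (simp add: dist_norm)
  qed
qed

text \<open>A box on which the remainder term is as small as the contraction argument requires: the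
  coefficients vanish at the origin and do not involve \<open>z\<^sub>s\<close>, so only the other radii shrink.\<close>

lemma division_box:
  fixes w f :: "'n::finite hg"
  assumes b: "\<forall>k<d. b k \<in> hO (- {s})" "\<forall>k<d. hev (b k) = 0"
    and c: "c = (\<Sum>k<d. hcoord s ^ k * b k) * w" and r0: "r0 > 0"
  obtains \<delta> \<epsilon> \<kappa> M where "\<delta> > 0" "\<epsilon> > 0" "pbox s \<delta> \<epsilon> \<subseteq> pbox s r0 r0" "(2 / \<epsilon>) ^ d * \<kappa> \<le> 1 / 2"
    "holo_on (hfun f) (pbox s \<delta> \<epsilon>)" "\<And>u. u \<in> pbox s \<delta> \<epsilon> \<Longrightarrow> cmod (hfun f u) \<le> M"
    "holo_on (hfun c) (pbox s \<delta> \<epsilon>)" "\<And>u. u \<in> pbox s \<delta> \<epsilon> \<Longrightarrow> cmod (hfun c u) \<le> \<kappa>"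
proof -
  obtain M r1 where r1: "r1 > 0" "holo_on (hfun f) (pbox s r1 r1)" "\<And>z. z \<in> pbox s r1 r1 \<Longrightarrow> cmod (hfun f z) \<le> M"
    using holo_at_bounded[OF holo_at_hfun[of f], of s] by blast
  obtain W r2 where r2: "r2 > 0" "\<And>z. z \<in> pbox s r2 r2 \<Longrightarrow> cmod (hfun w z) \<le> W"
    using holo_at_bounded[OF holo_at_hfun[of w], of s] by blast
  obtain r3 where r3: "r3 > 0" "holo_on (hfun c) (pbox s r3 r3)" using holo_at_pbox[OF holo_at_hfun] .
  have ev: "eventually (\<lambda>z. hfun (\<Sum>k\<in>A. hcoord s ^ k * b k) z = (\<Sum>k\<in>A. (z $ s) ^ k * hfun (b k) (proj (- {s}) z))) (nhds 0)"
    if "finite A" "A \<subseteq> {..<d}" for A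
    using that
  proof (induction A)
    case empty
    then show ?case using hfun_ops(5) by simp
  next
    case (insert k A)
    have bk: "hpr (- {s}) (b k) = b k" using b(1) insert by (simp add: hO_iff)
    have pw: "eventually (\<lambda>z. hfun (hcoord s ^ j) z = (z $ s) ^ j) (nhds 0)" for j
    proof (induction j)
      case 0
      then show ?case using hfun_ops(6) by simp
    next
      case (Suc j)
      then show ?case using hfun_ops(3)[of "hcoord s" "hcoord s ^ j"] hfun_ops(8)[of s]
        by eventually_elim simp
    qed
    show ?case
      using insert.IH[OF insert.prems[THEN subset_trans[OF subset_insertI]]] pw[of k]
        hfun_ops(1)[of "hcoord s ^ k * b k" "\<Sum>k\<in>A. hcoord s ^ k * b k"]
        hfun_ops(3)[of "hcoord s ^ k" "b k"] hfun_ops(9)[of "- {s}" "b k", unfolded bk]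
      by eventually_elim (simp add: insert.hyps)
  qed
  have "eventually (\<lambda>z. hfun c z = (\<Sum>k<d. (z $ s) ^ k * hfun (b k) (proj (- {s}) z)) * hfun w z) (nhds 0)"
    using ev[of "{..<d}"] hfun_ops(3)[of "\<Sum>k<d. hcoord s ^ k * b k" w] unfolding c
    by (auto elim: eventually_elim2)
  then obtain r4 where r4: "r4 > 0" "\<And>z. z \<in> pbox s r4 r4 \<Longrightarrow>
    hfun c z = (\<Sum>k<d. (z $ s) ^ k * hfun (b k) (proj (- {s}) z)) * hfun w z"
    using eventually_pbox[where s = s] by blast
  \<comment> \<open>The entry 1 bounds the powers of the coordinate \<open>s\<close>, so that the
    coefficients alone control the sum. The order of choices matters: \<kappa> and \<eta> depend on
    \<epsilon>, and only \<delta> is chosen after them.\<close>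
  define \<epsilon> where "\<epsilon> = Min {r0, r1, r2, r3, r4, 1}"
  have \<epsilon>: "\<epsilon> > 0" "\<epsilon> \<le> r1" "\<epsilon> \<le> r2" "\<epsilon> \<le> r3" "\<epsilon> \<le> r4" "\<epsilon> \<le> 1" "\<epsilon> \<le> r0"
    using r0 r1 r2 r3 r4 by (auto simp: \<epsilon>_def)
  \<comment> \<open>This value gives equality in the contraction condition.\<close>
  define \<kappa> where "\<kappa> = (\<epsilon> / 2) ^ d / 2"
  have \<kappa>: "\<kappa> > 0" using \<epsilon> by (simp add: \<kappa>_def)
  have W0: "W \<ge> 0" using r2(2)[OF zero_in_pbox[OF r2(1) r2(1)]] norm_ge_zero order_trans by blast
  define \<eta> where "\<eta> = \<kappa> / ((real d + 1) * (W + 1))"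
  have \<eta>: "\<eta> > 0" using \<kappa> W0 by (simp add: \<eta>_def)
  have "eventually (\<lambda>z. \<forall>k\<in>{..<d}. cmod (hfun (b k) z) < \<eta>) (nhds 0)"
  proof (rule eventually_ball_finite)
    show "\<forall>k\<in>{..<d}. eventually (\<lambda>z. cmod (hfun (b k) z) < \<eta>) (nhds 0)"
    proof
      fix k assume k: "k \<in> {..<d}"
      have "isCont (hfun (b k)) 0" by (rule holo_at_isCont[OF holo_at_hfun])
      then have "(hfun (b k) \<longlongrightarrow> hfun (b k) 0) (nhds 0)"
        unfolding isCont_def by (simp only: tendsto_at_iff_tendsto_nhds)
      then have "eventually (\<lambda>z. dist (hfun (b k) z) (hfun (b k) 0) < \<eta>) (nhds 0)" by (rule tendstoD) (rule \<eta>)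
      then show "eventually (\<lambda>z. cmod (hfun (b k) z) < \<eta>) (nhds 0)"
        using b(2) k by (simp add: hev_hfun)
    qed
  qed simp
  then obtain r5 where r5': "r5 > 0" "\<And>z. z \<in> pbox s r5 r5 \<Longrightarrow> \<forall>k\<in>{..<d}. cmod (hfun (b k) z) < \<eta>"
    using eventually_pbox[where s = s] by blast
  then have r5: "r5 > 0" "\<And>z k. z \<in> pbox s r5 r5 \<Longrightarrow> k < d \<Longrightarrow> cmod (hfun (b k) z) < \<eta>"
    by auto
  define \<delta> where "\<delta> = min \<epsilon> r5"
  have \<delta>: "\<delta> > 0" "\<delta> \<le> \<epsilon>" "\<delta> \<le> r5" using \<epsilon> r5 by (auto simp: \<delta>_def)
  have sub: "u \<in> pbox s r r" if "u \<in> pbox s \<delta> \<epsilon>" "\<epsilon> \<le> r" for u r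
    using pbox_mono[of \<delta> r \<epsilon> r s] that \<delta> by auto
  show thesis
  proof (rule that[OF \<delta>(1) \<epsilon>(1)])
    show "pbox s \<delta> \<epsilon> \<subseteq> pbox s r0 r0" using sub \<epsilon> by blast
    show "(2 / \<epsilon>) ^ d * \<kappa> \<le> 1 / 2"
      using \<epsilon> by (simp add: \<kappa>_def power_divide field_simps)
    show "holo_on (hfun f) (pbox s \<delta> \<epsilon>)" "holo_on (hfun c) (pbox s \<delta> \<epsilon>)"
      using sub \<epsilon> by (auto intro!: holo_on_subset[OF r1(2)] holo_on_subset[OF r3(2)] open_pbox)
    show "cmod (hfun f u) \<le> M" if "u \<in> pbox s \<delta> \<epsilon>" for u
      using r1(3)[OF sub[OF that \<epsilon>(2)]] .
    show "cmod (hfun c u) \<le> \<kappa>" if u: "u \<in> pbox s \<delta> \<epsilon>" for u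
    proof -
      have pu: "proj (- {s}) u \<in> pbox s r5 r5"
        using upd_in_pbox[OF u, of 0 r5] pbox_mono[of \<delta> r5 r5 r5 s] r5 \<delta> by (auto simp: proj_upd)
      have "cmod (\<Sum>k<d. (u $ s) ^ k * hfun (b k) (proj (- {s}) u)) \<le> (\<Sum>k<d. \<eta>)"
      proof (rule sum_norm_le)
        fix k assume k: "k \<in> {..<d}"
        have "cmod (u $ s) \<le> 1" using u \<epsilon> by (auto simp: pbox_def)
        then have "cmod (u $ s) ^ k \<le> 1" by (simp add: power_le_one)
        moreover have "cmod (hfun (b k) (proj (- {s}) u)) \<le> \<eta>" using r5(2)[OF pu, of k] k by simp
        ultimately show "cmod ((u $ s) ^ k * hfun (b k) (proj (- {s}) u)) \<le> \<eta>"
          using mult_mono[of "cmod (u $ s) ^ k" 1 "cmod (hfun (b k) (proj (- {s}) u))" \<eta>]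
          by (simp add: norm_mult norm_power)
      qed
      then have s1: "cmod (\<Sum>k<d. (u $ s) ^ k * hfun (b k) (proj (- {s}) u)) \<le> real d * \<eta>" by simp
      have "cmod (hfun c u) \<le> (real d * \<eta>) * W"
        unfolding r4(2)[OF sub[OF u \<epsilon>(5)]] norm_mult
        by (rule mult_mono[OF s1 r2(2)[OF sub[OF u \<epsilon>(3)]]]) (use \<eta> in auto)
      also have "\<dots> \<le> ((real d + 1) * \<eta>) * (W + 1)"
        by (intro mult_mono) (use \<eta> W0 in auto)
      also have "\<dots> = \<kappa>" using W0 by (simp add: \<eta>_def)
      finally show ?thesis .
    qed
  qed
qed

lemma germ_division_ex:
  fixes w f :: "'n::finite hg"
  assumes b: "\<forall>k<d. b k \<in> hO (- {s})" "\<forall>k<d. hev (b k) = 0"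
    and c: "c = (\<Sum>k<d. hcoord s ^ k * b k) * w"
  shows "\<exists>q. q = (hdq s ^^ d) (f - q * c)"
proof -
  obtain \<delta> \<epsilon> \<kappa> M where B: "\<delta> > 0" "\<epsilon> > 0" "(2 / \<epsilon>) ^ d * \<kappa> \<le> 1 / 2"
    "holo_on (hfun f) (pbox s \<delta> \<epsilon>)" "\<And>u. u \<in> pbox s \<delta> \<epsilon> \<Longrightarrow> cmod (hfun f u) \<le> M"
    "holo_on (hfun c) (pbox s \<delta> \<epsilon>)" "\<And>u. u \<in> pbox s \<delta> \<epsilon> \<Longrightarrow> cmod (hfun c u) \<le> \<kappa>"
    by (rule division_box[OF b c, of 1 f]) auto
  obtain q where q: "holo_on q (pbox s \<delta> \<epsilon>)"
    "\<And>z. z \<in> pbox s \<delta> \<epsilon> \<Longrightarrow> q z = (dquot s ^^ d) (\<lambda>z. hfun f z - q z * hfun c z) z"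
    using division_fixed_point[OF B(4-7) B(3,1,2)] by blast
  have hq: "holo_at q 0" using holo_at_holo_on[OF q(1) zero_in_pbox[OF B(1,2)]] .
  have hh: "holo_at (\<lambda>z. hfun f z - q z * hfun c z) 0"
    by (intro holo_at_minus holo_at_simps holo_at_hfun hq)
  have "abs_hg q = abs_hg ((dquot s ^^ d) (\<lambda>z. hfun f z - q z * hfun c z))"
    unfolding abs_hg_eq_iff[OF hq holo_at_dquot_pow[OF hh]]
    using pbox_eventually[OF B(1,2), of s] by eventually_elim (rule q(2))
  also have "\<dots> = (hdq s ^^ d) (f - abs_hg q * c)"
    unfolding abs_hg_dquot_pow[OF hh, symmetric]
    by (simp add: abs_hg_ops hq holo_at_hfun holo_at_simps(3))
  finally show ?thesis by blast
qed

lemma germ_division_zero: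
  fixes w q :: "'n::finite hg"
  assumes b: "\<forall>k<d. b k \<in> hO (- {s})" "\<forall>k<d. hev (b k) = 0"
    and c: "c = (\<Sum>k<d. hcoord s ^ k * b k) * w" and q: "q = - (hdq s ^^ d) (q * c)"
  shows "q = 0"
proof -
  have hh: "holo_at (\<lambda>z. hfun q z * hfun c z) 0" by (intro holo_at_simps holo_at_hfun)
  have qeq: "q = abs_hg (\<lambda>z. - (dquot s ^^ d) (\<lambda>z. hfun q z * hfun c z) z)"
  proof -
    have "q = - (hdq s ^^ d) (abs_hg (\<lambda>z. hfun q z * hfun c z))"
      using q by (simp add: abs_hg_ops holo_at_hfun)
    also have "\<dots> = abs_hg (\<lambda>z. - (dquot s ^^ d) (\<lambda>z. hfun q z * hfun c z) z)"
      unfolding abs_hg_dquot_pow[OF hh] using holo_at_dquot_pow[OF hh] by (simp add: uminus_hg.abs_eq)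
    finally show ?thesis .
  qed
  have "eventually (\<lambda>z. hfun q z = - (dquot s ^^ d) (\<lambda>z. hfun q z * hfun c z) z) (nhds 0)"
    using hfun_abs[OF holo_at_uminus[OF holo_at_dquot_pow[OF hh, of d s]]] by (simp only: qeq[symmetric])
  then obtain r where r: "r > 0" "\<And>z. z \<in> pbox s r r \<Longrightarrow> hfun q z = - (dquot s ^^ d) (\<lambda>z. hfun q z * hfun c z) z"
    using eventually_pbox[where s = s] by blast
  obtain \<delta> \<epsilon> \<kappa> M where B: "\<delta> > 0" "\<epsilon> > 0" "pbox s \<delta> \<epsilon> \<subseteq> pbox s r r" "(2 / \<epsilon>) ^ d * \<kappa> \<le> 1 / 2"
    "holo_on (hfun q) (pbox s \<delta> \<epsilon>)" "\<And>u. u \<in> pbox s \<delta> \<epsilon> \<Longrightarrow> cmod (hfun q u) \<le> M"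
    "holo_on (hfun c) (pbox s \<delta> \<epsilon>)" "\<And>u. u \<in> pbox s \<delta> \<epsilon> \<Longrightarrow> cmod (hfun c u) \<le> \<kappa>"
    using division_box[OF b c r(1), of q thesis] by blast
  have fx: "cmod (hfun q z) = cmod ((dquot s ^^ d) (\<lambda>z. hfun q z * hfun c z) z)" if "z \<in> pbox s \<delta> \<epsilon>" for z
  proof -
    have "z \<in> pbox s r r" using B(3) that by blast
    then have "hfun q z = - (dquot s ^^ d) (\<lambda>z. hfun q z * hfun c z) z" by (rule r(2))
    then show ?thesis by (simp only: norm_minus_cancel)
  qed
  have "hfun q z = 0" if "z \<in> pbox s \<delta> \<epsilon>" for z
    by (rule division_fixed_point_zero[OF B(5-8) B(4,1,2) fx that])
  then have "eventually (\<lambda>z. hfun q z = hfun 0 z) (nhds 0)"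
    using pbox_eventually[OF B(1,2), of s] hfun_ops(5) by (auto elim: eventually_elim2)
  then show ?thesis by (rule hg_eqI)
qed

text \<open>The values of the iterated divided differences at the origin are the Taylor coefficients
  along the axis, so the germ vanishes on the axis exactly to order \<open>d\<close>.\<close>

definition hreg :: "'n::finite \<Rightarrow> nat \<Rightarrow> 'n hg \<Rightarrow> bool" where
  "hreg s d b \<longleftrightarrow> hev ((hdq s ^^ d) b) \<noteq> 0 \<and> (\<forall>k<d. hev ((hdq s ^^ k) b) = 0)"

text \<open>The \<open>d\<close>-th divided difference is a unit, its value at the origin being
  nonzero. Multiplying the expansion by its inverse \<open>u\<close> leaves a pure power perturbed
  by terms whose coefficients vanish at the origin, which is the shape the contraction argument
  handles.\<close>

lemma hreg_normal_form:
  assumes "hreg s d b"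
  obtains u b' c where "(hdq s ^^ d) b * u = 1" "\<forall>k<d. b' k \<in> hO (- {s})" "\<forall>k<d. hev (b' k) = 0"
    "c = (\<Sum>k<d. hcoord s ^ k * b' k) * u" "b * u = hcoord s ^ d + c" "b = (hcoord s ^ d + c) * (hdq s ^^ d) b"
proof -
  obtain u where u: "(hdq s ^^ d) b * u = 1" using hg_unit assms unfolding hreg_def by blast
  define b' where "b' k = hpr (- {s}) ((hdq s ^^ k) b)" for k
  have b: "b = (\<Sum>k<d. hcoord s ^ k * b' k) + hcoord s ^ d * (hdq s ^^ d) b"
    unfolding b'_def by (rule hdq_expand)
  have 1: "b * u = hcoord s ^ d + (\<Sum>k<d. hcoord s ^ k * b' k) * u"
    by (subst b) (simp only: distrib_right mult.assoc u mult_1_right add.commute)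
  have 2: "b = (hcoord s ^ d + (\<Sum>k<d. hcoord s ^ k * b' k) * u) * (hdq s ^^ d) b"
    unfolding 1[symmetric] using u by (metis mult.assoc mult.commute mult.right_neutral)
  show thesis
    by (rule that[OF u _ _ refl 1 2]) (use assms in \<open>auto simp: b'_def hpr_in_hO hreg_def\<close>)
qed

theorem Weierstrass_division:
  assumes "hreg s d b"
  obtains q r where "a = q * b + (\<Sum>k<d. hcoord s ^ k * r k)" "\<And>k. r k \<in> hO (- {s})"
proof (rule hreg_normal_form[OF assms])
  fix u b' c
  assume *: "(hdq s ^^ d) b * u = 1" "\<forall>k<d. b' k \<in> hO (- {s})" "\<forall>k<d. hev (b' k) = 0"
    "c = (\<Sum>k<d. hcoord s ^ k * b' k) * u" "b * u = hcoord s ^ d + c" "b = (hcoord s ^ d + c) * (hdq s ^^ d) b"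
  \<comment> \<open>In the expansion of \<open>a - q * c\<close> the factor of the top power is
    \<open>q\<close> itself, so the expansion is already the division of \<open>a\<close> by
    \<open>hcoord s ^ d + c\<close>.\<close>
  obtain q where q: "q = (hdq s ^^ d) (a - q * c)" using germ_division_ex[OF *(2-4), of a] by (elim exE)
  define R where "R = (\<Sum>k<d. hcoord s ^ k * hpr (- {s}) ((hdq s ^^ k) (a - q * c)))"
  have "a - q * c = R + hcoord s ^ d * q" unfolding R_def
    by (subst hdq_expand[of _ s d]) (simp only: q[symmetric])
  moreover have "(q * u) * b = q * (hcoord s ^ d + c)" unfolding *(5)[symmetric] by (simp only: mult_ac)
  ultimately have "a = (q * u) * b + R" by (simp add: algebra_simps)
  then show thesis unfolding R_def by (rule that) (rule hpr_in_hO)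
qed

theorem Weierstrass_division_unique:
  assumes "hreg s d b" and eq: "q * b + (\<Sum>k<d. hcoord s ^ k * r k) = 0" and r: "\<And>k. k < d \<Longrightarrow> r k \<in> hO (- {s})"
  shows "q = 0 \<and> (\<forall>k<d. r k = 0)"
proof (rule hreg_normal_form[OF assms(1)])
  fix u b' c
  assume *: "(hdq s ^^ d) b * u = 1" "\<forall>k<d. b' k \<in> hO (- {s})" "\<forall>k<d. hev (b' k) = 0"
    "c = (\<Sum>k<d. hcoord s ^ k * b' k) * u" "b * u = hcoord s ^ d + c" "b = (hcoord s ^ d + c) * (hdq s ^^ d) b"
  define q' where "q' = q * (hdq s ^^ d) b"
  have "q * b = q' * (hcoord s ^ d + c)" unfolding q'_def by (subst *(6)) (simp only: mult_ac)
  then have "0 = hcoord s ^ d * q' + q' * c + (\<Sum>k<d. hcoord s ^ k * r k)"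
    using eq by (simp add: algebra_simps)
  \<comment> \<open>The \<open>d\<close>-fold divided difference kills the remainder and leaves the
    homogeneous fixed-point equation.\<close>
  then have "0 = (hdq s ^^ d) (hcoord s ^ d * q' + q' * c + (\<Sum>k<d. hcoord s ^ k * r k))" by simp
  also have "\<dots> = q' + (hdq s ^^ d) (q' * c)"
    by (simp add: hdq_pow_add hdq_pow_coord hdq_pow_sum hdq_pow_small r)
  finally have "q' = - (hdq s ^^ d) (q' * c)" by (simp add: eq_neg_iff_add_eq_0)
  then have "q' = 0" by (rule germ_division_zero[OF *(2-4)])
  then have q0: "q = 0" using *(1) unfolding q'_def by auto
  then have s0: "(\<Sum>k<d. hcoord s ^ k * r k) = 0" using eq by simp
  have "r k = 0" if "k < d" for k
    by (rule coord_poly_coeff_unique[of d r s]) (use r s0 that in auto)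
  with q0 show "q = 0 \<and> (\<forall>k<d. r k = 0)" by blast
qed


section \<open>Weierstrass polynomials\<close>

lemma hev_hdq_pow: "hev ((hdq s ^^ k) a) = (dquot s ^^ k) (hfun a) 0"
proof -
  have "(hdq s ^^ k) a = abs_hg ((dquot s ^^ k) (hfun a))"
    using abs_hg_dquot_pow[OF holo_at_hfun[of a], of k s] by simp
  then show ?thesis
    using holo_at_dquot_pow[OF holo_at_hfun[of a]] by (simp add: hev.abs_eq eq_onp_def)
qed

text \<open>If all Taylor coefficients on the axis vanish, the value at w is w^k times the k-th
  divided difference, hence at most (2|w|/r)^k M for every k. For |w| < r/2 this tends to 0.\<close>

lemma hreg_exists:
  assumes "\<not> eventually (\<lambda>w. hfun a (w *s axis s 1) = 0) (nhds 0)"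
  shows "\<exists>d. hreg s d a"
proof -
  have "\<exists>d. hev ((hdq s ^^ d) a) \<noteq> 0"
  proof (rule ccontr)
    assume "\<not> ?thesis"
    then have z: "(dquot s ^^ k) (hfun a) 0 = 0" for k by (simp add: hev_hdq_pow[symmetric])
    obtain M r where r: "r > 0" "holo_on (hfun a) (pbox s r r)" "\<And>z. z \<in> pbox s r r \<Longrightarrow> cmod (hfun a z) \<le> M"
      using holo_at_bounded[OF holo_at_hfun[of a], where s = s] by blast
    have "hfun a (w *s axis s 1) = 0" if w: "cmod w < r / 2" for w
    proof -
      have up: "upd s 0 (w *s axis s 1) = 0" and comp: "(w *s axis s 1) $ s = w"
        by (simp_all add: Finite_Cartesian_Product.vec_eq_iff axis_def)
      have box: "w *s axis s 1 \<in> pbox s r r" using w r(1) by (auto simp: pbox_def axis_def)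
      have eq: "hfun a (w *s axis s 1) = w ^ k * (dquot s ^^ k) (hfun a) (w *s axis s 1)" for k
      proof (induction k)
        case (Suc k)
        have "(dquot s ^^ k) (hfun a) (w *s axis s 1) = w * (dquot s ^^ Suc k) (hfun a) (w *s axis s 1)"
          using dquot_mult[of "(dquot s ^^ k) (hfun a)" "w *s axis s 1" s] by (simp only: up comp z add_0 funpow.simps o_def)
        then show ?case using Suc by simp
      qed simp
      have bd: "cmod (hfun a (w *s axis s 1)) \<le> (2 * cmod w / r) ^ k * M" for k
      proof -
        have "cmod (hfun a (w *s axis s 1)) \<le> cmod w ^ k * ((2 / r) ^ k * M)"
          by (subst eq[of k], unfold norm_mult norm_power, rule mult_left_mono[OF dquot_pow_bound[OF r(2,3) box]]) auto
        then show ?thesis by (simp add: power_divide power_mult_distrib mult_ac)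
      qed
      have "(\<lambda>k. (2 * cmod w / r) ^ k * M) \<longlonglongrightarrow> 0 * M"
        by (intro tendsto_intros LIMSEQ_realpow_zero) (use w r(1) in \<open>auto simp: field_simps\<close>)
      then have "cmod (hfun a (w *s axis s 1)) \<le> 0 * M"
        by (rule tendsto_lowerbound) (use bd in auto)
      then show ?thesis by simp
    qed
    moreover have "eventually (\<lambda>w. w \<in> ball 0 (r / 2)) (nhds (0 :: complex))"
      by (rule eventually_nhds_in_open) (use r in auto)
    ultimately have "eventually (\<lambda>w. hfun a (w *s axis s 1) = 0) (nhds 0)"
      by (auto elim: eventually_mono)
    then show False using assms by contradiction
  qed
  then obtain d0 where "hev ((hdq s ^^ d0) a) \<noteq> 0" by blast
  then have "hreg s (LEAST d. hev ((hdq s ^^ d) a) \<noteq> 0) a"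
    unfolding hreg_def using LeastI[of "\<lambda>d. hev ((hdq s ^^ d) a) \<noteq> 0" d0]
    by (auto dest: not_less_Least)
  then show ?thesis by blast
qed

text \<open>Commuting with the projection onto \<open>S\<close> in both directions makes the
  substitutions inverse automorphisms of \<open>hO S\<close>.\<close>

definition clin_auto :: "'n set \<Rightarrow> (complex ^ 'n \<Rightarrow> complex ^ 'n) \<Rightarrow> (complex ^ 'n \<Rightarrow> complex ^ 'n) \<Rightarrow> bool" where
  "clin_auto S T T' \<longleftrightarrow> clin T \<and> clin T' \<and> (\<forall>z. T (T' z) = z) \<and> (\<forall>z. T' (T z) = z) \<and>
     (\<forall>z. proj S (T z) = T (proj S z)) \<and> (\<forall>z. proj S (T' z) = T' (proj S z))"

text \<open>Choose a point \<open>u\<close> of the coordinate subspace, close to the origin, with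
  \<open>hfun b u\<close> nonzero; it is not 0 because \<open>b\<close> vanishes there. A shear
  \<open>T\<close> takes the axis of a coordinate \<open>s\<close> with \<open>u $ s\<close> nonzero
  to the line through \<open>u\<close>, and \<open>b\<close> does not vanish identically on that
  line near the origin, by the identity theorem.\<close>

lemma regular_coordinate:
  fixes b :: "'n::finite hg"
  assumes b: "b \<in> hO S" "b \<noteq> 0" "hev b = 0"
  obtains s T T' d where "s \<in> S" "clin_auto S T T'" "hreg s d (hsub T b)"
proof -
  obtain U where U: "0 \<in> U" "holo_on (hfun b) U" using holo_at_hfun by (auto simp: holo_at_def)
  obtain d where d: "d > 0" "ball 0 d \<subseteq> U" using U(1) holo_on_open[OF U(2)] openE by blast
  have hb: "holo_on (hfun b) (ball 0 d)" by (rule holo_on_subset[OF U(2)]) (use d in auto)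
  have "hpr S b = b" using b(1) by (simp add: hO_iff)
  then have e1: "eventually (\<lambda>z. hfun b z = hfun b (proj S z)) (nhds 0)"
    using hfun_ops(9)[of S b] by simp
  have "eventually (\<lambda>z. z \<in> ball 0 d) (nhds (0 :: complex ^ 'n))"
    by (rule eventually_nhds_in_open) (use d in auto)
  then have e2: "eventually (\<lambda>z. proj S z \<in> ball 0 d) (nhds (0 :: complex ^ 'n))"
    by (rule clin_eventually[OF clin_proj])
  have "\<not> eventually (\<lambda>z. hfun b (proj S z) = 0 \<or> proj S z \<notin> ball 0 d) (nhds 0)"
  proof
    assume "eventually (\<lambda>z. hfun b (proj S z) = 0 \<or> proj S z \<notin> ball 0 d) (nhds 0)"
    then have "eventually (\<lambda>z. hfun b z = hfun 0 z) (nhds 0)"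
      using e1 e2 hfun_ops(5) by eventually_elim auto
    then show False using b(2) hg_eqI by blast
  qed
  then obtain v where v: "hfun b (proj S v) \<noteq> 0" "proj S v \<in> ball 0 d"
    unfolding not_eventually using frequently_ex by blast
  define u where "u = proj S v"
  have u: "hfun b u \<noteq> 0" "u \<in> ball 0 d" "proj S u = u" using v by (simp_all add: u_def)
  have "u \<noteq> 0" using u(1) b(3) by (auto simp: hev_hfun)
  then obtain s where s: "u $ s \<noteq> 0" by (auto simp: Finite_Cartesian_Product.vec_eq_iff)
  have sS: "s \<in> S" using s u(3) by (metis proj_nth)
  have uS: "u $ i = 0" if "i \<notin> S" for i using u(3) that by (metis proj_nth)
  define T where "T z = upd s 0 z + z $ s *s u" for z
  define T' where "T' w = upd s (w $ s / u $ s) (w - (w $ s / u $ s) *s u)" for w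
  have lT: "clin T" unfolding clin_def T_def
    by (auto intro!: linearI simp: Finite_Cartesian_Product.vec_eq_iff algebra_simps)
  have lT': "clin T'" unfolding clin_def T'_def
    by (auto intro!: linearI simp: Finite_Cartesian_Product.vec_eq_iff algebra_simps add_divide_distrib
        scaleR_conv_of_real[where 'a = complex])
  have TT': "T (T' z) = z" "T' (T z) = z" for z
    using s by (auto simp: T_def T'_def Finite_Cartesian_Product.vec_eq_iff)
  have pT: "proj S (T z) = T (proj S z)" for z
    using sS uS by (auto simp: T_def Finite_Cartesian_Product.vec_eq_iff)
  have pT': "proj S (T' z) = T' (proj S z)" for z
    using sS uS by (auto simp: T'_def Finite_Cartesian_Product.vec_eq_iff)
  have Tax: "T (w *s axis s 1) = w *s u" for w
    by (auto simp: T_def Finite_Cartesian_Product.vec_eq_iff axis_def)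
  have "\<not> eventually (\<lambda>w. hfun (hsub T b) (w *s axis s 1) = 0) (nhds 0)"
  proof
    assume ev: "eventually (\<lambda>w. hfun (hsub T b) (w *s axis s 1) = 0) (nhds 0)"
    have tends: "filterlim (\<lambda>w. w *s axis s 1 :: complex ^ 'n) (nhds 0) (nhds 0)"
    proof -
      have "isCont (\<lambda>w. w *s axis s 1 :: complex ^ 'n) 0"
        by (rule linear_continuous_at[OF bounded_linear_smult_vec])
      then have "((\<lambda>w. w *s axis s 1) \<longlongrightarrow> (0 *s axis s 1 :: complex ^ 'n)) (nhds 0)"
        using tendsto_at_iff_tendsto_nhds[of "\<lambda>w. w *s axis s 1 :: complex ^ 'n" 0]
        unfolding isCont_def by simp
      then show ?thesis by simp
    qed
    have "eventually (\<lambda>w. hfun (hsub T b) (w *s axis s 1) = hfun b (T (w *s axis s 1))) (nhds 0)"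
      using hfun_ops(11)[OF lT, of b] tends unfolding filterlim_iff by blast
    then have ev0: "eventually (\<lambda>w. hfun b (0 + w *s u) = 0) (nhds 0)"
      using ev by eventually_elim (simp add: Tax)
    then obtain W where W: "open W" "0 \<in> W" "\<And>w. w \<in> W \<Longrightarrow> hfun b (0 + w *s u) = 0"
      unfolding eventually_nhds by blast
    let ?S = "{t. 0 + t *s u \<in> ball 0 d}"
    have oS: "open ?S" by (rule open_line) simp
    have "convex ?S"
      using convex_linear_vimage[OF bounded_linear.linear[OF bounded_linear_smult_vec[of u]], of "ball 0 d"]
      by (simp add: vimage_def)
    then have "connected ?S" by (rule convex_connected)
    have "hfun b (0 + 1 *s u) = 0"
    proof (rule analytic_continuation_open[of "?S \<inter> W" ?S "\<lambda>t. hfun b (0 + t *s u)" "\<lambda>_. 0" 1])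
      have "0 \<in> ?S \<inter> W" using W d by simp
      then show "?S \<inter> W \<noteq> {}" by blast
      show "1 \<in> ?S" using u(2) by simp
      show "open (?S \<inter> W)" using oS W by blast
    qed (use oS W \<open>connected ?S\<close> holo_on_line[OF hb, of 0 u] in auto)
    then show False using u(1) by simp
  qed
  then obtain e where "hreg s e (hsub T b)" using hreg_exists by blast
  then show thesis using that sS lT lT' TT' pT pT' unfolding clin_auto_def by blast
qed

section \<open>Weierstrass polynomials and the preparation theorem\<close>

lemma hdq_mult: "hdq s (a * b) = hdq s a * b + hpr (- {s}) a * hdq s b"
proof -
  have "a * b = (hpr (- {s}) a + hcoord s * hdq s a) * b" by (simp only: hdq_decomp[symmetric])
  also have "\<dots> = hpr (- {s}) a * b + hcoord s * (hdq s a * b)" by (simp only: distrib_right mult.assoc)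
  also have "hpr (- {s}) a * b = hpr (- {s}) a * (hpr (- {s}) b + hcoord s * hdq s b)"
    by (simp only: hdq_decomp[symmetric])
  also have "\<dots> + hcoord s * (hdq s a * b) =
    hpr (- {s}) (a * b) + hcoord s * (hdq s a * b + hpr (- {s}) a * hdq s b)"
    by (simp add: algebra_simps)
  finally show ?thesis using hdq_unique[OF hpr_in_hO] by metis
qed

lemma hev_hdq_pow_mult:
  "(\<And>i. i \<le> j \<Longrightarrow> hev ((hdq s ^^ i) b) = 0) \<Longrightarrow> hev ((hdq s ^^ j) (q * b)) = 0"
proof (induction j arbitrary: q b)
  case 0
  then show ?case using "0.prems"[of 0] by simp
next
  case (Suc j)
  have 1: "hev ((hdq s ^^ j) (hdq s q * b)) = 0" by (rule Suc.IH) (simp add: Suc.prems)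
  have 2: "hev ((hdq s ^^ j) (hpr (- {s}) q * hdq s b)) = 0"
  proof (rule Suc.IH)
    show "hev ((hdq s ^^ i) (hdq s b)) = 0" if "i \<le> j" for i
      using Suc.prems[of "Suc i"] that by (simp add: funpow_swap1)
  qed
  have "(hdq s ^^ Suc j) (q * b) = (hdq s ^^ j) (hdq s q * b) + (hdq s ^^ j) (hpr (- {s}) q * hdq s b)"
    by (simp add: funpow_swap1 hdq_mult hdq_pow_add)
  then show ?case using 1 2 by simp
qed

definition wpoly :: "'n set \<Rightarrow> 'n::finite \<Rightarrow> nat \<Rightarrow> (nat \<Rightarrow> 'n hg) \<Rightarrow> 'n hg \<Rightarrow> bool" where
  "wpoly S s d p P \<longleftrightarrow> s \<in> S \<and> (\<forall>k. p k \<in> hO (S - {s})) \<and> (\<forall>k<d. hev (p k) = 0) \<and>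
     P = hcoord s ^ d + (\<Sum>k<d. hcoord s ^ k * p k)"

lemma wpoly_hreg:
  assumes "wpoly S s d p P" shows "hreg s d P"
proof -
  have p: "p k \<in> hO (- {s})" for k
    using assms hO_mono[of "p k" "S - {s}" "- {s}"] by (auto simp: wpoly_def)
  have P: "P = hcoord s ^ d * 1 + (\<Sum>k<d. hcoord s ^ k * p k)" using assms by (simp add: wpoly_def)
  have "hev ((hdq s ^^ j) P) = (if j = d then 1 else if j < d then hev (p j) else 0)" for j
  proof -
    have "hev ((hdq s ^^ j) P) = hev (hpr (- {s}) ((hdq s ^^ j) P))" by simp
    also have "hpr (- {s}) ((hdq s ^^ j) P) = (if j = d then 1 else 0) + (\<Sum>k<d. if j = k then p k else 0)"
      unfolding P hdq_pow_add hdq_pow_sum hpr_sum hpr_simps(1)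
      using hpr_hdq_pow_coord[of 1 s j d] hpr_hdq_pow_coord[OF p, of j] by (simp add: hO_closed)
    finally show ?thesis by (simp add: sum.delta)
  qed
  then show ?thesis using assms by (simp add: hreg_def wpoly_def)
qed

text \<open>The ring homomorphism \<open>hpr S\<close> fixes \<open>a\<close>, \<open>b\<close> and
  the coordinate \<open>s\<close>, so applying it to a division identity gives another one, now
  inside \<open>hO S\<close>.\<close>

lemma Weierstrass_division_in:
  assumes "hreg s d b" "b \<in> hO S" "a \<in> hO S" and s: "s \<in> S"
  obtains q r where "a = q * b + (\<Sum>k<d. hcoord s ^ k * r k)" "q \<in> hO S" "\<And>k. r k \<in> hO (S - {s})"
proof -
  obtain q r where qr: "a = q * b + (\<Sum>k<d. hcoord s ^ k * r k)" "\<And>k. r k \<in> hO (- {s})"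
    using Weierstrass_division[OF assms(1)] by blast
  have "a = hpr S q * b + (\<Sum>k<d. hcoord s ^ k * hpr S (r k))"
  proof -
    have "a = hpr S (q * b + (\<Sum>k<d. hcoord s ^ k * r k))"
      using assms(3) qr(1) by (simp add: hO_iff)
    then show ?thesis using assms(2) s by (simp add: hpr_sum hO_iff)
  qed
  moreover have "hpr S (r k) \<in> hO (S - {s})" for k
  proof -
    have 1: "hpr S (hpr (- {s}) (r k)) = hpr (S - {s}) (r k)" by (simp add: Diff_eq Int_commute)
    have 2: "hpr (- {s}) (r k) = r k" using qr(2) by (simp add: hO_iff)
    show ?thesis using hpr_in_hO[of "S - {s}" "r k"] unfolding 1[symmetric] 2 .
  qed
  ultimately show thesis by (rule that[OF _ hpr_in_hO])
qed

text \<open>Divide the pure power \<open>hcoord s ^ d\<close> by \<open>b\<close>: power minus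
  remainder is a multiple of \<open>b\<close> of polynomial form. Along the axis a multiple of
  \<open>b\<close> vanishes to order \<open>d\<close>, which forces the coefficients of the
  remainder to vanish at the origin.\<close>

lemma Weierstrass_preparation:
  assumes b: "hreg s d b" "b \<in> hO S" and s: "s \<in> S"
  obtains q p P where "P = q * b" "q \<in> hO S" "wpoly S s d p P"
proof -
  have "hcoord s ^ d \<in> hO S" using s by (intro hO_closed) auto
  then obtain q r where qr: "hcoord s ^ d = q * b + (\<Sum>k<d. hcoord s ^ k * r k)" "q \<in> hO S" "\<And>k. r k \<in> hO (S - {s})"
    using Weierstrass_division_in[OF b _ s] by blast
  have r': "r k \<in> hO (- {s})" for k
    using hO_mono[OF qr(3), of "- {s}"] by auto
  have qb: "q * b = hcoord s ^ d * 1 + (\<Sum>k<d. hcoord s ^ k * - r k)"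
    using qr(1) by (simp add: sum_negf algebra_simps)
  have "hev (r j) = 0" if j: "j < d" for j
  proof -
    have "0 = hev ((hdq s ^^ j) (q * b))"
      using hev_hdq_pow_mult[of j s b q] b(1) j by (simp add: hreg_def)
    also have "\<dots> = hev (hpr (- {s}) ((hdq s ^^ j) (q * b)))" by simp
    also have "hpr (- {s}) ((hdq s ^^ j) (q * b)) = (if j = d then 1 else 0) + (\<Sum>k<d. if j = k then - r k else 0)"
      unfolding qb hdq_pow_add hdq_pow_sum hpr_sum hpr_simps(1)
      using hpr_hdq_pow_coord[of 1 s j d] hpr_hdq_pow_coord[OF hO_closed(4)[OF r'], of j] by (simp add: hO_closed)
    also have "hev \<dots> = - hev (r j)" using j by (simp add: sum.delta)
    finally show ?thesis by simp
  qed
  then have "wpoly S s d (\<lambda>k. - r k) (q * b)"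
    using qb s qr(3) by (auto simp: wpoly_def hO_closed)
  then show thesis using that qr(2) by blast
qed


section \<open>Regular sequences\<close>

inductive_set gidl :: "'a::comm_ring_1 set \<Rightarrow> 'a set" for F where
  zero: "0 \<in> gidl F"
| add: "a \<in> gidl F \<Longrightarrow> x \<in> F \<Longrightarrow> a + c * x \<in> gidl F"

lemma gidl_gen: "x \<in> F \<Longrightarrow> x \<in> gidl F"
  using gidl.add[OF gidl.zero, of x F 1] by simp

lemma gidl_mult_gen: "x \<in> F \<Longrightarrow> c * x \<in> gidl F"
  using gidl.add[OF gidl.zero, of x F c] by simp

lemma gidl_add:
  assumes a: "a \<in> gidl F" and b: "b \<in> gidl F" shows "a + b \<in> gidl F"
  using b
proof (induction b rule: gidl.induct)
  case (add b x c)
  then show ?case using gidl.add[of "a + b" F x c] by (simp add: add.assoc)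
qed (simp add: a)

lemma gidl_mult: "a \<in> gidl F \<Longrightarrow> c * a \<in> gidl F"
proof (induction a rule: gidl.induct)
  case (add a x c')
  then show ?case using gidl.add[of "c * a" F x "c * c'"] by (simp add: algebra_simps)
qed (simp add: gidl.zero)

lemma gidl_uminus: "a \<in> gidl F \<Longrightarrow> - a \<in> gidl F"
  using gidl_mult[of a F "-1"] by simp

lemma gidl_diff: "a \<in> gidl F \<Longrightarrow> b \<in> gidl F \<Longrightarrow> a - b \<in> gidl F"
  using gidl_add[OF _ gidl_uminus, of a F b] by simp

lemma gidl_sum: "(\<And>i. i \<in> A \<Longrightarrow> f i \<in> gidl F) \<Longrightarrow> (\<Sum>i\<in>A. f i) \<in> gidl F"
  by (induction A rule: infinite_finite_induct) (auto intro: gidl.zero gidl_add)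

lemma gidl_subset: "F \<subseteq> gidl G \<Longrightarrow> gidl F \<subseteq> gidl G"
proof
  fix a assume "F \<subseteq> gidl G" "a \<in> gidl F"
  from this(2,1) show "a \<in> gidl G"
    by (induction a rule: gidl.induct) (auto intro: gidl.zero gidl_add gidl_mult)
qed

lemma gidl_image_sum:
  "a \<in> gidl (x ` {..<k :: nat}) \<Longrightarrow> \<exists>c. a = (\<Sum>i<k. c i * x i)"
proof (induction a rule: gidl.induct)
  case zero
  then show ?case by (intro exI[of _ "\<lambda>_. 0"]) simp
next
  case (add a y c)
  then obtain c' j where c': "a = (\<Sum>i<k. c' i * x i)" and j: "y = x j" "j < k" by auto
  have "(\<Sum>i<k. (if i = j then c else 0) * x i) = (\<Sum>i<k. if i = j then c * x i else 0)"
    by (intro sum.cong) auto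
  also have "\<dots> = c * x j" using j(2) by (subst sum.delta) auto
  finally have "a + c * y = (\<Sum>i<k. (c' i + (if i = j then c else 0)) * x i)"
    unfolding c' j(1) distrib_right sum.distrib by simp
  then show ?case by (intro exI[of _ "\<lambda>i. c' i + (if i = j then c else 0)"])
qed

text \<open>Only the nonzerodivisor conditions are imposed, and the generated ideal may be the whole
  ring. In particular a list of ones is regular, which serves the case of an empty zero set.\<close>

definition regseq :: "'a::comm_ring_1 list \<Rightarrow> bool" where
  "regseq xs \<longleftrightarrow> (\<forall>k<length xs. \<forall>a. a * xs ! k \<in> gidl (set (take k xs)) \<longrightarrow> a \<in> gidl (set (take k xs)))"

lemma regseq_snoc:
  "regseq xs \<Longrightarrow> (\<And>a. a * x \<in> gidl (set xs) \<Longrightarrow> a \<in> gidl (set xs)) \<Longrightarrow> regseq (xs @ [x])"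
  by (auto simp: regseq_def less_Suc_eq nth_append)

lemma regseq_take: "regseq xs \<Longrightarrow> regseq (take m xs)"
  by (auto simp: regseq_def min_def)

text \<open>Write an element of the ideal as a combination of generators and divide the coefficients
  by \<open>P\<close>. Since the generators do not involve the coordinate \<open>s\<close>, the
  result is a division with quotient in the ideal. For \<open>a * P\<close> uniqueness identifies
  this quotient with \<open>a\<close>.\<close>

lemma hreg_nonzerodivisor:
  assumes F: "F \<subseteq> hO (- {s})" and P: "hreg s d P" and aP: "a * P \<in> gidl F"
  shows "a \<in> gidl F"
proof -
  have "\<exists>q r. y = q * P + (\<Sum>k<d. hcoord s ^ k * r k) \<and> q \<in> gidl F \<and> (\<forall>k. r k \<in> hO (- {s}))"
    if "y \<in> gidl F" for y
    using that
  proof (induction y rule: gidl.induct)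
    case zero
    show ?case by (intro exI[of _ 0] exI[of _ "\<lambda>_. 0"]) (simp add: gidl.zero hO_closed)
  next
    case (add y x c)
    then obtain q r where qr: "y = q * P + (\<Sum>k<d. hcoord s ^ k * r k)" "q \<in> gidl F" "\<forall>k. r k \<in> hO (- {s})" by blast
    obtain q' r' where qr': "c = q' * P + (\<Sum>k<d. hcoord s ^ k * r' k)" "\<And>k. r' k \<in> hO (- {s})"
      using Weierstrass_division[OF P] by blast
    have "y + c * x = (q + q' * x) * P + (\<Sum>k<d. hcoord s ^ k * (r k + r' k * x))"
      unfolding qr(1) qr'(1) by (simp add: algebra_simps sum.distrib sum_distrib_left)
    moreover have "q + q' * x \<in> gidl F" using gidl.add[OF qr(2) add.hyps(2)] .
    moreover have "\<forall>k. r k + r' k * x \<in> hO (- {s})" using qr(3) qr'(2) F add.hyps(2) by (auto intro!: hO_closed)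
    ultimately show ?case by (intro exI conjI)
  qed
  from this[OF aP] obtain q r where qr: "a * P = q * P + (\<Sum>k<d. hcoord s ^ k * r k)" "q \<in> gidl F" "\<forall>k. r k \<in> hO (- {s})" by blast
  have "(q - a) * P + (\<Sum>k<d. hcoord s ^ k * r k) = 0" using qr(1) by (simp add: algebra_simps)
  then have "q - a = 0" using Weierstrass_division_unique[OF P, of "q - a" r] qr(3) by blast
  then show ?thesis using qr(2) by simp
qed

lemma hreg_power_nonzerodivisor:
  assumes F: "F \<subseteq> hO (- {s})" and P: "hreg s d P" and aP: "a * P ^ e \<in> gidl F"
  shows "a \<in> gidl F"
  using aP
proof (induction e)
  case (Suc e)
  have "(a * P ^ e) * P \<in> gidl F" using Suc.prems by (simp add: mult_ac)
  then show ?case using hreg_nonzerodivisor[OF F P] Suc.IH by blast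
qed simp

text \<open>Later only some common power of the entries is known to lie in the ideal of interest, so
  regularity of all powers is carried through the constructions.\<close>

definition pow_regseq :: "'a::comm_ring_1 list \<Rightarrow> bool" where
  "pow_regseq xs \<longleftrightarrow> (\<forall>e. regseq (map (\<lambda>x. x ^ e) xs))"

lemma pow_regseq_snoc:
  assumes "pow_regseq xs" "set xs \<subseteq> hO (- {s})" "hreg s d P"
  shows "pow_regseq (xs @ [P])"
  unfolding pow_regseq_def
proof
  fix e
  have "set (map (\<lambda>x. x ^ e) xs) \<subseteq> hO (- {s})" using assms(2) by (auto intro: hO_closed)
  then have "regseq (map (\<lambda>x. x ^ e) xs @ [P ^ e])"
    using assms(1) hreg_power_nonzerodivisor[OF _ assms(3)] by (intro regseq_snoc) (auto simp: pow_regseq_def)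
  then show "regseq (map (\<lambda>x. x ^ e) (xs @ [P]))" by simp
qed

lemma pow_regseq_take: "pow_regseq xs \<Longrightarrow> pow_regseq (take m xs)"
  unfolding pow_regseq_def by (metis regseq_take take_map)

lemma pow_regseq_Nil: "pow_regseq []"
  by (simp add: pow_regseq_def regseq_def)

lemma gidl_image_hom:
  assumes "\<And>a b. h (a + b) = h a + h b" "\<And>a b. h (a * b) = h a * h b" "h 0 = 0" "a \<in> gidl F"
  shows "h a \<in> gidl (h ` F)"
  using assms(4) by (induction a rule: gidl.induct) (auto simp: assms(1-3) intro: gidl.intros)

lemma pow_regseq_hom:
  assumes h: "\<And>a b. h (a + b) = h a + h b" "\<And>a b. h (a * b) = h a * h b" "h 0 = 0" "h 1 = 1"
    and k: "\<And>a b. k (a + b) = k a + k b" "\<And>a b. k (a * b) = k a * k b" "k 0 = 0"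
    and hk: "\<And>a. h (k a) = a" "\<And>a. k (h a) = a" and xs: "pow_regseq xs"
  shows "pow_regseq (map h xs)"
  unfolding pow_regseq_def
proof
  fix e
  have pw: "h x ^ e = h (x ^ e)" for x by (induction e) (auto simp: h)
  have reg: "regseq (map (\<lambda>x. x ^ e) xs)" using xs by (simp add: pow_regseq_def)
  show "regseq (map (\<lambda>x. x ^ e) (map h xs))"
    unfolding regseq_def
  proof (intro allI impI)
    fix j a assume j: "j < length (map (\<lambda>x. x ^ e) (map h xs))"
      and a: "a * map (\<lambda>x. x ^ e) (map h xs) ! j \<in> gidl (set (take j (map (\<lambda>x. x ^ e) (map h xs))))"
    let ?Y = "set (take j (map (\<lambda>x. x ^ e) xs))"
    have Y: "set (take j (map (\<lambda>x. x ^ e) (map h xs))) = h ` ?Y"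
      by (simp add: take_map pw image_image)
    have jl: "j < length (map (\<lambda>x. x ^ e) xs)" using j by simp
    have xj: "map (\<lambda>x. x ^ e) (map h xs) ! j = h (map (\<lambda>x. x ^ e) xs ! j)"
      using jl by (simp add: pw)
    have "k (a * h (map (\<lambda>x. x ^ e) xs ! j)) \<in> gidl (k ` h ` ?Y)"
      using gidl_image_hom[OF k a] unfolding Y xj .
    then have "k a * map (\<lambda>x. x ^ e) xs ! j \<in> gidl ?Y"
      unfolding k(2) hk(2) image_image image_ident .
    then have "k a \<in> gidl ?Y" by (rule reg[unfolded regseq_def, rule_format, OF jl])
    then have "h (k a) \<in> gidl (h ` ?Y)" by (rule gidl_image_hom[OF h(1-3)])
    then show "a \<in> gidl (set (take j (map (\<lambda>x. x ^ e) (map h xs))))" unfolding Y hk(1) .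
  qed
qed


section \<open>Elimination of one variable\<close>

lemma det_mult_solution:
  fixes A :: "'a::comm_ring_1 Matrix.mat"
  assumes A: "A \<in> carrier_mat d d" and eq: "\<And>k. k < d \<Longrightarrow> (\<Sum>l<d. A $$ (k, l) * w l) = y k" and i: "i < d"
  shows "Determinant.det A * w i = (\<Sum>k<d. adj_mat A $$ (i, k) * y k)"
proof -
  have "(\<Sum>k<d. adj_mat A $$ (i, k) * y k) = (\<Sum>k<d. \<Sum>l<d. adj_mat A $$ (i, k) * A $$ (k, l) * w l)"
    by (intro sum.cong refl) (simp add: eq[symmetric] sum_distrib_left mult.assoc)
  also have "\<dots> = (\<Sum>l<d. (\<Sum>k<d. adj_mat A $$ (i, k) * A $$ (k, l)) * w l)"
    by (subst sum.swap) (simp add: sum_distrib_right)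
  also have "\<dots> = (\<Sum>l<d. (adj_mat A * A) $$ (i, l) * w l)"
    using A i adj_mat(1)[OF A] by (intro sum.cong refl) (auto simp: scalar_prod_def lessThan_atLeast0)
  also have "\<dots> = (\<Sum>l<d. if l = i then Determinant.det A * w l else 0)"
    unfolding adj_mat(3)[OF A] using i by (intro sum.cong refl) auto
  also have "\<dots> = Determinant.det A * w i" using i by (simp add: sum.delta)
  finally show ?thesis by simp
qed

lemma adj_mat_solution:
  fixes A :: "'a::comm_ring_1 Matrix.mat"
  assumes A: "A \<in> carrier_mat d d" and i: "i < d"
  shows "(\<Sum>k<d. A $$ (i, k) * (\<Sum>j<d. adj_mat A $$ (k, j) * v j)) = Determinant.det A * v i"
proof -
  have "(\<Sum>k<d. A $$ (i, k) * (\<Sum>j<d. adj_mat A $$ (k, j) * v j)) =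
    (\<Sum>k<d. \<Sum>j<d. A $$ (i, k) * adj_mat A $$ (k, j) * v j)"
    by (simp add: sum_distrib_left mult.assoc)
  also have "\<dots> = (\<Sum>j<d. (\<Sum>k<d. A $$ (i, k) * adj_mat A $$ (k, j)) * v j)"
    by (subst sum.swap) (simp add: sum_distrib_right)
  also have "\<dots> = (\<Sum>j<d. (A * adj_mat A) $$ (i, j) * v j)"
    using A i adj_mat(1)[OF A] by (intro sum.cong refl) (auto simp: scalar_prod_def lessThan_atLeast0)
  also have "\<dots> = (\<Sum>j<d. if j = i then Determinant.det A * v j else 0)"
    unfolding adj_mat(2)[OF A] using i by (intro sum.cong refl) auto
  also have "\<dots> = Determinant.det A * v i" using i by (simp add: sum.delta)
  finally show ?thesis .
qed

lemma comm_ring_hom_hpr: "comm_ring_hom (hpr S)"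
  by unfold_locales auto

lemma hO_det:
  assumes M: "M \<in> carrier_mat d d" "\<And>k l. k < d \<Longrightarrow> l < d \<Longrightarrow> M $$ (k, l) \<in> hO S"
  shows "Determinant.det M \<in> hO S"
proof -
  have "map_mat (hpr S) M = M" using M by (intro eq_matI) (auto simp: hO_iff)
  then show ?thesis using comm_ring_hom.hom_det[OF comm_ring_hom_hpr, of S M] by (simp add: hO_iff)
qed

lemma hO_char_poly:
  assumes M: "M \<in> carrier_mat d d" "\<And>k l. k < d \<Longrightarrow> l < d \<Longrightarrow> M $$ (k, l) \<in> hO S"
  shows "coeff (char_poly M) k \<in> hO S"
proof -
  have "map_mat (hpr S) M = M" using M by (intro eq_matI) (auto simp: hO_iff)
  then have "char_poly M = map_poly (hpr S) (char_poly M)"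
    using comm_ring_hom.char_poly_hom[OF comm_ring_hom_hpr M(1), of S] by simp
  then have "coeff (char_poly M) k = hpr S (coeff (char_poly M) k)"
    by (metis coeff_map_poly hpr_simps(5))
  then show ?thesis by (simp add: hO_iff)
qed

lemma wpoly_in_hO: "wpoly S s d p P \<Longrightarrow> P \<in> hO S"
  unfolding wpoly_def
  by (auto intro!: hO_closed hO_sum elim: hO_mono[of "p _" "S - {s}" S])

text \<open>Row \<open>k\<close> holds the remainder of \<open>G * hcoord s ^ k\<close> modulo
  \<open>P\<close>. The matrix thus represents multiplication by \<open>G\<close> on the module that
  Weierstrass division makes free over \<open>hO (S - {s})\<close> with basis the powers of the
  coordinate below \<open>d\<close>; \<open>y\<close> records the quotients.\<close>

lemma multiplication_matrix:
  assumes P: "wpoly S s d p P" and G: "G \<in> hO S"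
  obtains M y where "M \<in> carrier_mat d d" "\<And>k l. k < d \<Longrightarrow> l < d \<Longrightarrow> M $$ (k, l) \<in> hO (S - {s})"
    "\<And>k. k < d \<Longrightarrow> G * hcoord s ^ k = (\<Sum>l<d. M $$ (k, l) * hcoord s ^ l) + y k * P"
proof -
  have s: "s \<in> S" using P by (simp add: wpoly_def)
  have "\<forall>k. \<exists>y m. G * hcoord s ^ k = y * P + (\<Sum>l<d. hcoord s ^ l * m l) \<and> (\<forall>l. m l \<in> hO (S - {s}))"
  proof
    fix k
    have "G * hcoord s ^ k \<in> hO S" using G s by (intro hO_closed) auto
    then show "\<exists>y m. G * hcoord s ^ k = y * P + (\<Sum>l<d. hcoord s ^ l * m l) \<and> (\<forall>l. m l \<in> hO (S - {s}))"
    proof (rule Weierstrass_division_in[OF wpoly_hreg[OF P] wpoly_in_hO[OF P] _ s])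
      fix q r
      assume "G * hcoord s ^ k = q * P + (\<Sum>l<d. hcoord s ^ l * r l)" "\<And>l. r l \<in> hO (S - {s})"
      then show ?thesis by blast
    qed
  qed
  then obtain y m where ym: "\<And>k. G * hcoord s ^ k = y k * P + (\<Sum>l<d. hcoord s ^ l * m k l)" "\<And>k l. m k l \<in> hO (S - {s})"
    by metis
  show thesis
    by (rule that[of "mat d d (\<lambda>(k, l). m k l)" y]) (auto simp: ym mult.commute)
qed

lemma wpoly_degree_0: "wpoly S s 0 p P \<Longrightarrow> P = 1"
  by (simp add: wpoly_def)

text \<open>Modulo \<open>G\<close> and \<open>P\<close> the matrix kills the vector of powers of
  the coordinate, whose entry of index 0 is 1. Cramer's rule for that entry puts the determinant
  into the ideal.\<close>

lemma det_multiplication_in_ideal: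
  assumes M: "M \<in> carrier_mat d d" and P: "wpoly S s d p P"
    and eq: "\<And>k. k < d \<Longrightarrow> G * hcoord s ^ k = (\<Sum>l<d. M $$ (k, l) * hcoord s ^ l) + y k * P"
  shows "Determinant.det M \<in> gidl {G, P}"
proof (cases "d = 0")
  case True
  then have "P = 1" using wpoly_degree_0 P by blast
  then show ?thesis using gidl_mult_gen[of P "{G, P}" "Determinant.det M"] by simp
next
  case False
  have "(\<Sum>l<d. M $$ (k, l) * hcoord s ^ l) = G * hcoord s ^ k - y k * P" if "k < d" for k
    using eq[OF that] by simp
  then have "Determinant.det M * hcoord s ^ 0 = (\<Sum>k<d. adj_mat M $$ (0, k) * (G * hcoord s ^ k - y k * P))"
    by (rule det_mult_solution[OF M]) (use False in auto)
  also have "\<dots> \<in> gidl {G, P}"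
  proof (rule gidl_sum, rule gidl_mult, rule gidl_diff)
    fix k
    show "G * hcoord s ^ k \<in> gidl {G, P}" using gidl_mult_gen[of G "{G, P}" "hcoord s ^ k"] by (simp add: mult.commute)
    show "y k * P \<in> gidl {G, P}" by (rule gidl_mult_gen) simp
  qed
  finally show ?thesis by simp
qed

text \<open>The determinant trick: modulo \<open>P\<close> the matrix of \<open>a - M\<close> kills
  the vector of powers of the coordinate, whose first entry is 1, so its determinant, the
  characteristic polynomial of \<open>M\<close> at \<open>a\<close>, is a multiple of
  \<open>P\<close>.\<close>

lemma integral_equation:
  assumes P: "wpoly S s d p P" and a: "a \<in> hO S"
  obtains \<xi> c where "\<And>k. \<xi> k \<in> hO (S - {s})" "\<xi> d = 1" "(\<Sum>k\<le>d. \<xi> k * a ^ k) = c * P"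
proof (cases "d = 0")
  case True
  show ?thesis
    by (rule that[of "\<lambda>_. 1" 1]) (use True wpoly_degree_0 P in \<open>auto simp: hO_closed\<close>)
next
  case False
  obtain M y where M: "M \<in> carrier_mat d d" "\<And>k l. k < d \<Longrightarrow> l < d \<Longrightarrow> M $$ (k, l) \<in> hO (S - {s})"
    and eq: "\<And>k. k < d \<Longrightarrow> a * hcoord s ^ k = (\<Sum>l<d. M $$ (k, l) * hcoord s ^ l) + y k * P"
    by (rule multiplication_matrix[OF P a]) blast
  let ?h = "\<lambda>q. poly q a"
  let ?C = "map_mat ?h (char_poly_matrix M)"
  have hom: "comm_ring_hom ?h" by unfold_locales auto
  have C: "?C \<in> carrier_mat d d" using M(1) by auto
  have detC: "Determinant.det ?C = poly (char_poly M) a"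
    using comm_ring_hom.hom_det[OF hom, of "char_poly_matrix M"] by (simp add: char_poly_def)
  have entry: "?C $$ (k, l) = (if k = l then a else 0) - M $$ (k, l)" if "k < d" "l < d" for k l
    using M(1) that by (auto simp: char_poly_matrix_def)
  have "(\<Sum>l<d. ?C $$ (k, l) * hcoord s ^ l) = y k * P" if k: "k < d" for k
  proof -
    have "(\<Sum>l<d. ?C $$ (k, l) * hcoord s ^ l) =
      (\<Sum>l<d. (if l = k then a * hcoord s ^ l else 0) - M $$ (k, l) * hcoord s ^ l)"
      using k by (intro sum.cong refl) (auto simp: entry left_diff_distrib)
    also have "\<dots> = a * hcoord s ^ k - (\<Sum>l<d. M $$ (k, l) * hcoord s ^ l)"
      using k by (simp add: sum_subtractf sum.delta)
    finally show ?thesis using eq[OF k] by simp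
  qed
  then have "Determinant.det ?C * hcoord s ^ 0 = (\<Sum>k<d. adj_mat ?C $$ (0, k) * (y k * P))"
    by (rule det_mult_solution[OF C]) (use False in auto)
  then have 1: "poly (char_poly M) a = (\<Sum>k<d. adj_mat ?C $$ (0, k) * y k) * P"
    by (simp add: detC sum_distrib_right mult.assoc)
  have deg: "degree (char_poly M) = d" "coeff (char_poly M) d = 1"
    using degree_monic_char_poly[OF M(1)] by auto
  show ?thesis
    by (rule that[of "coeff (char_poly M)"])
      (use hO_char_poly[OF M] deg 1 in \<open>auto simp: poly_altdef\<close>)
qed


section \<open>Chains of primes\<close>

text \<open>Ideals of the subring \<open>hO S\<close> are plain sets of germs, so that a chain of
  primes can be contracted to fewer variables without leaving the type.\<close>

definition ideal_in :: "'n set \<Rightarrow> 'n::finite hg set \<Rightarrow> bool" where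
  "ideal_in S c \<longleftrightarrow> c \<subseteq> hO S \<and> 0 \<in> c \<and> (\<forall>a\<in>c. \<forall>b\<in>c. a + b \<in> c) \<and> (\<forall>a\<in>c. \<forall>b\<in>hO S. b * a \<in> c)"

definition prime_in :: "'n set \<Rightarrow> 'n::finite hg set \<Rightarrow> bool" where
  "prime_in S c \<longleftrightarrow> ideal_in S c \<and> 1 \<notin> c \<and> (\<forall>a\<in>hO S. \<forall>b\<in>hO S. a * b \<in> c \<longrightarrow> a \<in> c \<or> b \<in> c)"

lemma ideal_inD:
  assumes "ideal_in S c"
  shows "a \<in> c \<Longrightarrow> a \<in> hO S" "0 \<in> c" "a \<in> c \<Longrightarrow> b \<in> c \<Longrightarrow> a + b \<in> c" "a \<in> c \<Longrightarrow> b \<in> hO S \<Longrightarrow> b * a \<in> c"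
    "a \<in> c \<Longrightarrow> b \<in> hO S \<Longrightarrow> a * b \<in> c" "a \<in> c \<Longrightarrow> b \<in> c \<Longrightarrow> a - b \<in> c"
proof -
  show 1: "a \<in> c \<Longrightarrow> a \<in> hO S" "0 \<in> c" "a \<in> c \<Longrightarrow> b \<in> c \<Longrightarrow> a + b \<in> c" "a \<in> c \<Longrightarrow> b \<in> hO S \<Longrightarrow> b * a \<in> c" for a b
    using assms unfolding ideal_in_def by blast+
  then show "a \<in> c \<Longrightarrow> b \<in> hO S \<Longrightarrow> a * b \<in> c" by (simp add: mult.commute)
  have "- 1 \<in> hO S" by (simp add: hO_closed)
  then show "a \<in> c \<Longrightarrow> b \<in> c \<Longrightarrow> a - b \<in> c"
    using 1(3)[of a "- 1 * b"] 1(4)[of b "- 1"] by simp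
qed

lemma ideal_in_sum: "ideal_in S c \<Longrightarrow> (\<And>i. i \<in> A \<Longrightarrow> f i \<in> c) \<Longrightarrow> (\<Sum>i\<in>A. f i) \<in> c"
  by (induction A rule: infinite_finite_induct) (auto simp: ideal_inD)

lemma hpr_hsub:
  assumes "clin_auto S T T'" shows "hpr S (hsub T a) = hsub T (hpr S a)"
proof (rule hg_eqI)
  have lT: "clin T" using assms by (simp add: clin_auto_def)
  have "eventually (\<lambda>z. hfun (hsub T a) (proj S z) = hfun a (T (proj S z))) (nhds 0)"
    by (rule clin_eventually[OF clin_proj hfun_ops(11)[OF lT, of a]])
  moreover have "eventually (\<lambda>z. hfun (hpr S a) (T z) = hfun a (proj S (T z))) (nhds 0)"
    by (rule clin_eventually[OF lT hfun_ops(9)[of S a]])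
  ultimately show "eventually (\<lambda>z. hfun (hpr S (hsub T a)) z = hfun (hsub T (hpr S a)) z) (nhds 0)"
    using hfun_ops(9)[of S "hsub T a"] hfun_ops(11)[OF lT, of "hpr S a"]
    by eventually_elim (use assms in \<open>simp add: clin_auto_def\<close>)
qed

lemma clin_auto_sym: "clin_auto S T T' \<Longrightarrow> clin_auto S T' T"
  by (auto simp: clin_auto_def)

lemma hsub_inverse: "clin_auto S T T' \<Longrightarrow> hsub T (hsub T' a) = a"
  using hsub_hsub[of T T' a] hsub_id unfolding clin_auto_def by simp

lemma hsub_hO: "clin_auto S T T' \<Longrightarrow> a \<in> hO S \<Longrightarrow> hsub T a \<in> hO S"
  by (simp add: hO_iff hpr_hsub)

lemma inj_hsub: "clin_auto S T T' \<Longrightarrow> inj (hsub T)"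
  by (rule inj_on_inverseI[of _ "hsub T'"]) (auto dest: clin_auto_sym hsub_inverse)

lemma ideal_in_hsub:
  assumes T: "clin_auto S T T'" and c: "ideal_in S c"
  shows "ideal_in S (hsub T ` c)"
proof -
  have lT: "clin T" using T by (simp add: clin_auto_def)
  have "b * hsub T a \<in> hsub T ` c" if "a \<in> c" "b \<in> hO S" for a b
  proof -
    have "hsub T' b * a \<in> c" using ideal_inD(4)[OF c that(1)] hsub_hO[OF clin_auto_sym[OF T] that(2)] by blast
    moreover have "hsub T (hsub T' b * a) = b * hsub T a" by (simp add: hsub_simps(2)[OF lT] hsub_inverse[OF T])
    ultimately show ?thesis by force
  qed
  moreover have "hsub T a + hsub T b \<in> hsub T ` c" if "a \<in> c" "b \<in> c" for a b
    using ideal_inD(3)[OF c that] by (force simp: hsub_simps(1)[OF lT, symmetric])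
  moreover have "0 \<in> hsub T ` c" using ideal_inD(2)[OF c] hsub_simps(5)[OF lT] by (metis imageI)
  ultimately show ?thesis using c hsub_hO[OF T] unfolding ideal_in_def by auto
qed

lemma prime_in_hsub:
  assumes T: "clin_auto S T T'" and c: "prime_in S c"
  shows "prime_in S (hsub T ` c)"
proof -
  have lT: "clin T" and lT': "clin T'" using T by (auto simp: clin_auto_def)
  have mem: "x \<in> hsub T ` c \<longleftrightarrow> hsub T' x \<in> c" for x
    using hsub_inverse[OF T] hsub_inverse[OF clin_auto_sym[OF T]] by (metis image_iff)
  have "1 \<notin> hsub T ` c" using c by (simp add: mem hsub_simps(6)[OF lT'] prime_in_def)
  moreover have "a \<in> hsub T ` c \<or> b \<in> hsub T ` c" if "a \<in> hO S" "b \<in> hO S" "a * b \<in> hsub T ` c" for a b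
    using that c hsub_hO[OF clin_auto_sym[OF T]] unfolding mem prime_in_def hsub_simps(2)[OF lT'] by blast
  ultimately show ?thesis using ideal_in_hsub[OF T] c unfolding prime_in_def by blast
qed

lemma prime_in_contract:
  assumes "prime_in S c" shows "prime_in (S - {s}) (c \<inter> hO (S - {s}))"
proof -
  have sub: "hO (S - {s}) \<subseteq> hO S" using hO_mono[of _ "S - {s}" S] by auto
  have "ideal_in (S - {s}) (c \<inter> hO (S - {s}))"
    using assms sub unfolding prime_in_def ideal_in_def by (auto intro: hO_closed)
  moreover have "a \<in> c \<or> b \<in> c" if "a \<in> hO (S - {s})" "b \<in> hO (S - {s})" "a * b \<in> c" for a b
    using assms sub that unfolding prime_in_def by blast
  ultimately show ?thesis using assms unfolding prime_in_def by blast
qed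

lemma proper_ideal_hev:
  assumes c: "ideal_in S c" "1 \<notin> c" and a: "a \<in> c"
  shows "hev a = 0"
proof (rule ccontr)
  assume "hev a \<noteq> 0"
  then obtain b where b: "a * b = 1" using hg_unit by blast
  have "a * hpr S b = hpr S (a * b)" using ideal_inD(1)[OF c(1) a] by (simp add: hO_iff)
  then have "a * hpr S b = 1" using b by simp
  then show False using ideal_inD(5)[OF c(1) a hpr_in_hO[of S b]] c(2) by simp
qed

lemma prime_power:
  assumes c: "prime_in S c" and a: "a \<in> hO S" shows "a ^ k \<in> c \<Longrightarrow> a \<in> c"
proof (induction k)
  case 0
  then show ?case using c by (simp add: prime_in_def)
next
  case (Suc k)
  have "a ^ k \<in> hO S" using a by (rule hO_closed)
  then show ?case using c a Suc unfolding prime_in_def power_Suc by blast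
qed

text \<open>Incomparability for the integral extension defined by \<open>P\<close>. In a monic
  equation for \<open>a\<close> modulo \<open>c\<close> take the first coefficient outside
  \<open>c\<close>. Primality cancels the power of \<open>a\<close> that divides the remaining
  terms, and what is left shows this coefficient to be a multiple of \<open>a\<close> modulo
  \<open>c\<close>, hence an element of \<open>c'\<close>.\<close>

lemma contraction_strict:
  assumes c: "prime_in S c" and c': "prime_in S c'" and sub: "c \<subseteq> c'" and a: "a \<in> c'" "a \<notin> c"
    and P: "wpoly S s d p P" "P \<in> c"
  shows "\<exists>x\<in>hO (S - {s}). x \<in> c' \<and> x \<notin> c"
proof -
  have ci: "ideal_in S c" and ci': "ideal_in S c'" using c c' by (auto simp: prime_in_def)
  have aO: "a \<in> hO S" using ideal_inD(1)[OF ci' a(1)] .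
  obtain \<xi> e where \<xi>: "\<And>k. \<xi> k \<in> hO (S - {s})" "\<xi> d = 1" "(\<Sum>k\<le>d. \<xi> k * a ^ k) = e * P"
    by (rule integral_equation[OF P(1) aO]) blast
  have \<xi>S: "\<xi> k \<in> hO S" for k using hO_mono[OF \<xi>(1), of S] by blast
  have "(\<Sum>k\<le>d. \<xi> k * a ^ k) \<in> c"
  proof -
    have "(\<Sum>k\<le>d. \<xi> k * a ^ k) \<in> hO S" by (intro hO_sum hO_closed \<xi>S aO)
    then have "(\<Sum>k\<le>d. \<xi> k * a ^ k) = hpr S (e * P)" unfolding \<xi>(3) by (simp add: hO_iff)
    also have "\<dots> = hpr S e * P" using wpoly_in_hO[OF P(1)] by (simp add: hO_iff)
    finally show ?thesis using ideal_inD(4)[OF ci P(2) hpr_in_hO[of S e]] by simp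
  qed
  have "1 \<notin> c" using c by (simp add: prime_in_def)
  then have ex: "\<xi> d \<notin> c" using \<xi>(2) by simp
  define k where "k = (LEAST k. \<xi> k \<notin> c)"
  have k: "\<xi> k \<notin> c" "k \<le> d" "\<And>j. j < k \<Longrightarrow> \<xi> j \<in> c"
    using LeastI[of "\<lambda>k. \<xi> k \<notin> c", OF ex] Least_le[of "\<lambda>k. \<xi> k \<notin> c", OF ex] not_less_Least[of _ "\<lambda>k. \<xi> k \<notin> c"]
    unfolding k_def by blast+
  define w where "w = (\<Sum>j\<in>{k<..d}. \<xi> j * a ^ (j - Suc k))"
  have wO: "w \<in> hO S" unfolding w_def by (intro hO_sum hO_closed \<xi>S aO)
  have split: "{..d} = {..<k} \<union> {k} \<union> {k<..d}" using k(2) by auto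
  have "(\<Sum>j\<le>d. \<xi> j * a ^ j) = (\<Sum>j<k. \<xi> j * a ^ j) + \<xi> k * a ^ k + (\<Sum>j\<in>{k<..d}. \<xi> j * a ^ j)"
    unfolding split by (subst sum.union_disjoint; force)+
  also have "(\<Sum>j\<in>{k<..d}. \<xi> j * a ^ j) = a ^ k * (a * w)"
    unfolding w_def sum_distrib_left
  proof (intro sum.cong refl)
    fix j assume "j \<in> {k<..d}"
    then have "a ^ j = a ^ k * (a * a ^ (j - Suc k))"
      by (metis Suc_leI add_Suc_right greaterThanAtMost_iff le_add_diff_inverse power_Suc power_add add_Suc)
    then show "\<xi> j * a ^ j = a ^ k * (a * (\<xi> j * a ^ (j - Suc k)))" by (simp add: mult_ac)
  qed
  finally have "a ^ k * (\<xi> k + a * w) = (\<Sum>j\<le>d. \<xi> j * a ^ j) - (\<Sum>j<k. \<xi> j * a ^ j)"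
    by (simp add: algebra_simps)
  also have "\<dots> \<in> c"
    by (intro ideal_inD(6)[OF ci] ideal_in_sum[OF ci] ideal_inD(5)[OF ci] hO_closed aO k(3) \<open>(\<Sum>k\<le>d. \<xi> k * a ^ k) \<in> c\<close>) auto
  finally have "\<xi> k + a * w \<in> c"
    using c prime_power[OF c aO, of k] a(2) aO wO \<xi>S[of k] unfolding prime_in_def
    by (meson hO_closed(1,2,8))
  then have "(\<xi> k + a * w) - a * w \<in> c'"
    using sub by (intro ideal_inD(6)[OF ci'] ideal_inD(5)[OF ci' a(1) wO]) auto
  then show ?thesis using k(1) \<xi>(1)[of k] by auto
qed

text \<open>An element of the second prime outside the first yields, after a coordinate change, a
  Weierstrass polynomial in the second prime. Contracting the chain from there to one variable less
  keeps it strict, and the polynomial may be appended to the sequence found there because that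
  sequence does not involve the coordinate \<open>s\<close>.\<close>

theorem prime_chain_regseq:
  assumes "\<forall>i\<le>p. prime_in S (c i)" "\<forall>i<p. c i \<subset> c (Suc i)"
  shows "\<exists>xs. length xs = p \<and> set xs \<subseteq> c p \<and> pow_regseq (xs :: 'n::finite hg list)"
  using assms
proof (induction "card S" arbitrary: S c p rule: less_induct)
  case less
  show ?case
  proof (cases p)
    case 0
    then show ?thesis by (auto simp: pow_regseq_Nil)
  next
    case (Suc p')
    have pr: "prime_in S (c i)" if "i \<le> p" for i using less.prems(1) that by blast
    have idl: "ideal_in S (c i)" if "i \<le> p" for i using pr[OF that] by (simp add: prime_in_def)
    have st: "c i \<subset> c (Suc i)" if "i < p" for i using less.prems(2) that by blast
    obtain b where b: "b \<in> c 1" "b \<notin> c 0" using st[of 0] Suc by auto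
    have "b \<noteq> 0" using b(2) ideal_inD(2)[OF idl[of 0]] by auto
    have bO: "b \<in> hO S" using ideal_inD(1)[OF idl b(1)] Suc by simp
    have "hev b = 0" using proper_ideal_hev[OF idl _ b(1)] pr[of 1] Suc by (simp add: prime_in_def)
    then obtain s T T' d where sT: "s \<in> S" "clin_auto S T T'" "hreg s d (hsub T b)"
      using regular_coordinate[OF bO \<open>b \<noteq> 0\<close>] by blast
    define c' where "c' i = hsub T ` c i" for i
    have pr': "prime_in S (c' i)" if "i \<le> p" for i unfolding c'_def by (rule prime_in_hsub[OF sT(2) pr[OF that]])
    have idl': "ideal_in S (c' i)" if "i \<le> p" for i using pr'[OF that] by (simp add: prime_in_def)
    have st': "c' i \<subset> c' (Suc i)" if "i < p" for i
      using st[OF that] inj_image_mem_iff[OF inj_hsub[OF sT(2)]] unfolding c'_def by blast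
    obtain q pp P where P: "P = q * hsub T b" "q \<in> hO S" "wpoly S s d pp P"
      using Weierstrass_preparation[OF sT(3) hsub_hO[OF sT(2) bO] sT(1)] by blast
    have "hsub T b \<in> c' 1" using b(1) by (simp add: c'_def)
    then have P1: "P \<in> c' 1" using P(1,2) ideal_inD(4)[OF idl'[of 1]] Suc by simp
    have mono: "c' i \<subseteq> c' j" if "i \<le> j" "j \<le> p" for i j
      using that
    proof (induction j rule: dec_induct)
      case (step n)
      then show ?case using st'[of n] by auto
    qed simp
    \<comment> \<open>The shift drops the first prime: strictness of the contraction is available
      only for primes containing \<open>P\<close>.\<close>
    define e where "e i = c' (Suc i) \<inter> hO (S - {s})" for i
    have 1: "card (S - {s}) < card S" using sT(1) by (meson card_Diff1_less finite)
    have 2: "\<forall>i\<le>p'. prime_in (S - {s}) (e i)"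
      unfolding e_def using prime_in_contract[OF pr'] Suc by simp
    have 3: "\<forall>i<p'. e i \<subset> e (Suc i)"
    proof (intro allI impI)
      fix i assume i: "i < p'"
      obtain a where a: "a \<in> c' (Suc (Suc i))" "a \<notin> c' (Suc i)" using st'[of "Suc i"] i Suc by auto
      have "P \<in> c' (Suc i)" using P1 mono[of 1 "Suc i"] i Suc by auto
      then have "\<exists>x\<in>hO (S - {s}). x \<in> c' (Suc (Suc i)) \<and> x \<notin> c' (Suc i)"
        using contraction_strict[OF pr' pr' _ a P(3)] st'[of "Suc i"] i Suc by auto
      then show "e i \<subset> e (Suc i)" unfolding e_def using st'[of "Suc i"] i Suc by auto
    qed
    obtain xs where xs: "length xs = p'" "set xs \<subseteq> e p'" "pow_regseq xs"
      using less.hyps[OF 1 2 3] by blast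
    have "set xs \<subseteq> hO (- {s})" using xs(2) hO_mono[of _ "S - {s}" "- {s}"] unfolding e_def by auto
    then have reg: "pow_regseq (xs @ [P])" by (rule pow_regseq_snoc[OF xs(3) _ wpoly_hreg[OF P(3)]])
    have sub: "set (xs @ [P]) \<subseteq> c' p" using xs(2) P1 mono[of 1 p] Suc unfolding e_def by auto
    have lT: "clin T" "clin T'" using sT(2) by (auto simp: clin_auto_def)
    have "pow_regseq (map (hsub T') (xs @ [P]))"
      by (rule pow_regseq_hom[where k = "hsub T", OF _ _ _ _ _ _ _ _ _ reg])
        (simp_all add: hsub_simps lT hsub_inverse[OF sT(2)] hsub_inverse[OF clin_auto_sym[OF sT(2)]])
    moreover have "set (map (hsub T') (xs @ [P])) \<subseteq> c p"
    proof -
      have "hsub T' ` c' p = c p"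
        unfolding c'_def by (simp add: image_image hsub_inverse[OF clin_auto_sym[OF sT(2)]])
      then show ?thesis using sub by (metis image_mono set_map)
    qed
    moreover have "length (map (hsub T') (xs @ [P])) = p" using xs(1) Suc by simp
    ultimately show ?thesis by blast
  qed
qed


section \<open>Noetherianity and associated primes\<close>

lemma ideal_in_gidl: "ideal_in UNIV c \<Longrightarrow> F \<subseteq> c \<Longrightarrow> gidl F \<subseteq> c"
proof
  fix a assume c: "ideal_in UNIV c" and F: "F \<subseteq> c" and "a \<in> gidl F"
  from this(3) show "a \<in> c"
    by (induction a rule: gidl.induct) (use F in \<open>auto intro!: ideal_inD(2,3,4)[OF c]\<close>)
qed

lemma ideal_in_top_coefficients:
  assumes c: "ideal_in S c" and s: "s \<in> S"
  shows "ideal_in (S - {s}) {r j | r. (\<forall>k. r k \<in> hO (S - {s})) \<and> (\<Sum>k\<le>j. hcoord s ^ k * r k) \<in> c}"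
  (is "ideal_in _ ?N")
proof -
  have sub: "hO (S - {s}) \<subseteq> hO S" using hO_mono[of _ "S - {s}" S] by auto
  have "0 \<in> ?N" using ideal_inD(2)[OF c] by (auto intro!: exI[of _ "\<lambda>_. 0"] hO_closed)
  moreover have "a + b \<in> ?N" if ab: "a \<in> ?N" "b \<in> ?N" for a b
  proof -
    obtain r r' where r: "a = r j" "\<forall>k. r k \<in> hO (S - {s})" "(\<Sum>k\<le>j. hcoord s ^ k * r k) \<in> c"
      "b = r' j" "\<forall>k. r' k \<in> hO (S - {s})" "(\<Sum>k\<le>j. hcoord s ^ k * r' k) \<in> c"
      using ab by blast
    have "(\<Sum>k\<le>j. hcoord s ^ k * (r k + r' k)) \<in> c"
      using ideal_inD(3)[OF c r(3,6)] by (simp add: distrib_left sum.distrib)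
    then show ?thesis using r by (auto intro!: exI[of _ "\<lambda>k. r k + r' k"] hO_closed)
  qed
  moreover have "b * a \<in> ?N" if ab: "a \<in> ?N" "b \<in> hO (S - {s})" for a b
  proof -
    obtain r where r: "a = r j" "\<forall>k. r k \<in> hO (S - {s})" "(\<Sum>k\<le>j. hcoord s ^ k * r k) \<in> c"
      using ab by blast
    have "b * (\<Sum>k\<le>j. hcoord s ^ k * r k) \<in> c" using ideal_inD(4)[OF c r(3)] ab sub by blast
    then have "(\<Sum>k\<le>j. hcoord s ^ k * (b * r k)) \<in> c" by (simp add: sum_distrib_left mult.left_commute)
    then show ?thesis using r ab by (auto intro!: exI[of _ "\<lambda>k. b * r k"] hO_closed)
  qed
  ultimately show ?thesis unfolding ideal_in_def by blast
qed

text \<open>The remainders of an ideal modulo a Weierstrass polynomial are handled degree by degree, as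
  in the proof of the Hilbert basis theorem.\<close>

theorem hO_noetherian:
  fixes c :: "'n::finite hg set"
  assumes "ideal_in S c"
  shows "\<exists>F. finite F \<and> F \<subseteq> c \<and> c \<subseteq> gidl F"
  using assms
proof (induction "card S" arbitrary: S c rule: less_induct)
  case less
  note c = less.prems
  show ?case
  proof (cases "\<exists>b\<in>c. b \<noteq> 0")
    case False
    then show ?thesis by (intro exI[of _ "{}"]) (auto intro: gidl.zero)
  next
    case True
    then obtain b where b: "b \<in> c" "b \<noteq> 0" by blast
    have bO: "b \<in> hO S" using ideal_inD(1)[OF c b(1)] .
    show ?thesis
    proof (cases "hev b = 0")
      case False
      then obtain u where "b * u = 1" using hg_unit by blast
      then have "a = (a * u) * b" for a by (simp add: mult.assoc mult.commute[of u])
      then have "c \<subseteq> gidl {b}" by (metis gidl_mult_gen insertI1 subsetI)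
      then show ?thesis using b by (intro exI[of _ "{b}"]) auto
    next
      case hev: True
      obtain s T T' d where sT: "s \<in> S" "clin_auto S T T'" "hreg s d (hsub T b)"
        using regular_coordinate[OF bO b(2) hev] by blast
      define c' where "c' = hsub T ` c"
      have c': "ideal_in S c'" unfolding c'_def by (rule ideal_in_hsub[OF sT(2) c])
      obtain q pp P where P: "P = q * hsub T b" "q \<in> hO S" "wpoly S s d pp P"
        using Weierstrass_preparation[OF sT(3) hsub_hO[OF sT(2) bO] sT(1)] by blast
      have Pc: "P \<in> c'" using ideal_inD(4)[OF c' _ P(2)] b(1) unfolding P(1) c'_def by blast
      let ?S = "S - {s}"
      have sub: "hO ?S \<subseteq> hO S" using hO_mono[of _ ?S S] by auto
      define N where "N j = {r j | r. (\<forall>k. r k \<in> hO ?S) \<and> (\<Sum>k\<le>j. hcoord s ^ k * r k) \<in> c'}" for j :: nat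
      have "card ?S < card S" using sT(1) by (meson card_Diff1_less finite)
      then have "\<forall>j. \<exists>F. finite F \<and> F \<subseteq> N j \<and> N j \<subseteq> gidl F"
        using less.hyps[OF _ ideal_in_top_coefficients[OF c' sT(1)]] unfolding N_def by blast
      then obtain F where F: "\<And>j. finite (F j)" "\<And>j. F j \<subseteq> N j" "\<And>j. N j \<subseteq> gidl (F j)" by metis
      have "\<forall>j f. f \<in> F j \<longrightarrow> (\<exists>r. f = r j \<and> (\<forall>k. r k \<in> hO ?S) \<and> (\<Sum>k\<le>j. hcoord s ^ k * r k) \<in> c')"
        using F(2) unfolding N_def by blast
      then obtain r where r: "\<And>j f. f \<in> F j \<Longrightarrow> f = r j f j" "\<And>j f k. f \<in> F j \<Longrightarrow> r j f k \<in> hO ?S"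
        "\<And>j f. f \<in> F j \<Longrightarrow> (\<Sum>k\<le>j. hcoord s ^ k * r j f k) \<in> c'" by metis
      \<comment> \<open>For each degree below \<open>d\<close> the generators of the ideal of top
        coefficients are lifted to elements of \<open>c'\<close>; with \<open>P\<close> they will
        generate \<open>c'\<close>.\<close>
      define A where "A = insert P (\<Union>j<d. (\<lambda>f. \<Sum>k\<le>j. hcoord s ^ k * r j f k) ` F j)"
      have finA: "finite A" unfolding A_def using F(1) by blast
      have Ac: "A \<subseteq> c'" unfolding A_def using Pc r(3) by blast
      \<comment> \<open>The ideal \<open>gidl (F j)\<close> takes its coefficients from all germs,
        so they are projected before lifting, and the top coefficient reached is
        \<open>hpr ?S y\<close>. For \<open>y\<close> in the smaller ring this is
        \<open>y\<close>.\<close>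
      have lift: "\<exists>a \<rho>. a \<in> gidl A \<and> a \<in> c' \<and> a = (\<Sum>k\<le>j. hcoord s ^ k * \<rho> k) \<and> (\<forall>k. \<rho> k \<in> hO ?S) \<and> \<rho> j = hpr ?S y"
        if "y \<in> gidl (F j)" "j < d" for y j
        using that
      proof (induction y rule: gidl.induct)
        case zero
        show ?case
          by (intro exI[of _ 0] exI[of _ "\<lambda>_. 0"]) (auto simp: gidl.zero ideal_inD(2)[OF c'] hO_closed)
      next
        case (add y f e)
        then obtain a \<rho> where a: "a \<in> gidl A" "a \<in> c'" "a = (\<Sum>k\<le>j. hcoord s ^ k * \<rho> k)"
          "\<forall>k. \<rho> k \<in> hO ?S" "\<rho> j = hpr ?S y" by blast
        let ?g = "\<Sum>k\<le>j. hcoord s ^ k * r j f k"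
        have gA: "?g \<in> A" unfolding A_def using add by blast
        have eO: "hpr ?S e \<in> hO S" using sub hpr_in_hO by blast
        have 1: "a + hpr ?S e * ?g \<in> gidl A" by (rule gidl.add[OF a(1) gA])
        have 2: "a + hpr ?S e * ?g \<in> c'"
          using ideal_inD(3)[OF c' a(2) ideal_inD(4)[OF c' r(3)[OF add.hyps(2)] eO]] .
        have 3: "a + hpr ?S e * ?g = (\<Sum>k\<le>j. hcoord s ^ k * (\<rho> k + hpr ?S e * r j f k))"
          unfolding a(3) by (simp add: distrib_left sum.distrib sum_distrib_left mult.left_commute)
        have fO: "f \<in> hO ?S" using r(1,2)[OF add.hyps(2)] by metis
        have 4: "\<rho> j + hpr ?S e * r j f j = hpr ?S (y + e * f)"
          using r(1)[OF add.hyps(2)] fO by (simp add: a(5) hO_iff)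
        have 5: "\<forall>k. \<rho> k + hpr ?S e * r j f k \<in> hO ?S"
          using a(4) r(2)[OF add.hyps(2)] by (auto intro!: hO_closed hpr_in_hO)
        show ?case using 1 2 3 4 5
          by (intro exI[of _ "a + hpr ?S e * ?g"] exI[of _ "\<lambda>k. \<rho> k + hpr ?S e * r j f k"]) blast
      qed
      \<comment> \<open>Subtracting a lift with the same top coefficient lowers the degree bound by
        one.\<close>
      have red: "a \<in> gidl A" if "a \<in> c'" "a = (\<Sum>k<j. hcoord s ^ k * \<rho> k)" "\<forall>k. \<rho> k \<in> hO ?S" "j \<le> d" for a j \<rho>
        using that
      proof (induction j arbitrary: a \<rho>)
        case 0
        then show ?case by (simp add: gidl.zero)
      next
        case (Suc j)
        have aj: "a = (\<Sum>k\<le>j. hcoord s ^ k * \<rho> k)" using Suc.prems(2) by (simp add: lessThan_Suc_atMost)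
        then have "\<rho> j \<in> N j" using Suc.prems unfolding N_def by blast
        then obtain a' \<rho>' where a': "a' \<in> gidl A" "a' \<in> c'" "a' = (\<Sum>k\<le>j. hcoord s ^ k * \<rho>' k)"
          "\<forall>k. \<rho>' k \<in> hO ?S" "\<rho>' j = hpr ?S (\<rho> j)"
          using lift[of "\<rho> j" j] F(3)[of j] Suc.prems(4) by auto
        have top: "\<rho>' j = \<rho> j" using a'(5) Suc.prems(3) by (simp add: hO_iff)
        have "a - a' = (\<Sum>k\<le>j. hcoord s ^ k * (\<rho> k - \<rho>' k))"
          unfolding aj a'(3) by (simp add: right_diff_distrib sum_subtractf)
        also have "\<dots> = (\<Sum>k<j. hcoord s ^ k * (\<rho> k - \<rho>' k))"
          by (simp add: lessThan_Suc_atMost[symmetric] top)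
        finally have eq: "a - a' = (\<Sum>k<j. hcoord s ^ k * (\<rho> k - \<rho>' k))" .
        have "a - a' \<in> gidl A"
        proof (rule Suc.IH[OF _ eq])
          show "a - a' \<in> c'" by (rule ideal_inD(6)[OF c' Suc.prems(1) a'(2)])
          show "\<forall>k. \<rho> k - \<rho>' k \<in> hO ?S" using Suc.prems(3) a'(4) by (auto intro: hO_closed)
        qed (use Suc.prems(4) in simp)
        then show ?case using gidl_add[OF _ a'(1), of "a - a'"] by simp
      qed
      have "c' \<subseteq> gidl A"
      proof
        fix a assume a: "a \<in> c'"
        obtain q' \<rho> where qr: "a = q' * P + (\<Sum>k<d. hcoord s ^ k * \<rho> k)" "q' \<in> hO S" "\<And>k. \<rho> k \<in> hO ?S"
          by (rule Weierstrass_division_in[OF wpoly_hreg[OF P(3)] wpoly_in_hO[OF P(3)] ideal_inD(1)[OF c' a] sT(1)]) blast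
        have "a - q' * P \<in> c'" by (rule ideal_inD(6)[OF c' a ideal_inD(4)[OF c' Pc qr(2)]])
        then have "a - q' * P \<in> gidl A"
          by (rule red[where j = d and \<rho> = \<rho>]) (use qr in auto)
        moreover have "q' * P \<in> gidl A" by (rule gidl_mult_gen) (simp add: A_def)
        ultimately show "a \<in> gidl A" using gidl_add[of "a - q' * P" A "q' * P"] by simp
      qed
      have lT: "clin T'" using sT(2) by (auto simp: clin_auto_def)
      have cT: "c = hsub T' ` c'"
        unfolding c'_def by (simp add: image_image hsub_inverse[OF clin_auto_sym[OF sT(2)]])
      have "hsub T' ` gidl A \<subseteq> gidl (hsub T' ` A)"
        using gidl_image_hom[of "hsub T'" _ A, OF hsub_simps(1)[OF lT] hsub_simps(2)[OF lT] hsub_simps(5)[OF lT]]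
        by blast
      then have "c \<subseteq> gidl (hsub T' ` A)" using \<open>c' \<subseteq> gidl A\<close> unfolding cT by blast
      moreover have "hsub T' ` A \<subseteq> c" using Ac unfolding cT by blast
      ultimately show ?thesis using finA by blast
    qed
  qed
qed

section \<open>Colon ideals and associated primes\<close>

definition colon :: "'a::comm_ring_1 set \<Rightarrow> 'a \<Rightarrow> 'a set" where
  "colon I a = {b. b * a \<in> I}"

lemma ideal_in_colon: "ideal_in UNIV I \<Longrightarrow> ideal_in UNIV (colon I a)"
  unfolding colon_def ideal_in_def by (auto simp: distrib_right mult.assoc)

text \<open>A maximal element among the ideals \<open>(I : a)\<close> with \<open>a\<close> not killed by any power of \<open>\<Delta>\<close> is prime.\<close>

theorem associated_prime_avoiding:
  assumes I: "ideal_in UNIV I" and \<Delta>: "\<And>k. \<Delta> ^ k \<notin> I"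
  obtains a where "\<And>k. \<Delta> ^ k * a \<notin> I" "prime_in UNIV (colon I a)"
proof -
  define A where "A = {a. \<forall>k. \<Delta> ^ k * a \<notin> I}"
  have "\<exists>a\<in>A. \<forall>a'\<in>A. colon I a \<subseteq> colon I a' \<longrightarrow> colon I a' = colon I a"
  proof (rule ccontr)
    assume "\<not> ?thesis"
    then have "\<forall>a. \<exists>a'. a \<in> A \<longrightarrow> a' \<in> A \<and> colon I a \<subset> colon I a'" by blast
    then obtain nxt where nxt: "\<And>a. a \<in> A \<Longrightarrow> nxt a \<in> A" "\<And>a. a \<in> A \<Longrightarrow> colon I a \<subset> colon I (nxt a)" by metis
    \<comment> \<open>Without a maximal element an infinite strictly increasing chain of colon
      ideals would start at 1; the finite generation of its union makes it stop.\<close>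
    define \<sigma> where "\<sigma> n = (nxt ^^ n) 1" for n
    have "1 \<in> A" using \<Delta> by (simp add: A_def)
    then have \<sigma>A: "\<sigma> n \<in> A" for n by (induction n) (auto simp: \<sigma>_def nxt)
    have \<sigma>S: "colon I (\<sigma> n) \<subset> colon I (\<sigma> (Suc n))" for n using nxt(2)[OF \<sigma>A[of n]] by (simp add: \<sigma>_def)
    have mono: "colon I (\<sigma> m) \<subseteq> colon I (\<sigma> n)" if "m \<le> n" for m n
      using that by (induction n rule: dec_induct) (use \<sigma>S in blast)+
    define J where "J = (\<Union>n. colon I (\<sigma> n))"
    have idl: "ideal_in UNIV (colon I (\<sigma> n))" for n by (rule ideal_in_colon[OF I])
    have "ideal_in UNIV J"
      unfolding ideal_in_def
    proof (intro conjI ballI)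
      show "0 \<in> J" unfolding J_def using ideal_inD(2)[OF idl] by blast
      show "a + b \<in> J" if ab: "a \<in> J" "b \<in> J" for a b
      proof -
        obtain m n where "a \<in> colon I (\<sigma> m)" "b \<in> colon I (\<sigma> n)" using ab unfolding J_def by blast
        then have "a \<in> colon I (\<sigma> (max m n))" "b \<in> colon I (\<sigma> (max m n))"
          using mono[of m "max m n"] mono[of n "max m n"] by auto
        then show ?thesis unfolding J_def using ideal_inD(3)[OF idl] by blast
      qed
      show "b * a \<in> J" if "a \<in> J" for a b using that ideal_inD(4)[OF idl] unfolding J_def by auto
    qed auto
    then obtain F where F: "finite F" "F \<subseteq> J" "J \<subseteq> gidl F" using hO_noetherian by blast
    have "\<exists>n. F \<subseteq> colon I (\<sigma> n)" using F(1,2)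
    proof (induction F)
      case (insert x F)
      then obtain n m where "F \<subseteq> colon I (\<sigma> n)" "x \<in> colon I (\<sigma> m)" unfolding J_def by blast
      then have "insert x F \<subseteq> colon I (\<sigma> (max m n))"
        using mono[of m "max m n"] mono[of n "max m n"] by auto
      then show ?case by blast
    qed simp
    then obtain n where "F \<subseteq> colon I (\<sigma> n)" by blast
    then have "J \<subseteq> colon I (\<sigma> n)" using F(3) ideal_in_gidl[OF idl] by blast
    then show False using \<sigma>S[of n] unfolding J_def by blast
  qed
  then obtain a where a: "a \<in> A" "\<And>a'. a' \<in> A \<Longrightarrow> colon I a \<subseteq> colon I a' \<Longrightarrow> colon I a' = colon I a" by blast
  have aA: "\<Delta> ^ k * a \<notin> I" for k using a(1) by (simp add: A_def)
  have sub: "colon I a \<subseteq> colon I (e * a)" for e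
  proof
    fix b assume "b \<in> colon I a"
    then have "e * (b * a) \<in> I" using ideal_inD(4)[OF I _ hO_UNIV] by (simp add: colon_def)
    then show "b \<in> colon I (e * a)" by (simp add: colon_def mult.left_commute)
  qed
  have "x \<in> colon I a \<or> y \<in> colon I a" if xy: "x * y \<in> colon I a" for x y
  \<comment> \<open>If \<open>x * a\<close> is in \<open>A\<close>, maximality gives
    \<open>colon I (x * a) = colon I a\<close>, and the former contains \<open>y\<close>. Otherwise
    some power of \<Delta> kills \<open>x * a\<close>, so \<open>x\<close> is in
    \<open>colon I (\<Delta> ^ k * a)\<close>, which again equals \<open>colon I a\<close> by
    maximality.\<close>
  proof (cases "x * a \<in> A")
    case True
    have "y \<in> colon I (x * a)" using xy by (simp add: colon_def mult_ac)
    then show ?thesis using a(2)[OF True sub] by blast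
  next
    case False
    then obtain k where k: "\<Delta> ^ k * (x * a) \<in> I" by (auto simp: A_def)
    have "\<Delta> ^ j * (\<Delta> ^ k * a) \<notin> I" for j
      using aA[of "j + k"] by (simp add: power_add mult.assoc)
    then have "\<Delta> ^ k * a \<in> A" by (simp add: A_def)
    then have "colon I (\<Delta> ^ k * a) = colon I a" using a(2) sub by blast
    moreover have "x \<in> colon I (\<Delta> ^ k * a)" using k by (simp add: colon_def mult_ac)
    ultimately show ?thesis by blast
  qed
  moreover have "1 \<notin> colon I a" using aA[of 0] by (simp add: colon_def)
  ultimately have "prime_in UNIV (colon I a)" using ideal_in_colon[OF I] unfolding prime_in_def by blast
  then show thesis using that aA by blast
qed


section \<open>The Koszul complex of a regular sequence\<close>

text \<open>The sign of moving the index \<open>a\<close> to the front of the ordered set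
  \<open>S\<close> in an exterior product. With it \<open>kd\<close> is the wedge product with the
  sum of the vectors x_a e_a.\<close>

definition ksign :: "nat set \<Rightarrow> nat \<Rightarrow> 'a::comm_ring_1" where
  "ksign S a = (- 1) ^ card {b\<in>S. b < a}"

text \<open>A cochain of degree \<open>i\<close> is given by its values on the index sets of size \<open>i\<close>.\<close>

definition kd :: "(nat \<Rightarrow> 'a::comm_ring_1) \<Rightarrow> (nat set \<Rightarrow> 'a) \<Rightarrow> nat set \<Rightarrow> 'a" where
  "kd x c S = (\<Sum>a\<in>S. ksign S a * x a * c (S - {a}))"

lemma ksign_singleton: "ksign {i} i = 1"
proof -
  have "{b\<in>{i}. b < i} = {}" by auto
  then show ?thesis unfolding ksign_def by (simp only: card.empty power_0)
qed

lemma ksign_square: "ksign S a * ksign S a = 1"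
  by (simp add: ksign_def power_add[symmetric])

lemma ksign_remove_greater: "a \<le> b \<Longrightarrow> ksign (S - {b}) a = ksign S a"
proof -
  assume "a \<le> b"
  then have "{x\<in>S - {b}. x < a} = {x\<in>S. x < a}" by auto
  then show ?thesis by (simp add: ksign_def)
qed

lemma ksign_remove_smaller: "finite S \<Longrightarrow> b \<in> S \<Longrightarrow> b < a \<Longrightarrow> ksign (S - {b}) a = - ksign S a"
proof -
  assume *: "finite S" "b \<in> S" "b < a"
  have "{x\<in>S. x < a} = insert b {x\<in>S - {b}. x < a}" using * by auto
  then have "card {x\<in>S. x < a} = Suc (card {x\<in>S - {b}. x < a})" using * by simp
  then show ?thesis by (simp add: ksign_def)
qed

text \<open>The two orders of removing a pair of indices cancel: removing the smaller index first
  flips the sign of the larger one, while removing the larger first leaves the sign of the smaller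
  one.\<close>

lemma kd_kd:
  assumes S: "finite S" shows "kd x (kd x c) S = 0"
proof -
  define t where "t a b = ksign S a * x a * (ksign (S - {a}) b * x b * c (S - {a} - {b}))" for a b
  have anti: "t a b + t b a = 0" if "a \<in> S" "b \<in> S" "b < a" for a b
  proof -
    have "ksign (S - {a}) b = (ksign S b :: 'a)" "ksign (S - {b}) a = - (ksign S a :: 'a)"
      using that S by (auto simp: ksign_remove_greater ksign_remove_smaller)
    moreover have "S - {a} - {b} = S - {b} - {a}" by blast
    ultimately show ?thesis by (simp add: t_def mult_ac)
  qed
  let ?L = "{(a, b). a \<in> S \<and> b \<in> S \<and> b < a}"
  let ?U = "{(a, b). a \<in> S \<and> b \<in> S \<and> a < b}"
  have fin: "finite ?L" "finite ?U"
    by (rule finite_subset[of _ "S \<times> S"]; use S in auto)+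
  have "kd x (kd x c) S = (\<Sum>a\<in>S. \<Sum>b\<in>S - {a}. t a b)"
    by (simp add: kd_def t_def sum_distrib_left)
  also have "\<dots> = (\<Sum>(a, b)\<in>Sigma S (\<lambda>a. S - {a}). t a b)"
    using S by (subst sum.Sigma) auto
  also have "Sigma S (\<lambda>a. S - {a}) = ?L \<union> ?U" by auto
  also have "(\<Sum>(a, b)\<in>?L \<union> ?U. t a b) = (\<Sum>(a, b)\<in>?L. t a b) + (\<Sum>(a, b)\<in>?U. t a b)"
    by (rule sum.union_disjoint) (use fin in auto)
  also have "(\<Sum>(a, b)\<in>?U. t a b) = (\<Sum>(a, b)\<in>?L. t b a)"
    by (rule sum.reindex_bij_witness[of _ "\<lambda>(a, b). (b, a)" "\<lambda>(a, b). (b, a)"]) auto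
  also have "(\<Sum>(a, b)\<in>?L. t a b) + (\<Sum>(a, b)\<in>?L. t b a) = (\<Sum>(a, b)\<in>?L. t a b + t b a)"
    by (simp add: sum.distrib case_prod_unfold)
  also have "\<dots> = 0" by (rule sum.neutral) (auto simp: anti)
  finally show ?thesis .
qed

lemma kd_add: "kd x (\<lambda>S. c S + e S) S = kd x c S + kd x e S"
  by (simp add: kd_def distrib_left sum.distrib)

lemma kd_diff: "kd x (\<lambda>S. c S - e S) S = kd x c S - kd x e S"
  by (simp add: kd_def right_diff_distrib sum_subtractf)

lemma kd_cmult: "kd x (\<lambda>S. u * c S) S = u * kd x c S"
  by (simp add: kd_def sum_distrib_left mult_ac)

lemma kd_sum: "kd x (\<lambda>S. \<Sum>i\<in>A. c i S) S = (\<Sum>i\<in>A. kd x (c i) S)"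
  unfolding kd_def by (subst sum.swap) (simp add: sum_distrib_left)

lemma kd_cong: "(\<And>a. a \<in> S \<Longrightarrow> c (S - {a}) = e (S - {a})) \<Longrightarrow> kd x c S = kd x e S"
  unfolding kd_def by (intro sum.cong) auto

text \<open>This exhibits the Koszul complex as the cone of multiplication by \<open>x m\<close> on
  the complex of the earlier elements. As \<open>m\<close> is the largest index, its presence does
  not change the other signs.\<close>

lemma kd_insert_top:
  fixes x :: "nat \<Rightarrow> 'a::comm_ring_1"
  assumes T: "T \<subseteq> {..<m}"
  shows "kd x c (insert m T) = kd x (\<lambda>T. c (insert m T)) T + ksign (insert m T) m * x m * c T"
proof -
  have finT: "finite T" and mT: "m \<notin> T" using T finite_subset by auto
  have "kd x c (insert m T) = ksign (insert m T) m * x m * c (insert m T - {m}) +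
    (\<Sum>a\<in>T. ksign (insert m T) a * x a * c (insert m T - {a}))"
    using finT mT by (simp add: kd_def)
  also have "(\<Sum>a\<in>T. ksign (insert m T) a * x a * c (insert m T - {a})) = kd x (\<lambda>T. c (insert m T)) T"
    unfolding kd_def
  proof (intro sum.cong refl)
    fix a assume a: "a \<in> T"
    have 1: "insert m T - {m} = T" and 2: "insert m T - {a} = insert m (T - {a})" using mT a by auto
    have "ksign (insert m T - {m}) a = (ksign (insert m T) a :: 'a)"
      by (rule ksign_remove_greater) (use a T in auto)
    then have "ksign (insert m T) a = (ksign T a :: 'a)" unfolding 1 by (rule sym)
    then show "ksign (insert m T) a * x a * c (insert m T - {a}) = ksign T a * x a * c (insert m (T - {a}))"
      unfolding 2 by (simp only:)
  qed
  also have "insert m T - {m} = T" using mT by auto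
  finally show ?thesis by (simp only: add.commute)
qed

text \<open>Induction on the length. The restriction to sets without the last index is a cocycle of
  the shorter sequence, hence a coboundary; in the new top degree regularity of the last element
  replaces the induction hypothesis. After subtraction the cochain lives on sets containing the last
  index, where it is a cocycle of one degree less for the shorter sequence.\<close>

lemma Koszul_acyclic:
  fixes x :: "nat \<Rightarrow> 'a::comm_ring_1"
  assumes reg: "\<And>k a. k < m \<Longrightarrow> a * x k \<in> gidl (x ` {..<k}) \<Longrightarrow> a \<in> gidl (x ` {..<k})"
    and c: "\<And>S. S \<subseteq> {..<m} \<Longrightarrow> card S = Suc i \<Longrightarrow> kd x c S = 0" and i: "i < m"
  shows "\<exists>e. \<forall>S\<subseteq>{..<m}. card S = i \<longrightarrow> c S = kd x e S"
  using reg c i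
proof (induction m arbitrary: i c)
  case (Suc m)
  have reg': "\<And>k a. k < m \<Longrightarrow> a * x k \<in> gidl (x ` {..<k}) \<Longrightarrow> a \<in> gidl (x ` {..<k})"
    using Suc.prems(1) by simp
  have "\<exists>e1. \<forall>S\<subseteq>{..<m}. card S = i \<longrightarrow> c S = kd x e1 S"
  proof (cases "i < m")
    case True
    show ?thesis
      by (rule Suc.IH[OF reg' _ True]) (auto intro: Suc.prems(2) simp: subset_iff less_Suc_eq)
  next
    case False
    then have im: "i = m" using Suc.prems(3) by simp
    let ?t = "ksign (insert m {..<m}) m :: 'a"
    have "kd x c (insert m {..<m}) = 0" by (rule Suc.prems(2)) (auto simp: im)
    then have "kd x (\<lambda>T. c (insert m T)) {..<m} + ?t * x m * c {..<m} = 0"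
      by (simp only: kd_insert_top[OF subset_refl])
    then have "?t * (x m * c {..<m}) = - kd x (\<lambda>T. c (insert m T)) {..<m}"
      by (simp add: eq_neg_iff_add_eq_0 add.commute mult.assoc)
    then have "?t * (?t * (x m * c {..<m})) = ?t * - kd x (\<lambda>T. c (insert m T)) {..<m}" by (rule arg_cong)
    moreover have "?t * (?t * (x m * c {..<m})) = (?t * ?t) * (c {..<m} * x m)" by (simp only: mult_ac)
    ultimately have "c {..<m} * x m = ?t * - kd x (\<lambda>T. c (insert m T)) {..<m}"
      unfolding ksign_square by simp
    also have "\<dots> \<in> gidl (x ` {..<m})"
    proof (rule gidl_mult, rule gidl_uminus)
      show "kd x (\<lambda>T. c (insert m T)) {..<m} \<in> gidl (x ` {..<m})"
        unfolding kd_def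
      proof (rule gidl_sum)
        fix a assume "a \<in> {..<m}"
        then show "ksign {..<m} a * x a * c (insert m ({..<m} - {a})) \<in> gidl (x ` {..<m})"
          using gidl_mult_gen[of "x a" "x ` {..<m}" "ksign {..<m} a * c (insert m ({..<m} - {a}))"]
          by (simp add: mult_ac)
      qed
    qed
    finally have "c {..<m} \<in> gidl (x ` {..<m})" by (rule Suc.prems(1)[OF lessI])
    then obtain y where y: "c {..<m} = (\<Sum>a<m. y a * x a)" using gidl_image_sum by blast
    \<comment> \<open>The cochain with value y_a, up to sign, on the set that omits
      \<open>a\<close>. Its coboundary repeats the same sign, whose square is 1.\<close>
    define e1 where "e1 T = (\<Sum>a<m. if T = {..<m} - {a} then ksign {..<m} a * y a else 0)" for T
    have "e1 ({..<m} - {a}) = ksign {..<m} a * y a" if a: "a < m" for a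
    proof -
      have "e1 ({..<m} - {a}) = (\<Sum>b<m. if b = a then ksign {..<m} b * y b else 0)"
        unfolding e1_def by (intro sum.cong refl) (use a in auto)
      then show ?thesis using a by (simp add: sum.delta)
    qed
    then have "kd x e1 {..<m} = (\<Sum>a<m. ksign {..<m} a * x a * (ksign {..<m} a * y a))"
      unfolding kd_def by (intro sum.cong) auto
    also have "\<dots> = (\<Sum>a<m. y a * x a)"
    proof (intro sum.cong refl)
      fix a
      have "ksign {..<m} a * x a * (ksign {..<m} a * y a) = (ksign {..<m} a * ksign {..<m} a) * (y a * x a)"
        by (simp only: mult_ac)
      then show "ksign {..<m} a * x a * (ksign {..<m} a * y a) = y a * x a" by (simp add: ksign_square)
    qed
    finally have "c {..<m} = kd x e1 {..<m}" using y by simp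
    moreover have "S = {..<m}" if "S \<subseteq> {..<m}" "card S = i" for S
      using card_subset_eq[of "{..<m}" S] that im by simp
    ultimately show ?thesis by blast
  qed
  then obtain e1 where e1: "\<And>S. S \<subseteq> {..<m} \<Longrightarrow> card S = i \<Longrightarrow> c S = kd x e1 S" by blast
  \<comment> \<open>The difference is still a cocycle, and it vanishes on all sets of size
    \<open>i\<close> not containing \<open>m\<close>.\<close>
  define c1 where "c1 S = c S - kd x e1 S" for S
  have c1z: "c1 S = 0" if "S \<subseteq> {..<m}" "card S = i" for S using e1[OF that] by (simp add: c1_def)
  have c1c: "kd x c1 S = 0" if S: "S \<subseteq> {..<Suc m}" "card S = Suc i" for S
    using Suc.prems(2)[OF S] kd_kd[of S x e1] S finite_subset[OF S(1)] unfolding c1_def kd_diff by simp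
  show ?case
  proof (cases i)
    case 0
    have "S = {}" if "S \<subseteq> {..<Suc m}" "card S = i" for S
      using that 0 finite_subset[OF that(1)] by auto
    then have "c S = kd x e1 S" if "S \<subseteq> {..<Suc m}" "card S = i" for S
      using e1[of "{}"] that 0 by auto
    then show ?thesis by blast
  next
    case (Suc i')
    have "\<exists>e2. \<forall>T\<subseteq>{..<m}. card T = i' \<longrightarrow> c1 (insert m T) = kd x e2 T"
    proof (rule Suc.IH[OF reg'])
      fix T assume T: "T \<subseteq> {..<m}" "card T = Suc i'"
      have finT: "finite T" "m \<notin> T" using T(1) finite_subset by auto
      have "kd x c1 (insert m T) = 0"
        by (rule c1c) (use T finT Suc in auto)
      then show "kd x (\<lambda>T. c1 (insert m T)) T = 0"
        unfolding kd_insert_top[OF T(1)] using c1z[OF T(1)] T(2) Suc by simp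
    next
      show "i' < m" using Suc.prems(3) Suc by simp
    qed
    then obtain e2 where e2: "\<And>T. T \<subseteq> {..<m} \<Longrightarrow> card T = i' \<Longrightarrow> c1 (insert m T) = kd x e2 T" by blast
    define e3 where "e3 S = (if m \<in> S then e2 (S - {m}) else 0)" for S
    have "c S = kd x (\<lambda>S. e1 S + e3 S) S" if S: "S \<subseteq> {..<Suc m}" "card S = i" for S
    proof (cases "m \<in> S")
      case False
      then have "S \<subseteq> {..<m}" using S(1) by (auto simp: less_Suc_eq)
      moreover have "kd x e3 S = 0" unfolding kd_def e3_def using False by simp
      ultimately show ?thesis using e1 S(2) by (simp add: kd_add)
    next
      case True
      define T where "T = S - {m}"
      have T: "T \<subseteq> {..<m}" "S = insert m T" "m \<notin> T" using True S(1) by (auto simp: T_def less_Suc_eq)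
      have "finite T" using T(1) finite_subset by blast
      then have cT: "card T = i'" using S(2) T(2,3) Suc by simp
      have "kd x e3 S = kd x (\<lambda>T. e3 (insert m T)) T + ksign (insert m T) m * x m * e3 T"
        unfolding T(2) by (rule kd_insert_top[OF T(1)])
      also have "e3 T = 0" using T(3) by (simp add: e3_def)
      also have "kd x (\<lambda>T. e3 (insert m T)) T = kd x e2 T"
        by (rule kd_cong) (use T(3) in \<open>simp add: e3_def\<close>)
      finally have "kd x e3 S = c1 S" using e2[OF T(1) cT] T(2) by simp
      then show ?thesis by (simp add: kd_add c1_def)
    qed
    then show ?thesis by blast
  qed
qed simp


section \<open>Minors\<close>

definition minor :: "(nat \<Rightarrow> nat \<Rightarrow> 'a::comm_ring_1) \<Rightarrow> nat \<Rightarrow> (nat \<Rightarrow> nat) \<Rightarrow> (nat \<Rightarrow> nat) \<Rightarrow> 'a" where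
  "minor A q \<alpha> \<beta> = Determinant.det (mat q q (\<lambda>(i, j). A (\<alpha> i) (\<beta> j)))"

text \<open>The coefficients come from the expansion of the bordered minor along its last column, so they do
  not depend on that column.\<close>

lemma bordered_minor:
  assumes "\<And>l. l \<in> L \<Longrightarrow> minor A (Suc q) (\<alpha>(q := i)) (\<beta>(q := l)) = 0"
  shows "\<exists>\<kappa>. \<forall>l\<in>L. minor A q \<alpha> \<beta> * A i l = (\<Sum>t<q. \<kappa> t * A (\<alpha> t) l)"
proof -
  let ?B = "\<lambda>l. mat (Suc q) (Suc q) (\<lambda>(a, b). A ((\<alpha>(q := i)) a) ((\<beta>(q := l)) b))"
  define K where "K t = mat q q (\<lambda>(a, b). A ((\<alpha>(q := i)) (if a < t then a else Suc a)) (\<beta> b))" for t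
  have del: "mat_delete (?B l) t q = K t" if "t \<le> q" for t l
    unfolding mat_delete_def K_def by (rule eq_matI) (use that in auto)
  have Kq: "Determinant.det (K q) = minor A q \<alpha> \<beta>"
    unfolding K_def minor_def by (rule arg_cong[where f = Determinant.det], rule eq_matI) auto
  have "minor A q \<alpha> \<beta> * A i l = (\<Sum>t<q. - ((- 1) ^ (t + q) * Determinant.det (K t)) * A (\<alpha> t) l)" if "l \<in> L" for l
  proof -
    have "0 = Determinant.det (?B l)" using assms[OF that] by (simp add: minor_def)
    also have "\<dots> = (\<Sum>t<Suc q. ?B l $$ (t, q) * cofactor (?B l) t q)"
      by (rule laplace_expansion_column) auto
    also have "\<dots> = (\<Sum>t<Suc q. ?B l $$ (t, q) * ((- 1) ^ (t + q) * Determinant.det (K t)))"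
    proof (intro sum.cong refl)
      fix t assume "t \<in> {..<Suc q}"
      then have "cofactor (?B l) t q = (- 1) ^ (t + q) * Determinant.det (K t)"
        unfolding cofactor_def by (subst del) auto
      then show "?B l $$ (t, q) * cofactor (?B l) t q = ?B l $$ (t, q) * ((- 1) ^ (t + q) * Determinant.det (K t))"
        by (simp only:)
    qed
    also have "\<dots> = (\<Sum>t<q. A (\<alpha> t) l * ((- 1) ^ (t + q) * Determinant.det (K t))) + A i l * minor A q \<alpha> \<beta>"
      by (simp add: Kq)
    finally have "A i l * minor A q \<alpha> \<beta> = - (\<Sum>t<q. A (\<alpha> t) l * ((- 1) ^ (t + q) * Determinant.det (K t)))"
      by (metis add_eq_0_iff)
    also have "\<dots> = (\<Sum>t<q. - ((- 1) ^ (t + q) * Determinant.det (K t)) * A (\<alpha> t) l)"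
      unfolding sum_negf[symmetric] by (intro sum.cong refl) (simp add: mult_ac)
    finally show ?thesis by (simp only: mult.commute)
  qed
  then show ?thesis by (intro exI[of _ "\<lambda>t. - ((- 1) ^ (t + q) * Determinant.det (K t))"] ballI)
qed

text \<open>Cramer's rule on the selected square submatrix, with the solution placed in the columns
  \<beta> and zero elsewhere. The sum in \<open>w\<close> adds the contributions of repeated
  columns.\<close>

lemma minor_solution:
  assumes \<alpha>: "\<And>i. i < q \<Longrightarrow> \<beta> i < n"
  shows "\<exists>w. \<forall>i<q. minor A q \<alpha> \<beta> * v (\<alpha> i) = (\<Sum>l<n. A (\<alpha> i) l * w l)"
proof -
  let ?M = "mat q q (\<lambda>(i, j). A (\<alpha> i) (\<beta> j))"
  define u where "u k = (\<Sum>j<q. adj_mat ?M $$ (k, j) * v (\<alpha> j))" for k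
  define w where "w l = (\<Sum>j<q. if \<beta> j = l then u j else 0)" for l
  have "minor A q \<alpha> \<beta> * v (\<alpha> i) = (\<Sum>l<n. A (\<alpha> i) l * w l)" if i: "i < q" for i
  proof -
    have "(\<Sum>l<n. A (\<alpha> i) l * w l) = (\<Sum>l<n. \<Sum>j<q. if l = \<beta> j then A (\<alpha> i) l * u j else 0)"
      unfolding w_def sum_distrib_left by (intro sum.cong refl) auto
    also have "\<dots> = (\<Sum>j<q. \<Sum>l<n. if l = \<beta> j then A (\<alpha> i) l * u j else 0)" by (rule sum.swap)
    also have "\<dots> = (\<Sum>j<q. A (\<alpha> i) (\<beta> j) * u j)"
      by (intro sum.cong refl) (use \<alpha> in \<open>simp add: sum.delta\<close>)
    also have "\<dots> = (\<Sum>j<q. ?M $$ (i, j) * u j)" using i by (intro sum.cong) auto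
    also have "\<dots> = Determinant.det ?M * v (\<alpha> i)"
      unfolding u_def by (rule adj_mat_solution[of ?M q i "\<lambda>j. v (\<alpha> j)"]) (use i in auto)
    finally show ?thesis by (simp add: minor_def)
  qed
  then show ?thesis by blast
qed


section \<open>Free resolutions and regular sequences\<close>

text \<open>The algebra of the resolution in coordinates: \<open>A k\<close> is the matrix of the
  k-th map. Rank 0 after the end makes \<open>exact\<close> for \<open>k = N\<close> express
  injectivity of the last map, without a separate case.\<close>

locale resolution =
  fixes N :: nat and r :: "nat \<Rightarrow> nat" and A :: "nat \<Rightarrow> nat \<Rightarrow> nat \<Rightarrow> 'a::idom"
  assumes rank_end: "r (Suc N) = 0"
    and complex: "\<And>k w i. k \<in> {1..N} \<Longrightarrow> i < r (k - 1) \<Longrightarrow>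
      (\<Sum>j<r k. A k i j * (\<Sum>l<r (Suc k). A (Suc k) j l * w l)) = 0"
    and exact: "\<And>k v. k \<in> {1..N} \<Longrightarrow> (\<And>i. i < r (k - 1) \<Longrightarrow> (\<Sum>j<r k. A k i j * v j) = 0) \<Longrightarrow>
      \<exists>w. \<forall>j<r k. v j = (\<Sum>l<r (Suc k). A (Suc k) j l * w l)"
begin

definition mv :: "nat \<Rightarrow> (nat \<Rightarrow> 'a) \<Rightarrow> nat \<Rightarrow> 'a" where
  "mv k v i = (\<Sum>j<r k. A k i j * v j)"

text \<open>That is, \<open>v\<close> represents 0 in the cokernel of the (k+1)-st map. For
  \<open>k = 0\<close> this cokernel is the resolved quotient ring.\<close>

definition in_im :: "nat \<Rightarrow> (nat \<Rightarrow> 'a) \<Rightarrow> bool" where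
  "in_im k v \<longleftrightarrow> (\<exists>w. \<forall>i<r k. v i = mv (Suc k) w i)"

lemma mv_cong: "(\<And>j. j < r k \<Longrightarrow> v j = w j) \<Longrightarrow> mv k v i = mv k w i"
  by (simp add: mv_def)

lemma mv_add: "mv k (\<lambda>j. v j + w j) i = mv k v i + mv k w i"
  by (simp add: mv_def distrib_left sum.distrib)

lemma mv_diff: "mv k (\<lambda>j. v j - w j) i = mv k v i - mv k w i"
  by (simp add: mv_def right_diff_distrib sum_subtractf)

lemma mv_cmult: "mv k (\<lambda>j. u * v j) i = u * mv k v i"
  by (simp add: mv_def sum_distrib_left mult_ac)

lemma kd_mv: "kd x (\<lambda>S. mv k (b S) i) S = mv k (\<lambda>j. kd x (\<lambda>S. b S j) S) i"
  unfolding mv_def kd_sum by (simp add: kd_cmult)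

lemma mv_mv: "k \<in> {1..N} \<Longrightarrow> i < r (k - 1) \<Longrightarrow> mv k (mv (Suc k) w) i = 0"
  using complex unfolding mv_def by blast

lemma in_im_iff_kernel:
  assumes "k \<in> {1..N}"
  shows "in_im k v \<longleftrightarrow> (\<forall>i<r (k - 1). mv k v i = 0)"
proof
  assume "in_im k v"
  then obtain w where w: "\<forall>i<r k. v i = mv (Suc k) w i" by (auto simp: in_im_def)
  then have "mv k v i = mv k (mv (Suc k) w) i" for i by (intro mv_cong) auto
  then show "\<forall>i<r (k - 1). mv k v i = 0" using mv_mv[OF assms] by simp
next
  assume "\<forall>i<r (k - 1). mv k v i = 0"
  then show "in_im k v" using exact[OF assms, of v] unfolding in_im_def mv_def by blast
qed

lemma in_im_add:
  assumes "in_im k v" "in_im k w" shows "in_im k (\<lambda>i. v i + w i)"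
proof -
  obtain a b where "\<forall>i<r k. v i = mv (Suc k) a i" "\<forall>i<r k. w i = mv (Suc k) b i"
    using assms unfolding in_im_def by blast
  then have "\<forall>i<r k. v i + w i = mv (Suc k) (\<lambda>j. a j + b j) i" by (simp add: mv_add)
  then show ?thesis unfolding in_im_def by blast
qed

lemma in_im_cmult: "in_im k v \<Longrightarrow> in_im k (\<lambda>i. u * v i)"
  unfolding in_im_def by (elim exE, rule_tac x = "\<lambda>j. u * w j" in exI) (simp add: mv_cmult)

lemma in_im_zero: "in_im k (\<lambda>i. 0)"
  unfolding in_im_def by (rule exI[of _ "\<lambda>_. 0"]) (simp add: mv_def)

text \<open>\<open>split_at k \<Delta>\<close>: after inverting \<open>\<Delta>\<close>, the image of the \<open>(k+1)\<close>-st map is a direct summand, complemented by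
  the coordinates outside \<open>B\<close>.\<close>

definition split_at :: "nat \<Rightarrow> 'a \<Rightarrow> bool" where
  "split_at k \<Delta> \<longleftrightarrow> (\<exists>B\<subseteq>{..<r k}. (\<forall>v. \<exists>w. \<forall>i\<in>B. \<Delta> * v i = mv (Suc k) w i) \<and>
     (\<forall>w. (\<forall>i\<in>B. mv (Suc k) w i = 0) \<longrightarrow> (\<forall>i<r k. \<Delta> * mv (Suc k) w i = 0)))"

lemma split_at_end: "split_at N 1"
  unfolding split_at_def by (rule exI[of _ "{}"]) (simp add: mv_def rank_end)

text \<open>The rows \<alpha> serve as \<open>B\<close>. Cramer's rule prescribes the entries in
  these rows up to the minor as a factor, and the vanishing of all larger minors makes the minor
  times any other row a combination of them.\<close>

lemma split_at_minor:
  assumes \<alpha>: "\<And>i. i < q \<Longrightarrow> \<alpha> i < r k" and \<beta>: "\<And>i. i < q \<Longrightarrow> \<beta> i < r (Suc k)"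
    and zero: "\<And>\<alpha> \<beta>. (\<And>i. i < Suc q \<Longrightarrow> \<alpha> i < r k) \<Longrightarrow> (\<And>i. i < Suc q \<Longrightarrow> \<beta> i < r (Suc k)) \<Longrightarrow>
      minor (A (Suc k)) (Suc q) \<alpha> \<beta> = 0"
  shows "split_at k (minor (A (Suc k)) q \<alpha> \<beta>)"
  unfolding split_at_def
proof (intro exI[of _ "\<alpha> ` {..<q}"] conjI allI impI)
  show "\<alpha> ` {..<q} \<subseteq> {..<r k}" using \<alpha> by auto
  fix v
  show "\<exists>w. \<forall>i\<in>\<alpha> ` {..<q}. minor (A (Suc k)) q \<alpha> \<beta> * v i = mv (Suc k) w i"
    using minor_solution[of q \<beta> "r (Suc k)" "A (Suc k)" \<alpha> v] \<beta> by (auto simp: mv_def)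
next
  fix w i assume w: "\<forall>i\<in>\<alpha> ` {..<q}. mv (Suc k) w i = 0" and i: "i < r k"
  have "minor (A (Suc k)) (Suc q) (\<alpha>(q := i)) (\<beta>(q := l)) = 0" if "l \<in> {..<r (Suc k)}" for l
    by (rule zero) (use \<alpha> \<beta> i that in \<open>auto simp: less_Suc_eq\<close>)
  then obtain \<kappa> where \<kappa>: "\<And>l. l \<in> {..<r (Suc k)} \<Longrightarrow>
    minor (A (Suc k)) q \<alpha> \<beta> * A (Suc k) i l = (\<Sum>t<q. \<kappa> t * A (Suc k) (\<alpha> t) l)"
    using bordered_minor[of "{..<r (Suc k)}" "A (Suc k)" q \<alpha> i \<beta>] by metis
  have "minor (A (Suc k)) q \<alpha> \<beta> * mv (Suc k) w i = (\<Sum>l<r (Suc k). (\<Sum>t<q. \<kappa> t * A (Suc k) (\<alpha> t) l) * w l)"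
    unfolding mv_def sum_distrib_left
    by (intro sum.cong refl) (simp add: \<kappa>[symmetric] mult.assoc)
  also have "\<dots> = (\<Sum>t<q. \<kappa> t * mv (Suc k) w (\<alpha> t))"
    unfolding mv_def sum_distrib_left sum_distrib_right by (subst sum.swap) (simp add: mult.assoc)
  also have "\<dots> = 0" using w by simp
  finally show "minor (A (Suc k)) q \<alpha> \<beta> * mv (Suc k) w i = 0" .
qed

text \<open>Dimension shifting. A Koszul cocycle of degree \<open>i\<close> in the cokernel at
  \<open>j\<close> lifts to the free module, where its coboundary comes from a cochain at
  \<open>j + 1\<close>; by exactness this is a cocycle of degree \<open>i + 1\<close> in the next
  cokernel. At \<open>j = k\<close> the cokernel is free up to \<Delta>, and
  \<open>i + (k - j) < m\<close> keeps the degree below \<open>m\<close> all the way.\<close>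

lemma Koszul_cokernel_torsion:
  fixes x :: "nat \<Rightarrow> 'a"
  assumes reg: "\<And>k a. k < m \<Longrightarrow> a * x k \<in> gidl (x ` {..<k}) \<Longrightarrow> a \<in> gidl (x ` {..<k})"
    and split: "split_at k \<Delta>" and k: "k \<le> N" and j: "j \<le> k" and i: "i + (k - j) < m"
    and c: "\<And>S. S \<subseteq> {..<m} \<Longrightarrow> card S = Suc i \<Longrightarrow> in_im j (\<lambda>l. kd x (\<lambda>S. c S l) S)"
  shows "\<exists>s e. \<forall>S\<subseteq>{..<m}. card S = i \<longrightarrow> in_im j (\<lambda>l. \<Delta> ^ s * c S l - kd x (\<lambda>S. e S l) S)"
  using j i c
proof (induction "k - j" arbitrary: j i c)
  case 0
  then have jk: "j = k" by simp
  show ?case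
  \<comment> \<open>The zero case has to be covered: later \<Delta> is a minor whose size is the
    maximal rank over all of \<open>X\<close>, which need not be connected, so the minor may vanish
    near the given point. A nonzero \<Delta> can be cancelled.\<close>
  proof (cases "\<Delta> = 0")
    case True
    show ?thesis
      by (intro exI[of _ 1] exI[of _ "\<lambda>_ _. 0"]) (simp add: True in_im_zero kd_def)
  next
    case False
    obtain B where B: "B \<subseteq> {..<r k}" "\<And>v. \<exists>w. \<forall>i\<in>B. \<Delta> * v i = mv (Suc k) w i"
      "\<And>w. (\<forall>i\<in>B. mv (Suc k) w i = 0) \<Longrightarrow> (\<forall>i<r k. \<Delta> * mv (Suc k) w i = 0)"
      using split unfolding split_at_def by metis
    have "\<exists>W. \<forall>S. \<forall>i\<in>B. \<Delta> * c S i = mv (Suc k) (W S) i" using B(2)[of "c _"] by metis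
    then obtain W where W: "\<And>S i. i \<in> B \<Longrightarrow> \<Delta> * c S i = mv (Suc k) (W S) i" by blast
    \<comment> \<open>Subtracting an element of the image makes the entries in \<open>B\<close>
      zero. The coboundary of \<open>c'\<close> lies in the image and vanishes on \<open>B\<close>,
      hence is zero by the second property in \<open>split_at\<close>.\<close>
    define c' where "c' S l = \<Delta> * c S l - mv (Suc k) (W S) l" for S l
    have c'B: "c' S l = 0" if "l \<in> B" for S l using W[OF that] by (simp add: c'_def)
    have cyc: "kd x (\<lambda>S. c' S l) S = 0" if S: "S \<subseteq> {..<m}" "card S = Suc i" and l: "l < r k" for S l
    proof -
      obtain b where b: "\<And>l. l < r k \<Longrightarrow> kd x (\<lambda>S. c S l) S = mv (Suc k) b l"
        using "0.prems"(3)[OF S] unfolding in_im_def jk by blast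
      let ?w = "\<lambda>j. \<Delta> * b j - kd x (\<lambda>S. W S j) S"
      have eq: "kd x (\<lambda>S. c' S l) S = mv (Suc k) ?w l" if "l < r k" for l
        unfolding c'_def kd_diff kd_cmult kd_mv b[OF that] mv_diff mv_cmult ..
      have "mv (Suc k) ?w l = 0" if "l \<in> B" for l
        using eq[of l] B(1) that c'B[OF that] by (auto simp: kd_def)
      then have "\<Delta> * mv (Suc k) ?w l = 0" using B(3)[of ?w] l by blast
      then show ?thesis using False eq[OF l] by simp
    qed
    have im: "i < m" using 0 by simp
    have "\<exists>e. \<forall>S\<subseteq>{..<m}. card S = i \<longrightarrow> c' S l = kd x e S" if "l < r k" for l
      by (rule Koszul_acyclic[OF reg cyc im]) (use that in auto)
    then obtain e where e: "\<And>l S. l < r k \<Longrightarrow> S \<subseteq> {..<m} \<Longrightarrow> card S = i \<Longrightarrow> c' S l = kd x (e l) S" by metis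
    have "in_im j (\<lambda>l. \<Delta> ^ 1 * c S l - kd x (\<lambda>S. e l S) S)" if "S \<subseteq> {..<m}" "card S = i" for S
      unfolding in_im_def jk
      by (rule exI[of _ "W S"]) (use e[OF _ that] in \<open>auto simp: c'_def algebra_simps\<close>)
    then show ?thesis by (intro exI[of _ 1] exI[of _ "\<lambda>S l. e l S"]) blast
  qed
next
  case (Suc n)
  have jk: "j < k" "n = k - Suc j" using Suc.hyps(2) by auto
  have jN: "Suc j \<in> {1..N}" using jk k by simp
  have "\<forall>S. \<exists>b. S \<subseteq> {..<m} \<and> card S = Suc i \<longrightarrow> (\<forall>l<r j. kd x (\<lambda>S. c S l) S = mv (Suc j) b l)"
    using Suc.prems(3) unfolding in_im_def by blast
  then obtain b where b: "\<And>S l. S \<subseteq> {..<m} \<Longrightarrow> card S = Suc i \<Longrightarrow> l < r j \<Longrightarrow>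
    kd x (\<lambda>S. c S l) S = mv (Suc j) (b S) l" by metis
  \<comment> \<open>The map sends the coboundary of \<open>b\<close> to the twofold coboundary of
    \<open>c\<close>, which is 0; exactness turns the kernel into the image of the next map.\<close>
  have "in_im (Suc j) (\<lambda>l. kd x (\<lambda>S. b S l) S)" if S: "S \<subseteq> {..<m}" "card S = Suc (Suc i)" for S
    unfolding in_im_iff_kernel[OF jN]
  proof (intro allI impI)
    fix l assume "l < r (Suc j - 1)"
    then have l: "l < r j" by simp
    have finS: "finite S" using S(1) finite_subset by blast
    have "mv (Suc j) (\<lambda>l. kd x (\<lambda>S. b S l) S) l = kd x (\<lambda>S. mv (Suc j) (b S) l) S" by (simp only: kd_mv)
    also have "\<dots> = kd x (\<lambda>S. kd x (\<lambda>S. c S l) S) S"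
    proof (rule kd_cong)
      fix a assume a: "a \<in> S"
      have "S - {a} \<subseteq> {..<m}" "card (S - {a}) = Suc i" using S a finS by auto
      then show "mv (Suc j) (b (S - {a})) l = kd x (\<lambda>S. c S l) (S - {a})" using b l by simp
    qed
    also have "\<dots> = 0" by (rule kd_kd[OF finS])
    finally show "mv (Suc j) (\<lambda>l. kd x (\<lambda>S. b S l) S) l = 0" .
  qed
  then have "\<exists>s e. \<forall>S\<subseteq>{..<m}. card S = Suc i \<longrightarrow> in_im (Suc j) (\<lambda>l. \<Delta> ^ s * b S l - kd x (\<lambda>S. e S l) S)"
    by (intro Suc.hyps(1)[OF jk(2)]) (use jk Suc.prems(2) in auto)
  then obtain s e where se: "\<And>S. S \<subseteq> {..<m} \<Longrightarrow> card S = Suc i \<Longrightarrow>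
    in_im (Suc j) (\<lambda>l. \<Delta> ^ s * b S l - kd x (\<lambda>S. e S l) S)" by blast
  define c' where "c' S l = \<Delta> ^ s * c S l - mv (Suc j) (e S) l" for S l
  have cyc: "kd x (\<lambda>S. c' S l) S = 0" if S: "S \<subseteq> {..<m}" "card S = Suc i" and l: "l < r j" for S l
  proof -
    have "kd x (\<lambda>S. c' S l) S = \<Delta> ^ s * mv (Suc j) (b S) l - mv (Suc j) (\<lambda>l. kd x (\<lambda>S. e S l) S) l"
      unfolding c'_def kd_diff kd_cmult kd_mv b[OF S l] ..
    also have "\<dots> = mv (Suc j) (\<lambda>l. \<Delta> ^ s * b S l - kd x (\<lambda>S. e S l) S) l"
      by (simp add: mv_diff mv_cmult)
    also have "\<dots> = 0" using se[OF S] l unfolding in_im_iff_kernel[OF jN] by simp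
    finally show ?thesis .
  qed
  have im: "i < m" using Suc.prems by simp
  have "\<exists>e. \<forall>S\<subseteq>{..<m}. card S = i \<longrightarrow> c' S l = kd x e S" if "l < r j" for l
    by (rule Koszul_acyclic[OF reg cyc im]) (use that in auto)
  then obtain e' where e': "\<And>l S. l < r j \<Longrightarrow> S \<subseteq> {..<m} \<Longrightarrow> card S = i \<Longrightarrow> c' S l = kd x (e' l) S" by metis
  have "in_im j (\<lambda>l. \<Delta> ^ s * c S l - kd x (\<lambda>S. e' l S) S)" if "S \<subseteq> {..<m}" "card S = i" for S
    unfolding in_im_def
    by (rule exI[of _ "e S"]) (use e'[OF _ that] in \<open>auto simp: c'_def algebra_simps\<close>)
  then show ?case by (intro exI[of _ s] exI[of _ "\<lambda>S l. e' l S"]) blast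
qed

definition res_ideal :: "'a set" where
  "res_ideal = range (\<lambda>w. mv 1 w 0)"

lemma in_im_0: "r 0 = 1 \<Longrightarrow> in_im 0 v \<longleftrightarrow> v 0 \<in> res_ideal"
  by (auto simp: in_im_def res_ideal_def)

text \<open>An element killed by the sequence is a Koszul cocycle of degree 0 in the quotient ring.
  The coboundary at the empty set is an empty sum, so a power of \<Delta> kills the element.\<close>

theorem torsion_if_killed:
  assumes r0: "r 0 = 1"
    and reg: "\<And>k a. k < m \<Longrightarrow> a * x k \<in> gidl (x ` {..<k}) \<Longrightarrow> a \<in> gidl (x ` {..<k})"
    and split: "split_at k \<Delta>" and k: "k \<le> N" "k < m"
    and a: "\<And>i. i < m \<Longrightarrow> x i * a \<in> res_ideal"
  shows "\<exists>s. \<Delta> ^ s * a \<in> res_ideal"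
proof -
  have "\<exists>s e. \<forall>S\<subseteq>{..<m}. card S = 0 \<longrightarrow> in_im 0 (\<lambda>l. \<Delta> ^ s * a - kd x (\<lambda>S. e S l) S)"
  proof (rule Koszul_cokernel_torsion[OF reg split k(1)])
    fix S :: "nat set" assume S: "S \<subseteq> {..<m}" "card S = Suc 0"
    then obtain i where i: "S = {i}" "i < m" by (metis card_1_singletonE One_nat_def insert_subset lessThan_iff)
    then show "in_im 0 (\<lambda>l. kd x (\<lambda>S. a) S)"
      unfolding in_im_0[OF r0] kd_def using a[of i] by (simp add: ksign_singleton)
  qed (use k in auto)
  then obtain s e where "in_im 0 (\<lambda>l. \<Delta> ^ s * a - kd x (\<lambda>S. e S l) {})"
    by (metis card.empty empty_subsetI)
  then show ?thesis unfolding in_im_0[OF r0] by (auto simp: kd_def)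
qed

text \<open>As \<open>h\<close> is a nonzerodivisor modulo the ideal, the elements
  \<open>u i\<close> with \<open>x i * g\<close> congruent to \<open>u i * h\<close> form a cocycle
  of degree 1. So up to a power of \<Delta> they are \<open>x i * v\<close> for one
  \<open>v\<close>. Then each \<open>x i\<close> kills the difference of \<Delta>^s g and v h, and
  \<open>torsion_if_killed\<close> applies.\<close>

theorem torsion_if_killed_mod:
  assumes r0: "r 0 = 1"
    and reg: "\<And>k a. k < m \<Longrightarrow> a * x k \<in> gidl (x ` {..<k}) \<Longrightarrow> a \<in> gidl (x ` {..<k})"
    and split: "split_at k \<Delta>" and k: "k \<le> N" "k + 1 < m"
    and h: "\<And>a. a * h \<in> res_ideal \<Longrightarrow> a \<in> res_ideal"
    and g: "\<And>i. i < m \<Longrightarrow> \<exists>u. x i * g - u * h \<in> res_ideal"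
  shows "\<exists>s u. \<Delta> ^ s * g - u * h \<in> res_ideal"
proof -
  have add: "a + b \<in> res_ideal" if "a \<in> res_ideal" "b \<in> res_ideal" for a b
    using in_im_add[of 0 "\<lambda>_. a" "\<lambda>_. b"] that by (simp add: in_im_0[OF r0])
  have mult: "a * b \<in> res_ideal" if "b \<in> res_ideal" for a b
    using in_im_cmult[of 0 "\<lambda>_. b" a] that by (simp add: in_im_0[OF r0])
  have diff: "a - b \<in> res_ideal" if "a \<in> res_ideal" "b \<in> res_ideal" for a b
    using add[OF that(1) mult[OF that(2), of "-1"]] by simp
  obtain u where u: "\<And>i. i < m \<Longrightarrow> x i * g - u i * h \<in> res_ideal" using g by metis
  have cyc: "x i * u j - x j * u i \<in> res_ideal" if "i < m" "j < m" for i j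
  proof (rule h)
    have "x j * (x i * g - u i * h) - x i * (x j * g - u j * h) \<in> res_ideal"
      by (intro diff mult u that)
    moreover have "x j * (x i * g - u i * h) - x i * (x j * g - u j * h) = (x i * u j - x j * u i) * h"
      by (simp add: algebra_simps)
    ultimately show "(x i * u j - x j * u i) * h \<in> res_ideal" by simp
  qed
  have "\<exists>s e. \<forall>S\<subseteq>{..<m}. card S = 1 \<longrightarrow> in_im 0 (\<lambda>l. \<Delta> ^ s * u (the_elem S) - kd x (\<lambda>S. e S l) S)"
  proof (rule Koszul_cokernel_torsion[OF reg split k(1)])
    fix S :: "nat set" assume S: "S \<subseteq> {..<m}" "card S = Suc 1"
    then obtain i j where ij': "S = {i, j}" "i \<noteq> j" using card_2_iff[of S] by auto
    obtain i j where ij: "S = {i, j}" "i < j"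
    proof (cases "i < j")
      case True then show ?thesis using that ij' by blast
    next
      case False then show ?thesis using that[of j i] ij' by (auto simp: insert_commute)
    qed
    have ijm: "i < m" "j < m" using S(1) ij by auto
    have e: "{b\<in>{i, j}. b < i} = {}" "{b\<in>{i, j}. b < j} = {i}" using ij by auto
    have "ksign S i = (1 :: 'a)" "ksign S j = (- 1 :: 'a)" unfolding ksign_def ij(1) e by simp_all
    moreover have "S - {i} = {j}" "S - {j} = {i}" using ij by auto
    ultimately have "kd x (\<lambda>S. u (the_elem S)) S = x i * u j - x j * u i"
      unfolding kd_def using ij by simp
    then show "in_im 0 (\<lambda>l. kd x (\<lambda>S. u (the_elem S)) S)"
      unfolding in_im_0[OF r0] using cyc[OF ijm] by simp
  qed (use k in auto)
  then obtain s e where se: "\<And>S. S \<subseteq> {..<m} \<Longrightarrow> card S = 1 \<Longrightarrow>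
    \<Delta> ^ s * u (the_elem S) - kd x (\<lambda>S. e S (0::nat)) S \<in> res_ideal"
    unfolding in_im_0[OF r0] by blast
  define v where "v = e {} 0"
  have "\<Delta> ^ s * u i - x i * v \<in> res_ideal" if "i < m" for i
    using se[of "{i}"] that by (simp add: kd_def ksign_singleton v_def)
  then have "x i * (\<Delta> ^ s * g - v * h) \<in> res_ideal" if "i < m" for i
  proof -
    have "\<Delta> ^ s * (x i * g - u i * h) + h * (\<Delta> ^ s * u i - x i * v) \<in> res_ideal"
      using \<open>\<And>i. i < m \<Longrightarrow> \<Delta> ^ s * u i - x i * v \<in> res_ideal\<close>[OF that] by (intro add mult u that)
    moreover have "\<Delta> ^ s * (x i * g - u i * h) + h * (\<Delta> ^ s * u i - x i * v) = x i * (\<Delta> ^ s * g - v * h)"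
      by (simp add: algebra_simps)
    ultimately show ?thesis by simp
  qed
  then obtain s' where "\<Delta> ^ s' * (\<Delta> ^ s * g - v * h) \<in> res_ideal"
    using torsion_if_killed[OF r0 reg split k(1), of m "\<Delta> ^ s * g - v * h"] k(2) by auto
  then have "\<Delta> ^ (s' + s) * g - (\<Delta> ^ s' * v) * h \<in> res_ideal"
    by (simp add: power_add algebra_simps)
  then show ?thesis by blast
qed

end


section \<open>Roots of polynomials with varying coefficients\<close>

lemma poly_eq_sum_le:
  fixes p :: "complex poly"
  assumes "degree p \<le> d" shows "poly p w = (\<Sum>i\<le>d. coeff p i * w ^ i)"
  unfolding Polynomial.poly_altdef
  by (rule sum.mono_neutral_left) (use assms in \<open>auto simp: coeff_eq_0\<close>)

text \<open>The modulus of the value is the product of the distances of \<open>w\<close> to the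
  \<open>d\<close> roots, so they cannot all be at least \<eta>.\<close>

lemma monic_root_near:
  fixes q :: "complex poly"
  assumes "degree q = d" "coeff q d = 1" "cmod (poly q w) < \<eta> ^ d" "\<eta> > 0"
  shows "\<exists>r. poly q r = 0 \<and> dist w r < \<eta>"
proof (rule ccontr)
  assume no: "\<not> ?thesis"
  obtain root where root: "Polynomial.smult (lead_coeff q) (\<Prod>i<degree q. [:- root i, 1:]) = q"
    by (rule complex_poly_decompose')
  then have q: "q = (\<Prod>i<d. [:- root i, 1:])" using assms(1,2) by simp
  have val: "poly q u = (\<Prod>i<d. u - root i)" for u
    unfolding q poly_prod by simp
  have "\<eta> \<le> cmod (w - root i)" if "i < d" for i
  proof -
    have "poly q (root i) = 0" unfolding val using that by (auto intro!: prod_zero)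
    then show ?thesis using no by (force simp: dist_norm)
  qed
  then have "(\<Prod>i<d. \<eta>) \<le> (\<Prod>i<d. cmod (w - root i))"
    using assms(4) by (intro prod_mono) auto
  then have "\<eta> ^ d \<le> cmod (poly q w)" by (simp add: val prod_norm)
  then show False using assms(3) by simp
qed

lemma order_higher_pderiv:
  fixes q :: "complex poly"
  assumes "q \<noteq> 0" "Polynomial.order a q = m"
  shows "poly ((pderiv ^^ m) q) a \<noteq> 0 \<and> (\<forall>k<m. poly ((pderiv ^^ k) q) a = 0)"
  using assms
proof (induction m arbitrary: q)
  case 0
  then show ?case by (simp add: order_root)
next
  case (Suc m)
  then have r: "poly q a = 0" by (simp add: order_root)
  have "pderiv q \<noteq> 0"
  proof
    assume "pderiv q = 0"
    then obtain c where "q = [:c:]" using pderiv_iszero by blast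
    then show False using r Suc.prems(1) by simp
  qed
  moreover have "Polynomial.order a (pderiv q) = m" using order_pderiv[OF Suc.prems(1) r] Suc.prems(2) by simp
  ultimately have IH: "poly ((pderiv ^^ m) (pderiv q)) a \<noteq> 0" "\<forall>k<m. poly ((pderiv ^^ k) (pderiv q)) a = 0"
    using Suc.IH by auto
  have "poly ((pderiv ^^ k) q) a = 0" if "k < Suc m" for k
  proof (cases k)
    case (Suc k')
    then show ?thesis using IH(2) that by (simp add: funpow_swap1)
  qed (use r in simp)
  then show ?case using IH(1) by (simp add: funpow_swap1)
qed

lemma sum_order_complex:
  fixes q :: "complex poly"
  assumes "q \<noteq> 0" shows "(\<Sum>r | poly q r = 0. Polynomial.order r q) = degree q"
proof -
  have "degree q = size (proots q)" by (simp add: size_proots_complex)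
  also have "\<dots> = (\<Sum>r | poly q r = 0. Polynomial.order r q)"
    using assms by (simp add: size_multiset_overloaded_eq)
  finally show ?thesis by simp
qed

text \<open>After subtracting \<open>c * w\<close> the polynomial has Lipschitz constant at most
  half the modulus of \<open>c\<close>, too small to compensate the linear term.\<close>

lemma inj_on_near_constant_deriv:
  fixes p :: "complex poly"
  assumes d: "\<And>w. w \<in> ball \<rho> \<eta> \<Longrightarrow> cmod (poly (pderiv p) w - c) < cmod c / 2"
    and w: "w \<in> ball \<rho> \<eta>" "w' \<in> ball \<rho> \<eta>" "poly p w = poly p w'"
  shows "w = w'"
proof (rule ccontr)
  assume ne: "w \<noteq> w'"
  have "cmod ((poly p w - c * w) - (poly p w' - c * w')) \<le> cmod c / 2 * cmod (w - w')"
  proof (rule field_differentiable_bound[of "ball \<rho> \<eta>"])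
    show "((\<lambda>w. poly p w - c * w) has_field_derivative (poly (pderiv p) z - c)) (at z within ball \<rho> \<eta>)" for z
      by (auto intro!: derivative_eq_intros DERIV_subset[OF poly_DERIV])
    show "cmod (poly (pderiv p) z - c) \<le> cmod c / 2" if "z \<in> ball \<rho> \<eta>" for z
      using d[OF that] by simp
  qed (use w in auto)
  moreover have "(poly p w - c * w) - (poly p w' - c * w') = c * (w' - w)" using w(3) by (simp add: algebra_simps)
  ultimately have "cmod c * cmod (w - w') \<le> cmod c / 2 * cmod (w - w')"
    by (simp add: norm_mult norm_minus_commute)
  moreover have "cmod c > 0" using le_less_trans[OF norm_ge_zero d[OF w(1)]] by simp
  then have "cmod c * cmod (w - w') > 0" by (rule mult_pos_pos) (use ne in simp)
  ultimately show False by simp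
qed

lemma continuous_on_poly_pderiv:
  assumes cont: "\<And>i. continuous_on D (\<lambda>y. coeff (Q y) i)" and deg: "\<And>y. y \<in> D \<Longrightarrow> degree (Q y) = d"
  shows "continuous_on (D \<times> UNIV) (\<lambda>(y, w :: complex). poly ((pderiv ^^ k) (Q y)) w)"
proof -
  have eq: "poly ((pderiv ^^ k) (Q y)) w =
    (\<Sum>i\<le>d. pochhammer (of_nat (Suc i)) k * coeff (Q y) (i + k) * w ^ i)" if "y \<in> D" for y w
  proof -
    have "degree ((pderiv ^^ k) (Q y)) \<le> degree (Q y)" for y
      by (induction k) (auto simp: degree_pderiv)
    then have "degree ((pderiv ^^ k) (Q y)) \<le> d" using deg[OF that] by metis
    then show ?thesis by (subst poly_eq_sum_le) (auto simp: coeff_higher_pderiv)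
  qed
  have "continuous_on (D \<times> UNIV) (\<lambda>x. \<Sum>i\<le>d. pochhammer (of_nat (Suc i)) k * coeff (Q (fst x)) (i + k) * snd x ^ i)"
    by (intro continuous_intros continuous_on_compose2[OF cont]) auto
  then show ?thesis by (rule continuous_on_eq) (auto simp: eq)
qed

text \<open>Each root of \<open>Q y0\<close> attracts a root of \<open>Q y\<close>. As the number of
  distinct roots on \<open>X\<close> is largest at \<open>y0\<close>, for \<open>y\<close> in
  \<open>X\<close> there is exactly one in each disc. Its order is at most that at
  \<open>y0\<close>, because the derivative of this order has no zero in the disc; both families of
  orders sum to \<open>d\<close>, so the orders agree.\<close>

lemma root_tracking:
  fixes Q :: "'a::metric_space \<Rightarrow> complex poly"
  assumes D: "open D" and X: "X \<subseteq> D" "y0 \<in> X"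
    and Q: "\<And>y. y \<in> D \<Longrightarrow> degree (Q y) = d" "\<And>y. y \<in> D \<Longrightarrow> coeff (Q y) d = 1"
    and cont: "\<And>i. continuous_on D (\<lambda>y. coeff (Q y) i)"
    and max: "\<And>y. y \<in> X \<Longrightarrow> card {w. poly (Q y) w = 0} \<le> card {w. poly (Q y0) w = 0}"
    and e: "e > 0"
  obtains \<eta> V where "0 < \<eta>" "\<eta> \<le> e" "open V" "y0 \<in> V" "V \<subseteq> D"
    "\<And>y \<rho> w w'. y \<in> V \<Longrightarrow> poly (Q y0) \<rho> = 0 \<Longrightarrow> w \<in> ball \<rho> \<eta> \<Longrightarrow> w' \<in> ball \<rho> \<eta> \<Longrightarrow>
      poly ((pderiv ^^ (Polynomial.order \<rho> (Q y0) - 1)) (Q y)) w = poly ((pderiv ^^ (Polynomial.order \<rho> (Q y0) - 1)) (Q y)) w' \<Longrightarrow> w = w'"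
    "\<And>y \<rho> w. y \<in> V \<Longrightarrow> poly (Q y0) \<rho> = 0 \<Longrightarrow> w \<in> ball \<rho> \<eta> \<Longrightarrow> poly ((pderiv ^^ Polynomial.order \<rho> (Q y0)) (Q y)) w \<noteq> 0"
    "\<And>y w. y \<in> X \<inter> V \<Longrightarrow> poly (Q y) w = 0 \<Longrightarrow> \<exists>\<rho>. poly (Q y0) \<rho> = 0 \<and> w \<in> ball \<rho> \<eta>"
    "\<And>y \<rho> w. y \<in> X \<inter> V \<Longrightarrow> poly (Q y0) \<rho> = 0 \<Longrightarrow> w \<in> ball \<rho> \<eta> \<Longrightarrow> poly (Q y) w = 0 \<Longrightarrow> Polynomial.order w (Q y) = Polynomial.order \<rho> (Q y0)"
    "\<And>y \<rho> w w'. y \<in> X \<inter> V \<Longrightarrow> poly (Q y0) \<rho> = 0 \<Longrightarrow> w \<in> ball \<rho> \<eta> \<Longrightarrow> w' \<in> ball \<rho> \<eta> \<Longrightarrow>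
      poly (Q y) w = 0 \<Longrightarrow> poly (Q y) w' = 0 \<Longrightarrow> w = w'"
    "\<And>\<rho> \<rho>' w. poly (Q y0) \<rho> = 0 \<Longrightarrow> poly (Q y0) \<rho>' = 0 \<Longrightarrow> w \<in> ball \<rho> \<eta> \<Longrightarrow> w \<in> ball \<rho>' \<eta> \<Longrightarrow> \<rho> = \<rho>'"
proof -
  have y0D: "y0 \<in> D" using X by auto
  have Qnz: "Q y \<noteq> 0" if "y \<in> D" for y using Q(2)[OF that] by auto
  define R0 where "R0 = {w. poly (Q y0) w = 0}"
  have finR: "finite {w. poly (Q y) w = 0}" if "y \<in> D" for y using poly_roots_finite[OF Qnz[OF that]] .
  have finR0: "finite R0" unfolding R0_def using finR[OF y0D] .
  define m where "m \<rho> = Polynomial.order \<rho> (Q y0)" for \<rho>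
  define c where "c \<rho> = poly ((pderiv ^^ m \<rho>) (Q y0)) \<rho>" for \<rho>
  have c0: "c \<rho> \<noteq> 0" for \<rho> using order_higher_pderiv[OF Qnz[OF y0D] refl, of \<rho>] by (simp add: c_def m_def)
  have "\<forall>\<rho>\<in>R0. \<exists>t>0. \<forall>y w. dist y y0 < t \<longrightarrow> dist w \<rho> < t \<longrightarrow>
    y \<in> D \<and> cmod (poly ((pderiv ^^ m \<rho>) (Q y)) w - c \<rho>) < cmod (c \<rho>) / 2"
  proof
    fix \<rho> assume "\<rho> \<in> R0"
    have co: "continuous_on (D \<times> UNIV) (\<lambda>(y, w). poly ((pderiv ^^ m \<rho>) (Q y)) w)"
      by (rule continuous_on_poly_pderiv[OF cont Q(1)])
    have oDU: "open (D \<times> (UNIV :: complex set))" using D by (intro open_Times) auto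
    have "isCont (\<lambda>(y, w). poly ((pderiv ^^ m \<rho>) (Q y)) w) (y0, \<rho>)"
      using co oDU y0D by (simp add: continuous_on_eq_continuous_at)
    then have "((\<lambda>(y, w). poly ((pderiv ^^ m \<rho>) (Q y)) w) \<longlongrightarrow> c \<rho>) (at (y0, \<rho>))"
      by (simp add: isCont_def c_def)
    then have "\<forall>\<^sub>F x in at (y0, \<rho>). dist (case x of (y, w) \<Rightarrow> poly ((pderiv ^^ m \<rho>) (Q y)) w) (c \<rho>) < cmod (c \<rho>) / 2"
      by (rule tendstoD) (use c0 in simp)
    moreover have "\<forall>\<^sub>F x in at (y0, \<rho>). x \<in> D \<times> UNIV"
      by (rule eventually_at_in_open'[OF oDU]) (use y0D in simp)
    ultimately have "\<forall>\<^sub>F x in at (y0, \<rho>). x \<in> D \<times> UNIV \<and>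
      dist (case x of (y, w) \<Rightarrow> poly ((pderiv ^^ m \<rho>) (Q y)) w) (c \<rho>) < cmod (c \<rho>) / 2"
      by eventually_elim simp
    then obtain t where t: "t > 0" "\<And>x. x \<noteq> (y0, \<rho>) \<Longrightarrow> dist x (y0, \<rho>) < t \<Longrightarrow> x \<in> D \<times> UNIV \<and>
      dist (case x of (y, w) \<Rightarrow> poly ((pderiv ^^ m \<rho>) (Q y)) w) (c \<rho>) < cmod (c \<rho>) / 2"
      unfolding eventually_at by auto
    have "y \<in> D \<and> cmod (poly ((pderiv ^^ m \<rho>) (Q y)) w - c \<rho>) < cmod (c \<rho>) / 2"
      if "dist y y0 < t / 2" "dist w \<rho> < t / 2" for y w
    proof (cases "(y, w) = (y0, \<rho>)")
      case True
      then show ?thesis using y0D c0[of \<rho>] by (auto simp: c_def)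
    next
      case False
      have "dist (y, w) (y0, \<rho>) \<le> dist y y0 + dist w \<rho>"
        unfolding dist_prod_def by (simp add: sqrt_sum_squares_le_sum)
      then show ?thesis using t(2)[OF False] that by (simp add: dist_norm)
    qed
    then show "\<exists>t>0. \<forall>y w. dist y y0 < t \<longrightarrow> dist w \<rho> < t \<longrightarrow>
      y \<in> D \<and> cmod (poly ((pderiv ^^ m \<rho>) (Q y)) w - c \<rho>) < cmod (c \<rho>) / 2"
      using t(1) by (intro exI[of _ "t / 2"]) auto
  qed
  then obtain t where t: "\<And>\<rho>. \<rho> \<in> R0 \<Longrightarrow> t \<rho> > 0" "\<And>\<rho> y w. \<rho> \<in> R0 \<Longrightarrow> dist y y0 < t \<rho> \<Longrightarrow> dist w \<rho> < t \<rho> \<Longrightarrow>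
    y \<in> D \<and> cmod (poly ((pderiv ^^ m \<rho>) (Q y)) w - c \<rho>) < cmod (c \<rho>) / 2" by metis
  define sep where "sep = Min (insert 1 {dist \<rho> \<rho>' | \<rho> \<rho>'. \<rho> \<in> R0 \<and> \<rho>' \<in> R0 \<and> \<rho> \<noteq> \<rho>'})"
  have finS: "finite {dist \<rho> \<rho>' | \<rho> \<rho>'. \<rho> \<in> R0 \<and> \<rho>' \<in> R0 \<and> \<rho> \<noteq> \<rho>'}"
    by (rule finite_subset[of _ "(\<lambda>(\<rho>, \<rho>'). dist \<rho> \<rho>') ` (R0 \<times> R0)"]) (use finR0 in auto)
  have sep: "sep > 0" "\<And>\<rho> \<rho>'. \<rho> \<in> R0 \<Longrightarrow> \<rho>' \<in> R0 \<Longrightarrow> \<rho> \<noteq> \<rho>' \<Longrightarrow> sep \<le> dist \<rho> \<rho>'"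
    unfolding sep_def using finS by (auto intro!: Min_le)
  \<comment> \<open>The bound \<open>sep / 2\<close> makes the discs disjoint, and the bounds
    \<open>t \<rho>\<close> keep the derivative of order \<open>m \<rho>\<close> within half of its
    nonzero central value.\<close>
  define \<eta> where "\<eta> = Min (insert e (insert (sep / 2) (t ` R0)))"
  have finI: "finite (insert e (insert (sep / 2) (t ` R0)))" using finR0 by simp
  have "\<eta> > 0" unfolding \<eta>_def using finI e sep(1) t(1) by (subst Min_gr_iff) auto
  moreover have "\<eta> \<le> e" "\<eta> \<le> sep / 2" unfolding \<eta>_def by (rule Min_le[OF finI]; simp)+
  moreover have "\<eta> \<le> t \<rho>" if "\<rho> \<in> R0" for \<rho> unfolding \<eta>_def by (rule Min_le[OF finI]) (use that in auto)
  ultimately have \<eta>: "\<eta> > 0" "\<eta> \<le> e" "\<eta> \<le> sep / 2" "\<And>\<rho>. \<rho> \<in> R0 \<Longrightarrow> \<eta> \<le> t \<rho>" by blast+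
  have disj: "\<rho> = \<rho>'" if "\<rho> \<in> R0" "\<rho>' \<in> R0" "w \<in> ball \<rho> \<eta>" "w \<in> ball \<rho>' \<eta>" for \<rho> \<rho>' w
  proof (rule ccontr)
    assume "\<rho> \<noteq> \<rho>'"
    then have "2 * \<eta> \<le> dist \<rho> \<rho>'" using sep(2)[OF that(1,2)] \<eta>(3) by simp
    then show False using that(3,4) dist_triangle2[of \<rho> \<rho>' w] by (simp add: dist_commute)
  qed
  have "\<exists>V. open V \<and> y0 \<in> V \<and> V \<subseteq> D \<and> (\<forall>y\<in>V. \<forall>\<rho>\<in>R0. cmod (poly (Q y) \<rho>) < \<eta> ^ d)"
  proof -
    have "open (D \<inter> (\<Inter>\<rho>\<in>R0. (\<lambda>y. poly (Q y) \<rho>) -` ball 0 (\<eta> ^ d) \<inter> D))"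
    proof (intro open_Int[OF D] open_INT finR0 ballI)
      fix \<rho>
      have "continuous_on D (\<lambda>y. (\<lambda>(y, w). poly ((pderiv ^^ 0) (Q y)) w) (y, \<rho>))"
        by (rule continuous_on_compose2[OF continuous_on_poly_pderiv[OF cont Q(1)]])
          (auto intro!: continuous_intros)
      then have co: "continuous_on D (\<lambda>y. poly (Q y) \<rho>)" by simp
      show "open ((\<lambda>y. poly (Q y) \<rho>) -` ball 0 (\<eta> ^ d) \<inter> D)"
        using continuous_open_preimage[OF co D open_ball] by (simp add: Int_commute)
    qed
    moreover have "y0 \<in> D \<inter> (\<Inter>\<rho>\<in>R0. (\<lambda>y. poly (Q y) \<rho>) -` ball 0 (\<eta> ^ d) \<inter> D)"
      using y0D \<eta>(1) by (auto simp: R0_def)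
    ultimately show ?thesis
      by (intro exI[of _ "D \<inter> (\<Inter>\<rho>\<in>R0. (\<lambda>y. poly (Q y) \<rho>) -` ball 0 (\<eta> ^ d) \<inter> D)"]) auto
  qed
  then obtain V0 where V0: "open V0" "y0 \<in> V0" "V0 \<subseteq> D" "\<And>y \<rho>. y \<in> V0 \<Longrightarrow> \<rho> \<in> R0 \<Longrightarrow> cmod (poly (Q y) \<rho>) < \<eta> ^ d"
    by blast
  define V where "V = V0 \<inter> ball y0 \<eta>"
  have V: "open V" "y0 \<in> V" "V \<subseteq> D" using V0 \<eta>(1) by (auto simp: V_def)
  have near: "cmod (poly ((pderiv ^^ m \<rho>) (Q y)) w - c \<rho>) < cmod (c \<rho>) / 2"
    if "y \<in> V" "\<rho> \<in> R0" "w \<in> ball \<rho> \<eta>" for y \<rho> w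
    using t(2)[OF that(2), of y w] that \<eta>(4)[OF that(2)] by (auto simp: V_def dist_commute)
  have nz: "poly ((pderiv ^^ m \<rho>) (Q y)) w \<noteq> 0" if "y \<in> V" "\<rho> \<in> R0" "w \<in> ball \<rho> \<eta>" for y \<rho> w
    using near[OF that] c0[of \<rho>] by auto
  have sel: "\<exists>\<sigma>. (\<forall>\<rho>\<in>R0. \<sigma> \<rho> \<in> ball \<rho> \<eta>) \<and> inj_on \<sigma> R0 \<and> {w. poly (Q y) w = 0} = \<sigma> ` R0" if y: "y \<in> X \<inter> V" for y
  proof -
    have yV: "y \<in> V0" "y \<in> D" "y \<in> X" using y V(3) by (auto simp: V_def)
    have "\<forall>\<rho>\<in>R0. \<exists>r. poly (Q y) r = 0 \<and> dist \<rho> r < \<eta>"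
      using monic_root_near[OF Q(1)[OF yV(2)] Q(2)[OF yV(2)] V0(4)[OF yV(1)] \<eta>(1)] by blast
    then obtain \<sigma> where \<sigma>: "\<And>\<rho>. \<rho> \<in> R0 \<Longrightarrow> poly (Q y) (\<sigma> \<rho>) = 0" "\<And>\<rho>. \<rho> \<in> R0 \<Longrightarrow> \<sigma> \<rho> \<in> ball \<rho> \<eta>"
      by (metis mem_ball)
    have inj: "inj_on \<sigma> R0" by (rule inj_onI) (metis disj \<sigma>(2))
    have "\<sigma> ` R0 = {w. poly (Q y) w = 0}"
    proof (rule card_seteq[OF finR[OF yV(2)]])
      show "\<sigma> ` R0 \<subseteq> {w. poly (Q y) w = 0}" using \<sigma>(1) by auto
      show "card {w. poly (Q y) w = 0} \<le> card (\<sigma> ` R0)"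
        using max[OF yV(3)] card_image[OF inj] by (simp add: R0_def)
    qed
    then show ?thesis using \<sigma>(2) inj by auto
  qed
  have uniq: "w = \<sigma> \<rho>" if \<sigma>: "\<forall>\<rho>\<in>R0. \<sigma> \<rho> \<in> ball \<rho> \<eta>" "{w. poly (Q y) w = 0} = \<sigma> ` R0"
    and w: "poly (Q y) w = 0" "w \<in> ball \<rho> \<eta>" "\<rho> \<in> R0" for \<sigma> y w \<rho>
  proof -
    have "w \<in> \<sigma> ` R0" using w(1) \<sigma>(2) by blast
    then obtain \<rho>' where "\<rho>' \<in> R0" "w = \<sigma> \<rho>'" by blast
    then show ?thesis using disj[of \<rho> \<rho>' w] \<sigma>(1) w by auto
  qed
  have ord: "Polynomial.order w (Q y) = m \<rho>" if y: "y \<in> X \<inter> V" and \<rho>: "\<rho> \<in> R0" and w: "w \<in> ball \<rho> \<eta>" "poly (Q y) w = 0" for y \<rho> w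
  proof -
    have yD: "y \<in> D" "y \<in> V" using y V(3) by auto
    obtain \<sigma> where \<sigma>: "\<forall>\<rho>\<in>R0. \<sigma> \<rho> \<in> ball \<rho> \<eta>" "inj_on \<sigma> R0" "{w. poly (Q y) w = 0} = \<sigma> ` R0" using sel[OF y] by blast
    have le: "Polynomial.order (\<sigma> \<rho>) (Q y) \<le> m \<rho>" if "\<rho> \<in> R0" for \<rho>
    proof (rule ccontr)
      assume "\<not> ?thesis"
      then have "poly ((pderiv ^^ m \<rho>) (Q y)) (\<sigma> \<rho>) = 0"
        using order_higher_pderiv[OF Qnz[OF yD(1)] refl, of "\<sigma> \<rho>"] by simp
      then show False using nz[OF yD(2) that] \<sigma>(1) that by blast
    qed
    have "(\<Sum>\<rho>\<in>R0. Polynomial.order (\<sigma> \<rho>) (Q y)) = d"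
      using sum_order_complex[OF Qnz[OF yD(1)]] Q(1)[OF yD(1)] unfolding \<sigma>(3) sum.reindex[OF \<sigma>(2)] by simp
    also have "d = (\<Sum>\<rho>\<in>R0. m \<rho>)"
      using sum_order_complex[OF Qnz[OF y0D]] Q(1)[OF y0D] unfolding R0_def m_def by simp
    finally have "(\<Sum>\<rho>\<in>R0. m \<rho> - Polynomial.order (\<sigma> \<rho>) (Q y)) = 0"
      using sum_subtractf_nat[of R0 "\<lambda>\<rho>. Polynomial.order (\<sigma> \<rho>) (Q y)" m] le by simp
    then have "m \<rho> - Polynomial.order (\<sigma> \<rho>) (Q y) = 0" using finR0 \<rho> by simp
    then have "Polynomial.order (\<sigma> \<rho>) (Q y) = m \<rho>" using le[OF \<rho>] by simp
    moreover have "w = \<sigma> \<rho>" using uniq[OF \<sigma>(1,3) w(2,1) \<rho>] .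
    ultimately show ?thesis by simp
  qed
  show thesis
  proof (rule that[of \<eta> V, OF \<eta>(1,2) V])
    fix y \<rho> w w'
    assume y: "y \<in> V" and \<rho>: "poly (Q y0) \<rho> = 0" and w: "w \<in> ball \<rho> \<eta>" "w' \<in> ball \<rho> \<eta>"
      and eq: "poly ((pderiv ^^ (Polynomial.order \<rho> (Q y0) - 1)) (Q y)) w = poly ((pderiv ^^ (Polynomial.order \<rho> (Q y0) - 1)) (Q y)) w'"
    have \<rho>R: "\<rho> \<in> R0" using \<rho> by (simp add: R0_def)
    have "m \<rho> \<noteq> 0" using \<rho> Qnz[OF y0D] by (simp add: m_def order_root)
    then have "(pderiv ^^ m \<rho>) (Q y) = pderiv ((pderiv ^^ (m \<rho> - 1)) (Q y))"
      by (metis Suc_diff_1 bot_nat_0.not_eq_extremum comp_apply funpow.simps(2))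
    then have "cmod (poly (pderiv ((pderiv ^^ (m \<rho> - 1)) (Q y))) u - c \<rho>) < cmod (c \<rho>) / 2" if "u \<in> ball \<rho> \<eta>" for u
      using near[OF y \<rho>R that] by simp
    then show "w = w'" using inj_on_near_constant_deriv[OF _ w] eq unfolding m_def by blast
  next
    show "poly ((pderiv ^^ Polynomial.order \<rho> (Q y0)) (Q y)) w \<noteq> 0"
      if "y \<in> V" "poly (Q y0) \<rho> = 0" "w \<in> ball \<rho> \<eta>" for y \<rho> w
      using nz[OF that(1) _ that(3)] that(2) by (simp add: m_def R0_def)
    show "\<exists>\<rho>. poly (Q y0) \<rho> = 0 \<and> w \<in> ball \<rho> \<eta>" if *: "y \<in> X \<inter> V" "poly (Q y) w = 0" for y w
    proof -
      obtain \<sigma> where \<sigma>: "\<forall>\<rho>\<in>R0. \<sigma> \<rho> \<in> ball \<rho> \<eta>" "{w. poly (Q y) w = 0} = \<sigma> ` R0"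
        using sel[OF *(1)] by blast
      have "w \<in> \<sigma> ` R0" using *(2) \<sigma>(2) by blast
      then show ?thesis using \<sigma>(1) by (auto simp: R0_def)
    qed
    show "Polynomial.order w (Q y) = Polynomial.order \<rho> (Q y0)"
      if "y \<in> X \<inter> V" "poly (Q y0) \<rho> = 0" "w \<in> ball \<rho> \<eta>" "poly (Q y) w = 0" for y \<rho> w
      using ord[OF that(1) _ that(3,4)] that(2) by (simp add: m_def R0_def)
    show "w = w'" if *: "y \<in> X \<inter> V" "poly (Q y0) \<rho> = 0" "w \<in> ball \<rho> \<eta>" "w' \<in> ball \<rho> \<eta>"
      "poly (Q y) w = 0" "poly (Q y) w' = 0" for y \<rho> w w'
    proof -
      obtain \<sigma> where \<sigma>: "\<forall>\<rho>\<in>R0. \<sigma> \<rho> \<in> ball \<rho> \<eta>" "{w. poly (Q y) w = 0} = \<sigma> ` R0"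
        using sel[OF *(1)] by blast
      have "\<rho> \<in> R0" using *(2) by (simp add: R0_def)
      then have "w = \<sigma> \<rho>" "w' = \<sigma> \<rho>" using uniq[OF \<sigma> *(5,3)] uniq[OF \<sigma> *(6,4)] by auto
      then show ?thesis by simp
    qed
    show "\<rho> = \<rho>'" if "poly (Q y0) \<rho> = 0" "poly (Q y0) \<rho>' = 0" "w \<in> ball \<rho> \<eta>" "w \<in> ball \<rho>' \<eta>" for \<rho> \<rho>' w
      using disj that by (simp add: R0_def)
  qed
qed

text \<open>If some point is outside a relatively closed member of the cover, that member misses a
  neighbourhood of the point, where one set less suffices. This replaces an appeal to irreducible
  components.\<close>

lemma finite_closed_cover:
  assumes "finite I" and "open G" "X \<inter> G \<noteq> {}" and "X \<inter> G \<subseteq> (\<Union>i\<in>I. B i)"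
    and closed: "\<And>i y. i \<in> I \<Longrightarrow> y \<in> X \<inter> G \<Longrightarrow> y \<notin> B i \<Longrightarrow> \<exists>W. open W \<and> y \<in> W \<and> X \<inter> G \<inter> W \<inter> B i = {}"
  shows "\<exists>i\<in>I. \<exists>W. open W \<and> W \<subseteq> G \<and> X \<inter> W \<noteq> {} \<and> X \<inter> W \<subseteq> B i"
  using assms
proof (induction I arbitrary: G)
  case empty
  then show ?case by auto
next
  case (insert i I)
  show ?case
  proof (cases "X \<inter> G \<subseteq> B i")
    case True
    then show ?thesis using insert.prems(1,2) by blast
  next
    case False
    then obtain y where y: "y \<in> X \<inter> G" "y \<notin> B i" by blast
    then obtain W where W: "open W" "y \<in> W" "X \<inter> G \<inter> W \<inter> B i = {}" using insert.prems(4)[of i y] by blast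
    have "\<exists>j\<in>I. \<exists>W'. open W' \<and> W' \<subseteq> G \<inter> W \<and> X \<inter> W' \<noteq> {} \<and> X \<inter> W' \<subseteq> B j"
    proof (rule insert.IH)
      show "open (G \<inter> W)" using insert.prems(1) W(1) by blast
      show "X \<inter> (G \<inter> W) \<noteq> {}" using y W(2) by blast
      show "X \<inter> (G \<inter> W) \<subseteq> (\<Union>i\<in>I. B i)" using insert.prems(3) W(3) by blast
      fix j z assume "j \<in> I" "z \<in> X \<inter> (G \<inter> W)" "z \<notin> B j"
      then obtain W' where "open W'" "z \<in> W'" "X \<inter> G \<inter> W' \<inter> B j = {}" using insert.prems(4)[of j z] by blast
      then show "\<exists>W'. open W' \<and> z \<in> W' \<and> X \<inter> (G \<inter> W) \<inter> W' \<inter> B j = {}" by blast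
    qed
    then show ?thesis by blast
  qed
qed


section \<open>Regular points of analytic sets\<close>

text \<open>\<open>A\<close> is near \<open>x\<close> a submanifold of codimension \<open>j\<close> of the coordinate subspace of \<open>S\<close>. The derivatives of the
  equations along the vectors \<open>v\<close> form a triangular matrix.\<close>

definition regular_in :: "'n set \<Rightarrow> (complex ^ 'n) set \<Rightarrow> complex ^ 'n \<Rightarrow> nat \<Rightarrow> bool" where
  "regular_in S A x j \<longleftrightarrow> x \<in> A \<and> proj S x = x \<and>
     (\<exists>W g v. open W \<and> x \<in> W \<and> (\<forall>i<j. holo_on (g i) W \<and> proj S (v i) = v i) \<and>
        (\<forall>z\<in>W. proj S z = z \<longrightarrow> (z \<in> A \<longleftrightarrow> (\<forall>i<j. g i z = 0))) \<and>
        (\<forall>z\<in>W. proj S z = z \<longrightarrow> (\<forall>i<j. frechet_derivative (g i) (at z) (v i) \<noteq> 0 \<and>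
           (\<forall>k<j. i < k \<longrightarrow> frechet_derivative (g i) (at z) (v k) = 0))))"

lemma holo_on_frechet:
  assumes "holo_on f U" "z \<in> U"
  shows "(f has_derivative frechet_derivative f (at z)) (at z)"
    "frechet_derivative f (at z) (c *s v) = c * frechet_derivative f (at z) v"
proof -
  obtain f' where f': "(f has_derivative f') (at z)" "\<forall>c v. f' (c *s v) = c * f' v"
    using assms unfolding holo_on_def by blast
  have "f' = frechet_derivative f (at z)" by (rule frechet_derivative_at[OF f'(1)])
  then show "(f has_derivative frechet_derivative f (at z)) (at z)"
    "frechet_derivative f (at z) (c *s v) = c * frechet_derivative f (at z) v" using f' by auto
qed

lemma frechet_derivative_linear_comp:
  assumes "holo_on f U" "T z \<in> U" "clin T"
  shows "frechet_derivative (\<lambda>z. f (T z)) (at z) v = frechet_derivative f (at (T z)) (T v)"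
proof -
  have "(T has_derivative T) (at z)"
    using bounded_linear_imp_has_derivative linear_conv_bounded_linear assms(3) unfolding clin_def by blast
  from has_derivative_compose[OF this holo_on_frechet(1)[OF assms(1,2)]]
  have "frechet_derivative (\<lambda>z. f (T z)) (at z) = (\<lambda>v. frechet_derivative f (at (T z)) (T v))"
    by (rule frechet_derivative_at[symmetric])
  then show ?thesis by simp
qed

text \<open>In a linear relation among the differentials take the last nonzero coefficient and test
  with the vector of the same index: later coefficients vanish by choice, and earlier differentials
  by triangularity.\<close>

lemma regular_in_regular_point:
  assumes "regular_in UNIV A x j" shows "regular_point A x j"
proof -
  obtain W g v where W: "open W" "x \<in> W" "\<forall>i<j. holo_on (g i) W" "x \<in> A"
    "\<forall>z\<in>W. z \<in> A \<longleftrightarrow> (\<forall>i<j. g i z = 0)"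
    and tri: "\<forall>z\<in>W. \<forall>i<j. frechet_derivative (g i) (at z) (v i) \<noteq> 0 \<and>
      (\<forall>k<j. i < k \<longrightarrow> frechet_derivative (g i) (at z) (v k) = 0)"
    using assms unfolding regular_in_def by auto
  have "\<forall>i<j. c i = 0" if c: "\<forall>v. (\<Sum>i<j. c i * frechet_derivative (g i) (at x) v) = 0" for c :: "nat \<Rightarrow> complex"
  proof (rule ccontr)
    assume "\<not> ?thesis"
    then have ne: "{i. i < j \<and> c i \<noteq> 0} \<noteq> {}" by auto
    define k where "k = Max {i. i < j \<and> c i \<noteq> 0}"
    have fin: "finite {i. i < j \<and> c i \<noteq> 0}" by simp
    have k: "k < j" "c k \<noteq> 0" using Max_in[OF fin ne] by (auto simp: k_def)
    have big: "c i = 0" if "k < i" "i < j" for i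
    proof (rule ccontr)
      assume "c i \<noteq> 0"
      then have "i \<le> k" unfolding k_def using Max_ge[OF fin, of i] that(2) by simp
      then show False using that(1) by simp
    qed
    have "(\<Sum>i<j. c i * frechet_derivative (g i) (at x) (v k)) = (\<Sum>i<j. if i = k then c k * frechet_derivative (g k) (at x) (v k) else 0)"
    proof (intro sum.cong refl)
      fix i assume "i \<in> {..<j}"
      then show "c i * frechet_derivative (g i) (at x) (v k) = (if i = k then c k * frechet_derivative (g k) (at x) (v k) else 0)"
        using tri W(2) k(1) big[of i] by (cases i k rule: linorder_cases) auto
    qed
    then have "c k * frechet_derivative (g k) (at x) (v k) = 0" using c k(1) by (simp add: sum.delta)
    then show False using k tri W(2) by auto
  qed
  then show ?thesis
    unfolding regular_point_def using W by (intro conjI exI[of _ W] exI[of _ g]) auto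
qed

lemma regular_in_local:
  assumes "regular_in S A x j" "open D" "x \<in> D" "\<And>z. z \<in> D \<Longrightarrow> proj S z = z \<Longrightarrow> z \<in> A \<longleftrightarrow> z \<in> B"
  shows "regular_in S B x j"
proof -
  obtain W g v where W: "open W" "x \<in> W" "x \<in> A" "proj S x = x" "\<forall>i<j. holo_on (g i) W \<and> proj S (v i) = v i"
    "\<forall>z\<in>W. proj S z = z \<longrightarrow> (z \<in> A \<longleftrightarrow> (\<forall>i<j. g i z = 0))"
    "\<forall>z\<in>W. proj S z = z \<longrightarrow> (\<forall>i<j. frechet_derivative (g i) (at z) (v i) \<noteq> 0 \<and>
           (\<forall>k<j. i < k \<longrightarrow> frechet_derivative (g i) (at z) (v k) = 0))"
    using assms(1) unfolding regular_in_def by blast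
  have o: "open (W \<inter> D)" using W(1) assms(2) by blast
  have h: "\<forall>i<j. holo_on (g i) (W \<inter> D) \<and> proj S (v i) = v i"
    using W(5) holo_on_subset[OF _ o] by auto
  show ?thesis unfolding regular_in_def
    by (intro conjI exI[of _ "W \<inter> D"] exI[of _ g] exI[of _ v]) (use W assms(3,4) o h in auto)
qed

lemma regular_in_linear:
  assumes T: "clin_auto S T T'" and reg: "regular_in S A x j"
  shows "regular_in S (T ` A) (T x) j"
proof -
  have lT: "clin T" "clin T'" and inv: "\<And>z. T (T' z) = z" "\<And>z. T' (T z) = z"
    and pr: "\<And>z. proj S (T z) = T (proj S z)" "\<And>z. proj S (T' z) = T' (proj S z)"
    using T by (auto simp: clin_auto_def)
  obtain W g v where W: "open W" "x \<in> W" "x \<in> A" "proj S x = x" "\<forall>i<j. holo_on (g i) W \<and> proj S (v i) = v i"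
    "\<forall>z\<in>W. proj S z = z \<longrightarrow> (z \<in> A \<longleftrightarrow> (\<forall>i<j. g i z = 0))"
    "\<forall>z\<in>W. proj S z = z \<longrightarrow> (\<forall>i<j. frechet_derivative (g i) (at z) (v i) \<noteq> 0 \<and>
           (\<forall>k<j. i < k \<longrightarrow> frechet_derivative (g i) (at z) (v k) = 0))"
    using reg unfolding regular_in_def by blast
  let ?W = "T' -` W"
  have o: "open ?W" by (rule open_vimage[OF W(1) clin_continuous[OF lT(2)]])
  have h: "holo_on (\<lambda>z. g i (T' z)) ?W" if "i < j" for i
    using holo_on_compose_linear[of "g i" W ?W 0 T'] W(5) that o lT(2) unfolding clin_def by auto
  have fd: "frechet_derivative (\<lambda>z. g i (T' z)) (at z) (T u) = frechet_derivative (g i) (at (T' z)) u"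
    if "i < j" "z \<in> ?W" for i z u
    using frechet_derivative_linear_comp[of "g i" W T' z "T u"] W(5) that lT(2) inv by auto
  have mem: "z \<in> T ` A \<longleftrightarrow> T' z \<in> A" for z using inv by (metis image_iff)
  have fix': "proj S (T' z) = T' z" if "proj S z = z" for z using pr(2)[of z] that by simp
  show ?thesis unfolding regular_in_def
  proof (intro conjI exI[of _ ?W] exI[of _ "\<lambda>i z. g i (T' z)"] exI[of _ "\<lambda>i. T (v i)"] ballI impI allI)
    fix z i k assume z: "z \<in> ?W" "proj S z = z" "i < j"
    show "frechet_derivative (\<lambda>z. g i (T' z)) (at z) (T (v i)) \<noteq> 0"
      using W(7) z fix' by (simp add: fd)
    show "frechet_derivative (\<lambda>z. g i (T' z)) (at z) (T (v k)) = 0" if "k < j" "i < k"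
      using W(7) z fix' that by (simp add: fd)
  next
    show "proj S (T x) = T x" using pr(1) W(4) by simp
    show "proj S (T (v i)) = T (v i)" if "i < j" for i using pr(1) W(5) that by simp
  qed (use W o h mem inv fix' pr in auto)
qed

lemma regular_in_zero_codim:
  assumes "open W" "x \<in> W" "proj S x = x" "\<And>z. z \<in> W \<Longrightarrow> z \<in> A"
  shows "regular_in S A x 0"
  unfolding regular_in_def using assms by auto

lemma holo_on_poly_coeffs:
  fixes Q :: "complex ^ 'n \<Rightarrow> complex poly"
  assumes oW: "open W" and hol: "\<And>i. holo_on (\<lambda>z. coeff (Q z) i) W"
    and deg: "\<And>z. z \<in> W \<Longrightarrow> degree (Q z) = d"
  shows "holo_on (\<lambda>z. poly ((pderiv ^^ k) (Q z)) (z $ s)) W"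
proof -
  have "holo_on (\<lambda>z. \<Sum>i\<le>d. (pochhammer (of_nat (Suc i)) k * coeff (Q z) (i + k)) * (z $ s) ^ i) W"
    by (intro holo_on_sum holo_on_simps(2) holo_on_power holo_on_component holo_on_const hol oW)
  then show ?thesis
  proof (rule holo_on_cong)
    fix z assume z: "z \<in> W"
    have "degree ((pderiv ^^ k) (Q z)) \<le> degree (Q z)" for z
      by (induction k) (auto simp: degree_pderiv)
    then have "degree ((pderiv ^^ k) (Q z)) \<le> d" using deg[OF z] by metis
    then show "poly ((pderiv ^^ k) (Q z)) (z $ s) = (\<Sum>i\<le>d. (pochhammer (of_nat (Suc i)) k * coeff (Q z) (i + k)) * (z $ s) ^ i)"
      by (subst poly_eq_sum_le) (auto simp: coeff_higher_pderiv)
  qed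
qed

text \<open>The points of \<open>A\<close> over a regular piece of \<open>A'\<close>: where the number of distinct roots of \<open>Q\<close> is maximal, the
  roots have constant multiplicity \<open>m\<close>, and the equation \<open>\<partial>\<^sup>m\<^sup>-\<^sup>1Q = 0\<close> describes one root as a smooth function. The
  finitely many sheets cover \<open>A'\<close>, hence one of them lies in \<open>A\<close> over an open part of \<open>A'\<close>.\<close>

lemma regular_in_lift:
  fixes A A' :: "(complex ^ 'n) set" and s :: 'n
  assumes s: "s \<in> S" and D: "D = pbox s \<delta> \<epsilon>"
    and Q: "\<And>y. y \<in> D \<Longrightarrow> degree (Q y) = d" "\<And>y. y \<in> D \<Longrightarrow> coeff (Q y) d = 1"
      "\<And>i. holo_on (\<lambda>y. coeff (Q y) i) D"
    and A: "A = {z \<in> D. proj S z = z \<and> (\<forall>f\<in>F. f z = 0)}" and F: "\<And>f. f \<in> F \<Longrightarrow> holo_on f D"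
    and A'D: "\<And>y. y \<in> A' \<Longrightarrow> y \<in> D \<and> proj (S - {s}) y = y"
    and down: "\<And>z. z \<in> A \<Longrightarrow> proj (S - {s}) z \<in> A' \<and> poly (Q (proj (S - {s}) z)) (z $ s) = 0"
    and up: "\<And>y. y \<in> A' \<Longrightarrow> \<exists>w. upd s w y \<in> A"
    and inside: "\<And>y w. y \<in> D \<Longrightarrow> poly (Q y) w = 0 \<Longrightarrow> cmod w < \<epsilon>"
    and reg: "regular_in (S - {s}) A' a j"
  shows "\<exists>x. regular_in S A x (Suc j)"
proof -
  let ?S = "S - {s}"
  have oD: "open D" unfolding D by (rule open_pbox)
  obtain W g v where W: "open W" "a \<in> W" "a \<in> A'" "proj ?S a = a" "\<forall>i<j. holo_on (g i) W \<and> proj ?S (v i) = v i"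
    "\<forall>z\<in>W. proj ?S z = z \<longrightarrow> (z \<in> A' \<longleftrightarrow> (\<forall>i<j. g i z = 0))"
    "\<forall>z\<in>W. proj ?S z = z \<longrightarrow> (\<forall>i<j. frechet_derivative (g i) (at z) (v i) \<noteq> 0 \<and>
           (\<forall>k<j. i < k \<longrightarrow> frechet_derivative (g i) (at z) (v k) = 0))"
    using reg unfolding regular_in_def by blast
  define X where "X = A' \<inter> W"
  have X: "X \<subseteq> D" "a \<in> X" using A'D W(2,3) by (auto simp: X_def)
  define cr where "cr y = card {w. poly (Q y) w = 0}" for y
  have crb: "cr y \<le> d" if "y \<in> D" for y
  proof -
    have "Q y \<noteq> 0" using Q(2)[OF that] by auto
    then show ?thesis unfolding cr_def using card_poly_roots_bound[of "Q y"] Q(1)[OF that] by simp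
  qed
  have "\<exists>y0\<in>X. \<forall>y\<in>X. cr y \<le> cr y0"
  proof -
    have fin: "finite (cr ` X)" by (rule finite_subset[of _ "{..d}"]) (use crb X in auto)
    have "Max (cr ` X) \<in> cr ` X" using Max_in[OF fin] X(2) by blast
    then obtain y0 where "y0 \<in> X" "cr y0 = Max (cr ` X)" by auto
    then show ?thesis using Max_ge[OF fin] by (intro bexI[of _ y0]) auto
  qed
  then obtain y0 where y0: "y0 \<in> X" "\<And>y. y \<in> X \<Longrightarrow> cr y \<le> cr y0" by blast
  have y0D: "y0 \<in> D" using y0 X by auto
  have cont: "continuous_on D (\<lambda>y. coeff (Q y) i)" for i by (rule holo_on_continuous[OF Q(3)])
  define R0 where "R0 = {w. poly (Q y0) w = 0}"
  have finR0: "finite R0"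
  proof -
    have "Q y0 \<noteq> 0" using Q(2)[OF y0D] by auto
    then show ?thesis unfolding R0_def by (rule poly_roots_finite)
  qed
  \<comment> \<open>This keeps the discs around the roots of \<open>Q y0\<close> inside radius
    \<epsilon>, so lifted points stay in the box \<open>D\<close>.\<close>
  define e where "e = Min (insert 1 ((\<lambda>w. \<epsilon> - cmod w) ` R0))"
  have finI: "finite (insert 1 ((\<lambda>w. \<epsilon> - cmod w) ` R0))" using finR0 by simp
  have e: "e > 0" unfolding e_def using finI inside[OF y0D] by (subst Min_gr_iff) (auto simp: R0_def)
  have e_le: "e \<le> \<epsilon> - cmod \<rho>" if "\<rho> \<in> R0" for \<rho> unfolding e_def by (rule Min_le[OF finI]) (use that in auto)
  obtain \<eta> V where \<eta>: "0 < \<eta>" "\<eta> \<le> e" "open V" "y0 \<in> V" "V \<subseteq> D"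
    and inj: "\<And>y \<rho> w w'. y \<in> V \<Longrightarrow> poly (Q y0) \<rho> = 0 \<Longrightarrow> w \<in> ball \<rho> \<eta> \<Longrightarrow> w' \<in> ball \<rho> \<eta> \<Longrightarrow>
      poly ((pderiv ^^ (Polynomial.order \<rho> (Q y0) - 1)) (Q y)) w = poly ((pderiv ^^ (Polynomial.order \<rho> (Q y0) - 1)) (Q y)) w' \<Longrightarrow> w = w'"
    and nz: "\<And>y \<rho> w. y \<in> V \<Longrightarrow> poly (Q y0) \<rho> = 0 \<Longrightarrow> w \<in> ball \<rho> \<eta> \<Longrightarrow> poly ((pderiv ^^ Polynomial.order \<rho> (Q y0)) (Q y)) w \<noteq> 0"
    and ex: "\<And>y w. y \<in> X \<inter> V \<Longrightarrow> poly (Q y) w = 0 \<Longrightarrow> \<exists>\<rho>. poly (Q y0) \<rho> = 0 \<and> w \<in> ball \<rho> \<eta>"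
    and ord: "\<And>y \<rho> w. y \<in> X \<inter> V \<Longrightarrow> poly (Q y0) \<rho> = 0 \<Longrightarrow> w \<in> ball \<rho> \<eta> \<Longrightarrow> poly (Q y) w = 0 \<Longrightarrow>
      Polynomial.order w (Q y) = Polynomial.order \<rho> (Q y0)"
    and uniq: "\<And>y \<rho> w w'. y \<in> X \<inter> V \<Longrightarrow> poly (Q y0) \<rho> = 0 \<Longrightarrow> w \<in> ball \<rho> \<eta> \<Longrightarrow> w' \<in> ball \<rho> \<eta> \<Longrightarrow>
      poly (Q y) w = 0 \<Longrightarrow> poly (Q y) w' = 0 \<Longrightarrow> w = w'"
    and disj: "\<And>\<rho> \<rho>' w. poly (Q y0) \<rho> = 0 \<Longrightarrow> poly (Q y0) \<rho>' = 0 \<Longrightarrow> w \<in> ball \<rho> \<eta> \<Longrightarrow> w \<in> ball \<rho>' \<eta> \<Longrightarrow> \<rho> = \<rho>'"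
    by (rule root_tracking[OF oD X(1) y0(1) Q(1,2) cont y0(2)[unfolded cr_def] e]) (assumption | rule that)+
  have ball_eps: "cmod w < \<epsilon>" if "\<rho> \<in> R0" "w \<in> ball \<rho> \<eta>" for \<rho> w
  proof -
    have "dist \<rho> w < \<eta>" using that(2) by simp
    moreover have "cmod w \<le> cmod \<rho> + dist \<rho> w"
      using norm_triangle_ineq[of \<rho> "w - \<rho>"] by (simp add: dist_norm norm_minus_commute)
    ultimately show ?thesis using e_le[OF that(1)] \<eta>(2) by linarith
  qed
  \<comment> \<open>The points over which the sheet near the root \<rho> meets
    \<open>A\<close>.\<close>
  define B where "B \<rho> = {y. \<exists>w\<in>ball \<rho> \<eta>. upd s w y \<in> A}" for \<rho>
  have root_of: "poly (Q y) w = 0 \<and> y \<in> A'" if "upd s w y \<in> A" "proj ?S y = y" for w y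
  proof -
    have "proj ?S (upd s w y) = y"
    proof -
      have "proj ?S (upd s w y) = proj ?S y" by (auto simp: Finite_Cartesian_Product.vec_eq_iff)
      then show ?thesis using that(2) by simp
    qed
    then show ?thesis using down[OF that(1)] by simp
  qed
  have "\<exists>\<rho>\<in>R0. \<exists>W'. open W' \<and> W' \<subseteq> W \<inter> V \<and> A' \<inter> W' \<noteq> {} \<and> A' \<inter> W' \<subseteq> B \<rho>"
  proof (rule finite_closed_cover[OF finR0])
    show "open (W \<inter> V)" using W(1) \<eta>(3) by blast
    show "A' \<inter> (W \<inter> V) \<noteq> {}" using y0(1) \<eta>(4) by (auto simp: X_def)
    show "A' \<inter> (W \<inter> V) \<subseteq> (\<Union>\<rho>\<in>R0. B \<rho>)"
    proof
      fix y assume y: "y \<in> A' \<inter> (W \<inter> V)"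
      then obtain w where w: "upd s w y \<in> A" using up by blast
      then have "poly (Q y) w = 0" using root_of A'D y by blast
      then obtain \<rho> where "\<rho> \<in> R0" "w \<in> ball \<rho> \<eta>" using ex[of y w] y by (auto simp: X_def R0_def)
      then show "y \<in> (\<Union>\<rho>\<in>R0. B \<rho>)" using w unfolding B_def by blast
    qed
    fix \<rho> y assume \<rho>: "\<rho> \<in> R0" and y: "y \<in> A' \<inter> (W \<inter> V)" "y \<notin> B \<rho>"
    show "\<exists>W'. open W' \<and> y \<in> W' \<and> A' \<inter> (W \<inter> V) \<inter> W' \<inter> B \<rho> = {}"
    proof (rule ccontr)
      assume no: "\<not> ?thesis"
      have yD: "y \<in> D" using y A'D by blast
      have "\<exists>y' w'. dist y' y < 1 / real (Suc n) \<and> y' \<in> A' \<inter> (W \<inter> V) \<and> w' \<in> ball \<rho> \<eta> \<and> upd s w' y' \<in> A" for n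
      proof -
        have "A' \<inter> (W \<inter> V) \<inter> ball y (1 / real (Suc n)) \<inter> B \<rho> \<noteq> {}"
          using no[unfolded not_ex, rule_format, of "ball y (1 / real (Suc n))"] by auto
        then show ?thesis unfolding B_def by (auto simp: dist_commute)
      qed
      \<comment> \<open>Relative closedness of \<open>B \<rho>\<close>: a subsequence of the roots
        converges in the closed disc, and the limit is a root over \<open>y\<close>. It lies in one
        of the open discs, which by disjointness must be the one of \<rho>; the equations of
        \<open>A\<close> pass to the limit.\<close>
      then obtain ys ws where yw: "\<And>n. dist (ys n) y < 1 / real (Suc n)" "\<And>n. ys n \<in> A' \<inter> (W \<inter> V)"
        "\<And>n. ws n \<in> ball \<rho> \<eta>" "\<And>n. upd s (ws n) (ys n) \<in> A" by metis
      have ylim: "ys \<longlonglongrightarrow> y"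
        unfolding tendsto_iff
      proof (intro allI impI)
        fix e :: real assume "e > 0"
        then obtain N where "1 / real (Suc N) < e" using nat_approx_posE by blast
        then show "\<forall>\<^sub>F n in sequentially. dist (ys n) y < e"
          unfolding eventually_sequentially
        proof (intro exI[of _ N] allI impI)
          fix n assume "1 / real (Suc N) < e" "N \<le> n"
          have "dist (ys n) y < 1 / real (Suc n)" by (rule yw(1))
          also have "\<dots> \<le> 1 / real (Suc N)" using \<open>N \<le> n\<close> by (simp add: frac_le)
          finally show "dist (ys n) y < e" using \<open>1 / real (Suc N) < e\<close> by simp
        qed
      qed
      have "\<forall>n. ws n \<in> cball \<rho> \<eta>" using yw(3) by (auto simp: less_imp_le)
      then obtain w \<sigma> where w: "w \<in> cball \<rho> \<eta>" "strict_mono \<sigma>" "(ws \<circ> \<sigma>) \<longlonglongrightarrow> w"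
        using compact_cball[of \<rho> \<eta>] unfolding compact_def by blast
      have ylim': "(ys \<circ> \<sigma>) \<longlonglongrightarrow> y" by (rule LIMSEQ_subseq_LIMSEQ[OF ylim w(2)])
      have roots: "poly (Q (ys n)) (ws n) = 0" for n
        using root_of[OF yw(4)] A'D yw(2) by blast
      have pl: "(\<lambda>n. (\<lambda>(y, w). poly ((pderiv ^^ 0) (Q y)) w) ((ys \<circ> \<sigma>) n, (ws \<circ> \<sigma>) n)) \<longlonglongrightarrow>
        (\<lambda>(y, w). poly ((pderiv ^^ 0) (Q y)) w) (y, w)"
      proof (rule continuous_on_tendsto_compose[OF continuous_on_poly_pderiv[OF cont Q(1)]])
        show "(\<lambda>n. ((ys \<circ> \<sigma>) n, (ws \<circ> \<sigma>) n)) \<longlonglongrightarrow> (y, w)" by (intro tendsto_Pair ylim' w(3))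
        show "\<forall>\<^sub>F n in sequentially. ((ys \<circ> \<sigma>) n, (ws \<circ> \<sigma>) n) \<in> D \<times> UNIV"
          using yw(2) A'D by (intro always_eventually) auto
      qed (use yD in auto)
      then have "(\<lambda>n. 0) \<longlonglongrightarrow> poly (Q y) w" by (simp add: roots)
      then have wroot: "poly (Q y) w = 0" using LIMSEQ_unique tendsto_const by blast
      obtain \<rho>' where \<rho>': "poly (Q y0) \<rho>' = 0" "w \<in> ball \<rho>' \<eta>"
        using ex[OF _ wroot] y(1) by (auto simp: X_def)
      have "\<forall>\<^sub>F n in sequentially. (ws \<circ> \<sigma>) n \<in> ball \<rho>' \<eta>"
        using topological_tendstoD[OF w(3) open_ball \<rho>'(2)] .
      then obtain n where "ws (\<sigma> n) \<in> ball \<rho>' \<eta>" unfolding eventually_sequentially by auto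
      then have "\<rho> = \<rho>'" using disj[OF _ \<rho>'(1) yw(3)] \<rho> by (auto simp: R0_def)
      then have wb: "w \<in> ball \<rho> \<eta>" using \<rho>'(2) by simp
      have uD: "upd s w y \<in> D" using upd_in_pbox[of y s \<delta> \<epsilon> w \<epsilon>] yD ball_eps[OF \<rho> wb] by (simp add: D)
      have ulim: "(\<lambda>n. upd s ((ws \<circ> \<sigma>) n) ((ys \<circ> \<sigma>) n)) \<longlonglongrightarrow> upd s w y"
      proof -
        have "(\<lambda>n. upd s ((ws \<circ> \<sigma>) n) ((ys \<circ> \<sigma>) n) $ i) \<longlonglongrightarrow> upd s w y $ i" for i
          using w(3)[unfolded comp_def] tendsto_vec_nth[OF ylim', of i] by (cases "i = s") auto
        then show ?thesis by (rule vec_tendstoI)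
      qed
      have "f (upd s w y) = 0" if f: "f \<in> F" for f
      proof -
        have "(\<lambda>n. f (upd s ((ws \<circ> \<sigma>) n) ((ys \<circ> \<sigma>) n))) \<longlonglongrightarrow> f (upd s w y)"
          by (rule continuous_on_tendsto_compose[OF holo_on_continuous[OF F[OF f]] ulim uD])
            (use yw(4) in \<open>auto simp: A\<close>)
        moreover have "f (upd s ((ws \<circ> \<sigma>) n) ((ys \<circ> \<sigma>) n)) = 0" for n using yw(4)[of "\<sigma> n"] f by (auto simp: A)
        ultimately have "(\<lambda>n. 0) \<longlonglongrightarrow> f (upd s w y)" by simp
        then show ?thesis using LIMSEQ_unique tendsto_const by blast
      qed
      moreover have "proj S (upd s w y) = upd s w y"
      proof -
        have y0: "y $ i = 0" if "i \<notin> S" for i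
        proof -
          have "proj ?S y = y" using A'D[of y] y(1) by blast
          then have "y $ i = proj ?S y $ i" by simp
          then show ?thesis using that by simp
        qed
        then show ?thesis using s by (auto simp: Finite_Cartesian_Product.vec_eq_iff)
      qed
      ultimately have "upd s w y \<in> A" using uD by (simp add: A)
      then show False using y(2) wb unfolding B_def by blast
    qed
  qed
  then obtain \<rho> W' where \<rho>: "\<rho> \<in> R0" and W': "open W'" "W' \<subseteq> W \<inter> V" "A' \<inter> W' \<noteq> {}" "A' \<inter> W' \<subseteq> B \<rho>" by blast
  have \<rho>0: "poly (Q y0) \<rho> = 0" using \<rho> by (simp add: R0_def)
  define m where "m = Polynomial.order \<rho> (Q y0)"
  have m: "m \<noteq> 0"
  proof -
    have "Q y0 \<noteq> 0" using Q(2)[OF y0D] by auto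
    then show ?thesis using \<rho>0 by (simp add: m_def order_root)
  qed
  let ?p = "proj ?S"
  define Wn where "Wn = D \<inter> ?p -` W' \<inter> (\<lambda>z. z $ s) -` ball \<rho> \<eta>"
  have oWn: "open Wn" unfolding Wn_def
    by (intro open_Int oD open_vimage W'(1) open_ball clin_continuous[OF clin_proj]
        bounded_linear.continuous_on[OF bounded_linear_component] continuous_on_id)
  have pD: "?p z \<in> D" if "?p z \<in> W'" for z using that W'(2) \<eta>(5) by auto
  \<comment> \<open>If \<open>m > 1\<close>, the polynomial itself has zero derivative in
    \<open>w\<close> along the sheet. Its derivative of order \<open>m - 1\<close> has a simple zero
    there, and by \<open>inj\<close> no other zero in the disc.\<close>
  define h where "h z = poly ((pderiv ^^ (m - 1)) (Q (?p z))) (z $ s)" for z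
  have hol_p: "holo_on (\<lambda>z. f (?p z)) Wn" if "holo_on f U" "W' \<subseteq> U" for f U
    using holo_on_compose_linear[OF that(1) oWn, of 0 ?p] clin_proj[of ?S] that(2)
    by (auto simp: clin_def Wn_def)
  have hh: "holo_on h Wn" unfolding h_def
  proof (rule holo_on_poly_coeffs[OF oWn])
    show "holo_on (\<lambda>z. coeff (Q (?p z)) i) Wn" for i by (rule hol_p[OF Q(3)]) (use W'(2) \<eta>(5) in auto)
    show "degree (Q (?p z)) = d" if "z \<in> Wn" for z by (rule Q(1)) (use that pD in \<open>auto simp: Wn_def\<close>)
  qed
  have rec: "z = upd s (z $ s) (?p z)" if "proj S z = z" for z
  proof -
    have "z $ i = proj S z $ i" for i using that by simp
    then have "z $ i = 0" if "i \<notin> S" for i using that by (metis proj_nth)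
    then show ?thesis by (auto simp: Finite_Cartesian_Product.vec_eq_iff)
  qed
  have pp: "proj ?S (?p z) = ?p z" for z by simp
  have root_ord: "poly ((pderiv ^^ (m - 1)) (Q y)) w = 0"
    if y: "y \<in> A'" "y \<in> W'" and w: "w \<in> ball \<rho> \<eta>" "poly (Q y) w = 0" for y w
  proof -
    have yX: "y \<in> X \<inter> V" using y W'(2) by (auto simp: X_def)
    have "Q y \<noteq> 0" using Q(2)[of y] yX X(1) by auto
    moreover have "Polynomial.order w (Q y) = m" using ord[OF yX \<rho>0 w] by (simp add: m_def)
    ultimately show ?thesis using order_higher_pderiv[of "Q y" w m] m by simp
  qed
  have mem: "z \<in> A \<longleftrightarrow> (\<forall>i<j. g i (?p z) = 0) \<and> h z = 0" if z: "z \<in> Wn" "proj S z = z" for z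
  proof -
    have zW: "?p z \<in> W'" "?p z \<in> W" "?p z \<in> V" "z $ s \<in> ball \<rho> \<eta>" "z \<in> D"
      using z(1) W'(2) by (auto simp: Wn_def)
    have memA': "?p z \<in> A' \<longleftrightarrow> (\<forall>i<j. g i (?p z) = 0)" using W(6) zW(2) pp by blast
    show ?thesis
    proof
      assume "z \<in> A"
      then have "?p z \<in> A'" "poly (Q (?p z)) (z $ s) = 0" using down by auto
      then show "(\<forall>i<j. g i (?p z) = 0) \<and> h z = 0"
        using memA' root_ord[OF _ zW(1,4)] by (simp add: h_def)
    next
      assume *: "(\<forall>i<j. g i (?p z) = 0) \<and> h z = 0"
      then have yA: "?p z \<in> A'" using memA' by blast
      then have "?p z \<in> B \<rho>" using W'(4) zW(1) by blast
      then obtain w where w: "w \<in> ball \<rho> \<eta>" "upd s w (?p z) \<in> A" by (auto simp: B_def)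
      have "poly (Q (?p z)) w = 0" using root_of[OF w(2) pp] by blast
      then have "poly ((pderiv ^^ (m - 1)) (Q (?p z))) w = 0" by (rule root_ord[OF yA zW(1) w(1)])
      then have "w = z $ s"
        using inj[OF zW(3) \<rho>0 w(1) zW(4)] * by (simp add: m_def h_def)
      then show "z \<in> A" using w(2) rec[OF z(2)] by simp
    qed
  qed
  obtain y1 where y1: "y1 \<in> A'" "y1 \<in> W'" using W'(3) by blast
  obtain w1 where w1: "w1 \<in> ball \<rho> \<eta>" "upd s w1 y1 \<in> A" using W'(4) y1 by (auto simp: B_def)
  define x where "x = upd s w1 y1"
  have py1: "?p y1 = y1" using A'D[OF y1(1)] by blast
  have px: "?p x = y1"
  proof -
    have "proj ?S x = proj ?S y1" by (auto simp: x_def Finite_Cartesian_Product.vec_eq_iff)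
    then show ?thesis using py1 by simp
  qed
  have xA: "x \<in> A" "proj S x = x" "x \<in> D" using w1(2) by (auto simp: x_def A)
  have xW: "x \<in> Wn" using xA(3) px y1(2) w1(1) by (auto simp: Wn_def x_def)
  \<comment> \<open>The new equation and the new direction come last: the old equations do not
    depend on the coordinate \<open>s\<close>, so their derivatives along it vanish and the matrix
    stays triangular.\<close>
  define G where "G i = (if i < j then (\<lambda>z. g i (?p z)) else h)" for i
  define u where "u i = (if i < j then v i else axis s 1)" for i
  have Gh: "holo_on (G i) Wn" for i
    using hol_p[of "g i" W] W(5) W'(2) hh by (auto simp: G_def)
  have us: "proj S (u i) = u i" if "i < Suc j" for i
  proof (cases "i < j")
    case True
    then have "proj S (proj ?S (v i)) = proj ?S (v i)" by (simp add: Int_absorb1 Diff_subset)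
    then show ?thesis using True W(5) by (simp add: u_def)
  next
    case False
    then show ?thesis using s by (auto simp: u_def Finite_Cartesian_Product.vec_eq_iff axis_def)
  qed
  have pax: "?p (axis s 1) = 0" by (auto simp: Finite_Cartesian_Product.vec_eq_iff axis_def)
  have fd: "frechet_derivative (\<lambda>z. g i (?p z)) (at z) b = frechet_derivative (g i) (at (?p z)) (?p b)"
    if "i < j" "z \<in> Wn" for i z b
    by (rule frechet_derivative_linear_comp[of "g i" W ?p z b]) (use that W(5) W'(2) in \<open>auto simp: Wn_def\<close>)
  have fd0: "frechet_derivative (g i) (at (?p z)) 0 = 0" if "i < j" "z \<in> Wn" for i z
  proof -
    have "?p z \<in> W" using that W'(2) by (auto simp: Wn_def)
    then show ?thesis
      using holo_on_frechet(1)[of "g i" W "?p z"] W(5) that(1) linear_0[OF has_derivative_linear] by blast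
  qed
  have dh: "frechet_derivative h (at z) (axis s 1) \<noteq> 0" if z: "z \<in> Wn" for z
  proof -
    have zV: "?p z \<in> V" "z $ s \<in> ball \<rho> \<eta>" using z W'(2) by (auto simp: Wn_def)
    have "((\<lambda>t. h (z + t *s axis s 1)) has_field_derivative frechet_derivative h (at z) (axis s 1)) (at 0)"
      by (rule holo_line_deriv) (use holo_on_frechet[OF hh z] in auto)
    moreover have "((\<lambda>t. h (z + t *s axis s 1)) has_field_derivative
      poly (pderiv ((pderiv ^^ (m - 1)) (Q (?p z)))) (z $ s)) (at 0)"
    proof -
      have "?p (z + t *s axis s 1) = ?p z" "(z + t *s axis s 1) $ s = z $ s + t" for t
        by (auto simp: Finite_Cartesian_Product.vec_eq_iff axis_def)
      then have eq: "h (z + t *s axis s 1) = poly ((pderiv ^^ (m - 1)) (Q (?p z))) (z $ s + t)" for t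
        unfolding h_def by simp
      have "((\<lambda>t. z $ s + t) has_field_derivative 1) (at 0)" by (auto intro!: derivative_eq_intros)
      from DERIV_chain2[OF poly_DERIV this]
      show ?thesis unfolding eq by simp
    qed
    ultimately have "frechet_derivative h (at z) (axis s 1) = poly (pderiv ((pderiv ^^ (m - 1)) (Q (?p z)))) (z $ s)"
      by (rule DERIV_unique)
    also have "pderiv ((pderiv ^^ (m - 1)) (Q (?p z))) = (pderiv ^^ m) (Q (?p z))"
      using m by (metis Suc_diff_1 bot_nat_0.not_eq_extremum comp_apply funpow.simps(2))
    finally show ?thesis using nz[OF zV(1) \<rho>0 zV(2)] by (simp add: m_def)
  qed
  have "regular_in S A x (Suc j)"
    unfolding regular_in_def
  proof (intro conjI exI[of _ Wn] exI[of _ G] exI[of _ u] ballI impI allI)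
    show "z \<in> A \<longleftrightarrow> (\<forall>i<Suc j. G i z = 0)" if "z \<in> Wn" "proj S z = z" for z
      unfolding mem[OF that] by (auto simp: G_def less_Suc_eq)
  next
    fix z i assume z: "z \<in> Wn" "proj S z = z" and i: "i < Suc j"
    have pz: "?p z \<in> W" using z(1) W'(2) by (auto simp: Wn_def)
    have tri: "frechet_derivative (g i) (at (?p z)) (v i) \<noteq> 0 \<and>
      (\<forall>k<j. i < k \<longrightarrow> frechet_derivative (g i) (at (?p z)) (v k) = 0)" if "i < j"
      using W(7) pz pp that by blast
    have pv: "?p (v k) = v k" if "k < j" for k using W(5) that by blast
    show "frechet_derivative (G i) (at z) (u i) \<noteq> 0"
    proof (cases "i < j")
      case True
      then show ?thesis using tri pv by (simp add: G_def u_def fd[OF _ z(1)])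
    next
      case False
      then show ?thesis using dh[OF z(1)] by (simp add: G_def u_def)
    qed
    fix k assume k: "k < Suc j" "i < k"
    then have ij: "i < j" by simp
    show "frechet_derivative (G i) (at z) (u k) = 0"
    proof (cases "k < j")
      case True
      then show ?thesis using tri[OF ij] pv k ij by (simp add: G_def u_def fd[OF _ z(1)])
    next
      case False
      then show ?thesis using ij by (simp add: G_def u_def fd[OF _ z(1)] pax fd0[OF ij z(1)])
    qed
  qed (use xA xW oWn Gh us in auto)
  then show ?thesis by blast
qed


section \<open>Regular sequences in the ideal of an analytic set\<close>

lemma hfun_sum: "finite A \<Longrightarrow> eventually (\<lambda>z. hfun (\<Sum>i\<in>A. a i) z = (\<Sum>i\<in>A. hfun (a i) z)) (nhds 0)"
proof (induction A rule: finite_induct)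
  case empty
  then show ?case using hfun_ops(5) by simp
next
  case (insert i A)
  then show ?case using eventually_conj[OF insert.IH hfun_ops(1)[of "a i" "\<Sum>i\<in>A. a i"]]
    by (auto elim: eventually_mono)
qed

lemma hfun_prod: "finite A \<Longrightarrow> eventually (\<lambda>z. hfun (\<Prod>i\<in>A. a i) z = (\<Prod>i\<in>A. hfun (a i) z)) (nhds 0)"
proof (induction A rule: finite_induct)
  case empty
  then show ?case using hfun_ops(6) by simp
next
  case (insert i A)
  then show ?case using eventually_conj[OF insert.IH hfun_ops(3)[of "a i" "\<Prod>i\<in>A. a i"]]
    by (auto elim: eventually_mono)
qed

lemma hfun_power: "eventually (\<lambda>z. hfun (a ^ k) z = hfun a z ^ k) (nhds 0)"
  using hfun_prod[of "{..<k}" "\<lambda>_. a"] by simp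

lemma hfun_det:
  fixes M :: "('n::finite) hg Matrix.mat"
  assumes M: "M \<in> carrier_mat d d"
  shows "eventually (\<lambda>z. hfun (Determinant.det M) z = Determinant.det (Matrix.mat d d (\<lambda>(i, j). hfun (M $$ (i, j)) z))) (nhds 0)"
proof -
  let ?P = "{q. q permutes {0..<d}}"
  have fin: "finite ?P" by (simp add: finite_permutations)
  have d: "Determinant.det M = (\<Sum>q\<in>?P. signof q * (\<Prod>i = 0..<d. M $$ (i, q i)))"
    by (rule det_def'[OF M])
  have "eventually (\<lambda>z. \<forall>q\<in>?P. hfun (signof q * (\<Prod>i = 0..<d. M $$ (i, q i))) z = signof q * (\<Prod>i = 0..<d. hfun (M $$ (i, q i)) z)) (nhds 0)"
  proof (rule eventually_ball_finite[OF fin], rule ballI)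
    fix q
    have sg: "eventually (\<lambda>z. hfun (signof q :: 'n hg) z = signof q) (nhds 0)"
    proof (cases "sign q = 1")
      case True
      then show ?thesis using hfun_ops(6) by (simp add: sign_def)
    next
      case False
      then have "sign q = -1" by (simp add: sign_def split: if_splits)
      moreover have "eventually (\<lambda>z. hfun (- 1 :: 'n hg) z = - 1) (nhds 0)"
        using eventually_conj[OF hfun_ops(4)[of "1 :: 'n hg"] hfun_ops(6)] by (auto elim: eventually_mono)
      ultimately show ?thesis by simp
    qed
    from eventually_conj[OF sg eventually_conj[OF hfun_ops(3)[of "signof q" "\<Prod>i = 0..<d. M $$ (i, q i)"]
        hfun_prod[of "{0..<d}" "\<lambda>i. M $$ (i, q i)"]]]
    show "eventually (\<lambda>z. hfun (signof q * (\<Prod>i = 0..<d. M $$ (i, q i))) z = signof q * (\<Prod>i = 0..<d. hfun (M $$ (i, q i)) z)) (nhds 0)"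
      by (auto elim: eventually_mono)
  qed
  from eventually_conj[OF this hfun_sum[OF fin, of "\<lambda>q. signof q * (\<Prod>i = 0..<d. M $$ (i, q i))"]]
  show ?thesis
  proof (rule eventually_mono)
    fix z
    assume *: "(\<forall>q\<in>?P. hfun (signof q * (\<Prod>i = 0..<d. M $$ (i, q i))) z = signof q * (\<Prod>i = 0..<d. hfun (M $$ (i, q i)) z)) \<and>
      hfun (\<Sum>q\<in>?P. signof q * (\<Prod>i = 0..<d. M $$ (i, q i))) z = (\<Sum>q\<in>?P. hfun (signof q * (\<Prod>i = 0..<d. M $$ (i, q i))) z)"
    let ?m = "Matrix.mat d d (\<lambda>(i, j). hfun (M $$ (i, j)) z)"
    have "Determinant.det ?m = (\<Sum>q\<in>?P. signof q * (\<Prod>i = 0..<d. ?m $$ (i, q i)))"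
      by (rule det_def') simp
    also have "\<dots> = (\<Sum>q\<in>?P. signof q * (\<Prod>i = 0..<d. hfun (M $$ (i, q i)) z))"
      by (intro sum.cong prod.cong arg_cong2[of _ _ _ _ "(*)"] refl) (auto simp: permutes_in_image)
    also have "\<dots> = hfun (Determinant.det M) z" unfolding d using * by simp
    finally show "hfun (Determinant.det M) z = Determinant.det ?m" by simp
  qed
qed

lemma gidl_vanish:
  "a \<in> gidl F \<Longrightarrow> eventually (\<lambda>z. (\<forall>f\<in>F. hfun f z = 0) \<longrightarrow> hfun a z = 0) (nhds 0)"
proof (induction rule: gidl.induct)
  case zero
  show ?case using hfun_ops(5) by (auto elim: eventually_mono)
next
  case (add a x c)
  from eventually_conj[OF add.IH eventually_conj[OF hfun_ops(1)[of a "c * x"] hfun_ops(3)[of c x]]] add.hyps(2)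
  show ?case by (auto elim: eventually_mono)
qed

section \<open>Polynomial facts behind the elimination step\<close>

lemma holo_at_eventually: "holo_at f x \<Longrightarrow> eventually (holo_at f) (nhds x)"
  unfolding holo_at_def using holo_on_open by (metis (mono_tags, lifting) eventually_nhds)

lemma holo_on_of_at: "open U \<Longrightarrow> (\<And>z. z \<in> U \<Longrightarrow> holo_at f z) \<Longrightarrow> holo_on f U"
  by (rule holo_on_local) (auto simp: holo_at_def)

text \<open>Linear factors of \<open>Q\<close> are removed one by one. At a root the factor
  \<open>g\<close> is nonzero, so \<open>V\<close> vanishes too; after cancelling the common factor,
  the identity holds off the root and extends to it by continuity.\<close>

lemma poly_dvd_of_quotient:
  fixes V Q :: "complex poly"
  assumes "Q \<noteq> 0" and B: "open B" "continuous_on B g" "continuous_on B h"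
    and "\<And>w. w \<in> B \<Longrightarrow> poly V w * g w = h w * poly Q w"
    and "\<And>w. poly Q w = 0 \<Longrightarrow> w \<in> B \<and> g w \<noteq> 0"
  shows "Q dvd V"
  using assms(1,5,6)
proof (induction "degree Q" arbitrary: Q V)
  case 0
  then show ?case by (metis is_unit_iff_degree unit_imp_dvd)
next
  case (Suc n)
  then obtain \<rho> where \<rho>: "poly Q \<rho> = 0"
    using fundamental_theorem_of_algebra constant_degree by (metis Zero_not_Suc)
  then obtain Q1 where Q1: "Q = [:- \<rho>, 1:] * Q1" by (auto simp: poly_eq_0_iff_dvd elim: dvdE)
  have \<rho>B: "\<rho> \<in> B" "g \<rho> \<noteq> 0" using Suc.prems(3)[OF \<rho>] by auto
  then have "poly V \<rho> = 0" using Suc.prems(2)[of \<rho>] \<rho> by simp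
  then obtain V1 where V1: "V = [:- \<rho>, 1:] * V1" by (auto simp: poly_eq_0_iff_dvd elim: dvdE)
  let ?d = "\<lambda>w. poly V1 w * g w - h w * poly Q1 w"
  have off: "?d w = 0" if "w \<in> B" "w \<noteq> \<rho>" for w
  proof -
    have "(w - \<rho>) * ?d w = 0" using Suc.prems(2)[OF that(1)] unfolding Q1 V1 by (simp add: algebra_simps)
    then show ?thesis using that(2) by simp
  qed
  have "continuous_on B ?d" by (intro continuous_intros B(2,3))
  then have "isCont ?d \<rho>" using B(1) \<rho>B(1) continuous_on_eq_continuous_at by blast
  then have "(?d \<longlongrightarrow> ?d \<rho>) (at \<rho>)" by (simp add: isCont_def)
  moreover have "(?d \<longlongrightarrow> 0) (at \<rho>)"
  proof (rule tendsto_eventually)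
    have "eventually (\<lambda>w. w \<in> B) (at \<rho>)" using B(1) \<rho>B(1) eventually_at_topological by blast
    moreover have "eventually (\<lambda>w. w \<noteq> \<rho>) (at \<rho>)" by (simp add: eventually_at_filter)
    ultimately show "eventually (\<lambda>w. ?d w = 0) (at \<rho>)" by eventually_elim (rule off)
  qed
  ultimately have at: "?d \<rho> = 0" using LIM_unique by blast
  have Q1nz: "Q1 \<noteq> 0" using Suc.prems(1) Q1 by auto
  have "Q1 dvd V1"
  proof (rule Suc.hyps(1)[OF _ Q1nz])
    have "degree Q = Suc (degree Q1)" unfolding Q1 using Q1nz by (subst degree_mult_eq) auto
    then show "n = degree Q1" using Suc.hyps(2) by simp
    show "poly V1 w * g w = h w * poly Q1 w" if "w \<in> B" for w
      using off[OF that] at by (cases "w = \<rho>") auto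
    show "w \<in> B \<and> g w \<noteq> 0" if "poly Q1 w = 0" for w using Suc.prems(3)[of w] that Q1 by simp
  qed
  then show ?case unfolding Q1 V1 by (rule mult_dvd_mono[OF dvd_refl])
qed

text \<open>At a point that is not a common zero the combinations are the values of a nonzero
  polynomial in \<open>c\<close>, which has at most \<open>l\<close> roots. With at most
  \<open>d\<close> points, \<open>d * l + 1\<close> values of \<open>c\<close> cannot all be
  served.\<close>

lemma common_root_of_combinations:
  fixes f :: "nat \<Rightarrow> 'a \<Rightarrow> complex"
  assumes R: "finite R" "card R \<le> d"
    and G: "\<And>c :: nat. c \<le> d * l \<Longrightarrow> \<exists>w\<in>R. (\<Sum>k<l. of_nat c ^ k * f k w) = 0"
  shows "\<exists>w\<in>R. \<forall>k<l. f k w = 0"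
proof (rule ccontr)
  assume no: "\<not> ?thesis"
  define pp where "pp w = (\<Sum>k<l. monom (f k w) k)" for w
  have ev: "poly (pp w) t = (\<Sum>k<l. t ^ k * f k w)" for w t
    by (simp add: pp_def poly_sum poly_monom mult.commute)
  have cf: "coeff (pp w) k = f k w" if "k < l" for w k
    using that by (simp add: pp_def coeff_sum if_distrib cong: if_cong)
  have nz: "pp w \<noteq> 0" if w: "w \<in> R" for w
  proof
    assume "pp w = 0"
    then have "f k w = 0" if "k < l" for k using cf[OF that, of w] by simp
    then show False using no w by blast
  qed
  have "degree (pp w) \<le> l" for w
    unfolding pp_def by (rule degree_sum_le) (auto intro: order.trans[OF degree_monom_le])
  then have cb: "card {t. poly (pp w) t = 0} \<le> l" if "w \<in> R" for w
    using card_poly_roots_bound[OF nz[OF that]] order.trans by blast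
  have "(of_nat :: nat \<Rightarrow> complex) ` {..d * l} \<subseteq> (\<Union>w\<in>R. {t. poly (pp w) t = 0})"
    using G by (fastforce simp: ev)
  then have "card ((of_nat :: nat \<Rightarrow> complex) ` {..d * l}) \<le> card (\<Union>w\<in>R. {t. poly (pp w) t = 0})"
    by (rule card_mono[rotated]) (use R(1) nz poly_roots_finite in auto)
  also have "\<dots> \<le> (\<Sum>w\<in>R. card {t. poly (pp w) t = 0})" by (rule card_UN_le[OF R(1)])
  also have "\<dots> \<le> card R * l" using sum_bounded_above[of R _ l] cb by (simp add: mult.commute)
  also have "\<dots> \<le> d * l" using R(2) by simp
  finally have "card ((of_nat :: nat \<Rightarrow> complex) ` {..d * l}) \<le> d * l" .
  moreover have "card ((of_nat :: nat \<Rightarrow> complex) ` {..d * l}) = d * l + 1"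
    by (subst card_image) (auto simp: inj_on_def)
  ultimately show False by simp
qed

text \<open>\<open>m\<close> is the matrix of the multiplication by \<open>g\<close> modulo \<open>Q\<close>. A vector in the kernel of its transpose is a polynomial
  \<open>V\<close> of degree less than \<open>d\<close> with \<open>V g\<close> divisible by \<open>Q\<close>.\<close>

lemma root_of_singular_multiplication:
  fixes m :: "complex Matrix.mat" and Q :: "complex poly"
  assumes m: "m \<in> carrier_mat d d" "Determinant.det m = 0" and Q: "degree Q = d" "Q \<noteq> 0"
    and B: "open B" "continuous_on B g" "\<And>k. k < d \<Longrightarrow> continuous_on B (y k)"
    and eq: "\<And>k w. k < d \<Longrightarrow> w \<in> B \<Longrightarrow> g w * w ^ k = (\<Sum>l<d. m $$ (k, l) * w ^ l) + y k w * poly Q w"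
    and roots: "\<And>w. poly Q w = 0 \<Longrightarrow> w \<in> B"
  shows "\<exists>w. poly Q w = 0 \<and> g w = 0"
proof (rule ccontr)
  assume no: "\<not> ?thesis"
  have "Determinant.det (transpose_mat m) = 0" using det_transpose[OF m(1)] m(2) by simp
  then obtain v where v: "v \<in> carrier_vec d" "v \<noteq> 0\<^sub>v d" "transpose_mat m *\<^sub>v v = 0\<^sub>v d"
    using det_0_iff_vec_prod_zero[of "transpose_mat m" d] m(1) by auto
  have ker: "(\<Sum>k<d. vec_index v k * m $$ (k, l)) = 0" if l: "l < d" for l
  proof -
    have "vec_index (transpose_mat m *\<^sub>v v) l = (\<Sum>k<d. vec_index v k * m $$ (k, l))"
      using l m(1) v(1) by (simp add: scalar_prod_def mult.commute lessThan_atLeast0)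
    then show ?thesis using v(3) l by simp
  qed
  define V where "V = (\<Sum>k<d. monom (vec_index v k) k)"
  have cf: "coeff V k = vec_index v k" if "k < d" for k
    using that by (simp add: V_def coeff_sum if_distrib cong: if_cong)
  have "\<exists>k<d. vec_index v k \<noteq> 0"
  proof (rule ccontr)
    assume "\<not> ?thesis"
    then have "v = 0\<^sub>v d" using v(1) by (intro eq_vecI) auto
    then show False using v(2) by simp
  qed
  then obtain k0 where k0: "k0 < d" "vec_index v k0 \<noteq> 0" by blast
  have Vnz: "V \<noteq> 0" using cf[OF k0(1)] k0(2) by auto
  have Vdeg: "degree V < d"
  proof -
    have "degree V \<le> d - 1"
      unfolding V_def by (rule degree_sum_le) (auto intro: order.trans[OF degree_monom_le])
    then show ?thesis using k0(1) by simp
  qed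
  have "Q dvd V"
  proof (rule poly_dvd_of_quotient[OF Q(2) B(1,2)])
    show "continuous_on B (\<lambda>w. \<Sum>k<d. vec_index v k * y k w)"
      using B(3) by (intro continuous_intros) auto
    fix w assume w: "w \<in> B"
    have "poly V w * g w = (\<Sum>k<d. vec_index v k * (g w * w ^ k))"
      unfolding V_def poly_sum poly_monom sum_distrib_right by (intro sum.cong refl) (simp add: mult_ac)
    also have "\<dots> = (\<Sum>k<d. vec_index v k * ((\<Sum>l<d. m $$ (k, l) * w ^ l) + y k w * poly Q w))"
      by (intro sum.cong refl arg_cong2[of _ _ _ _ "(*)"] eq w) simp
    also have "\<dots> = (\<Sum>k<d. vec_index v k * (\<Sum>l<d. m $$ (k, l) * w ^ l)) + (\<Sum>k<d. vec_index v k * y k w) * poly Q w"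
      by (simp add: distrib_left sum.distrib sum_distrib_right mult.assoc)
    also have "(\<Sum>k<d. vec_index v k * (\<Sum>l<d. m $$ (k, l) * w ^ l)) = (\<Sum>l<d. (\<Sum>k<d. vec_index v k * m $$ (k, l)) * w ^ l)"
      unfolding sum_distrib_left sum_distrib_right by (subst sum.swap) (simp add: mult_ac)
    also have "\<dots> = 0" using ker by simp
    finally show "poly V w * g w = (\<Sum>k<d. vec_index v k * y k w) * poly Q w" by simp
  qed (use no roots in blast)
  then show False using dvd_imp_degree_le[OF _ Vnz] Vdeg Q(1) by fastforce
qed

text \<open>For w of modulus at least \<epsilon>, where \<epsilon> is at most 1, each product |w|^k
  \<epsilon>^d with k < d is at most |w|^d. The lower terms together are then strictly smaller than
  the leading one.\<close>

lemma small_coefficients_small_roots: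
  fixes p :: "nat \<Rightarrow> complex"
  assumes "w ^ d + (\<Sum>k<d. p k * w ^ k) = 0" and \<epsilon>: "0 < \<epsilon>" "\<epsilon> \<le> 1" and d: "d > 0"
    and p: "\<And>k. k < d \<Longrightarrow> cmod (p k) < \<epsilon> ^ d / of_nat d"
  shows "cmod w < \<epsilon>"
proof (rule ccontr)
  assume "\<not> ?thesis"
  then have ge: "\<epsilon> \<le> cmod w" by simp
  then have wpos: "cmod w > 0" using \<epsilon>(1) by linarith
  have le: "cmod w ^ k * \<epsilon> ^ d \<le> cmod w ^ d" if "k < d" for k
  proof -
    have "cmod w ^ k * \<epsilon> ^ d = cmod w ^ k * (\<epsilon> ^ k * \<epsilon> ^ (d - k))" using that by (simp flip: power_add)
    also have "\<dots> \<le> cmod w ^ k * (1 * cmod w ^ (d - k))"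
      using \<epsilon> ge by (intro mult_left_mono mult_mono power_mono power_le_one) auto
    also have "\<dots> = cmod w ^ d" using that by (simp flip: power_add)
    finally show ?thesis .
  qed
  have "cmod w ^ d = cmod (\<Sum>k<d. p k * w ^ k)"
    using assms(1) by (metis add_eq_0_iff norm_minus_cancel norm_power)
  also have "\<dots> \<le> (\<Sum>k<d. cmod (p k) * cmod w ^ k)"
    by (rule order.trans[OF norm_sum]) (simp add: norm_mult norm_power)
  also have "\<dots> < (\<Sum>k<d. \<epsilon> ^ d / of_nat d * cmod w ^ k)"
    using d p wpos by (intro sum_strict_mono mult_strict_right_mono) auto
  also have "\<dots> \<le> (\<Sum>k<d. cmod w ^ d / of_nat d)"
    using le by (intro sum_mono) (auto simp: mult.commute divide_right_mono)
  also have "\<dots> = cmod w ^ d" using d by simp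
  finally show False by simp
qed

text \<open>The ideal of \<open>F\<close> contains a regular sequence whose length is the codimension of the zero set at
  some regular points arbitrarily close to the origin.\<close>

definition attains_codim :: "'n::finite set \<Rightarrow> 'n hg set \<Rightarrow> bool" where
  "attains_codim S F \<longleftrightarrow> (\<exists>xs. set xs \<subseteq> hO S \<and> set xs \<subseteq> gidl F \<and> pow_regseq xs \<and>
     (\<forall>U. open U \<and> 0 \<in> U \<longrightarrow> (\<exists>x\<in>U. regular_in S {z. \<forall>a\<in>F. hfun a z = 0} x (length xs))))"

lemma attains_codimE:
  assumes "attains_codim S F"
  obtains xs where "set xs \<subseteq> hO S" "set xs \<subseteq> gidl F" "pow_regseq xs"
    "\<forall>U. open U \<and> 0 \<in> U \<longrightarrow> (\<exists>x\<in>U. regular_in S {z. \<forall>a\<in>F. hfun a z = 0} x (length xs))"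
  using assms[unfolded attains_codim_def] by (elim exE conjE) (rule that)

lemma codim_attained_hsub:
  assumes T: "clin_auto S T T'" and F: "finite F" and g: "attains_codim S (hsub T ` F)"
  shows "attains_codim S F"
proof -
  have T': "clin_auto S T' T" by (rule clin_auto_sym[OF T])
  have lT: "clin T" "clin T'" and inv: "\<And>z. T (T' z) = z" "\<And>z. T' (T z) = z"
    using T by (auto simp: clin_auto_def)
  obtain xs where xs: "set xs \<subseteq> hO S" "set xs \<subseteq> gidl (hsub T ` F)" "pow_regseq xs"
    and reg: "\<forall>U. open U \<and> 0 \<in> U \<longrightarrow> (\<exists>x\<in>U. regular_in S {z. \<forall>a\<in>hsub T ` F. hfun a z = 0} x (length xs))"
    by (rule attains_codimE[OF g])
  have img: "hsub T' ` hsub T ` F = F" using hsub_inverse[OF T'] by (simp add: image_image)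
  have "set (map (hsub T') xs) \<subseteq> hO S" using xs(1) hsub_hO[OF T'] by auto
  moreover have "set (map (hsub T') xs) \<subseteq> gidl F"
  proof
    fix a assume "a \<in> set (map (hsub T') xs)"
    then obtain x where "x \<in> set xs" "a = hsub T' x" by auto
    then show "a \<in> gidl F"
      using gidl_image_hom[of "hsub T'" x "hsub T ` F"] hsub_simps[OF lT(2)] xs(2) by (auto simp: img)
  qed
  moreover have "pow_regseq (map (hsub T') xs)"
    by (rule pow_regseq_hom[where k = "hsub T"])
      (use hsub_simps[OF lT(1)] hsub_simps[OF lT(2)] hsub_inverse[OF T] hsub_inverse[OF T'] xs(3) in auto)
  moreover have "\<exists>x\<in>U. regular_in S {z. \<forall>a\<in>F. hfun a z = 0} x (length xs)" if U: "open U" "0 \<in> U" for U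
  proof -
    have "eventually (\<lambda>z. \<forall>a\<in>F. hfun (hsub T a) z = hfun a (T z)) (nhds 0)"
      using hfun_ops(11)[of T] lT(1) by (intro eventually_ball_finite[OF F]) auto
    then obtain D where D: "open D" "0 \<in> D" "\<And>z a. z \<in> D \<Longrightarrow> a \<in> F \<Longrightarrow> hfun (hsub T a) z = hfun a (T z)"
      unfolding eventually_nhds by blast
    have "open (T -` U \<inter> D)" by (intro open_Int open_vimage U(1) D(1) clin_continuous lT)
    moreover have "0 \<in> T -` U \<inter> D" using U(2) D(2) clin_0[OF lT(1)] by simp
    ultimately have "\<exists>x\<in>T -` U \<inter> D. regular_in S {z. \<forall>a\<in>hsub T ` F. hfun a z = 0} x (length xs)"
      by (intro mp[OF spec[OF reg]] conjI)
    then obtain x where x: "x \<in> T -` U \<inter> D" "regular_in S {z. \<forall>a\<in>hsub T ` F. hfun a z = 0} x (length xs)"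
      by (rule bexE)
    have "regular_in S {z. \<forall>a\<in>F. hfun a (T z) = 0} x (length xs)"
      by (rule regular_in_local[OF x(2) D(1)]) (use x(1) D(3) in auto)
    from regular_in_linear[OF T this]
    have "regular_in S (T ` {z. \<forall>a\<in>F. hfun a (T z) = 0}) (T x) (length xs)" .
    moreover have "T ` {z. \<forall>a\<in>F. hfun a (T z) = 0} = {z. \<forall>a\<in>F. hfun a z = 0}"
    proof (intro equalityI subsetI)
      fix z assume "z \<in> {z. \<forall>a\<in>F. hfun a z = 0}"
      then show "z \<in> T ` {z. \<forall>a\<in>F. hfun a (T z) = 0}" using inv(1)[of z] by (intro image_eqI[of _ _ "T' z"]) auto
    qed auto
    ultimately show ?thesis using x(1) by auto
  qed
  ultimately show ?thesis unfolding attains_codim_def by (intro exI[of _ "map (hsub T') xs"]) simp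
qed

lemma hfun_hO: "a \<in> hO S \<Longrightarrow> eventually (\<lambda>z. hfun a z = hfun a (proj S z)) (nhds 0)"
  using hfun_ops(9)[of S a] by (simp add: hO_iff)

lemma hev_gidl: "a \<in> gidl F \<Longrightarrow> \<forall>b\<in>F. hev b = 0 \<Longrightarrow> hev a = 0"
  by (induction rule: gidl.induct) auto

text \<open>Elimination of \<open>s\<close>: the norms modulo \<open>P\<close> of suitable
  combinations of the elements of \<open>F\<close> cut out the projection of the zero set. Passing
  to fewer variables lowers the codimension by one, and appending \<open>P\<close> to the sequence
  compensates this; \<open>regular_in_lift\<close> does the same for the regular points.\<close>

lemma codim_attained_step:
  assumes F: "finite F" "F \<subseteq> hO S" "\<forall>a\<in>F. hev a = 0" and b: "b \<in> F" "hreg s d b" and s: "s \<in> S"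
    and IH: "\<And>F'. finite F' \<Longrightarrow> F' \<subseteq> hO (S - {s}) \<Longrightarrow> \<forall>a\<in>F'. hev a = 0 \<Longrightarrow> attains_codim (S - {s}) F'"
  shows "attains_codim S F"
proof -
  let ?S = "S - {s}"
  obtain q p P where P: "P = q * b" "q \<in> hO S" and wp: "wpoly S s d p P"
    by (rule Weierstrass_preparation[OF b(2) subsetD[OF F(2) b(1)] s])
  have PF: "P \<in> gidl F" unfolding P(1) by (rule gidl_mult_gen[OF b(1)])
  have PhO: "P \<in> hO S" by (rule wpoly_in_hO[OF wp])
  have d: "d > 0"
  proof (rule ccontr)
    assume "\<not> ?thesis"
    then show False using b F(3) by (simp add: hreg_def)
  qed
  have pO: "p k \<in> hO ?S" for k using wp by (simp add: wpoly_def)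
  obtain fs where fs: "set fs = F" using finite_list[OF F(1)] by blast
  define l where "l = length fs"
  have fsF: "fs ! k \<in> F" if "k < l" for k using that fs by (auto simp: l_def)
  \<comment> \<open>With powers of \<open>c\<close> as coefficients, the values at a fixed point
    form a polynomial in \<open>c\<close>.\<close>
  define G where "G c = (\<Sum>k<l. hconst (of_nat c ^ k) * fs ! k)" for c :: nat
  have GO: "G c \<in> hO S" for c unfolding G_def using fsF F(2) by (intro hO_sum hO_closed(2,7)) auto
  have GF: "G c \<in> gidl F" for c unfolding G_def using fsF by (intro gidl_sum gidl_mult_gen) auto
  define \<Phi> where "\<Phi> c M y \<longleftrightarrow> M \<in> carrier_mat d d \<and> (\<forall>k<d. \<forall>l<d. M $$ (k, l) \<in> hO ?S) \<and>
    (\<forall>k<d. G c * hcoord s ^ k = (\<Sum>l<d. M $$ (k, l) * hcoord s ^ l) + y k * P)" for c M and y :: "nat \<Rightarrow> 'a hg"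
  have "\<exists>M y. \<Phi> c M y" for c
  proof (rule multiplication_matrix[OF wp GO[of c]])
    fix M y assume "M \<in> carrier_mat d d" "\<And>k l. k < d \<Longrightarrow> l < d \<Longrightarrow> M $$ (k, l) \<in> hO ?S"
      "\<And>k. k < d \<Longrightarrow> G c * hcoord s ^ k = (\<Sum>l<d. M $$ (k, l) * hcoord s ^ l) + y k * P"
    then have "\<Phi> c M y" unfolding \<Phi>_def by blast
    then show ?thesis by blast
  qed
  then obtain M y where My: "\<And>c. \<Phi> c (M c) (y c)" by metis
  have M: "M c \<in> carrier_mat d d" "\<And>k l. k < d \<Longrightarrow> l < d \<Longrightarrow> M c $$ (k, l) \<in> hO ?S"
    and Meq: "\<And>k. k < d \<Longrightarrow> G c * hcoord s ^ k = (\<Sum>l<d. M c $$ (k, l) * hcoord s ^ l) + y c k * P" for c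
    using My[of c] by (auto simp: \<Phi>_def)
  define N where "N c = Determinant.det (M c)" for c
  have NF: "N c \<in> gidl F" for c
  proof -
    have "N c \<in> gidl {G c, P}" unfolding N_def by (rule det_multiplication_in_ideal[OF M(1) wp Meq])
    moreover have "gidl {G c, P} \<subseteq> gidl F" by (rule gidl_subset) (use GF PF in auto)
    ultimately show ?thesis by blast
  qed
  have NO: "N c \<in> hO ?S" for c unfolding N_def by (rule hO_det[OF M])
  \<comment> \<open>Over each point there are at most \<open>d\<close> roots of \<open>P\<close>,
    and a root that is not a common zero of \<open>F\<close> accounts for at most \<open>l\<close>
    of the combinations.\<close>
  let ?C = "{..d * l}"
  have "attains_codim ?S (N ` ?C)"
    by (rule IH) (use NO hev_gidl[OF NF F(3)] in auto)
  then obtain xs where xs: "set xs \<subseteq> hO ?S" "set xs \<subseteq> gidl (N ` ?C)" "pow_regseq xs"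
    and reg: "\<forall>U. open U \<and> 0 \<in> U \<longrightarrow> (\<exists>x\<in>U. regular_in ?S {z. \<forall>a\<in>N ` ?C. hfun a z = 0} x (length xs))"
    by (rule attains_codimE)
  have "gidl (N ` ?C) \<subseteq> gidl F" by (rule gidl_subset) (use NF in auto)
  then have xsF: "set (xs @ [P]) \<subseteq> gidl F" using xs(2) PF by auto
  have xsO: "set (xs @ [P]) \<subseteq> hO S" using xs(1) PhO hO_mono[of _ ?S S] by auto
  have xsr: "pow_regseq (xs @ [P])"
    by (rule pow_regseq_snoc[OF xs(3) _ wpoly_hreg[OF wp]]) (use xs(1) hO_mono[of _ ?S "- {s}"] in auto)
  have "\<exists>x\<in>U. regular_in S {z. \<forall>a\<in>F. hfun a z = 0} x (length (xs @ [P]))" if U: "open U" "0 \<in> U" for U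
  proof -
    \<comment> \<open>Identities of germs hold for the representatives only near the origin. The
      facts \<open>e0\<close> to \<open>e13\<close> are collected so that one box serves for all of
      them.\<close>
    have e0: "eventually (\<lambda>z. z \<in> U) (nhds 0)" using U eventually_nhds by blast
    have e1: "eventually (\<lambda>z. hfun P z = (z $ s) ^ d + (\<Sum>k<d. hfun (p k) z * (z $ s) ^ k)) (nhds 0)"
    proof -
      let ?t = "\<lambda>k. hcoord s ^ k * p k"
      have pw: "eventually (\<lambda>z. hfun (hcoord s ^ k) z = (z $ s) ^ k) (nhds 0)" for k
        using eventually_conj[OF hfun_power[of "hcoord s" k] hfun_ops(8)[of s]] by (auto elim: eventually_mono)
      have t: "eventually (\<lambda>z. hfun (?t k) z = hfun (p k) z * (z $ s) ^ k) (nhds 0)" for k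
        using eventually_conj[OF hfun_ops(3)[of "hcoord s ^ k" "p k"] pw[of k]] by (auto elim: eventually_mono)
      have ts: "eventually (\<lambda>z. \<forall>k\<in>{..<d}. hfun (?t k) z = hfun (p k) z * (z $ s) ^ k) (nhds 0)"
        by (intro eventually_ball_finite) (use t in auto)
      have "P = hcoord s ^ d + (\<Sum>k<d. ?t k)" using wp by (simp add: wpoly_def)
      then have "eventually (\<lambda>z. hfun P z = hfun (hcoord s ^ d) z + hfun (\<Sum>k<d. ?t k) z) (nhds 0)"
        using hfun_ops(1)[of "hcoord s ^ d" "\<Sum>k<d. ?t k"] by simp
      from eventually_conj[OF this eventually_conj[OF pw[of d] eventually_conj[OF ts hfun_sum[of "{..<d}" ?t]]]]
      show ?thesis by (rule eventually_mono) auto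
    qed
    have e2: "eventually (\<lambda>z. \<forall>k\<in>{..<d}. hfun (p k) z = hfun (p k) (proj ?S z)) (nhds 0)"
      by (intro eventually_ball_finite ballI hfun_hO pO) simp
    have e3: "eventually (\<lambda>z. \<forall>c\<in>?C. hfun (G c) z = (\<Sum>k<l. of_nat c ^ k * hfun (fs ! k) z)) (nhds 0)"
    proof (intro eventually_ball_finite ballI)
      fix c
      let ?t = "\<lambda>k. hconst (of_nat c ^ k) * fs ! k"
      have t: "eventually (\<lambda>z. hfun (?t k) z = of_nat c ^ k * hfun (fs ! k) z) (nhds 0)" for k
        using eventually_conj[OF hfun_ops(3)[of "hconst (of_nat c ^ k)" "fs ! k"] hfun_ops(7)[of "of_nat c ^ k"]]
        by (auto elim: eventually_mono)
      have ts: "eventually (\<lambda>z. \<forall>k\<in>{..<l}. hfun (?t k) z = of_nat c ^ k * hfun (fs ! k) z) (nhds 0)"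
        by (intro eventually_ball_finite) (use t in auto)
      from eventually_conj[OF ts hfun_sum[of "{..<l}" ?t]]
      show "eventually (\<lambda>z. hfun (G c) z = (\<Sum>k<l. of_nat c ^ k * hfun (fs ! k) z)) (nhds 0)"
        unfolding G_def by (rule eventually_mono) auto
    qed simp
    have e4: "eventually (\<lambda>z. \<forall>c\<in>?C. hfun (N c) z =
        Determinant.det (Matrix.mat d d (\<lambda>(i, j). hfun (M c $$ (i, j)) z))) (nhds 0)"
      unfolding N_def by (intro eventually_ball_finite ballI hfun_det M(1)) simp
    have e5: "eventually (\<lambda>z. \<forall>c\<in>?C. \<forall>k\<in>{..<d}. hfun (G c) z * (z $ s) ^ k =
        (\<Sum>i<d. hfun (M c $$ (k, i)) z * (z $ s) ^ i) + hfun (y c k) z * hfun P z) (nhds 0)"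
    proof (intro eventually_ball_finite ballI)
      fix c k assume k: "k \<in> {..<d}"
      let ?t = "\<lambda>i. M c $$ (k, i) * hcoord s ^ i"
      have pw: "eventually (\<lambda>z. hfun (hcoord s ^ k) z = (z $ s) ^ k) (nhds 0)" for k
        using eventually_conj[OF hfun_power[of "hcoord s" k] hfun_ops(8)[of s]] by (auto elim: eventually_mono)
      have t: "eventually (\<lambda>z. hfun (?t i) z = hfun (M c $$ (k, i)) z * (z $ s) ^ i) (nhds 0)" for i
        using eventually_conj[OF hfun_ops(3)[of "M c $$ (k, i)" "hcoord s ^ i"] pw[of i]] by (auto elim: eventually_mono)
      have ts: "eventually (\<lambda>z. \<forall>i\<in>{..<d}. hfun (?t i) z = hfun (M c $$ (k, i)) z * (z $ s) ^ i) (nhds 0)"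
        by (intro eventually_ball_finite) (use t in auto)
      have 1: "eventually (\<lambda>z. hfun (G c * hcoord s ^ k) z = hfun (\<Sum>i<d. ?t i) z + hfun (y c k * P) z) (nhds 0)"
        using hfun_ops(1)[of "\<Sum>i<d. ?t i" "y c k * P"] Meq[of k c] k by simp
      have 2: "eventually (\<lambda>z. hfun (G c * hcoord s ^ k) z = hfun (G c) z * (z $ s) ^ k) (nhds 0)"
        using eventually_conj[OF hfun_ops(3)[of "G c" "hcoord s ^ k"] pw[of k]] by (auto elim: eventually_mono)
      from eventually_conj[OF 1 eventually_conj[OF 2 eventually_conj[OF ts eventually_conj[OF hfun_sum[of "{..<d}" ?t]
          hfun_ops(3)[of "y c k" P]]]]]
      show "eventually (\<lambda>z. hfun (G c) z * (z $ s) ^ k =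
        (\<Sum>i<d. hfun (M c $$ (k, i)) z * (z $ s) ^ i) + hfun (y c k) z * hfun P z) (nhds 0)"
        by (rule eventually_mono) auto
    qed auto
    have e6: "eventually (\<lambda>z. \<forall>c\<in>?C. \<forall>k\<in>{..<d}. \<forall>i\<in>{..<d}. hfun (M c $$ (k, i)) z = hfun (M c $$ (k, i)) (proj ?S z)) (nhds 0)"
      by (intro eventually_ball_finite ballI hfun_hO M(2)) auto
    have e7: "eventually (\<lambda>z. \<forall>a\<in>F. holo_at (hfun a) z) (nhds 0)"
      by (intro eventually_ball_finite ballI holo_at_eventually holo_at_hfun F(1))
    have e8: "eventually (\<lambda>z. \<forall>k\<in>{..<d}. holo_at (hfun (p k)) z) (nhds 0)"
      by (intro eventually_ball_finite ballI holo_at_eventually holo_at_hfun) simp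
    have e9: "eventually (\<lambda>z. \<forall>c\<in>?C. holo_at (hfun (G c)) z) (nhds 0)"
      by (intro eventually_ball_finite ballI holo_at_eventually holo_at_hfun) simp
    have e10: "eventually (\<lambda>z. \<forall>c\<in>?C. \<forall>k\<in>{..<d}. holo_at (hfun (y c k)) z) (nhds 0)"
      by (intro eventually_ball_finite ballI holo_at_eventually holo_at_hfun) auto
    have e11: "eventually (\<lambda>z. (\<forall>a\<in>F. hfun a z = 0) \<longrightarrow> hfun P z = 0) (nhds 0)"
      by (rule gidl_vanish[OF PF])
    have e12: "eventually (\<lambda>z. \<forall>c\<in>?C. (\<forall>a\<in>F. hfun a z = 0) \<longrightarrow> hfun (N c) z = 0) (nhds 0)"
      by (intro eventually_ball_finite ballI gidl_vanish NF) simp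
    have e13: "eventually (\<lambda>z. \<forall>c\<in>?C. hfun (N c) z = hfun (N c) (proj ?S z)) (nhds 0)"
      by (intro eventually_ball_finite ballI hfun_hO NO) simp
    note ev = eventually_conj[OF e0 eventually_conj[OF e1 eventually_conj[OF e2 eventually_conj[OF e3 eventually_conj[OF e4
      eventually_conj[OF e5 eventually_conj[OF e6 eventually_conj[OF e7 eventually_conj[OF e8 eventually_conj[OF e9
      eventually_conj[OF e10 eventually_conj[OF e11 eventually_conj[OF e12 e13]]]]]]]]]]]]]
    obtain r0 where r0: "r0 > 0" and E: "\<And>z. z \<in> pbox s r0 r0 \<Longrightarrow> z \<in> U \<and> hfun P z = (z $ s) ^ d + (\<Sum>k<d. hfun (p k) z * (z $ s) ^ k) \<and>
      (\<forall>k\<in>{..<d}. hfun (p k) z = hfun (p k) (proj ?S z)) \<and>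
      (\<forall>c\<in>?C. hfun (G c) z = (\<Sum>k<l. of_nat c ^ k * hfun (fs ! k) z)) \<and>
      (\<forall>c\<in>?C. hfun (N c) z = Determinant.det (Matrix.mat d d (\<lambda>(i, j). hfun (M c $$ (i, j)) z))) \<and>
      (\<forall>c\<in>?C. \<forall>k\<in>{..<d}. hfun (G c) z * (z $ s) ^ k =
        (\<Sum>i<d. hfun (M c $$ (k, i)) z * (z $ s) ^ i) + hfun (y c k) z * hfun P z) \<and>
      (\<forall>c\<in>?C. \<forall>k\<in>{..<d}. \<forall>i\<in>{..<d}. hfun (M c $$ (k, i)) z = hfun (M c $$ (k, i)) (proj ?S z)) \<and>
      (\<forall>a\<in>F. holo_at (hfun a) z) \<and> (\<forall>k\<in>{..<d}. holo_at (hfun (p k)) z) \<and>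
      (\<forall>c\<in>?C. holo_at (hfun (G c)) z) \<and> (\<forall>c\<in>?C. \<forall>k\<in>{..<d}. holo_at (hfun (y c k)) z) \<and>
      ((\<forall>a\<in>F. hfun a z = 0) \<longrightarrow> hfun P z = 0) \<and> (\<forall>c\<in>?C. (\<forall>a\<in>F. hfun a z = 0) \<longrightarrow> hfun (N c) z = 0) \<and>
      (\<forall>c\<in>?C. hfun (N c) z = hfun (N c) (proj ?S z))"
      by (rule eventually_pbox[OF ev, where s = s]) (assumption | rule that)+
    define r where "r = min r0 1"
    have r: "0 < r" "r \<le> 1" "r \<le> r0" using r0 by (auto simp: r_def)
    have sm: "eventually (\<lambda>z. \<forall>k\<in>{..<d}. cmod (hfun (p k) z) < r ^ d / of_nat d) (nhds 0)"
    proof (intro eventually_ball_finite ballI)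
      fix k assume k: "k \<in> {..<d}"
      have "hfun (p k) 0 = 0" using wp k by (simp add: wpoly_def hev_hfun)
      then have "(hfun (p k) \<longlongrightarrow> 0) (nhds 0)"
        using holo_at_isCont[OF holo_at_hfun[of "p k"]] by (metis isCont_def tendsto_at_iff_tendsto_nhds)
      then have "((\<lambda>z. cmod (hfun (p k) z)) \<longlongrightarrow> 0) (nhds 0)" by (rule tendsto_norm_zero)
      then show "eventually (\<lambda>z. cmod (hfun (p k) z) < r ^ d / of_nat d) (nhds 0)"
        by (rule order_tendstoD) (use r(1) d in simp)
    qed simp
    obtain r1 where r1: "r1 > 0" and small: "\<And>z. z \<in> pbox s r1 r1 \<Longrightarrow> \<forall>k\<in>{..<d}. cmod (hfun (p k) z) < r ^ d / of_nat d"
      by (rule eventually_pbox[OF sm, where s = s]) (assumption | rule that)+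
    \<comment> \<open>Only the other coordinates are restricted further. The coefficients of
      \<open>P\<close> vanish at the origin and become so small that all its roots over the box have
      modulus below \<open>r\<close>.\<close>
    define \<delta> where "\<delta> = min r r1"
    have \<delta>: "\<delta> > 0" "\<delta> \<le> r" "\<delta> \<le> r1" using r(1) r1 by (auto simp: \<delta>_def)
    define D where "D = pbox s \<delta> r"
    have oD: "open D" unfolding D_def by (rule open_pbox)
    have D0: "0 \<in> D" unfolding D_def by (rule zero_in_pbox[OF \<delta>(1) r(1)])
    have Dr: "z \<in> pbox s r0 r0" if "z \<in> D" for z
      using that pbox_mono[of \<delta> r0 r r0 s] \<delta> r by (auto simp: D_def)
    note E0 = E[OF Dr, THEN conjunct1] and E' = E[OF Dr, THEN conjunct2]
    note E1 = E'[THEN conjunct1] and E'' = E'[THEN conjunct2]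
    note E2 = E''[THEN conjunct1, rule_format] and E3' = E''[THEN conjunct2]
    note E3 = E3'[THEN conjunct1, rule_format] and E4' = E3'[THEN conjunct2]
    note E4 = E4'[THEN conjunct1, rule_format] and E5' = E4'[THEN conjunct2]
    note E5 = E5'[THEN conjunct1, rule_format] and E6' = E5'[THEN conjunct2]
    note E6 = E6'[THEN conjunct1, rule_format] and E7' = E6'[THEN conjunct2]
    note E7 = E7'[THEN conjunct1, rule_format] and E8' = E7'[THEN conjunct2]
    note E8 = E8'[THEN conjunct1, rule_format] and E9' = E8'[THEN conjunct2]
    note E9 = E9'[THEN conjunct1, rule_format] and E10' = E9'[THEN conjunct2]
    note E10 = E10'[THEN conjunct1, rule_format] and E11' = E10'[THEN conjunct2]
    note E11 = E11'[THEN conjunct1, THEN mp] and E12' = E11'[THEN conjunct2]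
    note E12 = E12'[THEN conjunct1, THEN bspec, THEN mp] and E13 = E12'[THEN conjunct2, rule_format]
    define Q where "Q z = monom 1 d + (\<Sum>k<d. monom (hfun (p k) z) k)" for z
    have cfQ: "coeff (Q z) k = (if k = d then 1 else if k < d then hfun (p k) z else 0)" for z k
      by (auto simp: Q_def coeff_sum)
    have Qdeg: "degree (Q z) = d" for z
    proof (rule antisym)
      show "degree (Q z) \<le> d" by (rule degree_le) (auto simp: cfQ)
      show "d \<le> degree (Q z)" by (rule le_degree) (simp add: cfQ)
    qed
    have Qnz: "Q z \<noteq> 0" for z using Qdeg[of z] d by auto
    have Qev: "poly (Q z) w = w ^ d + (\<Sum>k<d. hfun (p k) z * w ^ k)" for z w
      by (simp add: Q_def poly_monom poly_sum)
    have pz: "hfun (p k) z = hfun (p k) (proj ?S z)" if "z \<in> D" "k < d" for k z using E2[of z k] that by simp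
    have prD: "proj ?S z \<in> D" "proj ?S z \<in> pbox s r1 r1" if "z \<in> D" for z
      using that \<delta> r(1) r1 by (auto simp: D_def pbox_def intro: less_le_trans)
    have QP: "poly (Q (proj ?S z)) (z $ s) = hfun P z" if "z \<in> D" for z
      unfolding Qev E1[OF that] using pz[OF that] by simp
    have Qproj: "Q (proj ?S z) = Q z" if "z \<in> D" for z
      unfolding Q_def using pz[OF that] by (intro arg_cong2[of _ _ _ _ "(+)"] sum.cong refl) simp
    have inside: "cmod w < r" if z: "z \<in> D" and w: "poly (Q z) w = 0" for z w
    proof (rule small_coefficients_small_roots[OF _ r(1,2) d])
      show "w ^ d + (\<Sum>k<d. hfun (p k) (proj ?S z) * w ^ k) = 0" using w Qproj[OF z] Qev by metis
      show "cmod (hfun (p k) (proj ?S z)) < r ^ d / of_nat d" if "k < d" for k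
        using small[OF prD(2)[OF z]] that by simp
    qed
    define A where "A = {z \<in> D. proj S z = z \<and> (\<forall>f\<in>hfun ` F. f z = 0)}"
    define A' where "A' = {z \<in> D. proj ?S z = z \<and> (\<forall>a\<in>N ` ?C. hfun a z = 0)}"
    have projS: "proj S (proj ?S z) = proj ?S z" "proj ?S (proj S z) = proj ?S z" for z
      by (simp_all add: Int_absorb1 Int_absorb2 Diff_subset)
    \<comment> \<open>A vanishing norm makes multiplication by \<open>G c\<close> modulo
      \<open>Q z\<close> singular, so \<open>G c\<close> vanishes at some root over
      \<open>z\<close>. As this holds for all \<open>c\<close> in \<open>?C\<close>, one root is a
      common zero of \<open>F\<close>.\<close>
    have up: "\<exists>w. upd s w z \<in> A" if z: "z \<in> A'" for z
    proof -
      have zD: "z \<in> D" "proj ?S z = z" and Nz: "\<And>c. c \<in> ?C \<Longrightarrow> hfun (N c) z = 0" using z by (auto simp: A'_def)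
      have uD: "upd s w z \<in> D" if "cmod w < r" for w using upd_in_pbox zD(1) that unfolding D_def by blast
      have up': "proj ?S (upd s w z) = z" for w
      proof -
        have "proj ?S (upd s w z) = proj ?S z" by (auto simp: Finite_Cartesian_Product.vec_eq_iff)
        then show ?thesis using zD(2) by simp
      qed
      have hc: "continuous_on (ball 0 r) (\<lambda>w. f (upd s w z))" if "\<And>u. u \<in> D \<Longrightarrow> holo_at f u" for f
      proof -
        have "holo_on f D" using that by (rule holo_on_of_at[OF oD])
        then show ?thesis
          using holomorphic_on_upd zD(1) holomorphic_on_imp_continuous_on unfolding D_def by blast
      qed
      let ?R = "{w. poly (Q z) w = 0}"
      have "\<exists>w\<in>?R. \<forall>k<l. hfun (fs ! k) (upd s w z) = 0"
      proof (rule common_root_of_combinations)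
        show "finite ?R" by (rule poly_roots_finite[OF Qnz])
        show "card ?R \<le> d" using card_poly_roots_bound[OF Qnz[of z]] Qdeg by simp
        fix c assume "c \<le> d * l"
        then have c: "c \<in> ?C" by simp
        let ?m = "Matrix.mat d d (\<lambda>(i, j). hfun (M c $$ (i, j)) z)"
        have "\<exists>w. poly (Q z) w = 0 \<and> hfun (G c) (upd s w z) = 0"
        proof (rule root_of_singular_multiplication[where B = "ball 0 r" and m = ?m and y = "\<lambda>k w. hfun (y c k) (upd s w z)"])
          show "Determinant.det ?m = 0" using E4[OF zD(1) c] Nz[OF c] by simp
          show "continuous_on (ball 0 r) (\<lambda>w. hfun (G c) (upd s w z))" by (rule hc[OF E9[OF _ c]])
          show "continuous_on (ball 0 r) (\<lambda>w. hfun (y c k) (upd s w z))" if "k < d" for k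
            by (rule hc[OF E10[OF _ c]]) (use that in auto)
          show "w \<in> ball 0 r" if "poly (Q z) w = 0" for w using inside[OF zD(1) that] by simp
          fix k w assume k: "k < d" and "w \<in> ball (0 :: complex) r"
          then have u: "upd s w z \<in> D" using uD by simp
          have "hfun (G c) (upd s w z) * w ^ k =
            (\<Sum>i<d. hfun (M c $$ (k, i)) (upd s w z) * w ^ i) + hfun (y c k) (upd s w z) * hfun P (upd s w z)"
            using E5[OF u c, of k] k by simp
          also have "hfun P (upd s w z) = poly (Q z) w" using QP[OF u] by (simp only: up' upd_nth refl if_True)
          also have "(\<Sum>i<d. hfun (M c $$ (k, i)) (upd s w z) * w ^ i) = (\<Sum>i<d. ?m $$ (k, i) * w ^ i)"
          proof (intro sum.cong refl)
            fix i assume i: "i \<in> {..<d}"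
            have "hfun (M c $$ (k, i)) (upd s w z) = hfun (M c $$ (k, i)) z"
              using E6[OF u c, of k i] i k by (simp only: up' lessThan_iff)
            then show "hfun (M c $$ (k, i)) (upd s w z) * w ^ i = ?m $$ (k, i) * w ^ i" using i k by simp
          qed
          finally show "hfun (G c) (upd s w z) * w ^ k = (\<Sum>i<d. ?m $$ (k, i) * w ^ i) + hfun (y c k) (upd s w z) * poly (Q z) w" .
        qed (use Qdeg Qnz in auto)
        then obtain w where w: "poly (Q z) w = 0" "hfun (G c) (upd s w z) = 0" by blast
        have "(\<Sum>k<l. of_nat c ^ k * hfun (fs ! k) (upd s w z)) = 0"
          using E3[OF uD[OF inside[OF zD(1) w(1)]] c] w(2) by simp
        then show "\<exists>w\<in>?R. (\<Sum>k<l. of_nat c ^ k * hfun (fs ! k) (upd s w z)) = 0" using w(1) by blast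
      qed
      then obtain w where w: "poly (Q z) w = 0" "\<forall>k<l. hfun (fs ! k) (upd s w z) = 0" by blast
      have "\<forall>a\<in>F. hfun a (upd s w z) = 0"
        using w(2) fs by (metis in_set_conv_nth l_def)
      moreover have "proj S (upd s w z) = upd s w z"
      proof -
        have "z $ i = proj ?S z $ i" for i using zD(2) by simp
        then have "z $ i = 0" if "i \<notin> S" for i using that by (metis Diff_iff proj_nth)
        then show ?thesis using s by (auto simp: Finite_Cartesian_Product.vec_eq_iff)
      qed
      ultimately have "upd s w z \<in> A" using uD[OF inside[OF zD(1) w(1)]] by (simp add: A_def)
      then show ?thesis by blast
    qed
    have "\<exists>x\<in>D. regular_in ?S {z. \<forall>a\<in>N ` ?C. hfun a z = 0} x (length xs)"
      by (intro mp[OF spec[OF reg]] conjI oD D0)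
    then obtain a where a: "a \<in> D" "regular_in ?S {z. \<forall>a\<in>N ` ?C. hfun a z = 0} a (length xs)" by (rule bexE)
    have a': "regular_in ?S A' a (length xs)"
      by (rule regular_in_local[OF a(2) oD a(1)]) (auto simp: A'_def)
    have "\<exists>x. regular_in S A x (Suc (length xs))"
    proof (rule regular_in_lift[OF s D_def _ _ _ A_def _ _ _ up inside a'])
      show "degree (Q z) = d" for z by (rule Qdeg)
      show "coeff (Q z) d = 1" for z by (simp add: cfQ)
      show "holo_on (\<lambda>z. coeff (Q z) i) D" for i
      proof (cases "i < d")
        case True
        have "holo_on (hfun (p i)) D" by (rule holo_on_of_at[OF oD]) (use E8 True in auto)
        then show ?thesis by (rule holo_on_cong) (use True in \<open>simp add: cfQ\<close>)
      next
        case False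
        then have "(\<lambda>z. coeff (Q z) i) = (\<lambda>z. if i = d then 1 else 0)" by (auto simp: cfQ)
        then show ?thesis using holo_on_const[OF oD] by simp
      qed
      show "holo_on f D" if "f \<in> hfun ` F" for f
        by (rule holo_on_of_at[OF oD]) (use that E7 in auto)
      show "z \<in> D \<and> proj ?S z = z" if "z \<in> A'" for z using that by (simp add: A'_def)
      fix z assume "z \<in> A"
      then have z: "z \<in> D" "\<forall>a\<in>F. hfun a z = 0" by (auto simp: A_def)
      have "hfun (N c) (proj ?S z) = 0" if "c \<in> ?C" for c
        using E12[OF z(1) that z(2)] E13[OF z(1) that] by simp
      then show "proj ?S z \<in> A' \<and> poly (Q (proj ?S z)) (z $ s) = 0"
        using prD(1)[OF z(1)] QP[OF z(1)] E11[OF z] by (simp add: A'_def)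
    qed
    then obtain x where x: "regular_in S A x (Suc (length xs))" by blast
    have xD: "x \<in> D" using x by (simp add: regular_in_def A_def)
    have "regular_in S {z. \<forall>a\<in>F. hfun a z = 0} x (Suc (length xs))"
      by (rule regular_in_local[OF x oD xD]) (simp add: A_def)
    then show ?thesis using E0[OF xD] by auto
  qed
  then show ?thesis unfolding attains_codim_def using xsF xsO xsr by (intro exI[of _ "xs @ [P]"]) blast
qed

theorem codim_attained:
  assumes "finite F" "F \<subseteq> hO S" "\<forall>a\<in>F. hev a = 0" shows "attains_codim S F"
proof -
  have "finite S" by simp
  then show ?thesis using assms
  proof (induction S arbitrary: F rule: finite_psubset_induct)
    case (psubset S)
    show ?case
    proof (cases "\<forall>a\<in>F. a = 0")
      case True
      have "\<exists>x\<in>U. regular_in S {z. \<forall>a\<in>F. hfun a z = 0} x (length ([] :: 'a hg list))" if U: "open U" "0 \<in> U" for U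
      proof -
        have "eventually (\<lambda>z. \<forall>a\<in>F. hfun a z = 0) (nhds 0)"
          using True hfun_ops(5) by (intro eventually_ball_finite psubset.prems(1)) auto
        then obtain W where "open W" "0 \<in> W" "\<forall>z\<in>W. \<forall>a\<in>F. hfun a z = 0" unfolding eventually_nhds by blast
        then have "regular_in S {z. \<forall>a\<in>F. hfun a z = 0} 0 0" by (intro regular_in_zero_codim[of W]) auto
        then show ?thesis using U(2) by auto
      qed
      then show ?thesis unfolding attains_codim_def by (intro exI[of _ "[]"]) (auto simp: pow_regseq_Nil)
    next
      case False
      then obtain b where b: "b \<in> F" "b \<noteq> 0" by blast
      obtain s T T' d where s: "s \<in> S" "clin_auto S T T'" "hreg s d (hsub T b)"
        by (rule regular_coordinate[of b S]) (use b psubset.prems in auto)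
      have lT: "clin T" using s(2) by (simp add: clin_auto_def)
      have "attains_codim S (hsub T ` F)"
      proof (rule codim_attained_step[OF _ _ _ _ s(3,1)])
        show "hsub T ` F \<subseteq> hO S" using psubset.prems(2) hsub_hO[OF s(2)] by auto
        show "\<forall>a\<in>hsub T ` F. hev a = 0" using psubset.prems(3) hsub_simps(7)[OF lT] by simp
        show "attains_codim (S - {s}) F'" if "finite F'" "F' \<subseteq> hO (S - {s})" "\<forall>a\<in>F'. hev a = 0" for F'
          by (rule psubset.IH[OF _ that]) (use s(1) in auto)
      qed (use b psubset.prems(1) in auto)
      then show ?thesis by (rule codim_attained_hsub[OF s(2) psubset.prems(1)])
    qed
  qed
qed

lemma pow_regseq_ones: "pow_regseq (replicate q 1)"
  by (simp add: pow_regseq_def regseq_def)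

text \<open>The sequence from \<open>codim_attained\<close> has the codimension at a regular point
  close to the origin as its length, so it is long enough and a prefix is taken. If the origin is
  not a zero, the ideal contains 1 and a list of ones serves.\<close>

theorem codim_regseq:
  assumes F: "finite F" and A: "eventually (\<lambda>z. z \<in> A \<longleftrightarrow> (\<forall>a\<in>F. hfun a z = 0)) (nhds 0)"
    and codim: "\<And>x j. regular_point A x j \<Longrightarrow> q \<le> j"
  shows "\<exists>xs. length xs = q \<and> set xs \<subseteq> gidl F \<and> pow_regseq xs"
proof (cases "\<forall>a\<in>F. hev a = 0")
  case True
  have "attains_codim UNIV F" by (rule codim_attained[OF F _ True]) auto
  then obtain xs where xs: "set xs \<subseteq> gidl F" "pow_regseq xs"
    and reg: "\<forall>U. open U \<and> 0 \<in> U \<longrightarrow> (\<exists>x\<in>U. regular_in UNIV {z. \<forall>a\<in>F. hfun a z = 0} x (length xs))"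
    by (rule attains_codimE)
  obtain W where W: "open W" "0 \<in> W" "\<forall>z\<in>W. z \<in> A \<longleftrightarrow> (\<forall>a\<in>F. hfun a z = 0)"
    using A unfolding eventually_nhds by blast
  have "\<exists>x\<in>W. regular_in UNIV {z. \<forall>a\<in>F. hfun a z = 0} x (length xs)"
    by (intro mp[OF spec[OF reg]] conjI W)
  then obtain x where x: "x \<in> W" "regular_in UNIV {z. \<forall>a\<in>F. hfun a z = 0} x (length xs)" by (rule bexE)
  have "regular_in UNIV A x (length xs)" by (rule regular_in_local[OF x(2) W(1) x(1)]) (use W(3) in auto)
  then have "q \<le> length xs" using codim regular_in_regular_point by blast
  then show ?thesis
    using xs pow_regseq_take[of xs q] set_take_subset[of q xs] by (intro exI[of _ "take q xs"]) auto
next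
  case False
  then obtain a where a: "a \<in> F" "hev a \<noteq> 0" by blast
  obtain b where "a * b = 1" using hg_unit[OF a(2)] by blast
  then have "1 \<in> gidl F" using gidl_mult_gen[OF a(1), of b] by (simp add: mult.commute)
  then show ?thesis
    by (intro exI[of _ "replicate q 1"]) (auto simp: pow_regseq_ones)
qed


section \<open>Rank and minors\<close>

lemma minor_transpose: "minor (\<lambda>i j. A j i) q \<beta> \<alpha> = minor A q \<alpha> \<beta>"
proof -
  have "mat q q (\<lambda>(i, j). A (\<alpha> j) (\<beta> i)) = transpose_mat (mat q q (\<lambda>(i, j). A (\<alpha> i) (\<beta> j)))"
    by (rule eq_matI) auto
  then show ?thesis unfolding minor_def by (simp add: det_transpose[of _ q])
qed

lemma minor_cong:
  assumes "\<And>i j. i < q \<Longrightarrow> j < q \<Longrightarrow> A (\<alpha> i) (\<beta> j) = B (\<alpha>' i) (\<beta>' j)"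
  shows "minor A q \<alpha> \<beta> = minor B q \<alpha>' \<beta>'"
  unfolding minor_def by (rule arg_cong[of _ _ Determinant.det]) (use assms in \<open>auto intro!: cong_mat\<close>)

context vec_space
begin

text \<open>A kernel vector of the selected columns is one of the invertible submatrix, hence zero.
  So these columns are distinct and independent.\<close>

lemma minor_le_rank:
  assumes M: "M \<in> carrier_mat n l" and \<alpha>: "\<And>i. i < q \<Longrightarrow> \<alpha> i < n" and \<beta>: "\<And>i. i < q \<Longrightarrow> \<beta> i < l"
    and nz: "minor (\<lambda>i j. M $$ (i, j)) q \<alpha> \<beta> \<noteq> 0"
  shows "q \<le> rank M"
proof -
  define B where "B = mat n q (\<lambda>(i, j). M $$ (i, \<beta> j))"
  define m where "m = mat q q (\<lambda>(i, j). M $$ (\<alpha> i, \<beta> j))"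
  have det: "Determinant.det m \<noteq> 0" using nz by (simp add: minor_def m_def)
  have B: "B \<in> carrier_mat n q" by (simp add: B_def)
  have ker: "v = 0\<^sub>v q" if v: "v \<in> carrier_vec q" "B *\<^sub>v v = 0\<^sub>v n" for v
  proof -
    have "m *\<^sub>v v = 0\<^sub>v q"
    proof (rule eq_vecI)
      fix i assume i: "i < dim_vec (0\<^sub>v q)"
      have "vec_index (m *\<^sub>v v) i = vec_index (B *\<^sub>v v) (\<alpha> i)"
        using i v(1) \<alpha> by (simp add: m_def B_def scalar_prod_def)
      then show "vec_index (m *\<^sub>v v) i = vec_index (0\<^sub>v q) i" using v(2) \<alpha> i by simp
    qed (simp add: m_def)
    then show ?thesis using det det_0_iff_vec_prod_zero_field[of m q] v(1) by (auto simp: m_def)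
  qed
  have dist: "distinct (cols B)"
  proof (rule ccontr)
    assume "\<not> distinct (cols B)"
    then obtain i j where ij: "i < q" "j < q" "i \<noteq> j" "col B i = col B j"
      unfolding distinct_conv_nth by (auto simp: B_def)
    have *: "M $$ (k, \<beta> i) = M $$ (k, \<beta> j)" if "k < n" for k
    proof -
      have "vec_index (col B i) k = vec_index (col B j) k" using ij(4) by simp
      then show ?thesis using ij(1,2) that by (simp add: B_def)
    qed
    have "col m i = col m j" by (rule eq_vecI) (use ij(1,2) * \<alpha> in \<open>auto simp: m_def\<close>)
    then have "Determinant.det m = 0" by (intro det_identical_cols[of m q i j]) (use ij in \<open>auto simp: m_def\<close>)
    then show False using det by simp
  qed
  have indpt: "lin_indpt (set (cols B))"
  proof
    assume "lin_dep (set (cols B))"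
    then obtain v where "v \<in> carrier_vec q" "v \<noteq> 0\<^sub>v q" "B *\<^sub>v v = 0\<^sub>v n" by (rule lin_depE[OF B _ dist])
    then show False using ker by blast
  qed
  have "set (cols B) \<subseteq> set (cols M)"
  proof
    fix c assume "c \<in> set (cols B)"
    then obtain j where j: "j < q" "c = col B j" by (auto simp: cols_def B_def)
    then have "c = col M (\<beta> j)" using M \<beta> by (auto simp: B_def intro!: eq_vecI)
    then show "c \<in> set (cols M)" using j(1) \<beta> M by (auto simp: cols_def)
  qed
  from rank_ge_card_indpt[OF M this indpt]
  show ?thesis using distinct_card[OF dist] by (simp add: B_def)
qed

text \<open>If a nonvanishing minor of maximal size misses a column, all its borderings by that
  column vanish. Then \<open>bordered_minor\<close>, applied to the transpose, gives a nontrivial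
  relation among the columns.\<close>

lemma independent_columns_minor:
  assumes B: "B \<in> carrier_mat n q" "distinct (cols B)" "lin_indpt (set (cols B))"
  shows "\<exists>\<alpha> \<beta>. (\<forall>i<q. \<alpha> i < n \<and> \<beta> i < q) \<and> minor (\<lambda>i j. B $$ (i, j)) q \<alpha> \<beta> \<noteq> 0"
proof -
  define ex where "ex k \<longleftrightarrow> k \<le> q \<and> (\<exists>\<alpha> \<beta>. (\<forall>i<k. \<alpha> i < n \<and> \<beta> i < q) \<and> minor (\<lambda>i j. B $$ (i, j)) k \<alpha> \<beta> \<noteq> 0)" for k
  have ex0: "ex 0" by (simp add: ex_def minor_def)
  have bd: "k \<le> q" if "ex k" for k using that by (simp add: ex_def)
  define k where "k = Greatest ex"
  have k: "ex k" unfolding k_def by (rule GreatestI_nat[of ex 0 q, OF ex0 bd])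
  have kmax: "j \<le> k" if "ex j" for j unfolding k_def by (rule Greatest_le_nat[of ex j q, OF that bd])
  show ?thesis
  proof (cases "k = q")
    case True
    then show ?thesis using k unfolding ex_def by blast
  next
    case False
    then have kq: "k < q" using k by (simp add: ex_def)
    obtain \<alpha> \<beta> where ab: "\<forall>i<k. \<alpha> i < n \<and> \<beta> i < q" "minor (\<lambda>i j. B $$ (i, j)) k \<alpha> \<beta> \<noteq> 0"
      using k unfolding ex_def by blast
    have "\<exists>l0<q. l0 \<notin> \<beta> ` {..<k}"
    proof (rule ccontr)
      assume "\<not> ?thesis"
      then have "{..<q} \<subseteq> \<beta> ` {..<k}" by blast
      then have "q \<le> k" using card_mono[of "\<beta> ` {..<k}" "{..<q}"] card_image_le[of "{..<k}" \<beta>] by simp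
      then show False using kq by simp
    qed
    then obtain l0 where l0: "l0 < q" "l0 \<notin> \<beta> ` {..<k}" by blast
    let ?A = "\<lambda>i j. B $$ (j, i)" and ?\<Delta> = "minor (\<lambda>i j. B $$ (i, j)) k \<alpha> \<beta>"
    have "minor ?A (Suc k) (\<beta>(k := l0)) (\<alpha>(k := l)) = 0" if "l \<in> {..<n}" for l
    proof (rule ccontr)
      assume "\<not> ?thesis"
      then have "minor (\<lambda>i j. B $$ (i, j)) (Suc k) (\<alpha>(k := l)) (\<beta>(k := l0)) \<noteq> 0"
        using minor_transpose[of "\<lambda>i j. B $$ (i, j)" "Suc k" "\<beta>(k := l0)" "\<alpha>(k := l)"] by simp
      moreover have "\<forall>i<Suc k. (\<alpha>(k := l)) i < n \<and> (\<beta>(k := l0)) i < q"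
        using ab(1) l0(1) that by (auto simp: less_Suc_eq)
      ultimately have "ex (Suc k)" unfolding ex_def using kq by (intro conjI exI[of _ "\<alpha>(k := l)"] exI[of _ "\<beta>(k := l0)"]) auto
      then show False using kmax by fastforce
    qed
    from bordered_minor[OF this]
    obtain \<kappa> where \<kappa>: "\<And>l. l < n \<Longrightarrow> ?\<Delta> * B $$ (l, l0) = (\<Sum>t<k. \<kappa> t * B $$ (l, \<beta> t))"
      unfolding minor_transpose[of "\<lambda>i j. B $$ (i, j)" k \<beta> \<alpha>] by blast
    \<comment> \<open>The relation written as a kernel vector. Its entry at \<open>l0\<close> is the
      nonzero minor because \<open>l0\<close> is not among the columns \<beta>.\<close>
    define v where "v = Matrix.vec q (\<lambda>j. (if j = l0 then ?\<Delta> else 0) - (\<Sum>t<k. if \<beta> t = j then \<kappa> t else 0))"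
    have v0: "vec_index v l0 = ?\<Delta>"
    proof -
      have "(\<Sum>t<k. if \<beta> t = l0 then \<kappa> t else 0) = 0" by (intro sum.neutral) (use l0(2) in auto)
      then show ?thesis using l0(1) by (simp add: v_def)
    qed
    have "B *\<^sub>v v = 0\<^sub>v n"
    proof (rule eq_vecI)
      fix l assume "l < dim_vec (0\<^sub>v n)"
      then have l: "l < n" by simp
      have "vec_index (B *\<^sub>v v) l = (\<Sum>j<q. B $$ (l, j) * vec_index v j)"
        using l B(1) by (simp add: v_def scalar_prod_def lessThan_atLeast0)
      also have "\<dots> = (\<Sum>j<q. B $$ (l, j) * (if j = l0 then ?\<Delta> else 0)) - (\<Sum>j<q. \<Sum>t<k. B $$ (l, j) * (if \<beta> t = j then \<kappa> t else 0))"
        by (simp add: v_def right_diff_distrib sum_subtractf sum_distrib_left)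
      also have "(\<Sum>j<q. B $$ (l, j) * (if j = l0 then ?\<Delta> else 0)) = B $$ (l, l0) * ?\<Delta>"
        using l0(1) by (simp add: if_distrib[of "(*) _"] cong: if_cong)
      also have "(\<Sum>j<q. \<Sum>t<k. B $$ (l, j) * (if \<beta> t = j then \<kappa> t else 0)) = (\<Sum>t<k. \<Sum>j<q. if j = \<beta> t then B $$ (l, j) * \<kappa> t else 0)"
        by (subst sum.swap) (intro sum.cong refl, auto)
      also have "\<dots> = (\<Sum>t<k. \<kappa> t * B $$ (l, \<beta> t))"
        using ab(1) by (intro sum.cong refl) (simp add: mult.commute)
      finally show "vec_index (B *\<^sub>v v) l = vec_index (0\<^sub>v n) l" using \<kappa>[OF l] l by (simp add: mult.commute)
    qed (use B(1) in auto)
    moreover have "v \<in> carrier_vec q" by (simp add: v_def)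
    moreover have "v \<noteq> 0\<^sub>v q" using v0 ab(2) l0(1) by auto
    ultimately have "lin_dep (set (cols B))" by (intro lin_depI[OF B(1) _ _ _ B(2)])
    then show ?thesis using B(3) by blast
  qed
qed

lemma rank_le_minor:
  assumes M: "M \<in> carrier_mat n l" and q: "q \<le> rank M"
  shows "\<exists>\<alpha> \<beta>. (\<forall>i<q. \<alpha> i < n \<and> \<beta> i < l) \<and> minor (\<lambda>i j. M $$ (i, j)) q \<alpha> \<beta> \<noteq> 0"
proof -
  have "\<exists>S. finite S \<and> maximal S (\<lambda>T. T \<subseteq> set (cols M) \<and> lin_indpt T) \<and> {} \<subseteq> S"
    by (rule maximal_exists_superset[of "set (cols M)"]) (auto simp: zero_lin_dep lin_dep_def)
  then obtain S where S: "finite S" "maximal S (\<lambda>T. T \<subseteq> set (cols M) \<and> lin_indpt T)" by blast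
  have cS: "card S = rank M" using rank_card_indpt[OF M S(2)] by simp
  have S': "S \<subseteq> set (cols M)" "lin_indpt S" using S(2) by (auto simp: maximal_def)
  obtain U where U: "U \<subseteq> S" "card U = q" "finite U"
    using obtain_subset_with_card_n[of q S] q cS S(1) finite_subset by metis
  have Ui: "lin_indpt U" using subset_li_is_li[OF S'(2) U(1)] .
  obtain us where us: "set us = U" "distinct us" "length us = q"
    using finite_distinct_list[OF U(3)] distinct_card U(2) by metis
  have "\<exists>j<l. us ! i = col M j" if "i < q" for i
  proof -
    have "us ! i \<in> set (cols M)" using that us U(1) S'(1) by (metis nth_mem subsetD)
    then show ?thesis using M by (auto simp: cols_def)
  qed
  then obtain \<beta> where \<beta>: "\<And>i. i < q \<Longrightarrow> \<beta> i < l \<and> us ! i = col M (\<beta> i)" by metis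
  define B where "B = mat n q (\<lambda>(i, j). M $$ (i, \<beta> j))"
  have "cols B = us"
  proof (rule nth_equalityI)
    fix i assume "i < length (cols B)"
    then have i: "i < q" by (simp add: B_def)
    have "cols B ! i = col M (\<beta> i)" using i M \<beta>[OF i] by (auto simp: B_def intro!: eq_vecI)
    then show "cols B ! i = us ! i" using \<beta>[OF i] by simp
  qed (simp add: B_def us(3))
  then have "distinct (cols B)" "lin_indpt (set (cols B))" using us Ui by auto
  then obtain \<alpha> \<beta>' where ab: "\<forall>i<q. \<alpha> i < n \<and> \<beta>' i < q" "minor (\<lambda>i j. B $$ (i, j)) q \<alpha> \<beta>' \<noteq> 0"
    using independent_columns_minor[of B q] by (auto simp: B_def)
  have "minor (\<lambda>i j. M $$ (i, j)) q \<alpha> (\<lambda>i. \<beta> (\<beta>' i)) = minor (\<lambda>i j. B $$ (i, j)) q \<alpha> \<beta>'"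
    by (rule minor_cong) (use ab(1) in \<open>auto simp: B_def\<close>)
  then show ?thesis using ab \<beta> by (intro exI[of _ \<alpha>] exI[of _ "\<lambda>i. \<beta> (\<beta>' i)"]) auto
qed

end


section \<open>The local ring at a point\<close>

lemma eventually_shift: "eventually P (nhds (x :: complex ^ 'n)) \<longleftrightarrow> eventually (\<lambda>z. P (x + z)) (nhds 0)"
proof -
  have "nhds x = filtermap (\<lambda>z. z - (- x)) (nhds 0)" by (subst filtermap_nhds_shift) simp
  then show ?thesis by (simp add: eventually_filtermap add.commute)
qed

lemma holo_at_translate:
  assumes "holo_at f x" "y + a = x" shows "holo_at (\<lambda>z. f (a + z)) y"
proof -
  obtain U where U: "x \<in> U" "holo_on f U" using assms(1) by (auto simp: holo_at_def)
  let ?V = "(\<lambda>z. a + z) -` U"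
  have o: "open ?V" by (intro open_vimage holo_on_open[OF U(2)] continuous_intros)
  have "holo_on (\<lambda>z. f (a + id z)) ?V"
    by (rule holo_on_compose_linear[OF U(2) o]) (auto simp: bounded_linear.linear[OF bounded_linear_ident])
  then show ?thesis using U(1) assms(2) unfolding holo_at_def by (intro exI[of _ ?V]) (auto simp: add.commute)
qed

definition hgerm :: "complex ^ 'n \<Rightarrow> (complex ^ 'n \<Rightarrow> complex) \<Rightarrow> ('n::finite) hg" where
  "hgerm x f = abs_hg (\<lambda>z. f (x + z))"

lemma hgerm_eq_iff:
  assumes "holo_at f x" "holo_at g x"
  shows "hgerm x f = hgerm x g \<longleftrightarrow> eventually (\<lambda>z. f z = g z) (nhds x)"
  unfolding hgerm_def using holo_at_translate[OF assms(1), of 0 x] holo_at_translate[OF assms(2), of 0 x]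
  by (simp add: abs_hg_eq_iff eventually_shift[of _ x])

lemma hgerm_cong: "eventually (\<lambda>z. f z = g z) (nhds x) \<Longrightarrow> holo_at f x \<Longrightarrow> holo_at g x \<Longrightarrow> hgerm x f = hgerm x g"
  by (simp add: hgerm_eq_iff)

lemma hfun_hgerm: "holo_at f x \<Longrightarrow> eventually (\<lambda>z. hfun (hgerm x f) z = f (x + z)) (nhds 0)"
  unfolding hgerm_def by (rule hfun_abs) (simp add: holo_at_translate)

lemma hgerm_ops:
  assumes "holo_at f x" "holo_at g x"
  shows "hgerm x (\<lambda>z. f z * g z) = hgerm x f * hgerm x g" "hgerm x (\<lambda>z. f z - g z) = hgerm x f - hgerm x g"
    "hgerm x (\<lambda>z. f z + g z) = hgerm x f + hgerm x g"
  unfolding hgerm_def by (rule abs_hg_ops; rule holo_at_translate[OF assms(1)] holo_at_translate[OF assms(2)]; simp)+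

lemma hgerm_const [simp]: "hgerm x (\<lambda>_. 0) = 0" "hgerm x (\<lambda>_. 1) = 1"
  unfolding hgerm_def by (simp_all add: zero_hg_def one_hg_def)

lemma holo_at_sum: "finite A \<Longrightarrow> (\<And>i. i \<in> A \<Longrightarrow> holo_at (f i) x) \<Longrightarrow> holo_at (\<lambda>z. \<Sum>i\<in>A. f i z) x"
  by (induction A rule: finite_induct) (simp_all add: holo_at_simps)

lemma hgerm_sum:
  "finite A \<Longrightarrow> (\<And>i. i \<in> A \<Longrightarrow> holo_at (f i) x) \<Longrightarrow> hgerm x (\<lambda>z. \<Sum>i\<in>A. f i z) = (\<Sum>i\<in>A. hgerm x (f i))"
  by (induction A rule: finite_induct) (simp_all add: hgerm_ops holo_at_sum)

lemma hgerm_surj: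
  obtains f where "holo_at f x" "hgerm x f = a"
proof
  show "holo_at (\<lambda>z. hfun a (- x + z)) x" by (rule holo_at_translate[OF holo_at_hfun]) simp
  show "hgerm x (\<lambda>z. hfun a (- x + z)) = a" by (simp add: hgerm_def)
qed

lemma local_ring_consts: "\<one>\<^bsub>local_ring x\<^esub> = germ x (\<lambda>_. 1)" "\<zero>\<^bsub>local_ring x\<^esub> = germ x (\<lambda>_. 0)"
proof -
  show "\<one>\<^bsub>local_ring x\<^esub> = germ x (\<lambda>_. 1)" by (simp add: local_ring_def FactRing_def germ_def fun_ring_def)
  interpret R: cring "local_ring x" by (rule cring_local_ring)
  have c: "germ x (\<lambda>_. 0) \<in> carrier (local_ring x)" using holo_at_simps(1) by (auto simp: carrier_local_ring)
  have "germ x (\<lambda>_. 0) \<oplus>\<^bsub>local_ring x\<^esub> germ x (\<lambda>_. 0) = germ x (\<lambda>_. 0)"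
    using germ_ops(1)[OF holo_at_simps(1)[of 0 x] holo_at_simps(1)[of 0 x]] by simp
  then show "\<zero>\<^bsub>local_ring x\<^esub> = germ x (\<lambda>_. 0)" using c by (metis R.add.r_cancel_one)
qed

lemma germ_minus:
  assumes "holo_at f x" "holo_at g x"
  shows "germ x f \<ominus>\<^bsub>local_ring x\<^esub> germ x g = germ x (\<lambda>z. f z - g z)"
proof -
  interpret R: cring "local_ring x" by (rule cring_local_ring)
  have c: "germ x f \<in> carrier (local_ring x)" "germ x g \<in> carrier (local_ring x)"
    "germ x (\<lambda>z. f z - g z) \<in> carrier (local_ring x)" "germ x (\<lambda>z. - g z) \<in> carrier (local_ring x)"
    using assms holo_at_minus[OF assms] holo_at_uminus[OF assms(2)] by (auto simp: carrier_local_ring)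
  have "germ x (\<lambda>z. - g z) \<oplus>\<^bsub>local_ring x\<^esub> germ x g = \<zero>\<^bsub>local_ring x\<^esub>"
    using germ_ops(1)[OF holo_at_uminus[OF assms(2)] assms(2)] by (simp add: local_ring_consts)
  then have "\<ominus>\<^bsub>local_ring x\<^esub> germ x g = germ x (\<lambda>z. - g z)" by (rule R.minus_equality[OF _ c(2,4)])
  then show ?thesis using germ_ops(1)[OF assms(1) holo_at_uminus[OF assms(2)]] by (simp add: a_minus_def)
qed

text \<open>Together with \<open>gid\<close> this moves ideals between the record ring
  \<open>local_ring x\<close>, in which associated primes and heights are defined, and the type of
  germs at the origin, where the algebra is done.\<close>

definition hid :: "complex ^ 'n \<Rightarrow> 'n germ set \<Rightarrow> ('n::finite) hg set" where
  "hid x Q = {hgerm x f | f. holo_at f x \<and> germ x f \<in> Q}"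

lemma mem_hid: "holo_at f x \<Longrightarrow> hgerm x f \<in> hid x Q \<longleftrightarrow> germ x f \<in> Q"
  unfolding hid_def using hgerm_eq_iff germ_eq_iff by fastforce

definition gid :: "complex ^ 'n \<Rightarrow> ('n::finite) hg set \<Rightarrow> 'n germ set" where
  "gid x c = {germ x f | f. holo_at f x \<and> hgerm x f \<in> c}"

lemma mem_gid: "holo_at f x \<Longrightarrow> germ x f \<in> gid x c \<longleftrightarrow> hgerm x f \<in> c"
  unfolding gid_def using hgerm_eq_iff germ_eq_iff by fastforce

lemma hid_gid: "hid x (gid x c) = c"
proof (intro equalityI subsetI)
  fix a assume "a \<in> c"
  moreover obtain f where "holo_at f x" "hgerm x f = a" by (rule hgerm_surj)
  ultimately show "a \<in> hid x (gid x c)" using mem_hid mem_gid by metis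
next
  fix a assume "a \<in> hid x (gid x c)"
  moreover obtain f where "holo_at f x" "hgerm x f = a" by (rule hgerm_surj)
  ultimately show "a \<in> c" using mem_hid mem_gid by metis
qed

lemma ideal_in_hid:
  assumes "ideal Q (local_ring x)" shows "ideal_in UNIV (hid x Q)"
  unfolding ideal_in_def
proof (intro conjI ballI)
  interpret ideal Q "local_ring x" by fact
  show "0 \<in> hid x Q"
    using mem_hid[OF holo_at_simps(1)[of 0 x], of Q] additive_subgroup.zero_closed[OF is_additive_subgroup]
    by (simp add: local_ring_consts)
  fix a b
  obtain f g where f: "holo_at f x" "hgerm x f = a" and g: "holo_at g x" "hgerm x g = b" by (metis hgerm_surj)
  show "a + b \<in> hid x Q" if "a \<in> hid x Q" "b \<in> hid x Q"
    using that mem_hid[OF f(1), of Q] mem_hid[OF g(1), of Q] mem_hid[OF holo_at_simps(2)[OF f(1) g(1)], of Q]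
      additive_subgroup.a_closed[OF is_additive_subgroup, of "germ x f" "germ x g"] germ_ops(1)[OF f(1) g(1)] hgerm_ops(3)[OF f(1) g(1)] f(2) g(2) by simp
  show "b * a \<in> hid x Q" if "a \<in> hid x Q"
  proof -
    have "germ x g \<in> carrier (local_ring x)" using g by (auto simp: carrier_local_ring)
    then show ?thesis
      using that mem_hid[OF f(1), of Q] mem_hid[OF holo_at_simps(3)[OF g(1) f(1)], of Q]
        I_l_closed[of "germ x f" "germ x g"] germ_ops(2)[OF g(1) f(1)] hgerm_ops(1)[OF g(1) f(1)] f(2) g(2) by simp
  qed
qed auto

lemma prime_in_hid:
  assumes "primeideal Q (local_ring x)" shows "prime_in UNIV (hid x Q)"
  unfolding prime_in_def
proof (intro conjI ballI impI)
  interpret primeideal Q "local_ring x" by fact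
  show "ideal_in UNIV (hid x Q)" by (rule ideal_in_hid) (rule is_ideal)
  show "1 \<notin> hid x Q"
    using mem_hid[OF holo_at_simps(1)[of 1 x], of Q] one_imp_carrier I_notcarr by (auto simp: local_ring_consts)
  fix a b
  obtain f g where f: "holo_at f x" "hgerm x f = a" and g: "holo_at g x" "hgerm x g = b" by (metis hgerm_surj)
  have c: "germ x f \<in> carrier (local_ring x)" "germ x g \<in> carrier (local_ring x)"
    using f g by (auto simp: carrier_local_ring)
  assume "a * b \<in> hid x Q"
  then have "germ x f \<otimes>\<^bsub>local_ring x\<^esub> germ x g \<in> Q"
    using mem_hid[OF holo_at_simps(3)[OF f(1) g(1)], of Q] germ_ops(2)[OF f(1) g(1)] hgerm_ops(1)[OF f(1) g(1)] f(2) g(2)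
    by simp
  then show "a \<in> hid x Q \<or> b \<in> hid x Q"
    using I_prime[OF c] mem_hid[OF f(1), of Q] mem_hid[OF g(1), of Q] f(2) g(2) by auto
qed

lemma hid_strict:
  assumes "Q \<subset> Q'" "Q' \<subseteq> carrier (local_ring x)" shows "hid x Q \<subset> hid x Q'"
proof -
  obtain q where q: "q \<in> Q'" "q \<notin> Q" using assms(1) by blast
  then obtain f where f: "holo_at f x" "q = germ x f" using assms(2) by (auto simp: carrier_local_ring)
  have "hgerm x f \<in> hid x Q'" "hgerm x f \<notin> hid x Q" using mem_hid[OF f(1)] q f(2) by auto
  moreover have "hid x Q \<subseteq> hid x Q'" using assms(1) by (auto simp: hid_def)
  ultimately show ?thesis by blast
qed

lemma ideal_gid:
  assumes "ideal_in UNIV c" shows "ideal (gid x c) (local_ring x)"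
proof -
  interpret R: cring "local_ring x" by (rule cring_local_ring)
  note cD = ideal_inD[OF assms]
  have sub: "gid x c \<subseteq> carrier (local_ring x)" by (auto simp: gid_def carrier_local_ring)
  have add: "a \<oplus>\<^bsub>local_ring x\<^esub> b \<in> gid x c" if ab: "a \<in> gid x c" "b \<in> gid x c" for a b
  proof -
    obtain f g where f: "holo_at f x" "a = germ x f" "hgerm x f \<in> c" and g: "holo_at g x" "b = germ x g" "hgerm x g \<in> c"
      using ab by (auto simp: gid_def)
    show ?thesis
      using mem_gid[OF holo_at_simps(2)[OF f(1) g(1)], of c] germ_ops(1)[OF f(1) g(1)] hgerm_ops(3)[OF f(1) g(1)]
        cD(3)[OF f(3) g(3)] f(2) g(2) by simp
  qed
  have mul: "a \<otimes>\<^bsub>local_ring x\<^esub> b \<in> gid x c" if ab: "b \<in> gid x c" "a \<in> carrier (local_ring x)" for a b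
  proof -
    obtain f g where f: "holo_at f x" "a = germ x f" and g: "holo_at g x" "b = germ x g" "hgerm x g \<in> c"
      using ab by (auto simp: gid_def carrier_local_ring)
    show ?thesis
      using mem_gid[OF holo_at_simps(3)[OF f(1) g(1)], of c] germ_ops(2)[OF f(1) g(1)] hgerm_ops(1)[OF f(1) g(1)]
        cD(4)[OF g(3) hO_UNIV] f(2) g(2) by simp
  qed
  have neg: "\<ominus>\<^bsub>local_ring x\<^esub> a \<in> gid x c" if "a \<in> gid x c" for a
    using mul[OF that, of "\<ominus>\<^bsub>local_ring x\<^esub> \<one>\<^bsub>local_ring x\<^esub>"] that sub by (auto simp: R.l_minus)
  have "germ x (\<lambda>_. 0) \<in> gid x c" using mem_gid[OF holo_at_simps(1)[of 0 x], of c] cD(2) by simp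
  then have ne: "gid x c \<noteq> {}" by blast
  show ?thesis
  proof (rule idealI)
    show "subgroup (gid x c) (add_monoid (local_ring x))"
      using sub add neg ne by (intro R.add.subgroupI) (auto simp: a_inv_def)
  next
    fix a b assume "a \<in> gid x c" "b \<in> carrier (local_ring x)"
    then show "b \<otimes>\<^bsub>local_ring x\<^esub> a \<in> gid x c" "a \<otimes>\<^bsub>local_ring x\<^esub> b \<in> gid x c"
      using mul[of a b] R.m_comm[of a b] sub by auto
  qed (rule R.ring_axioms)
qed

lemma primeideal_gid:
  assumes "prime_in UNIV c" shows "primeideal (gid x c) (local_ring x)"
proof (rule primeidealI)
  have c: "ideal_in UNIV c" "1 \<notin> c" "\<And>a b. a * b \<in> c \<Longrightarrow> a \<in> c \<or> b \<in> c"
    using assms by (auto simp: prime_in_def)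
  show "ideal (gid x c) (local_ring x)" by (rule ideal_gid[OF c(1)])
  show "cring (local_ring x)" by (rule cring_local_ring)
  have "germ x (\<lambda>_. 1) \<notin> gid x c" using mem_gid[OF holo_at_simps(1)[of 1 x], of c] c(2) by simp
  moreover have "germ x (\<lambda>_. 1) \<in> carrier (local_ring x)" using holo_at_simps(1) by (auto simp: carrier_local_ring)
  ultimately show "carrier (local_ring x) \<noteq> gid x c" by blast
  fix a b assume ab: "a \<in> carrier (local_ring x)" "b \<in> carrier (local_ring x)" "a \<otimes>\<^bsub>local_ring x\<^esub> b \<in> gid x c"
  obtain f g where f: "holo_at f x" "a = germ x f" and g: "holo_at g x" "b = germ x g"
    using ab(1,2) by (auto simp: carrier_local_ring)
  have "hgerm x f * hgerm x g \<in> c"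
    using mem_gid[OF holo_at_simps(3)[OF f(1) g(1)], of c] germ_ops(2)[OF f(1) g(1)] hgerm_ops(1)[OF f(1) g(1)] ab(3) f(2) g(2)
    by simp
  then show "a \<in> gid x c \<or> b \<in> gid x c" using c(3) mem_gid[OF f(1)] mem_gid[OF g(1)] f(2) g(2) by auto
qed

text \<open>A nonempty set of extended naturals with finite supremum attains it. The bound on
  \<open>p\<close> excludes the empty set, whose supremum is 0.\<close>

lemma height_chain:
  assumes "height R Q = enat p" "p \<ge> 1"
  shows "\<exists>c. (\<forall>i\<le>p. primeideal (c i) R) \<and> (\<forall>i<p. c i \<subset> c (Suc i)) \<and> c p = Q"
proof -
  let ?S = "{enat m | m. \<exists>c. (\<forall>i\<le>m. primeideal (c i) R) \<and> (\<forall>i<m. c i \<subset> c (Suc i)) \<and> c m = Q}"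
  have sup: "Sup ?S = enat p" using assms(1) by (simp add: height_def)
  have "enat p \<in> ?S"
  proof (rule ccontr)
    assume no: "enat p \<notin> ?S"
    have "e \<le> enat (p - 1)" if e: "e \<in> ?S" for e
    proof -
      have "e \<le> enat p" using Sup_upper[OF e] sup by simp
      moreover have "e \<noteq> enat p" using no e by blast
      ultimately show ?thesis using e by fastforce
    qed
    then have "Sup ?S \<le> enat (p - 1)" by (rule Sup_least)
    then show False using sup assms(2) by simp
  qed
  then show ?thesis by auto
qed

text \<open>Transported to the local ring, the prime colon ideal is the annihilator of the class of
  a germ, thus an associated prime of height \<open>p\<close>. A chain of primes realizing the
  height is transported back and turned into a regular sequence.\<close>

lemma associated_prime_regseq:
  assumes K: "ideal K (local_ring x)" and pure: "\<And>Q. associated_prime (local_ring x) K Q \<Longrightarrow> height (local_ring x) Q = enat p"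
    and p: "p \<ge> 1" and pr: "prime_in UNIV (colon (hid x K) a)"
  shows "\<exists>xs. length xs = p \<and> set xs \<subseteq> colon (hid x K) a \<and> pow_regseq xs"
proof -
  let ?c = "colon (hid x K) a"
  obtain f where f: "holo_at f x" "hgerm x f = a" by (rule hgerm_surj)
  have fc: "germ x f \<in> carrier (local_ring x)" using f by (auto simp: carrier_local_ring)
  have "gid x ?c = {b \<in> carrier (local_ring x). b \<otimes>\<^bsub>local_ring x\<^esub> germ x f \<in> K}"
  proof -
    have "germ x g \<in> gid x ?c \<longleftrightarrow> germ x g \<otimes>\<^bsub>local_ring x\<^esub> germ x f \<in> K" if g: "holo_at g x" for g
      using mem_gid[OF g, of ?c] mem_hid[OF holo_at_simps(3)[OF g f(1)], of K] hgerm_ops(1)[OF g f(1)] germ_ops(2)[OF g f(1)] f(2)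
      by (simp add: colon_def)
    moreover have "gid x ?c \<subseteq> carrier (local_ring x)" by (auto simp: gid_def carrier_local_ring)
    ultimately show ?thesis by (auto simp: carrier_local_ring)
  qed
  then have "associated_prime (local_ring x) K (gid x ?c)"
    unfolding associated_prime_def using primeideal_gid[OF pr] fc by blast
  from height_chain[OF pure[OF this] p]
  obtain c where c: "\<forall>i\<le>p. primeideal (c i) (local_ring x)" "\<forall>i<p. c i \<subset> c (Suc i)" "c p = gid x ?c" by blast
  have "hid x (c i) \<subset> hid x (c (Suc i))" if "i < p" for i
  proof (rule hid_strict)
    show "c i \<subset> c (Suc i)" using c(2) that by blast
    have "primeideal (c (Suc i)) (local_ring x)" using c(1) that by simp
    then interpret primeideal "c (Suc i)" "local_ring x" .
    show "c (Suc i) \<subseteq> carrier (local_ring x)" using a_subset by blast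
  qed
  then have strict: "\<forall>i<p. hid x (c i) \<subset> hid x (c (Suc i))" by blast
  have "\<forall>i\<le>p. prime_in UNIV (hid x (c i))"
  proof (intro allI impI)
    fix i assume "i \<le> p"
    then show "prime_in UNIV (hid x (c i))" using c(1) by (intro prime_in_hid) blast
  qed
  from prime_chain_regseq[OF this strict]
  have "\<exists>xs. length xs = p \<and> set xs \<subseteq> hid x (c p) \<and> pow_regseq xs" .
  then show ?thesis by (simp add: c(3) hid_gid)
qed

text \<open>Otherwise the zero ideal would be an associated prime, with 1 as its witness, and would
  contain a regular sequence of positive length. A nonzero section is needed later as a multiplier
  in \<open>denominators_finite_type\<close>.\<close>

lemma pure_codim_nonzero:
  assumes K: "ideal K (local_ring x)" and pure: "\<And>Q. associated_prime (local_ring x) K Q \<Longrightarrow> height (local_ring x) Q = enat p"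
    and p: "p \<ge> 1"
  shows "hid x K \<noteq> {0}"
proof
  assume z: "hid x K = {0}"
  have "colon (hid x K) 1 = {0}" by (simp add: colon_def z)
  moreover have "prime_in UNIV {0 :: 'a hg}" by (auto simp: prime_in_def ideal_in_def)
  ultimately obtain xs where xs: "length xs = p" "set xs \<subseteq> {0 :: 'a hg}" "pow_regseq xs"
    using associated_prime_regseq[OF K pure p, of 1] by auto
  have "regseq (map (\<lambda>x. x ^ 1) xs)" using xs(3) unfolding pow_regseq_def by blast
  then have reg: "\<forall>k<p. \<forall>a. a * xs ! k \<in> gidl (set (take k xs)) \<longrightarrow> a \<in> gidl (set (take k xs))"
    using xs(1) by (simp add: regseq_def)
  have "0 < p" using p by simp
  from spec[OF reg, of 0] this have "\<forall>a. a * xs ! 0 \<in> gidl {} \<longrightarrow> a \<in> gidl {}" by simp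
  moreover have "xs ! 0 = 0"
  proof -
    have "xs ! 0 \<in> set xs" using xs(1) p by (intro nth_mem) simp
    then show ?thesis using xs(2) by blast
  qed
  ultimately have "(1 :: 'a hg) \<in> gidl {}" using gidl.zero by auto
  moreover have "a = 0" if "a \<in> gidl {}" for a :: "'a hg" using that by (induction rule: gidl.induct) auto
  ultimately show False by fastforce
qed


section \<open>Fractions\<close>

context
  fixes X :: "(complex ^ 'n) set" and I x
  assumes K: "ideal (stalk X I x) (local_ring x)"
begin

lemma OZ_carrier: "carrier (OZ_ring X I x) = {OZ_germ X I x f | f. holo_at f x}"
  unfolding OZ_ring_def OZ_germ_def FactRing_def A_RCOSETS_def' by (auto simp: carrier_local_ring)

lemma OZ_eq_iff:
  assumes "holo_at f x" "holo_at g x"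
  shows "OZ_germ X I x f = OZ_germ X I x g \<longleftrightarrow> hgerm x f - hgerm x g \<in> hid x (stalk X I x)"
proof -
  interpret R: cring "local_ring x" by (rule cring_local_ring)
  have c: "germ x f \<in> carrier (local_ring x)" "germ x g \<in> carrier (local_ring x)"
    using assms by (auto simp: carrier_local_ring)
  show ?thesis unfolding OZ_germ_def
    using R.quotient_eq_iff_same_a_r_cos[OF K c] germ_minus[OF assms] mem_hid[OF holo_at_minus[OF assms], of "stalk X I x"]
      hgerm_ops(2)[OF assms] by simp
qed

lemma OZ_mult:
  assumes "holo_at f x" "holo_at g x"
  shows "OZ_germ X I x f \<otimes>\<^bsub>OZ_ring X I x\<^esub> OZ_germ X I x g = OZ_germ X I x (\<lambda>z. f z * g z)"
proof -
  interpret ideal "stalk X I x" "local_ring x" by (rule K)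
  have c: "germ x f \<in> carrier (local_ring x)" "germ x g \<in> carrier (local_ring x)"
    using assms by (auto simp: carrier_local_ring)
  show ?thesis using rcoset_mult_add[OF c] germ_ops(2)[OF assms]
    by (simp add: OZ_ring_def OZ_germ_def FactRing_def)
qed

lemma OZ_consts: "\<one>\<^bsub>OZ_ring X I x\<^esub> = OZ_germ X I x (\<lambda>_. 1)" "\<zero>\<^bsub>OZ_ring X I x\<^esub> = OZ_germ X I x (\<lambda>_. 0)"
proof -
  interpret ideal "stalk X I x" "local_ring x" by (rule K)
  show "\<one>\<^bsub>OZ_ring X I x\<^esub> = OZ_germ X I x (\<lambda>_. 1)"
    by (simp add: OZ_ring_def OZ_germ_def FactRing_def local_ring_consts)
  have "OZ_germ X I x (\<lambda>_. 0) = stalk X I x"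
    unfolding OZ_germ_def local_ring_consts(2)[symmetric] using a_subset by simp
  then show "\<zero>\<^bsub>OZ_ring X I x\<^esub> = OZ_germ X I x (\<lambda>_. 0)" by (simp add: OZ_ring_def FactRing_def)
qed

lemma OZ_nonzerodivisor:
  assumes h: "holo_at h x"
  shows "OZ_germ X I x h \<in> nonzerodivisors (OZ_ring X I x) \<longleftrightarrow>
    (\<forall>a. a * hgerm x h \<in> hid x (stalk X I x) \<longrightarrow> a \<in> hid x (stalk X I x))"
proof -
  let ?J = "hid x (stalk X I x)" and ?R = "OZ_ring X I x"
  have *: "OZ_germ X I x f \<otimes>\<^bsub>?R\<^esub> OZ_germ X I x h = \<zero>\<^bsub>?R\<^esub> \<longleftrightarrow> hgerm x f * hgerm x h \<in> ?J" if "holo_at f x" for f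
    using OZ_mult[OF that h] OZ_eq_iff[OF holo_at_simps(3)[OF that h] holo_at_simps(1)[of 0]] hgerm_ops(1)[OF that h]
    by (simp add: OZ_consts)
  have **: "OZ_germ X I x f = \<zero>\<^bsub>?R\<^esub> \<longleftrightarrow> hgerm x f \<in> ?J" if "holo_at f x" for f
    using OZ_eq_iff[OF that holo_at_simps(1)[of 0]] by (simp add: OZ_consts)
  have "OZ_germ X I x h \<in> nonzerodivisors ?R \<longleftrightarrow>
    (\<forall>f. holo_at f x \<longrightarrow> hgerm x f * hgerm x h \<in> ?J \<longrightarrow> hgerm x f \<in> ?J)"
  proof
    assume l: "OZ_germ X I x h \<in> nonzerodivisors ?R"
    show "\<forall>f. holo_at f x \<longrightarrow> hgerm x f * hgerm x h \<in> ?J \<longrightarrow> hgerm x f \<in> ?J"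
    proof (intro allI impI)
      fix f assume f: "holo_at f x" "hgerm x f * hgerm x h \<in> ?J"
      have "OZ_germ X I x f \<in> carrier ?R" using f(1) by (auto simp: OZ_carrier)
      then have "OZ_germ X I x f = \<zero>\<^bsub>?R\<^esub>" using l *[OF f(1)] f(2) unfolding nonzerodivisors_def by simp
      then show "hgerm x f \<in> ?J" using **[OF f(1)] by simp
    qed
  next
    assume r: "\<forall>f. holo_at f x \<longrightarrow> hgerm x f * hgerm x h \<in> ?J \<longrightarrow> hgerm x f \<in> ?J"
    show "OZ_germ X I x h \<in> nonzerodivisors ?R"
      unfolding nonzerodivisors_def
    proof (intro CollectI conjI ballI impI)
      show "OZ_germ X I x h \<in> carrier ?R" using h by (auto simp: OZ_carrier)
      fix a assume a: "a \<in> carrier ?R" "a \<otimes>\<^bsub>?R\<^esub> OZ_germ X I x h = \<zero>\<^bsub>?R\<^esub>"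
      then obtain f where f: "holo_at f x" "a = OZ_germ X I x f" by (auto simp: OZ_carrier)
      then show "a = \<zero>\<^bsub>?R\<^esub>" using a(2) *[OF f(1)] **[OF f(1)] r by simp
    qed
  qed
  also have "\<dots> \<longleftrightarrow> (\<forall>a. a * hgerm x h \<in> ?J \<longrightarrow> a \<in> ?J)" by (metis hgerm_surj)
  finally show ?thesis .
qed

text \<open>Equality of the two classes amounts to g = u h in the quotient ring: the pair (g, h)
  lies in its own class, and conversely the nonzerodivisor \<open>h\<close> can be cancelled in the
  defining equation of every other pair.\<close>

lemma OZ_fraction_eq:
  assumes g: "holo_at g x" and h: "holo_at h x" "OZ_germ X I x h \<in> nonzerodivisors (OZ_ring X I x)" and u: "holo_at u x"
  shows "fraction (OZ_ring X I x) (OZ_germ X I x g) (OZ_germ X I x h) =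
      fraction (OZ_ring X I x) (OZ_germ X I x u) \<one>\<^bsub>OZ_ring X I x\<^esub> \<longleftrightarrow>
    hgerm x g - hgerm x u * hgerm x h \<in> hid x (stalk X I x)" (is "?l \<longleftrightarrow> ?r")
proof -
  let ?R = "OZ_ring X I x"
  interpret R: cring ?R
    unfolding OZ_ring_def by (rule ideal.quotient_is_cring[OF K cring_local_ring])
  define G H V where GHV: "G = OZ_germ X I x g" "H = OZ_germ X I x h" "V = OZ_germ X I x u"
  have c: "G \<in> carrier ?R" "H \<in> carrier ?R" "V \<in> carrier ?R" using g h(1) u by (auto simp: GHV OZ_carrier)
  have r: "?r \<longleftrightarrow> G = V \<otimes>\<^bsub>?R\<^esub> H"
    using OZ_mult[OF u h(1)] OZ_eq_iff[OF g holo_at_simps(3)[OF u h(1)]] hgerm_ops(1)[OF u h(1)] by (simp add: GHV)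
  have "?l \<longleftrightarrow> G = V \<otimes>\<^bsub>?R\<^esub> H"
  proof
    assume "?l"
    moreover have "(G, H) \<in> fraction ?R G H" using c h(2) by (simp add: fraction_def GHV)
    ultimately have "(G, H) \<in> fraction ?R V \<one>\<^bsub>?R\<^esub>" by (simp add: GHV)
    then show "G = V \<otimes>\<^bsub>?R\<^esub> H" using c by (simp add: fraction_def)
  next
    assume eq: "G = V \<otimes>\<^bsub>?R\<^esub> H"
    have "a \<otimes>\<^bsub>?R\<^esub> H = G \<otimes>\<^bsub>?R\<^esub> b \<longleftrightarrow> a \<otimes>\<^bsub>?R\<^esub> \<one>\<^bsub>?R\<^esub> = V \<otimes>\<^bsub>?R\<^esub> b" if ab: "a \<in> carrier ?R" "b \<in> carrier ?R" for a b
    proof -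
      have "G \<otimes>\<^bsub>?R\<^esub> b = (V \<otimes>\<^bsub>?R\<^esub> b) \<otimes>\<^bsub>?R\<^esub> H" unfolding eq using ab c by (simp add: R.m_ac)
      moreover have "a = V \<otimes>\<^bsub>?R\<^esub> b" if e: "a \<otimes>\<^bsub>?R\<^esub> H = (V \<otimes>\<^bsub>?R\<^esub> b) \<otimes>\<^bsub>?R\<^esub> H"
      proof -
        have vb: "V \<otimes>\<^bsub>?R\<^esub> b \<in> carrier ?R" using ab c by simp
        have "(a \<ominus>\<^bsub>?R\<^esub> V \<otimes>\<^bsub>?R\<^esub> b) \<otimes>\<^bsub>?R\<^esub> H = \<zero>\<^bsub>?R\<^esub>"
          using e ab(1) vb c(2) by (simp add: a_minus_def R.l_distr R.l_minus R.r_neg)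
        moreover have "a \<ominus>\<^bsub>?R\<^esub> V \<otimes>\<^bsub>?R\<^esub> b \<in> carrier ?R" using ab(1) vb by simp
        ultimately have "a \<ominus>\<^bsub>?R\<^esub> V \<otimes>\<^bsub>?R\<^esub> b = \<zero>\<^bsub>?R\<^esub>" using h(2) unfolding nonzerodivisors_def GHV by blast
        moreover have "a = (a \<ominus>\<^bsub>?R\<^esub> V \<otimes>\<^bsub>?R\<^esub> b) \<oplus>\<^bsub>?R\<^esub> V \<otimes>\<^bsub>?R\<^esub> b"
          using ab(1) vb by (simp add: a_minus_def R.a_assoc R.l_neg)
        ultimately show ?thesis using vb by simp
      qed
      ultimately show ?thesis using ab by auto
    qed
    moreover have "b \<in> carrier ?R" if "b \<in> nonzerodivisors ?R" for b using that by (simp add: nonzerodivisors_def)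
    ultimately have "fraction ?R G H = fraction ?R V \<one>\<^bsub>?R\<^esub>" unfolding fraction_def by blast
    then show ?l by (simp add: GHV)
  qed
  then show ?thesis using r by simp
qed

end


section \<open>Sections and their germs\<close>

lemma holo_at_cong:
  assumes "holo_at f x" "eventually (\<lambda>z. g z = f z) (nhds x)" shows "holo_at g x"
proof -
  obtain U where U: "x \<in> U" "holo_on f U" using assms(1) by (auto simp: holo_at_def)
  obtain W where W: "open W" "x \<in> W" "\<forall>z\<in>W. g z = f z" using assms(2) unfolding eventually_nhds by blast
  have o: "open (U \<inter> W)" using holo_on_open[OF U(2)] W(1) by blast
  have "holo_on g (U \<inter> W)"
    by (rule holo_on_cong[OF holo_on_subset[OF U(2) o]]) (use W(3) in auto)
  then show ?thesis using U(1) W(2) unfolding holo_at_def by blast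
qed

lemma hev_hgerm: "holo_at f x \<Longrightarrow> hev (hgerm x f) = f x"
  using eventually_nhds_x_imp_x[OF hfun_hgerm] by (simp add: hev_hfun)

locale ideal_sheaf_on =
  fixes X :: "(complex ^ ('n::finite)) set" and I :: "'n presheaf"
  assumes open_X: "open X" and sheaf: "ideal_sheaf X I"
begin

definition J :: "complex ^ 'n \<Rightarrow> 'n hg set" where "J x = hid x (stalk X I x)"

lemma sec:
  assumes "open U" "U \<subseteq> X"
  shows "f \<in> I U \<Longrightarrow> holo_on f U" "f \<in> I U \<Longrightarrow> (\<And>z. z \<in> U \<Longrightarrow> g z = f z) \<Longrightarrow> g \<in> I U"
    "f \<in> I U \<Longrightarrow> holo_on h U \<Longrightarrow> (\<lambda>z. h z * f z) \<in> I U"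
  using conjunct1[OF sheaf[unfolded ideal_sheaf_def], rule_format, of U] assms by auto

lemma sec_restrict:
  assumes "open U" "U \<subseteq> X" "open V" "V \<subseteq> U" "f \<in> I U" shows "f \<in> I V"
  using conjunct1[OF conjunct2[OF sheaf[unfolded ideal_sheaf_def]], rule_format, of U V] assms by auto

lemma ideal_stalk_at: "x \<in> X \<Longrightarrow> ideal (stalk X I x) (local_ring x)"
  by (rule ideal_stalk[OF sheaf open_X])

lemma ideal_J: "x \<in> X \<Longrightarrow> ideal_in UNIV (J x)"
  unfolding J_def by (rule ideal_in_hid[OF ideal_stalk_at])

lemma section_germ:
  assumes "open U" "U \<subseteq> X" "f \<in> I U" "x \<in> U" shows "hgerm x f \<in> J x"
proof -
  have "holo_at f x" by (rule holo_at_holo_on[OF sec(1)[OF assms(1-3)] assms(4)])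
  moreover have "germ x f \<in> stalk X I x" using assms unfolding stalk_def by blast
  ultimately show ?thesis unfolding J_def by (simp add: mem_hid)
qed

lemma germ_section:
  assumes f: "holo_at f x" "hgerm x f \<in> J x"
  shows "\<exists>U. open U \<and> x \<in> U \<and> U \<subseteq> X \<and> f \<in> I U"
proof -
  have "germ x f \<in> stalk X I x" using f by (simp add: J_def mem_hid)
  then obtain f' U where U: "germ x f = germ x f'" "open U" "x \<in> U" "U \<subseteq> X" "f' \<in> I U"
    unfolding stalk_def by blast
  have "holo_at f' x" by (rule holo_at_holo_on[OF sec(1)[OF U(2,4,5)] U(3)])
  from germ_eq_iff[OF f(1) this] have "eventually (\<lambda>z. f z = f' z) (nhds x)" using U(1) by simp
  then obtain W where W: "open W" "x \<in> W" "\<forall>z\<in>W. f z = f' z" unfolding eventually_nhds by blast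
  have o: "open (U \<inter> W)" "U \<inter> W \<subseteq> X" using U W by auto
  have "f' \<in> I (U \<inter> W)" by (rule sec_restrict[OF U(2,4) o(1) _ U(5)]) auto
  then have "f \<in> I (U \<inter> W)" by (rule sec(2)[OF o]) (use W(3) in auto)
  then show ?thesis using o U(3) W(2) by blast
qed

lemma unit_off_Z:
  assumes "x \<in> X" "x \<notin> zero_variety X I" shows "1 \<in> J x"
proof -
  obtain U f where U: "open U" "x \<in> U" "U \<subseteq> X" "f \<in> I U" "f x \<noteq> 0"
    using assms unfolding zero_variety_def by blast
  have h: "holo_at f x" by (rule holo_at_holo_on[OF sec(1)[OF U(1,3,4)] U(2)])
  have "hgerm x f \<in> J x" by (rule section_germ[OF U(1,3,4,2)])
  moreover obtain b where "hgerm x f * b = 1" using hg_unit[of "hgerm x f"] hev_hgerm[OF h] U(5) by auto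
  ultimately show ?thesis using ideal_inD(5)[OF ideal_J[OF assms(1)] _ hO_UNIV] by metis
qed

lemma no_unit_on_Z:
  assumes "x \<in> zero_variety X I" shows "1 \<notin> J x"
proof
  assume "1 \<in> J x"
  then have "hgerm x (\<lambda>_. 1) \<in> J x" by simp
  from germ_section[OF holo_at_simps(1) this]
  obtain U where "open U" "x \<in> U" "U \<subseteq> X" "(\<lambda>_. 1) \<in> I U" by blast
  then show False using assms unfolding zero_variety_def by fastforce
qed

end


section \<open>The resolution of the local ring\<close>

text \<open>In the binomial expansion of the power n + m each term contains at least the n-th power
  of the first summand or the m-th power of the second.\<close>

lemma radical_gidl:
  assumes Q: "ideal_in UNIV Q" and F: "\<And>a. a \<in> F \<Longrightarrow> \<exists>n. a ^ n \<in> Q" and a: "a \<in> gidl F"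
  shows "\<exists>n. a ^ n \<in> Q"
  using a
proof (induction rule: gidl.induct)
  case zero
  show ?case using ideal_inD(2)[OF Q] by (intro exI[of _ 1]) simp
next
  case (add a x c)
  obtain n where n: "a ^ n \<in> Q" using add.IH by blast
  obtain m where m: "x ^ m \<in> Q" using F[OF add.hyps(2)] by blast
  have "(a + c * x) ^ (n + m) = (\<Sum>k\<le>n + m. of_nat (n + m choose k) * a ^ k * (c * x) ^ (n + m - k))"
    by (rule binomial_ring)
  also have "\<dots> \<in> Q"
  proof (rule ideal_in_sum[OF Q])
    fix k assume k: "k \<in> {..n + m}"
    show "of_nat (n + m choose k) * a ^ k * (c * x) ^ (n + m - k) \<in> Q"
    proof (cases "n \<le> k")
      case True
      then have "a ^ k = a ^ (k - n) * a ^ n" by (simp flip: power_add)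
      then have "a ^ k \<in> Q" using ideal_inD(4)[OF Q n hO_UNIV] by simp
      from ideal_inD(4)[OF Q this hO_UNIV] have "of_nat (n + m choose k) * a ^ k \<in> Q" .
      then show ?thesis by (rule ideal_inD(5)[OF Q _ hO_UNIV])
    next
      case False
      then have "x ^ (n + m - k) = x ^ (n - k) * x ^ m" by (simp flip: power_add)
      then have "x ^ (n + m - k) \<in> Q" using ideal_inD(4)[OF Q m hO_UNIV] by simp
      then have "(c * x) ^ (n + m - k) \<in> Q"
        unfolding power_mult_distrib by (rule ideal_inD(4)[OF Q _ hO_UNIV])
      then show ?thesis by (rule ideal_inD(4)[OF Q _ hO_UNIV])
    qed
  qed
  finally show ?case by blast
qed

lemma pow_regseq_nth:
  assumes "pow_regseq xs" "k < length xs" "a * (xs ! k) ^ e \<in> gidl ((\<lambda>i. (xs ! i) ^ e) ` {..<k})"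
  shows "a \<in> gidl ((\<lambda>i. (xs ! i) ^ e) ` {..<k})"
proof -
  let ?ys = "map (\<lambda>x. x ^ e) xs"
  have "set (take k ?ys) = (\<lambda>i. ?ys ! i) ` {..<k}"
    using nth_image[of k ?ys] assms(2) by (simp add: lessThan_atLeast0)
  also have "\<dots> = (\<lambda>i. (xs ! i) ^ e) ` {..<k}" using assms(2) by (intro image_cong) auto
  finally have "set (take k ?ys) = (\<lambda>i. (xs ! i) ^ e) ` {..<k}" .
  moreover have "regseq ?ys" using assms(1) by (simp add: pow_regseq_def)
  then have "\<forall>k<length ?ys. \<forall>a. a * ?ys ! k \<in> gidl (set (take k ?ys)) \<longrightarrow> a \<in> gidl (set (take k ?ys))"
    by (simp only: regseq_def)
  then have "a * ?ys ! k \<in> gidl (set (take k ?ys)) \<longrightarrow> a \<in> gidl (set (take k ?ys))" using assms(2) by simp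
  ultimately show ?thesis using assms(2,3) by simp
qed

locale resolved = ideal_sheaf_on X I for X :: "(complex ^ ('n::finite)) set" and I :: "'n presheaf" +
  fixes N :: nat and r :: "nat \<Rightarrow> nat" and f :: "nat \<Rightarrow> complex ^ 'n \<Rightarrow> complex Matrix.mat"
  assumes res: "free_resolution X I N r f"
begin

lemma N_pos: "N \<ge> 1" and r_0: "r 0 = 1"
  using res by (auto simp: free_resolution_def)

lemma f_mat:
  assumes "k \<in> {1..N}"
  shows "z \<in> X \<Longrightarrow> f k z \<in> carrier_mat (r (k - 1)) (r k)"
    "i < r (k - 1) \<Longrightarrow> j < r k \<Longrightarrow> holo_on (\<lambda>z. f k z $$ (i, j)) X"
  using res assms unfolding free_resolution_def holo_mat_on_def by blast+

lemma f_holo: "k \<in> {1..N} \<Longrightarrow> i < r (k - 1) \<Longrightarrow> j < r k \<Longrightarrow> x \<in> X \<Longrightarrow> holo_at (\<lambda>z. f k z $$ (i, j)) x"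
  by (rule holo_at_holo_on[OF f_mat(2)])

lemma near_X: "x \<in> X \<Longrightarrow> eventually (\<lambda>z. z \<in> X) (nhds x)"
  using open_X eventually_nhds by blast

text \<open>The values of \<open>r\<close> beyond \<open>N\<close> are arbitrary; the locale
  \<open>resolution\<close> wants rank 0 there.\<close>

definition rr :: "nat \<Rightarrow> nat" where "rr k = (if k \<le> N then r k else 0)"

definition A :: "complex ^ 'n \<Rightarrow> nat \<Rightarrow> nat \<Rightarrow> nat \<Rightarrow> 'n hg" where
  "A x k i j = hgerm x (\<lambda>z. f k z $$ (i, j))"

lemma mult_vec_germ:
  assumes k: "k \<in> {1..N}" and x: "x \<in> X" and w: "holo_vec_at (r k) w x" and i: "i < r (k - 1)"
  shows "holo_at (\<lambda>z. vec_index (f k z *\<^sub>v w z) i) x"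
    "hgerm x (\<lambda>z. vec_index (f k z *\<^sub>v w z) i) = (\<Sum>j<r k. A x k i j * hgerm x (\<lambda>z. vec_index (w z) j))"
proof -
  let ?s = "\<lambda>z. \<Sum>j<r k. f k z $$ (i, j) * vec_index (w z) j"
  have w': "eventually (\<lambda>z. w z \<in> carrier_vec (r k)) (nhds x)" "\<And>j. j < r k \<Longrightarrow> holo_at (\<lambda>z. vec_index (w z) j) x"
    using w by (auto simp: holo_vec_at_def)
  have t: "holo_at (\<lambda>z. f k z $$ (i, j) * vec_index (w z) j) x" if "j < r k" for j
    by (rule holo_at_simps(3)[OF f_holo[OF k i that x] w'(2)[OF that]])
  have s: "holo_at ?s x" by (rule holo_at_sum) (use t in auto)
  have eq: "eventually (\<lambda>z. vec_index (f k z *\<^sub>v w z) i = ?s z) (nhds x)"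
    using near_X[OF x] w'(1)
  proof eventually_elim
    case (elim z)
    then show ?case using f_mat(1)[OF k elim(1)] i by (simp add: scalar_prod_def lessThan_atLeast0)
  qed
  show h: "holo_at (\<lambda>z. vec_index (f k z *\<^sub>v w z) i) x" by (rule holo_at_cong[OF s eq])
  have "hgerm x (\<lambda>z. vec_index (f k z *\<^sub>v w z) i) = hgerm x ?s" by (rule hgerm_cong[OF eq h s])
  also have "\<dots> = (\<Sum>j<r k. hgerm x (\<lambda>z. f k z $$ (i, j) * vec_index (w z) j))"
    by (rule hgerm_sum) (use t in auto)
  also have "\<dots> = (\<Sum>j<r k. A x k i j * hgerm x (\<lambda>z. vec_index (w z) j))"
    unfolding A_def by (intro sum.cong refl hgerm_ops(1) f_holo[OF k i _ x] w'(2)) auto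
  finally show "hgerm x (\<lambda>z. vec_index (f k z *\<^sub>v w z) i) = (\<Sum>j<r k. A x k i j * hgerm x (\<lambda>z. vec_index (w z) j))" .
qed

lemma vec_of_germs:
  obtains V where "holo_vec_at m V x" "\<And>j. j < m \<Longrightarrow> hgerm x (\<lambda>z. vec_index (V z) j) = v j"
proof -
  have "\<forall>j. \<exists>g. holo_at g x \<and> hgerm x g = v j" by (metis hgerm_surj)
  then obtain g where g: "\<And>j. holo_at (g j) x" "\<And>j. hgerm x (g j) = v j" by metis
  show thesis
  proof (rule that[of "\<lambda>z. Matrix.vec m (\<lambda>j. g j z)"])
    have e: "(\<lambda>z. vec_index (Matrix.vec m (\<lambda>j. g j z)) j) = g j" if "j < m" for j using that by auto
    show "holo_vec_at m (\<lambda>z. Matrix.vec m (\<lambda>j. g j z)) x"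
      unfolding holo_vec_at_def using e g(1) by simp
    show "hgerm x (\<lambda>z. vec_index (Matrix.vec m (\<lambda>j. g j z)) j) = v j" if "j < m" for j
      using e[OF that] g(2) by simp
  qed
qed

lemma zero_vec_iff: "dim_vec v = m \<Longrightarrow> v = 0\<^sub>v m \<longleftrightarrow> (\<forall>i\<in>{..<m}. vec_index v i = 0)"
proof -
  assume d: "dim_vec v = m"
  show ?thesis
  proof
    assume "v = 0\<^sub>v m"
    then show "\<forall>i\<in>{..<m}. vec_index v i = 0" by simp
  qed (use d in \<open>auto intro!: eq_vecI\<close>)
qed

lemma eventually_zero_vec_iff:
  assumes k: "k \<in> {1..N}" and x: "x \<in> X" and w: "holo_vec_at (r k) w x"
  shows "eventually (\<lambda>z. f k z *\<^sub>v w z = 0\<^sub>v (r (k - 1))) (nhds x) \<longleftrightarrow>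
    (\<forall>i<r (k - 1). (\<Sum>j<r k. A x k i j * hgerm x (\<lambda>z. vec_index (w z) j)) = 0)"
proof -
  have c: "(\<Sum>j<r k. A x k i j * hgerm x (\<lambda>z. vec_index (w z) j)) = 0 \<longleftrightarrow>
    eventually (\<lambda>z. vec_index (f k z *\<^sub>v w z) i = 0) (nhds x)" if i: "i < r (k - 1)" for i
    using mult_vec_germ[OF k x w i] hgerm_eq_iff[OF mult_vec_germ(1)[OF k x w i] holo_at_simps(1)[of 0]] by simp
  have "eventually (\<lambda>z. f k z *\<^sub>v w z = 0\<^sub>v (r (k - 1))) (nhds x) \<longleftrightarrow>
    eventually (\<lambda>z. \<forall>i\<in>{..<r (k - 1)}. vec_index (f k z *\<^sub>v w z) i = 0) (nhds x)"
    by (rule eventually_cong[OF near_X[OF x] zero_vec_iff]) (use carrier_matD(1)[OF f_mat(1)[OF k]] in simp)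
  also have "\<dots> \<longleftrightarrow> (\<forall>i\<in>{..<r (k - 1)}. eventually (\<lambda>z. vec_index (f k z *\<^sub>v w z) i = 0) (nhds x))"
    by (rule eventually_ball_finite_distrib) simp
  finally show ?thesis using c by auto
qed

lemma resolution_at:
  assumes x: "x \<in> X" shows "resolution N rr (A x)"
proof
  show "rr (Suc N) = 0" by (simp add: rr_def)
next
  fix k w i assume k: "k \<in> {1..N}" and i: "i < rr (k - 1)"
  show "(\<Sum>j<rr k. A x k i j * (\<Sum>l<rr (Suc k). A x (Suc k) j l * w l)) = 0"
  proof (cases "k = N")
    case True
    then show ?thesis by (simp add: rr_def)
  next
    case False
    then have k': "k \<in> {1..<N}" "Suc k \<in> {1..N}" and rk: "rr (Suc k) = r (Suc k)" "rr k = r k" "i < r (k - 1)"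
      using k i by (auto simp: rr_def split: if_splits)
    obtain W where W: "holo_vec_at (r (Suc k)) W x" "\<And>j. j < r (Suc k) \<Longrightarrow> hgerm x (\<lambda>z. vec_index (W z) j) = w j"
      using vec_of_germs[of "r (Suc k)" x w] by blast
    define V where "V z = f (Suc k) z *\<^sub>v W z" for z
    have Vc: "holo_at (\<lambda>z. vec_index (V z) j) x" "hgerm x (\<lambda>z. vec_index (V z) j) = (\<Sum>l<r (Suc k). A x (Suc k) j l * w l)"
      if j: "j < r k" for j
      using mult_vec_germ[OF k'(2) x W(1), of j] j W(2) by (simp_all add: V_def)
    have V: "holo_vec_at (r k) V x"
      unfolding holo_vec_at_def
    proof (intro conjI allI impI)
      show "eventually (\<lambda>z. V z \<in> carrier_vec (r k)) (nhds x)"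
        using near_X[OF x] by eventually_elim (use carrier_matD(1)[OF f_mat(1)[OF k'(2)]] in \<open>auto simp: V_def intro!: carrier_vecI\<close>)
    qed (rule Vc(1))
    have "eventually (\<lambda>z. f k z *\<^sub>v V z = 0\<^sub>v (r (k - 1))) (nhds x) \<longleftrightarrow>
      (\<exists>w. holo_vec_at (r (k + 1)) w x \<and> eventually (\<lambda>z. V z = f (k + 1) z *\<^sub>v w z) (nhds x))"
      using res x k'(1) V unfolding free_resolution_def by blast
    moreover have "holo_vec_at (r (k + 1)) W x \<and> eventually (\<lambda>z. V z = f (k + 1) z *\<^sub>v W z) (nhds x)"
      using W(1) by (simp add: V_def)
    ultimately have "eventually (\<lambda>z. f k z *\<^sub>v V z = 0\<^sub>v (r (k - 1))) (nhds x)" by blast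
    then have "(\<Sum>j<r k. A x k i j * hgerm x (\<lambda>z. vec_index (V z) j)) = 0"
      using eventually_zero_vec_iff[OF k x V] rk(3) by blast
    then show ?thesis unfolding rk using Vc(2) by simp
  qed
next
  fix k v assume k: "k \<in> {1..N}" and v: "\<And>i. i < rr (k - 1) \<Longrightarrow> (\<Sum>j<rr k. A x k i j * v j) = 0"
  have rk: "rr (k - 1) = r (k - 1)" "rr k = r k" using k by (auto simp: rr_def)
  obtain V where V: "holo_vec_at (r k) V x" "\<And>j. j < r k \<Longrightarrow> hgerm x (\<lambda>z. vec_index (V z) j) = v j"
    using vec_of_germs[of "r k" x v] by blast
  have Vh: "holo_at (\<lambda>z. vec_index (V z) j) x" if "j < r k" for j using V(1) that by (simp add: holo_vec_at_def)
  have "\<forall>i<r (k - 1). (\<Sum>j<r k. A x k i j * hgerm x (\<lambda>z. vec_index (V z) j)) = 0"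
    using v V(2) unfolding rk by simp
  then have ev: "eventually (\<lambda>z. f k z *\<^sub>v V z = 0\<^sub>v (r (k - 1))) (nhds x)"
    using eventually_zero_vec_iff[OF k x V(1)] by blast
  show "\<exists>w. \<forall>j<rr k. v j = (\<Sum>l<rr (Suc k). A x (Suc k) j l * w l)"
  proof (cases "k = N")
    case True
    have "eventually (\<lambda>z. V z = 0\<^sub>v (r N)) (nhds x)"
      using res x V(1) ev True unfolding free_resolution_def by blast
    then have "hgerm x (\<lambda>z. vec_index (V z) j) = 0" if "j < r k" for j
      using that True hgerm_eq_iff[OF Vh[OF that] holo_at_simps(1)[of 0]] by (auto elim!: eventually_mono)
    then have "v j = 0" if "j < rr k" for j using V(2) that by (simp add: rk)
    then show ?thesis using True by (simp add: rr_def)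
  next
    case False
    then have k': "k \<in> {1..<N}" "Suc k \<in> {1..N}" and rS: "rr (Suc k) = r (Suc k)" using k by (auto simp: rr_def)
    have "\<exists>w. holo_vec_at (r (k + 1)) w x \<and> eventually (\<lambda>z. V z = f (k + 1) z *\<^sub>v w z) (nhds x)"
      using res x k'(1) V(1) ev unfolding free_resolution_def by blast
    then obtain w where w: "holo_vec_at (r (Suc k)) w x" "eventually (\<lambda>z. V z = f (Suc k) z *\<^sub>v w z) (nhds x)" by auto
    have "v j = (\<Sum>l<r (Suc k). A x (Suc k) j l * hgerm x (\<lambda>z. vec_index (w z) l))" if j: "j < r k" for j
    proof -
      have j': "j < r (Suc k - 1)" using j by simp
      have "v j = hgerm x (\<lambda>z. vec_index (V z) j)" using V(2)[OF j] by simp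
      also have "\<dots> = hgerm x (\<lambda>z. vec_index (f (Suc k) z *\<^sub>v w z) j)"
        by (rule hgerm_cong[OF _ Vh[OF j] mult_vec_germ(1)[OF k'(2) x w(1) j']])
          (use w(2) in \<open>auto elim: eventually_mono\<close>)
      finally show ?thesis using mult_vec_germ(2)[OF k'(2) x w(1) j'] by simp
    qed
    then show ?thesis by (intro exI[of _ "\<lambda>l. hgerm x (\<lambda>z. vec_index (w z) l)"]) (simp add: rk rS)
  qed
qed

lemma res_ideal_at:
  assumes x: "x \<in> X"
  shows "resolution.res_ideal rr (A x) = J x"
proof -
  interpret resolution N rr "A x" by (rule resolution_at[OF x])
  have k: "1 \<in> {1..N}" using N_pos by simp
  have i: "0 < r (1 - 1)" using r_0 by simp
  have r1: "rr 1 = r 1" using N_pos by (simp add: rr_def)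
  have st: "stalk X I x = {germ x (\<lambda>z. vec_index (f 1 z *\<^sub>v w z) 0) | w. holo_vec_at (r 1) w x}"
    using res x unfolding free_resolution_def by blast
  have "mv 1 w 0 \<in> J x" for w
  proof -
    obtain W where W: "holo_vec_at (r 1) W x" "\<And>j. j < r 1 \<Longrightarrow> hgerm x (\<lambda>z. vec_index (W z) j) = w j"
      using vec_of_germs[of "r 1" x w] by blast
    have "mv 1 w 0 = hgerm x (\<lambda>z. vec_index (f 1 z *\<^sub>v W z) 0)"
      using mult_vec_germ(2)[OF k x W(1) i] W(2) r1 by (simp add: mv_def)
    moreover have "germ x (\<lambda>z. vec_index (f 1 z *\<^sub>v W z) 0) \<in> stalk X I x" using st W(1) by blast
    ultimately show ?thesis using mem_hid[OF mult_vec_germ(1)[OF k x W(1) i]] by (simp add: J_def)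
  qed
  moreover have "\<exists>w. a = mv 1 w 0" if a: "a \<in> J x" for a
  proof -
    obtain g where g: "holo_at g x" "a = hgerm x g" "germ x g \<in> stalk X I x" using a by (auto simp: J_def hid_def)
    then obtain w where w: "holo_vec_at (r 1) w x" "germ x g = germ x (\<lambda>z. vec_index (f 1 z *\<^sub>v w z) 0)" using st by blast
    then have "a = hgerm x (\<lambda>z. vec_index (f 1 z *\<^sub>v w z) 0)"
      using g germ_eq_iff[OF g(1) mult_vec_germ(1)[OF k x w(1) i]] hgerm_eq_iff[OF g(1) mult_vec_germ(1)[OF k x w(1) i]] by simp
    then show ?thesis
      using mult_vec_germ(2)[OF k x w(1) i] r1
      by (intro exI[of _ "\<lambda>j. hgerm x (\<lambda>z. vec_index (w z) j)"]) (simp add: mv_def)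
  qed
  ultimately show ?thesis unfolding res_ideal_def by blast
qed

section \<open>Maximal ranks and the minors that cut out the resolution sets\<close>

definition max_rank :: "nat \<Rightarrow> nat" where
  "max_rank k = Max ((\<lambda>z. vec_space.rank (r (k - 1)) (f k z)) ` X)"

lemma rank_le_max_rank:
  assumes k: "k \<in> {1..N}" and z: "z \<in> X"
  shows "vec_space.rank (r (k - 1)) (f k z) \<le> max_rank k" "\<exists>w\<in>X. vec_space.rank (r (k - 1)) (f k w) = max_rank k"
proof -
  let ?R = "(\<lambda>z. vec_space.rank (r (k - 1)) (f k z)) ` X"
  have "?R \<subseteq> {..r k}" using vec_space.rank_le_nc[OF f_mat(1)[OF k]] by auto
  then have fin: "finite ?R" using finite_subset by blast
  then show "vec_space.rank (r (k - 1)) (f k z) \<le> max_rank k" unfolding max_rank_def using z by (intro Max_ge) auto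
  have "max_rank k \<in> ?R" unfolding max_rank_def by (rule Max_in[OF fin]) (use z in auto)
  then show "\<exists>w\<in>X. vec_space.rank (r (k - 1)) (f k w) = max_rank k" by auto
qed

text \<open>Extensional index maps keep the set finite. Repetitions are allowed, since a minor with
  a repeated row or column is zero.\<close>

definition idx :: "nat \<Rightarrow> ((nat \<Rightarrow> nat) \<times> (nat \<Rightarrow> nat)) set" where
  "idx k = ({..<max_rank k} \<rightarrow>\<^sub>E {..<r (k - 1)}) \<times> ({..<max_rank k} \<rightarrow>\<^sub>E {..<r k})"

lemma finite_idx: "finite (idx k)"
  by (auto simp: idx_def intro!: finite_PiE)

lemma resolution_set_iff:
  assumes k: "k \<in> {1..N}" and z: "z \<in> X"
  shows "z \<in> resolution_set X N r f k \<longleftrightarrow>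
    (\<forall>(\<alpha>, \<beta>)\<in>idx k. minor (\<lambda>i j. f k z $$ (i, j)) (max_rank k) \<alpha> \<beta> = 0)" (is "?l \<longleftrightarrow> ?r")
proof -
  let ?q = "max_rank k" and ?rk = "\<lambda>z. vec_space.rank (r (k - 1)) (f k z)"
  have l: "?l \<longleftrightarrow> ?rk z < ?q"
  proof -
    have "?l \<longleftrightarrow> (\<exists>w\<in>X. ?rk z < ?rk w)" using k z by (simp add: resolution_set_def)
    also have "\<dots> \<longleftrightarrow> ?rk z < ?q" using rank_le_max_rank[OF k] z by (metis order.strict_trans2)
    finally show ?thesis .
  qed
  have "?rk z < ?q \<longleftrightarrow> ?r"
  proof
    assume lt: "?rk z < ?q"
    show ?r
    proof (intro ballI, clarify, rule ccontr)
      fix \<alpha> \<beta> assume ab: "(\<alpha>, \<beta>) \<in> idx k" "minor (\<lambda>i j. f k z $$ (i, j)) ?q \<alpha> \<beta> \<noteq> 0"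
      then have "?q \<le> ?rk z"
        by (intro vec_space.minor_le_rank[OF f_mat(1)[OF k z], of _ \<alpha> \<beta>]) (auto simp: idx_def)
      then show False using lt by simp
    qed
  next
    assume r: ?r
    show "?rk z < ?q"
    proof (rule ccontr)
      assume "\<not> ?rk z < ?q"
      then obtain \<alpha> \<beta> where ab: "\<forall>i<?q. \<alpha> i < r (k - 1) \<and> \<beta> i < r k" "minor (\<lambda>i j. f k z $$ (i, j)) ?q \<alpha> \<beta> \<noteq> 0"
        using vec_space.rank_le_minor[OF f_mat(1)[OF k z], of ?q] by auto
      let ?\<alpha> = "restrict \<alpha> {..<?q}" and ?\<beta> = "restrict \<beta> {..<?q}"
      have "(?\<alpha>, ?\<beta>) \<in> idx k" using ab(1) by (auto simp: idx_def)
      moreover have "minor (\<lambda>i j. f k z $$ (i, j)) ?q ?\<alpha> ?\<beta> = minor (\<lambda>i j. f k z $$ (i, j)) ?q \<alpha> \<beta>"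
        by (rule minor_cong) auto
      ultimately show False using r ab(2) by fastforce
    qed
  qed
  then show ?thesis using l by simp
qed

lemma minor_germ:
  assumes k: "k \<in> {1..N}" and x: "x \<in> X" and ab: "\<And>i. i < q \<Longrightarrow> \<alpha> i < r (k - 1)" "\<And>i. i < q \<Longrightarrow> \<beta> i < r k"
  shows "eventually (\<lambda>z. hfun (minor (A x k) q \<alpha> \<beta>) z = minor (\<lambda>i j. f k (x + z) $$ (i, j)) q \<alpha> \<beta>) (nhds 0)"
proof -
  let ?M = "mat q q (\<lambda>(i, j). A x k (\<alpha> i) (\<beta> j))"
  have e: "eventually (\<lambda>z. \<forall>i\<in>{..<q}. \<forall>j\<in>{..<q}. hfun (A x k (\<alpha> i) (\<beta> j)) z = f k (x + z) $$ (\<alpha> i, \<beta> j)) (nhds 0)"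
    unfolding A_def by (intro eventually_ball_finite ballI hfun_hgerm f_holo[OF k _ _ x] ab) auto
  have "eventually (\<lambda>z. hfun (Determinant.det ?M) z = Determinant.det (mat q q (\<lambda>(i, j). hfun (?M $$ (i, j)) z))) (nhds 0)"
    by (rule hfun_det) simp
  from eventually_conj[OF this e] show ?thesis
  proof (rule eventually_mono)
    fix z assume z: "hfun (Determinant.det ?M) z = Determinant.det (mat q q (\<lambda>(i, j). hfun (?M $$ (i, j)) z)) \<and>
      (\<forall>i\<in>{..<q}. \<forall>j\<in>{..<q}. hfun (A x k (\<alpha> i) (\<beta> j)) z = f k (x + z) $$ (\<alpha> i, \<beta> j))"
    have "mat q q (\<lambda>(i, j). hfun (?M $$ (i, j)) z) = mat q q (\<lambda>(i, j). f k (x + z) $$ (\<alpha> i, \<beta> j))"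
      by (rule eq_matI) (use z in auto)
    then show "hfun (minor (A x k) q \<alpha> \<beta>) z = minor (\<lambda>i j. f k (x + z) $$ (i, j)) q \<alpha> \<beta>"
      unfolding minor_def using z by simp
  qed
qed

definition minors :: "complex ^ 'n \<Rightarrow> nat \<Rightarrow> 'n hg set" where
  "minors x k = (\<lambda>(\<alpha>, \<beta>). minor (A x k) (max_rank k) \<alpha> \<beta>) ` idx k"

lemma finite_minors: "finite (minors x k)"
  by (simp add: minors_def finite_idx)

lemma minors_vanish:
  assumes k: "k \<in> {1..N}" and x: "x \<in> X"
  shows "eventually (\<lambda>z. x + z \<in> resolution_set X N r f k \<longleftrightarrow> (\<forall>a\<in>minors x k. hfun a z = 0)) (nhds 0)"
proof -
  have "eventually (\<lambda>z. \<forall>(\<alpha>, \<beta>)\<in>idx k. hfun (minor (A x k) (max_rank k) \<alpha> \<beta>) z =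
      minor (\<lambda>i j. f k (x + z) $$ (i, j)) (max_rank k) \<alpha> \<beta>) (nhds 0)"
    by (intro eventually_ball_finite[OF finite_idx] ballI, clarify, rule minor_germ[OF k x]) (auto simp: idx_def)
  moreover have "eventually (\<lambda>z. x + z \<in> X) (nhds 0)" by (rule iffD1[OF eventually_shift near_X[OF x]])
  ultimately show ?thesis
  proof eventually_elim
    case (elim z)
    then show ?case unfolding resolution_set_iff[OF k elim(2)] minors_def by (fastforce simp: split_beta)
  qed
qed

text \<open>Minors larger than the maximal rank vanish at every point of \<open>X\<close>, so they
  are zero as germs, which is what \<open>split_at_minor\<close> asks for.\<close>

lemma split_at_minors:
  assumes k: "Suc k \<in> {1..N}" and x: "x \<in> X" and \<mu>: "\<mu> \<in> minors x (Suc k)"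
  shows "resolution.split_at rr (A x) k \<mu>"
proof -
  interpret resolution N rr "A x" by (rule resolution_at[OF x])
  let ?q = "max_rank (Suc k)"
  have rk: "rr k = r k" "rr (Suc k) = r (Suc k)" using k by (auto simp: rr_def)
  obtain \<alpha> \<beta> where ab: "(\<alpha>, \<beta>) \<in> idx (Suc k)" "\<mu> = minor (A x (Suc k)) ?q \<alpha> \<beta>" using \<mu> by (auto simp: minors_def)
  have "split_at k (minor (A x (Suc k)) ?q \<alpha> \<beta>)"
  proof (rule split_at_minor)
    show "\<alpha> i < rr k" "\<beta> i < rr (Suc k)" if "i < ?q" for i using ab(1) that by (auto simp: idx_def rk)
    fix \<alpha> \<beta> assume a: "\<And>i. i < Suc ?q \<Longrightarrow> \<alpha> i < rr k" and b: "\<And>i. i < Suc ?q \<Longrightarrow> \<beta> i < rr (Suc k)"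
    have z: "minor (\<lambda>i j. f (Suc k) z $$ (i, j)) (Suc ?q) \<alpha> \<beta> = 0" if z: "z \<in> X" for z
    proof (rule ccontr)
      assume nz: "\<not> ?thesis"
      have "Suc ?q \<le> vec_space.rank (r (Suc k - 1)) (f (Suc k) z)"
        by (rule vec_space.minor_le_rank[OF f_mat(1)[OF k z] _ _ nz]) (use a b in \<open>auto simp: rk\<close>)
      then show False using rank_le_max_rank(1)[OF k z] by simp
    qed
    show "minor (A x (Suc k)) (Suc ?q) \<alpha> \<beta> = 0"
    proof (rule hg_eqI)
      have "eventually (\<lambda>z. x + z \<in> X) (nhds 0)" by (rule iffD1[OF eventually_shift near_X[OF x]])
      moreover have "eventually (\<lambda>z. hfun (minor (A x (Suc k)) (Suc ?q) \<alpha> \<beta>) z =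
          minor (\<lambda>i j. f (Suc k) (x + z) $$ (i, j)) (Suc ?q) \<alpha> \<beta>) (nhds 0)"
        by (rule minor_germ[OF k x]) (use a b in \<open>auto simp: rk\<close>)
      moreover have "eventually (\<lambda>z. hfun (0 :: 'n hg) z = 0) (nhds 0)" by (rule hfun_ops(5))
      ultimately show "eventually (\<lambda>z. hfun (minor (A x (Suc k)) (Suc ?q) \<alpha> \<beta>) z = hfun 0 z) (nhds 0)"
        by eventually_elim (simp add: z)
    qed
  qed
  then show ?thesis using ab(2) by simp
qed

text \<open>If no power of \<Delta> lay in the ideal, some prime colon ideal would belong to an
  element \<open>a\<close> that no power of \<Delta> kills. This prime contains a regular sequence
  of length \<open>p\<close>, longer than the resolution that exists after inverting \<Delta>, so a
  power of \<Delta> does kill \<open>a\<close>. With the full resolution and \<Delta> = 1 this gives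
  \<open>p \<le> N\<close>; with \<open>k = p - 1\<close> it gives the minors of the p-th
  map.\<close>

lemma minors_nilpotent:
  assumes x: "x \<in> zero_variety X I" and p: "p \<ge> 1"
    and pure: "\<And>Q. associated_prime (local_ring x) (stalk X I x) Q \<Longrightarrow> height (local_ring x) Q = enat p"
  shows "p \<le> N" "\<mu> \<in> minors x p \<Longrightarrow> \<exists>s. \<mu> ^ s \<in> J x"
proof -
  have xX: "x \<in> X" using x by (simp add: zero_variety_def)
  interpret resolution N rr "A x" by (rule resolution_at[OF xX])
  have ri: "res_ideal = J x" by (rule res_ideal_at[OF xX])
  have main: "\<exists>s. \<Delta> ^ s \<in> J x" if split: "split_at k \<Delta>" "k \<le> N" "k < p" for k \<Delta>
  proof (rule ccontr)
    assume no: "\<not> ?thesis"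
    obtain a where a: "\<And>k. \<Delta> ^ k * a \<notin> J x" "prime_in UNIV (colon (J x) a)"
      using associated_prime_avoiding[OF ideal_J[OF xX], of \<Delta>] no by blast
    obtain xs where xs: "length xs = p" "set xs \<subseteq> colon (J x) a" "pow_regseq xs"
      using associated_prime_regseq[OF ideal_stalk_at[OF xX] pure p, of a] a(2) unfolding J_def by blast
    have "\<exists>s. \<Delta> ^ s * a \<in> res_ideal"
    proof (rule torsion_if_killed[where x = "\<lambda>i. (xs ! i) ^ 1" and m = p, OF _ _ split])
      show "rr 0 = 1" using r_0 by (simp add: rr_def)
      show "b \<in> gidl ((\<lambda>i. (xs ! i) ^ 1) ` {..<k})" if "k < p" "b * (xs ! k) ^ 1 \<in> gidl ((\<lambda>i. (xs ! i) ^ 1) ` {..<k})" for k b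
        by (rule pow_regseq_nth[OF xs(3) _ that(2)]) (use that(1) xs(1) in simp)
      show "(xs ! i) ^ 1 * a \<in> res_ideal" if "i < p" for i
      proof -
        have "xs ! i \<in> set xs" using xs(1) that by (intro nth_mem) simp
        then show ?thesis using xs(2) by (auto simp: colon_def ri)
      qed
    qed
    then show False using a(1) ri by blast
  qed
  show "p \<le> N"
  proof (rule ccontr)
    assume "\<not> ?thesis"
    then have "\<exists>s. 1 ^ s \<in> J x" by (intro main[OF split_at_end]) auto
    then show False using no_unit_on_Z[OF x] by simp
  qed
  then have pN: "Suc (p - 1) \<in> {1..N}" using p by auto
  show "\<exists>s. \<mu> ^ s \<in> J x" if "\<mu> \<in> minors x p"
    by (rule main[OF split_at_minors[OF pN xX]]) (use that p pN in auto)
qed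

text \<open>The ideal \<open>((\<I>, h) : g)\<close> contains powers of the maximal minors of the \<open>k\<close>-th map, by induction on \<open>k\<close>.\<close>

lemma divisible_at:
  assumes x: "x \<in> zero_variety X I" and p: "p \<ge> 1"
    and pure: "\<And>Q. associated_prime (local_ring x) (stalk X I x) Q \<Longrightarrow> height (local_ring x) Q = enat p"
    and h: "\<And>a. a * h \<in> J x \<Longrightarrow> a \<in> J x"
    and R0: "\<And>\<rho>. \<rho> \<in> R0 \<Longrightarrow> \<exists>u. \<rho> * g - u * h \<in> J x"
    and codim: "\<And>k. k \<in> {p..N} \<Longrightarrow> \<exists>xs. length xs = k + 2 \<and> set xs \<subseteq> gidl (R0 \<union> minors x k) \<and> pow_regseq xs"
  shows "\<exists>u. g - u * h \<in> J x"
proof -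
  have xX: "x \<in> X" using x by (simp add: zero_variety_def)
  interpret resolution N rr "A x" by (rule resolution_at[OF xX])
  have ri: "res_ideal = J x" by (rule res_ideal_at[OF xX])
  note JD = ideal_inD[OF ideal_J[OF xX]]
  have pN: "p \<le> N" by (rule minors_nilpotent(1)[OF x p pure])
  define Q where "Q = {e. \<exists>u. e * g - u * h \<in> J x}"
  have Qadd: "a + b \<in> Q" if ab: "a \<in> Q" "b \<in> Q" for a b
  proof -
    obtain u v where "a * g - u * h \<in> J x" "b * g - v * h \<in> J x" using ab by (auto simp: Q_def)
    from JD(3)[OF this] have "(a + b) * g - (u + v) * h \<in> J x" by (simp add: algebra_simps)
    then show ?thesis unfolding Q_def by blast
  qed
  have Qmult: "c * a \<in> Q" if a: "a \<in> Q" for a c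
  proof -
    obtain u where "a * g - u * h \<in> J x" using a by (auto simp: Q_def)
    from JD(4)[OF this hO_UNIV, of c] have "(c * a) * g - (c * u) * h \<in> J x" by (simp add: algebra_simps)
    then show ?thesis unfolding Q_def by blast
  qed
  have "0 * g - 0 * h \<in> J x" using JD(2) by simp
  then have "0 \<in> Q" unfolding Q_def by blast
  then have Q: "ideal_in UNIV Q" using Qadd Qmult by (auto simp: ideal_in_def)
  have JQ: "e \<in> Q" if "e \<in> J x" for e
  proof -
    have "e * g - 0 * h \<in> J x" using JD(5)[OF that hO_UNIV] by simp
    then show ?thesis unfolding Q_def by blast
  qed
  have step: "\<exists>s. \<Delta> ^ s \<in> Q" if k: "k \<in> {p..N}" and mk: "\<forall>\<mu>\<in>minors x k. \<exists>n. \<mu> ^ n \<in> Q" and split: "split_at k \<Delta>" for k \<Delta>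
  proof -
    obtain xs where xs: "length xs = k + 2" "set xs \<subseteq> gidl (R0 \<union> minors x k)" "pow_regseq xs"
      using codim[OF k] by blast
    have "\<exists>n. a ^ n \<in> Q" if "a \<in> R0 \<union> minors x k" for a
    proof (cases "a \<in> R0")
      case True
      then have "a ^ 1 \<in> Q" using R0 by (simp add: Q_def)
      then show ?thesis by blast
    qed (use mk that in blast)
    then have "\<exists>n. a ^ n \<in> Q" if "a \<in> set xs" for a using radical_gidl[OF Q] xs(2) that by blast
    then have "\<forall>a\<in>set xs. \<exists>n. a ^ n \<in> Q" by blast
    then obtain n where n: "\<And>a. a \<in> set xs \<Longrightarrow> a ^ n a \<in> Q" by metis
    \<comment> \<open>One exponent for all entries, which is the form in which
      \<open>pow_regseq\<close> guarantees regularity.\<close>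
    define e where "e = Max (n ` set xs)"
    have xe: "a ^ e \<in> Q" if "a \<in> set xs" for a
    proof -
      have "n a \<le> e" unfolding e_def using that by (intro Max_ge) auto
      then have "a ^ e = a ^ (e - n a) * a ^ n a" by (simp flip: power_add)
      then show ?thesis using Qmult[OF n[OF that]] by simp
    qed
    have "\<exists>s u. \<Delta> ^ s * g - u * h \<in> res_ideal"
    proof (rule torsion_if_killed_mod[where x = "\<lambda>i. (xs ! i) ^ e" and m = "k + 2", OF _ _ split])
      show "rr 0 = 1" using r_0 by (simp add: rr_def)
      show "b \<in> gidl ((\<lambda>i. (xs ! i) ^ e) ` {..<j})" if "j < k + 2" "b * (xs ! j) ^ e \<in> gidl ((\<lambda>i. (xs ! i) ^ e) ` {..<j})" for j b
        by (rule pow_regseq_nth[OF xs(3) _ that(2)]) (use that(1) xs(1) in simp)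
      show "\<exists>u. (xs ! i) ^ e * g - u * h \<in> res_ideal" if "i < k + 2" for i
        using xe[of "xs ! i"] xs(1) that by (simp add: Q_def ri)
      show "a \<in> res_ideal" if "a * h \<in> res_ideal" for a using h that by (simp add: ri)
    qed (use k in auto)
    then show ?thesis by (auto simp: Q_def ri)
  qed
  have all: "\<forall>\<mu>\<in>minors x k. \<exists>n. \<mu> ^ n \<in> Q" if "p \<le> k" "k \<le> N" for k
    using that
  proof (induction k rule: dec_induct)
    case base
    show ?case using minors_nilpotent(2)[OF x p pure] JQ by blast
  next
    case (step k)
    show ?case
    proof
      fix \<mu> assume \<mu>: "\<mu> \<in> minors x (Suc k)"
      show "\<exists>n. \<mu> ^ n \<in> Q"
        by (rule \<open>\<And>k \<Delta>. k \<in> {p..N} \<Longrightarrow> \<forall>\<mu>\<in>minors x k. \<exists>n. \<mu> ^ n \<in> Q \<Longrightarrow> split_at k \<Delta> \<Longrightarrow> \<exists>s. \<Delta> ^ s \<in> Q\<close>[OF _ _ split_at_minors[OF _ xX \<mu>]])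
          (use step in auto)
    qed
  qed
  \<comment> \<open>At the end of the resolution \<open>split_at\<close> holds for 1, so the
    inductive step itself yields 1 as an element of \<open>Q\<close>.\<close>
  have "\<exists>s. 1 ^ s \<in> Q" by (rule step[OF _ all split_at_end]) (use pN in auto)
  then show ?thesis by (simp add: Q_def)
qed

end


section \<open>The pole set\<close>

lemma regular_point_translate:
  assumes "regular_point {z. x + z \<in> A} w j" shows "regular_point A (x + w) j"
proof -
  obtain U g where U: "x + w \<in> A" "open U" "w \<in> U" "\<forall>i<j. holo_on (g i) U"
    "{z. x + z \<in> A} \<inter> U = {z\<in>U. \<forall>i<j. g i z = 0}"
    and ind: "\<forall>c :: nat \<Rightarrow> complex. (\<forall>v. (\<Sum>i<j. c i * frechet_derivative (g i) (at w) v) = 0) \<longrightarrow> (\<forall>i<j. c i = 0)"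
    using assms unfolding regular_point_def by auto
  let ?T = "\<lambda>z. - x + z"
  let ?U = "?T -` U"
  have o: "open ?U" by (intro open_vimage U(2) continuous_intros)
  have h: "holo_on (\<lambda>z. g i (?T z)) ?U" if "i < j" for i
    using holo_on_compose_linear[of "g i" U ?U "- x" "\<lambda>z. z"] U(4) that o
    by (auto simp: bounded_linear.linear[OF bounded_linear_ident])
  have fd: "frechet_derivative (\<lambda>z. g i (?T z)) (at (x + w)) = frechet_derivative (g i) (at w)" if i: "i < j" for i
  proof -
    have "(g i has_derivative frechet_derivative (g i) (at w)) (at (?T (x + w)))"
      using holo_on_frechet(1)[of "g i" U w] U(3,4) i by simp
    moreover have "(?T has_derivative (\<lambda>v. v)) (at (x + w))" by (auto intro!: derivative_eq_intros)
    ultimately have "((\<lambda>z. g i (?T z)) has_derivative (\<lambda>v. frechet_derivative (g i) (at w) v)) (at (x + w))"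
      using has_derivative_compose by blast
    then show ?thesis using frechet_derivative_at by metis
  qed
  have eq: "z \<in> A \<longleftrightarrow> (\<forall>i<j. g i (?T z) = 0)" if "?T z \<in> U" for z
  proof -
    have "?T z \<in> {z. x + z \<in> A} \<inter> U \<longleftrightarrow> ?T z \<in> {z\<in>U. \<forall>i<j. g i z = 0}" using U(5) by simp
    then show ?thesis using that by simp
  qed
  show ?thesis
    unfolding regular_point_def
  proof (intro conjI exI[of _ ?U] exI[of _ "\<lambda>i z. g i (?T z)"])
    show "A \<inter> ?U = {z\<in>?U. \<forall>i<j. g i (?T z) = 0}" using eq by auto
    show "\<forall>c :: nat \<Rightarrow> complex. (\<forall>v. (\<Sum>i<j. c i * frechet_derivative (\<lambda>z. g i (?T z)) (at (x + w)) v) = 0) \<longrightarrow> (\<forall>i<j. c i = 0)"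
      using ind fd by simp
  qed (use U o h in auto)
qed

lemma unit_in_gidl_iff:
  assumes F: "\<And>j. j < l \<Longrightarrow> holo_at (\<rho> j) y"
  shows "1 \<in> gidl ((\<lambda>j. hgerm y (\<rho> j)) ` {..<l}) \<longleftrightarrow> (\<exists>j<l. \<rho> j y \<noteq> 0)"
proof
  assume 1: "1 \<in> gidl ((\<lambda>j. hgerm y (\<rho> j)) ` {..<l})"
  show "\<exists>j<l. \<rho> j y \<noteq> 0"
  proof (rule ccontr)
    assume "\<not> ?thesis"
    then have "\<forall>b\<in>(\<lambda>j. hgerm y (\<rho> j)) ` {..<l}. hev b = 0"
      using hev_hgerm[OF F] by auto
    from hev_gidl[OF 1 this] show False by simp
  qed
next
  assume "\<exists>j<l. \<rho> j y \<noteq> 0"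
  then obtain j where j: "j < l" "\<rho> j y \<noteq> 0" by blast
  then obtain b where b: "hgerm y (\<rho> j) * b = 1" using hg_unit[of "hgerm y (\<rho> j)"] hev_hgerm F by metis
  have "b * hgerm y (\<rho> j) \<in> gidl ((\<lambda>j. hgerm y (\<rho> j)) ` {..<l})" by (rule gidl_mult_gen) (use j(1) in blast)
  then show "1 \<in> gidl ((\<lambda>j. hgerm y (\<rho> j)) ` {..<l})" using b by (simp add: mult.commute)
qed

lemma nonzero_germ_nearby:
  fixes \<sigma> :: "complex ^ ('n::finite) \<Rightarrow> complex"
  assumes \<sigma>: "holo_on \<sigma> (ball x d)" "d > 0" "hgerm x \<sigma> \<noteq> 0" and y: "y \<in> ball x d"
  shows "hgerm y \<sigma> \<noteq> 0"
proof
  assume "hgerm y \<sigma> = 0"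
  then have ev: "eventually (\<lambda>z. \<sigma> z = 0) (nhds y)"
    using hgerm_eq_iff[OF holo_at_holo_on[OF \<sigma>(1) y] holo_at_simps(1)[of 0]] by simp
  have "\<sigma> z = 0" if "z \<in> ball x d" for z by (rule holo_identity[OF \<sigma>(1) y ev that])
  moreover have "eventually (\<lambda>z. z \<in> ball x d) (nhds x)"
    using \<sigma>(2) by (intro eventually_nhds_in_open) auto
  ultimately have "eventually (\<lambda>z. \<sigma> z = 0) (nhds x)" by (auto elim: eventually_mono)
  then have "hgerm x \<sigma> = 0"
    using hgerm_eq_iff[OF holo_at_holo_on[OF \<sigma>(1)] holo_at_simps(1)[of 0], of x] \<sigma>(2) by simp
  then show False using \<sigma>(3) by simp
qed

context resolved
begin

text \<open>The relations among \<open>g\<close>, \<open>h\<close> and the generators of \<open>\<I>\<close> become relations among sections of \<open>\<I>\<close> after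
  multiplication by a nonzero section \<open>\<sigma>\<close>. Their first components generate \<open>((\<I>, h) : g)\<close>.\<close>

lemma denominators_finite_type:
  assumes rel: "finite_type_relations X I" and x: "x \<in> X" "J x \<noteq> {0}"
    and U: "open U" "x \<in> U" "U \<subseteq> X" and gh: "holo_on g U" "holo_on h U"
  shows "\<exists>V l \<rho>. open V \<and> x \<in> V \<and> V \<subseteq> U \<and> (\<forall>j<(l :: nat). holo_on (\<rho> j) V) \<and>
    (\<forall>y\<in>V. \<forall>a. (\<exists>u. a * hgerm y g - u * hgerm y h \<in> J y) \<longleftrightarrow> a \<in> gidl ((\<lambda>j. hgerm y (\<rho> j)) ` {..<l}))"
proof -
  have "\<exists>a\<in>J x. a \<noteq> 0" using x(2) ideal_inD(2)[OF ideal_J[OF x(1)]] by blast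
  then obtain \<sigma> where \<sigma>: "holo_at \<sigma> x" "hgerm x \<sigma> \<in> J x" "hgerm x \<sigma> \<noteq> 0"
    unfolding J_def hid_def by (auto simp: mem_hid)
  obtain W where W: "open W" "x \<in> W" "W \<subseteq> X" "\<sigma> \<in> I W" using germ_section[OF \<sigma>(1,2)] by blast
  have "open (U \<inter> W)" "x \<in> U \<inter> W" using U W by auto
  then obtain d where d: "d > 0" "ball x d \<subseteq> U \<inter> W" using openE by blast
  let ?B = "ball x d"
  have B: "open ?B" "?B \<subseteq> X" "x \<in> ?B" using d U(3) by auto
  have \<sigma>B: "\<sigma> \<in> I ?B" by (rule sec_restrict[OF W(1,3) B(1) _ W(4)]) (use d in blast)
  have \<sigma>h: "holo_on \<sigma> ?B" by (rule sec(1)[OF B(1,2) \<sigma>B])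
  have ghB: "holo_on g ?B" "holo_on h ?B" using gh holo_on_subset[OF _ B(1)] d(2) by auto
  \<comment> \<open>The first two places hold \<open>g\<close> and \<open>h\<close>, the others the
    entries of the first map, which generate the stalks. The functions \<open>g\<close> and
    \<open>h\<close> need not be sections of the ideal sheaf, hence the factor \<sigma> in
    \<open>s\<close>.\<close>
  define t where "t i = (if i = 0 then g else if i = 1 then h else (\<lambda>z. f 1 z $$ (0, i - 2)))" for i :: nat
  define s where "s i = (\<lambda>z. t i z * \<sigma> z)" for i
  define m where "m = r 1 + 2"
  have m: "0 < m" "1 < m" "\<And>i. i < r 1 \<Longrightarrow> i + 2 < m" by (auto simp: m_def)
  have k1: "1 \<in> {1..N}" and r0: "0 < r (1 - 1)" using N_pos r_0 by auto
  have th: "holo_on (t i) ?B" if "i < m" for i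
    using ghB f_mat(2)[OF k1 r0, of "i - 2"] that holo_on_subset[OF _ B(1,2)] by (auto simp: t_def m_def)
  have sI: "s i \<in> I ?B" if "i < m" for i
    unfolding s_def by (rule sec(3)[OF B(1,2) \<sigma>B th[OF that]])
  have "\<exists>V l \<rho>. open V \<and> x \<in> V \<and> V \<subseteq> ?B \<and>
      (\<forall>j<(l::nat). (\<forall>i<m. holo_on (\<rho> j i) V) \<and> (\<forall>y\<in>V. relation_at m s (\<rho> j) y)) \<and>
      (\<forall>y\<in>V. \<forall>a. relation_at m s a y \<longrightarrow>
         (\<exists>c. (\<forall>j<l. holo_at (c j) y) \<and> eventually (\<lambda>z. \<forall>i<m. a i z = (\<Sum>j<l. c j z * \<rho> j i z)) (nhds y)))"
    using rel[unfolded finite_type_relations_def, rule_format, of ?B m s x] B sI by blast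
  then obtain V l \<rho> where V: "open V" "x \<in> V" "V \<subseteq> ?B"
    and \<rho>: "\<forall>j<(l::nat). (\<forall>i<m. holo_on (\<rho> j i) V) \<and> (\<forall>y\<in>V. relation_at m s (\<rho> j) y)"
    and gen: "\<forall>y\<in>V. \<forall>a. relation_at m s a y \<longrightarrow>
      (\<exists>c. (\<forall>j<l. holo_at (c j) y) \<and> eventually (\<lambda>z. \<forall>i<m. a i z = (\<Sum>j<l. c j z * \<rho> j i z)) (nhds y))"
    by (elim exE conjE) (rule that)
  \<comment> \<open>The germ of \<sigma> is nonzero at every point of the ball, so \<sigma> cancels.
    What remains says that the first two coefficients, paired with \<open>g\<close> and
    \<open>h\<close>, give an element of the ideal.\<close>
  have rel_iff: "relation_at m s a y \<longleftrightarrow>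
      hgerm y (a 0) * hgerm y g + hgerm y (a 1) * hgerm y h + (\<Sum>i<r 1. A y 1 0 i * hgerm y (a (i + 2))) = 0"
    if y: "y \<in> V" and a: "\<forall>i<m. holo_at (a i) y" for a y
  proof -
    have yB: "y \<in> ?B" using y V(3) by blast
    have tat: "holo_at (t i) y" if "i < m" for i by (rule holo_at_holo_on[OF th[OF that] yB])
    have \<sigma>at: "holo_at \<sigma> y" by (rule holo_at_holo_on[OF \<sigma>h yB])
    have at: "holo_at (\<lambda>z. a i z * t i z) y" if "i < m" for i using holo_at_simps(3)[of "a i" y "t i"] a tat that by simp
    have st: "holo_at (\<lambda>z. \<Sum>i<m. a i z * t i z) y" by (rule holo_at_sum) (use at in auto)
    have eq: "(\<Sum>i<m. a i z * s i z) = (\<Sum>i<m. a i z * t i z) * \<sigma> z" for z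
      by (simp add: s_def sum_distrib_right mult.assoc)
    have "relation_at m s a y \<longleftrightarrow> eventually (\<lambda>z. (\<Sum>i<m. a i z * t i z) * \<sigma> z = 0) (nhds y)"
      unfolding relation_at_def eq using a by blast
    also have "\<dots> \<longleftrightarrow> hgerm y (\<lambda>z. (\<Sum>i<m. a i z * t i z) * \<sigma> z) = 0"
      using hgerm_eq_iff[OF holo_at_simps(3)[OF st \<sigma>at] holo_at_simps(1)[of 0]] by simp
    also have "\<dots> \<longleftrightarrow> hgerm y (\<lambda>z. \<Sum>i<m. a i z * t i z) = 0"
      using nonzero_germ_nearby[OF \<sigma>h d(1) \<sigma>(3) yB] by (simp add: hgerm_ops(1)[OF st \<sigma>at])
    also have "hgerm y (\<lambda>z. \<Sum>i<m. a i z * t i z) = (\<Sum>i<m. hgerm y (\<lambda>z. a i z * t i z))"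
      by (rule hgerm_sum) (use at in auto)
    also have "\<dots> = (\<Sum>i<m. hgerm y (a i) * hgerm y (t i))"
      by (intro sum.cong refl hgerm_ops(1)) (use a tat in auto)
    also have "\<dots> = hgerm y (a 0) * hgerm y g + hgerm y (a 1) * hgerm y h + (\<Sum>i<r 1. A y 1 0 i * hgerm y (a (i + 2)))"
    proof -
      have "(\<Sum>i<m. hgerm y (a i) * hgerm y (t i)) = (\<Sum>i<Suc (Suc (r 1)). hgerm y (a i) * hgerm y (t i))" by (simp add: m_def)
      also have "\<dots> = hgerm y (a 0) * hgerm y (t 0) + (hgerm y (a 1) * hgerm y (t 1) +
          (\<Sum>i<r 1. hgerm y (a (i + 2)) * hgerm y (t (i + 2))))"
        by (simp add: sum.lessThan_Suc_shift del: sum.lessThan_Suc)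
      finally show ?thesis by (simp add: t_def A_def mult.commute add.assoc)
    qed
    finally show ?thesis .
  qed
  have inJ: "(\<exists>w. b = (\<Sum>i<r 1. A y 1 0 i * w i)) \<longleftrightarrow> b \<in> J y" if y: "y \<in> V" for b y
  proof -
    have yX: "y \<in> X" using y V(3) B(2) by blast
    interpret R: resolution N rr "A y" by (rule resolution_at[OF yX])
    have "rr 1 = r 1" using N_pos by (simp add: rr_def)
    then show ?thesis using res_ideal_at[OF yX] by (auto simp: R.res_ideal_def R.mv_def)
  qed
  have main: "(\<exists>u. a * hgerm y g - u * hgerm y h \<in> J y) \<longleftrightarrow> a \<in> gidl ((\<lambda>j. hgerm y (\<rho> j 0)) ` {..<l})"
    if y: "y \<in> V" for y a
  proof
    have yX: "y \<in> X" using y V(3) B(2) by blast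
    note JD = ideal_inD[OF ideal_J[OF yX]]
    have \<rho>at: "holo_at (\<rho> j i) y" if "j < l" "i < m" for i j using \<rho> that holo_at_holo_on[OF _ y] by blast
    {
      assume "\<exists>u. a * hgerm y g - u * hgerm y h \<in> J y"
      then obtain u w where uw: "a * hgerm y g - u * hgerm y h = (\<Sum>i<r 1. A y 1 0 i * w i)" using inJ[OF y] by metis
      have "\<forall>i. \<exists>b. holo_at b y \<and> hgerm y b = (if i = 0 then a else if i = 1 then - u else - w (i - 2))" for i :: nat
        by (metis hgerm_surj)
      then obtain b where b: "\<And>i. holo_at (b i) y" "\<And>i :: nat. hgerm y (b i) = (if i = 0 then a else if i = 1 then - u else - w (i - 2))"
        by metis
      have "relation_at m s b y"
        using rel_iff[OF y, of b] b uw by (simp add: sum_negf)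
      then obtain c where c: "\<forall>j<l. holo_at (c j) y" "eventually (\<lambda>z. \<forall>i<m. b i z = (\<Sum>j<l. c j z * \<rho> j i z)) (nhds y)"
        using gen y by blast
      have t: "holo_at (\<lambda>z. c j z * \<rho> j 0 z) y" if "j < l" for j by (rule holo_at_simps(3)) (use c(1) \<rho>at[OF that m(1)] that in auto)
      have "a = hgerm y (b 0)" using b(2)[of 0] by simp
      also have "\<dots> = hgerm y (\<lambda>z. \<Sum>j<l. c j z * \<rho> j 0 z)"
      proof (rule hgerm_cong[OF _ b(1) holo_at_sum])
        show "eventually (\<lambda>z. b 0 z = (\<Sum>j<l. c j z * \<rho> j 0 z)) (nhds y)"
          using c(2) by (rule eventually_mono) (use m(1) in blast)
      qed (use t in auto)
      also have "\<dots> = (\<Sum>j<l. hgerm y (\<lambda>z. c j z * \<rho> j 0 z))"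
        by (rule hgerm_sum) (use t in auto)
      also have "\<dots> = (\<Sum>j<l. hgerm y (c j) * hgerm y (\<rho> j 0))"
        by (intro sum.cong refl hgerm_ops(1)) (use c(1) \<rho>at[OF _ m(1)] in auto)
      also have "\<dots> \<in> gidl ((\<lambda>j. hgerm y (\<rho> j 0)) ` {..<l})" by (intro gidl_sum gidl_mult_gen) auto
      finally show "a \<in> gidl ((\<lambda>j. hgerm y (\<rho> j 0)) ` {..<l})" .
    }
    assume "a \<in> gidl ((\<lambda>j. hgerm y (\<rho> j 0)) ` {..<l})"
    then show "\<exists>u. a * hgerm y g - u * hgerm y h \<in> J y"
    proof (induction rule: gidl.induct)
      case zero
      show ?case using JD(2) by (intro exI[of _ 0]) simp
    next
      case (add a b c)
      obtain u where u: "a * hgerm y g - u * hgerm y h \<in> J y" using add.IH by blast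
      obtain j where j: "j < l" "b = hgerm y (\<rho> j 0)" using add.hyps(2) by auto
      have "relation_at m s (\<rho> j) y" using \<rho> j(1) y by blast
      then have "b * hgerm y g + hgerm y (\<rho> j 1) * hgerm y h + (\<Sum>i<r 1. A y 1 0 i * hgerm y (\<rho> j (i + 2))) = 0"
        using rel_iff[OF y, of "\<rho> j"] \<rho>at[OF j(1)] j(2) by blast
      then have "b * hgerm y g + hgerm y (\<rho> j 1) * hgerm y h = (\<Sum>i<r 1. A y 1 0 i * - hgerm y (\<rho> j (i + 2)))"
        by (simp add: sum_negf eq_neg_iff_add_eq_0)
      then have "b * hgerm y g + hgerm y (\<rho> j 1) * hgerm y h \<in> J y"
        using inJ[OF y] by (metis (mono_tags))
      from JD(3)[OF u JD(4)[OF this hO_UNIV, of c]]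
      have "(a + c * b) * hgerm y g - (u - c * hgerm y (\<rho> j 1)) * hgerm y h \<in> J y" by (simp add: algebra_simps)
      then show ?case by blast
    qed
  qed
  have "\<forall>j<l. holo_on (\<rho> j 0) V" using \<rho> m(1) by blast
  then show ?thesis
    by (intro exI[of _ V] exI[of _ l] exI[of _ "\<lambda>j. \<rho> j 0"]) (use V d(2) main in auto)
qed

end

theorem theorem1p2:
  fixes X P :: "(complex ^ 'n) set"
    and I :: "'n presheaf"
    and \<phi> :: "'n mero"
    and p N :: nat
    and r :: "nat \<Rightarrow> nat"
    and f :: "nat \<Rightarrow> complex ^ 'n \<Rightarrow> complex Matrix.mat"
  assumes "open X" and "cball 0 1 \<subseteq> X"
    and "coherent_ideal_sheaf X I"
    and "p \<ge> 1" and "pure_codim X I p"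
    and "free_resolution X I N r f"
    and "meromorphic_function X I \<phi>"
    and "is_pole_set X I \<phi> P"
    and "\<forall>k\<ge>p. codim (P \<inter> resolution_set X N r f k) \<ge> enat (k + 2)"
  shows "strongly_holomorphic_on X I \<phi> (zero_variety X I)"
proof -
  have rel: "finite_type_relations X I" using assms(3) by (simp add: coherent_ideal_sheaf_def)
  interpret resolved X I N r f
    by unfold_locales (use assms(1,3,6) in \<open>auto simp: coherent_ideal_sheaf_def\<close>)
  let ?Z = "zero_variety X I"
  have ZX: "?Z \<subseteq> X" by (auto simp: zero_variety_def)
  have pure: "height (local_ring x) Q = enat p"
    if "x \<in> ?Z" "associated_prime (local_ring x) (stalk X I x) Q" for x Q
    using assms(5) that by (simp add: pure_codim_def)
  have Jnz: "J x \<noteq> {0}" if x: "x \<in> ?Z" for x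
    unfolding J_def
  proof (rule pure_codim_nonzero[OF ideal_stalk_at _ assms(4)])
    show "x \<in> X" using x ZX by blast
    show "height (local_ring x) Q = enat p" if "associated_prime (local_ring x) (stalk X I x) Q" for Q
      by (rule pure[OF x that])
  qed
  define hol where "hol y \<longleftrightarrow> (\<exists>u. holo_at u y \<and>
    \<phi> y = fraction (OZ_ring X I y) (OZ_germ X I y u) \<one>\<^bsub>OZ_ring X I y\<^esub>)" for y
  \<comment> \<open>This set will turn out to be \<open>P\<close>: once it is known to be analytic
    and admissible, minimality gives one inclusion, and every point of \<open>?Z - P\<close>
    satisfies \<open>hol\<close>.\<close>
  define Q0 where "Q0 = {y \<in> ?Z. \<not> hol y}"
  define rep where "rep g h V \<longleftrightarrow> open V \<and> V \<subseteq> X \<and> holo_on g V \<and> holo_on h V \<and>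
    (\<forall>y\<in>V \<inter> ?Z. OZ_germ X I y h \<in> nonzerodivisors (OZ_ring X I y) \<and>
      \<phi> y = fraction (OZ_ring X I y) (OZ_germ X I y g) (OZ_germ X I y h))" for g h V
  have rep_ex: "\<exists>U g h. x \<in> U \<and> rep g h U" if "x \<in> ?Z" for x
    using assms(7)[unfolded meromorphic_function_def, rule_format, OF that] unfolding rep_def by blast
  have frac: "\<phi> y = fraction (OZ_ring X I y) (OZ_germ X I y u) \<one>\<^bsub>OZ_ring X I y\<^esub> \<longleftrightarrow>
      hgerm y g - hgerm y u * hgerm y h \<in> J y"
    if "rep g h V" "y \<in> V \<inter> ?Z" "holo_at u y" for g h V y u
    using OZ_fraction_eq[OF ideal_stalk_at, of y g h u] that holo_at_holo_on[of _ V y] ZX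
    unfolding rep_def J_def by auto
  have hol_iff: "hol y \<longleftrightarrow> (\<exists>u. hgerm y g - u * hgerm y h \<in> J y)" if "rep g h V" "y \<in> V \<inter> ?Z" for g h V y
    unfolding hol_def using frac[OF that] by (metis hgerm_surj)
  \<comment> \<open>At \<open>y\<close> in \<open>?Z\<close>, \<open>hol y\<close> says that 1 is in
    the ideal generated by the germs of the \<rho> j, that is, some \<open>\<rho> j y\<close> is
    nonzero. Off \<open>?Z\<close> the stalk contains 1, so some \<open>\<rho> j y\<close> is
    nonzero there too.\<close>
  have loc: "\<exists>V g h l \<rho>. x \<in> V \<and> rep g h V \<and> (\<forall>j<(l :: nat). holo_on (\<rho> j) V) \<and>
      (\<forall>y\<in>V. \<forall>a. (\<exists>u. a * hgerm y g - u * hgerm y h \<in> J y) \<longleftrightarrow> a \<in> gidl ((\<lambda>j. hgerm y (\<rho> j)) ` {..<l})) \<and>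
      Q0 \<inter> V = {y \<in> V. \<forall>j<l. \<rho> j y = 0}" if x: "x \<in> ?Z" for x
  proof -
    obtain U g h where U: "x \<in> U" "rep g h U" using rep_ex[OF x] by blast
    have xX: "x \<in> X" using x ZX by blast
    have U': "open U" "U \<subseteq> X" "holo_on g U" "holo_on h U" using U(2) by (auto simp: rep_def)
    obtain V l \<rho> where V: "open V" "x \<in> V" "V \<subseteq> U" "\<forall>j<(l :: nat). holo_on (\<rho> j) V"
      and gen: "\<forall>y\<in>V. \<forall>a. (\<exists>u. a * hgerm y g - u * hgerm y h \<in> J y) \<longleftrightarrow> a \<in> gidl ((\<lambda>j. hgerm y (\<rho> j)) ` {..<l})"
      using denominators_finite_type[OF rel xX Jnz[OF x] U'(1) U(1) U'(2-4)] by (elim exE conjE) (rule that)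
    have rV: "rep g h V" using U(2) V(1,3) holo_on_subset[OF _ V(1,3)] unfolding rep_def by blast
    have "y \<in> Q0 \<longleftrightarrow> (\<forall>j<l. \<rho> j y = 0)" if y: "y \<in> V" for y
    proof -
      have yX: "y \<in> X" using y V(3) U'(2) by blast
      have \<rho>at: "holo_at (\<rho> j) y" if "j < l" for j using V(4) that holo_at_holo_on[OF _ y] by blast
      have one: "(\<exists>u. hgerm y g - u * hgerm y h \<in> J y) \<longleftrightarrow> (\<exists>j<l. \<rho> j y \<noteq> 0)"
        using gen[rule_format, OF y, of 1] unit_in_gidl_iff[of l \<rho> y, OF \<rho>at] by simp
      show ?thesis
      proof (cases "y \<in> ?Z")
        case True
        then show ?thesis using hol_iff[OF rV, of y] y one by (simp add: Q0_def)
      next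
        case False
        have "hgerm y g - 0 * hgerm y h \<in> J y"
          using ideal_inD(4)[OF ideal_J[OF yX] unit_off_Z[OF yX False] hO_UNIV, of "hgerm y g"] by simp
        then have "\<exists>j<l. \<rho> j y \<noteq> 0" using one by blast
        then show ?thesis using False by (auto simp: Q0_def)
      qed
    qed
    then have "Q0 \<inter> V = {y \<in> V. \<forall>j<l. \<rho> j y = 0}" by blast
    then show ?thesis using V rV gen by blast
  qed
  have "analytic_subset X Q0"
    unfolding analytic_subset_def
  proof (intro conjI ballI)
    show "Q0 \<subseteq> X" using ZX by (auto simp: Q0_def)
    fix x assume xX: "x \<in> X"
    show "\<exists>U F. open U \<and> x \<in> U \<and> U \<subseteq> X \<and> finite F \<and> (\<forall>f\<in>F. holo_on f U) \<and> Q0 \<inter> U = {z \<in> U. \<forall>f\<in>F. f z = 0}"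
    proof (cases "x \<in> ?Z")
      case True
      from loc[OF this] obtain V g h l \<rho> where V: "x \<in> V" "rep g h V" "\<forall>j<(l :: nat). holo_on (\<rho> j) V"
        "Q0 \<inter> V = {y \<in> V. \<forall>j<l. \<rho> j y = 0}" by (elim exE conjE) (rule that)
      show ?thesis
        by (intro exI[of _ V] exI[of _ "\<rho> ` {..<l}"]) (use V in \<open>auto simp: rep_def\<close>)
    next
      case False
      then obtain U s where U: "open U" "x \<in> U" "U \<subseteq> X" "s \<in> I U" "s x \<noteq> 0"
        using xX unfolding zero_variety_def by blast
      \<comment> \<open>A section of the ideal sheaf without zeros on \<open>?W\<close> keeps
        \<open>?W\<close> away from \<open>?Z\<close>, so there \<open>Q0\<close> is empty and cut
        out by the constant 1.\<close>
      let ?W = "U \<inter> s -` (- {0})"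
      have W: "open ?W"
        by (rule continuous_open_preimage[OF holo_on_continuous[OF sec(1)[OF U(1,3,4)]] U(1)])
          (rule open_Compl[OF closed_singleton])
      have "?W \<inter> ?Z = {}" using U(1,3,4) by (auto simp: zero_variety_def)
      then have "Q0 \<inter> ?W = {z \<in> ?W. \<forall>f\<in>{\<lambda>_. 1 :: complex}. f z = 0}" by (auto simp: Q0_def)
      then show ?thesis using W U(2,3,5) holo_on_const[OF W]
        by (intro exI[of _ ?W] exI[of _ "{\<lambda>_. 1}"]) auto
    qed
  qed
  moreover have strong: "strongly_holomorphic_on X I \<phi> (?Z - Q0)"
    unfolding strongly_holomorphic_on_def
  proof (intro ballI)
    fix x assume x: "x \<in> ?Z - Q0"
    obtain V g h where V: "x \<in> V" "rep g h V" using rep_ex x by blast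
    have V': "open V" "V \<subseteq> X" "holo_on g V" "holo_on h V" using V(2) by (auto simp: rep_def)
    obtain u where u: "holo_at u x" "\<phi> x = fraction (OZ_ring X I x) (OZ_germ X I x u) \<one>\<^bsub>OZ_ring X I x\<^esub>"
      using x unfolding Q0_def hol_def by blast
    obtain W where W: "x \<in> W" "holo_on u W" using u(1) by (auto simp: holo_at_def)
    have at: "holo_at g x" "holo_at h x" using V' V(1) holo_at_holo_on by blast+
    let ?e = "\<lambda>z. g z - u z * h z"
    have germ_e: "hgerm y ?e = hgerm y g - hgerm y u * hgerm y h" if "holo_at g y" "holo_at h y" "holo_at u y" for y
      using hgerm_ops(2)[OF that(1) holo_at_simps(3)[OF that(3,2)]] hgerm_ops(1)[OF that(3,2)] by simp
    \<comment> \<open>The equation g = u h modulo the ideal at \<open>x\<close> becomes a section of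
      the sheaf near \<open>x\<close>, so the same \<open>u\<close> works at all nearby points; this
      turns the pointwise \<open>hol\<close> into a local statement.\<close>
    have "hgerm x ?e \<in> J x" using frac[OF V(2), of x u] V(1) x u germ_e[OF at u(1)] by simp
    from germ_section[OF holo_at_minus[OF at(1) holo_at_simps(3)[OF u(1) at(2)]] this]
    obtain Y where Y: "open Y" "x \<in> Y" "Y \<subseteq> X" "?e \<in> I Y" by blast
    let ?U = "V \<inter> W \<inter> Y"
    have o: "open ?U" using V'(1) holo_on_open[OF W(2)] Y(1) by blast
    show "\<exists>U g. open U \<and> x \<in> U \<and> U \<subseteq> X \<and> holo_on g U \<and>
      (\<forall>y\<in>U \<inter> (?Z - Q0). \<phi> y = fraction (OZ_ring X I y) (OZ_germ X I y g) \<one>\<^bsub>OZ_ring X I y\<^esub>)"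
    proof (intro exI[of _ ?U] exI[of _ u] conjI ballI)
      show "holo_on u ?U" by (rule holo_on_subset[OF W(2) o]) blast
      fix y assume y: "y \<in> ?U \<inter> (?Z - Q0)"
      have yat: "holo_at g y" "holo_at h y" "holo_at u y" using V'(3,4) W(2) y holo_at_holo_on by blast+
      have "hgerm y ?e \<in> J y" by (rule section_germ[OF Y(1,3,4)]) (use y in blast)
      then show "\<phi> y = fraction (OZ_ring X I y) (OZ_germ X I y u) \<one>\<^bsub>OZ_ring X I y\<^esub>"
        using frac[OF V(2), of y u] y yat(3) germ_e[OF yat] by simp
    qed (use o V(1) W(1) Y(2,3) in auto)
  qed
  ultimately have PQ: "P \<subseteq> Q0" using assms(8) by (auto simp: is_pole_set_def Let_def Q0_def)
  have "Q0 \<subseteq> P"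
  proof
    fix y assume y: "y \<in> Q0"
    show "y \<in> P"
    proof (rule ccontr)
      assume "y \<notin> P"
      then have yZ: "y \<in> ?Z - P" using y by (simp add: Q0_def)
      have "strongly_holomorphic_on X I \<phi> (?Z - P)" using assms(8) by (simp add: is_pole_set_def Let_def)
      then obtain U u where U: "y \<in> U" "holo_on u U"
        "\<forall>y\<in>U \<inter> (?Z - P). \<phi> y = fraction (OZ_ring X I y) (OZ_germ X I y u) \<one>\<^bsub>OZ_ring X I y\<^esub>"
        using yZ unfolding strongly_holomorphic_on_def by blast
      have "holo_at u y" by (rule holo_at_holo_on[OF U(2,1)])
      then have "hol y" unfolding hol_def using U(1,3) yZ by blast
      then show False using y by (simp add: Q0_def)
    qed
  qed
  with PQ have P: "P = Q0" by blast
  have "hol x" if x: "x \<in> ?Z" for x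
  proof -
    have xX: "x \<in> X" using x ZX by blast
    from loc[OF x] obtain V g h l \<rho> where V: "x \<in> V" "rep g h V" "\<forall>j<(l :: nat). holo_on (\<rho> j) V"
      and gen: "\<forall>y\<in>V. \<forall>a. (\<exists>u. a * hgerm y g - u * hgerm y h \<in> J y) \<longleftrightarrow> a \<in> gidl ((\<lambda>j. hgerm y (\<rho> j)) ` {..<l})"
      and Q0V: "Q0 \<inter> V = {y \<in> V. \<forall>j<l. \<rho> j y = 0}" by (elim exE conjE) (rule that)
    have oV: "open V" using V(2) by (simp add: rep_def)
    have \<rho>at: "holo_at (\<rho> j) x" if "j < l" for j using V(3) that holo_at_holo_on[OF _ V(1)] by blast
    have hat: "holo_at h x" using V(1,2) holo_at_holo_on by (auto simp: rep_def)
    let ?R = "(\<lambda>j. hgerm x (\<rho> j)) ` {..<l}"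
    have "\<exists>u. hgerm x g - u * hgerm x h \<in> J x"
    proof (rule divisible_at[OF x assms(4) pure[OF x]])
      show "a \<in> J x" if "a * hgerm x h \<in> J x" for a
        using V(1,2) x that OZ_nonzerodivisor[OF ideal_stalk_at[OF xX] hat] unfolding rep_def J_def by blast
      show "\<exists>u. \<rho>' * hgerm x g - u * hgerm x h \<in> J x" if "\<rho>' \<in> ?R" for \<rho>'
        using gen V(1) gidl_gen[OF that] by blast
      fix k assume k: "k \<in> {p..N}"
      then have k1: "k \<in> {1..N}" using assms(4) by auto
      let ?B = "P \<inter> resolution_set X N r f k"
      show "\<exists>xs. length xs = k + 2 \<and> set xs \<subseteq> gidl (?R \<union> minors x k) \<and> pow_regseq xs"
      proof (rule codim_regseq)
        show "finite (?R \<union> minors x k)" by (simp add: finite_minors)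
        have "eventually (\<lambda>z. z \<in> V) (nhds x)" using oV V(1) eventually_nhds by blast
        then have "eventually (\<lambda>z. x + z \<in> V) (nhds 0)" by (rule iffD1[OF eventually_shift])
        moreover have "eventually (\<lambda>z. \<forall>j\<in>{..<l}. hfun (hgerm x (\<rho> j)) z = \<rho> j (x + z)) (nhds 0)"
          by (intro eventually_ball_finite ballI hfun_hgerm \<rho>at) auto
        ultimately show "eventually (\<lambda>z. z \<in> {z. x + z \<in> ?B} \<longleftrightarrow> (\<forall>a\<in>?R \<union> minors x k. hfun a z = 0)) (nhds 0)"
          using minors_vanish[OF k1 xX]
        proof eventually_elim
          case (elim z)
          have "x + z \<in> P \<longleftrightarrow> (\<forall>j<l. \<rho> j (x + z) = 0)" using Q0V elim(1) P by blast
          also have "\<dots> \<longleftrightarrow> (\<forall>a\<in>?R. hfun a z = 0)" using elim(2) by auto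
          finally show ?case using elim(3) by auto
        qed
        fix w j assume "regular_point {z. x + z \<in> ?B} w j"
        then have "regular_point ?B (x + w) j" by (rule regular_point_translate)
        \<comment> \<open>The codimension is an infimum over all regular points of the set, so the
          hypothesis bounds the codimension at each of them.\<close>
        then have "codim ?B \<le> enat j" unfolding codim_def by (intro Inf_lower) blast
        moreover have "enat (k + 2) \<le> codim ?B" using assms(9) k by simp
        ultimately have "enat (k + 2) \<le> enat j" by (rule order.trans[rotated])
        then show "k + 2 \<le> j" by simp
      qed
    qed
    then show ?thesis using hol_iff[OF V(2), of x] V(1) x by blast
  qed
  then have "Q0 = {}" by (auto simp: Q0_def)
  then show ?thesis using strong by simp
qed

end
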